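(* For all $(\gamma,\eta)^{\mathrm T}\in\mathcal H$, the Hessian $\nabla^2(F\circ\Psi)(\gamma,\eta)\langle(\cdot,\cdot),(\cdot,\cdot)\rangle$, given for $(f,\hat f),(k,\hat k)\in\mathcal H$ by $$\nabla F(\phi^0)\big\langle\nabla^2\Psi(\gamma,\eta)\langle(f,\hat f),(k,\hat k)\rangle\big\rangle+\nabla^2F(\phi^0)\big\langle\nabla\Psi(\gamma,\eta)\langle(f,\hat f)\rangle,\nabla\Psi(\gamma,\eta)\langle(k,\hat k)\rangle\big\rangle,\qquad \phi^0=\Psi(\gamma,\eta),$$ is a symmetric Hilbert–Schmidt bilinear form on $\mathcal H$.
   Context: Time runs over $[0,1]$. Fix $H\in(1/3,1/2)$ and exponents $p,q,p'$ with $\frac1{p'}\vee\frac13<\frac1p<H$, $\frac12<\frac1q<H+\frac12$, $\frac1p+\frac1q>1$, $\frac1q-\frac1p>\frac12$. $\mathcal H=\mathcal H^{H,d_1}\oplus\mathcal H^{\frac12,d_2}$, where $\mathcal H^{H,d_1}$ is the Cameron–Martin (reproducing kernel Hilbert) space of $d_1$-dimensional fractional Brownian motion with Hurst parameter $H$ on $[0,1]$ and $\mathcal H^{\frac12,d_2}$ is the space of absolutely continuous $\hat k:[0,1]\to\mathbb R^{d_2}$ with $\hat k_0=0$ and norm$^2$ $\int_0^1|\hat k'_t|^2dt<\infty$. Elements of $\mathcal H$ have finite $q$-variation. $C_0^{r\text{-var}}(\mathbb R^n)$ is the space of continuous paths $[0,1]\to\mathbb R^n$ starting at $0$ with finite $r$-variation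 norm. Coefficients: $\sigma\in C_b^\infty(\mathbb R^n,\mathrm{Mat}(n,d_1))$, $\hat\sigma\in C_b^\infty(\mathbb R^n,\mathrm{Mat}(n,d_2))$, $\beta\in C_b^\infty([0,1]\times\mathbb R^n,\mathbb R^n)$ (bounded, smooth, with bounded derivatives); $S=[\sigma|\hat\sigma]$ is the block matrix and $\beta_0(y)=\beta(0,y)$. $\Psi(\gamma,\eta)=\phi^0$ is the solution of the Young ODE $d\phi^0_t=S(\phi^0_t)d(\gamma_t,\eta_t)^{\mathrm T}+\beta_0(\phi^0_t)dt$, $\phi^0_0=0$. $F$ is a real-valued bounded continuous function on $C_0^{p'\text{-var}}(\mathbb R^n)$ which is three times Fréchet differentiable in a neighbourhood $U$ of $\phi^0$, with $|\nabla^jF(y)\langle z,\dots,z\rangle|\le M_j\|z\|_{p'\text{-var}}^j$ for $j=1,2,3$, $y\in U$, $z\in C_0^{p'\text{-var}}(\mathbb R^n)$, for some constants $M_j$. Explicit derivatives of $\Psi$ (all integrals are Young integrals): $M$ solves $dM_t=d\Omega_t\cdot M_t$, $M_0=\mathrm{Id}_n$, where $d\Omega_t\langle v\rangle=\nabla S(\phi^0_t)\langle v,d(\gamma_t,\eta_t)^{\mathrm T}\rangle+\nabla\beta_0(\phi^0_t)\langle v\rangle dt$. Then $\nabla\Psi(\gamma,\eta)\langle(k,\hat k)\rangle_t=\chi(k,\hat k)_t=M_t\int_0^tM_s^{-1}S(\phi^0_s)d(k_s,\hat k_s)^{\mathrm T}$, and $\nabla^2\Psi(\gamma,\eta)\langle(f,\hat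 f),(k,\hat k)\rangle=V_1+V_2$ with $V_{1,t}=M_t\int_0^tM_s^{-1}\{\nabla S(\phi^0_s)\langle\chi(f,\hat f)_s,d(k_s,\hat k_s)^{\mathrm T}\rangle+\nabla S(\phi^0_s)\langle\chi(k,\hat k)_s,d(f_s,\hat f_s)^{\mathrm T}\rangle\}$, $V_{2,t}=M_t\int_0^tM_s^{-1}\{\nabla^2S(\phi^0_s)\langle\chi(f,\hat f)_s,\chi(k,\hat k)_s,d(\gamma_s,\eta_s)^{\mathrm T}\rangle+\nabla^2\beta_0(\phi^0_s)\langle\chi(f,\hat f)_s,\chi(k,\hat k)_s\rangle ds\}$. Here $\nabla S(y)\langle v,z\rangle$ is the directional derivative of $S$ at $y$ along $v$ applied to $z$, and similarly for $\nabla^2S$. *)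

theory Defs
  imports "HOL-Analysis.Analysis" "HOL-Library.Function_Algebras"
begin

section \<open>Spaces of functions as real vector spaces\<close>

instantiation "fun" :: (type, real_vector) real_vector
begin

definition scaleR_fun :: "real \<Rightarrow> ('a \<Rightarrow> 'b) \<Rightarrow> 'a \<Rightarrow> 'b"
  where "scaleR_fun c f = (\<lambda>x. c *\<^sub>R f x)"

instance
  by standard (simp_all add: scaleR_fun_def fun_eq_iff scaleR_add_right scaleR_add_left)

end

text \<open>A path on \<open>[0,1]\<close> is encoded as a function on the reals that vanishes off \<open>[0,1]\<close>, so that
  equality of functions is equality of paths.\<close>

definition on_unit :: "(real \<Rightarrow> 'a::zero) \<Rightarrow> real \<Rightarrow> 'a"
  where "on_unit x = (\<lambda>t. if t \<in> {0..1} then x t else 0)"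


section \<open>Hilbert spaces on a carrier, Hilbert--Schmidt forms\<close>

definition norm_of :: "('v \<Rightarrow> 'v \<Rightarrow> real) \<Rightarrow> 'v \<Rightarrow> real"
  where "norm_of ip x = sqrt (ip x x)"

definition hilbert_space_on :: "'v::real_vector set \<Rightarrow> ('v \<Rightarrow> 'v \<Rightarrow> real) \<Rightarrow> bool" where
  "hilbert_space_on V ip \<longleftrightarrow>
     subspace V \<and>
     (\<forall>x\<in>V. \<forall>y\<in>V. ip x y = ip y x) \<and>
     (\<forall>x\<in>V. \<forall>y\<in>V. \<forall>z\<in>V. \<forall>a. ip (a *\<^sub>R x + y) z = a * ip x z + ip y z) \<and>
     (\<forall>x\<in>V. x \<noteq> 0 \<longrightarrow> ip x x > 0) \<and>
     (\<forall>X :: nat \<Rightarrow> 'v. range X \<subseteq> V \<longrightarrow>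
        (\<forall>\<epsilon>>0. \<exists>N. \<forall>m\<ge>N. \<forall>n\<ge>N. norm_of ip (X m - X n) < \<epsilon>) \<longrightarrow>
        (\<exists>x\<in>V. (\<lambda>n. norm_of ip (X n - x)) \<longlonglongrightarrow> 0))"

definition orthonormal_basis_on :: "'v::real_vector set \<Rightarrow> ('v \<Rightarrow> 'v \<Rightarrow> real) \<Rightarrow> 'v set \<Rightarrow> bool" where
  "orthonormal_basis_on V ip E \<longleftrightarrow>
     E \<subseteq> V \<and>
     (\<forall>e\<in>E. \<forall>e'\<in>E. ip e e' = (if e = e' then 1 else 0)) \<and>
     (\<forall>x\<in>V. \<forall>\<epsilon>>0. \<exists>y\<in>span E. norm_of ip (x - y) < \<epsilon>)"

definition bounded_bilinear_form_on ::
    "'v::real_vector set \<Rightarrow> ('v \<Rightarrow> 'v \<Rightarrow> real) \<Rightarrow> ('v \<Rightarrow> 'v \<Rightarrow> real) \<Rightarrow> bool" where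
  "bounded_bilinear_form_on V ip B \<longleftrightarrow>
     (\<forall>x\<in>V. \<forall>y\<in>V. \<forall>z\<in>V. \<forall>a. B (a *\<^sub>R x + y) z = a * B x z + B y z) \<and>
     (\<forall>x\<in>V. \<forall>y\<in>V. \<forall>z\<in>V. \<forall>a. B z (a *\<^sub>R x + y) = a * B z x + B z y) \<and>
     (\<exists>C. \<forall>x\<in>V. \<forall>y\<in>V. \<bar>B x y\<bar> \<le> C * norm_of ip x * norm_of ip y)"

text \<open>The sum of squares does not depend on the choice of the orthonormal basis; we require it to be
  finite for all of them.\<close>

definition hilbert_schmidt_form_on ::
    "'v::real_vector set \<Rightarrow> ('v \<Rightarrow> 'v \<Rightarrow> real) \<Rightarrow> ('v \<Rightarrow> 'v \<Rightarrow> real) \<Rightarrow> bool" where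
  "hilbert_schmidt_form_on V ip B \<longleftrightarrow>
     bounded_bilinear_form_on V ip B \<and>
     (\<forall>E. orthonormal_basis_on V ip E \<longrightarrow> (\<lambda>(e, e'). (B e e')\<^sup>2) summable_on E \<times> E)"

definition symmetric_form_on :: "'v set \<Rightarrow> ('v \<Rightarrow> 'v \<Rightarrow> real) \<Rightarrow> bool"
  where "symmetric_form_on V B \<longleftrightarrow> (\<forall>x\<in>V. \<forall>y\<in>V. B x y = B y x)"

definition direct_sum_ip ::
    "('v \<Rightarrow> 'v \<Rightarrow> real) \<Rightarrow> ('w \<Rightarrow> 'w \<Rightarrow> real) \<Rightarrow> 'v \<times> 'w \<Rightarrow> 'v \<times> 'w \<Rightarrow> real"
  where "direct_sum_ip ip1 ip2 x y = ip1 (fst x) (fst y) + ip2 (snd x) (snd y)"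


section \<open>Cameron--Martin spaces\<close>

text \<open>\<open>(V, ip)\<close> is the reproducing kernel Hilbert space, over the index set \<open>T\<close>, of the matrix-valued
  kernel \<open>K s t \<cdot> Id\<close>. By Moore--Aronszajn these properties determine \<open>(V, ip)\<close> uniquely.\<close>

definition is_rkhs ::
    "'t set \<Rightarrow> ('t \<Rightarrow> 't \<Rightarrow> real) \<Rightarrow> ('t \<Rightarrow> 'a::euclidean_space) set
      \<Rightarrow> (('t \<Rightarrow> 'a) \<Rightarrow> ('t \<Rightarrow> 'a) \<Rightarrow> real) \<Rightarrow> bool" where
  "is_rkhs T K V ip \<longleftrightarrow>
     hilbert_space_on V ip \<and>
     (\<forall>h\<in>V. \<forall>t. t \<notin> T \<longrightarrow> h t = 0) \<and>
     (\<forall>t\<in>T. \<forall>a.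
        (\<lambda>s. if s \<in> T then K s t *\<^sub>R a else 0) \<in> V \<and>
        (\<forall>h\<in>V. ip h (\<lambda>s. if s \<in> T then K s t *\<^sub>R a else 0) = h t \<bullet> a))"

definition fbm_cov :: "real \<Rightarrow> real \<Rightarrow> real \<Rightarrow> real"
  where "fbm_cov H s t = (\<bar>s\<bar> powr (2 * H) + \<bar>t\<bar> powr (2 * H) - \<bar>t - s\<bar> powr (2 * H)) / 2"

definition fbm_cameron_martin ::
    "real \<Rightarrow> (real \<Rightarrow> 'a::euclidean_space) set \<Rightarrow> ((real \<Rightarrow> 'a) \<Rightarrow> (real \<Rightarrow> 'a) \<Rightarrow> real) \<Rightarrow> bool"
  where "fbm_cameron_martin H V ip \<longleftrightarrow> is_rkhs {0..1} (fbm_cov H) V ip"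

definition absolutely_continuous_path :: "(real \<Rightarrow> 'a::euclidean_space) \<Rightarrow> bool" where
  "absolutely_continuous_path k \<longleftrightarrow>
     (\<forall>\<epsilon>>0. \<exists>\<delta>>0. \<forall>d T. d division_of T \<and> T \<subseteq> {0..1} \<and> (\<Sum>K\<in>d. Sup K - Inf K) < \<delta>
        \<longrightarrow> (\<Sum>K\<in>d. norm (k (Sup K) - k (Inf K))) < \<epsilon>)"

text \<open>Almost everywhere differentiability follows from absolute continuity (Lebesgue); it is listed
  because the next clause refers to the derivative.\<close>

definition bm_cameron_martin :: "(real \<Rightarrow> 'a::euclidean_space) set" where
  "bm_cameron_martin = {k.
     absolutely_continuous_path k \<and> k 0 = 0 \<and> (\<forall>t. t \<notin> {0..1} \<longrightarrow> k t = 0) \<and>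
     (AE t in lebesgue. t \<in> {0..1} \<longrightarrow> k differentiable (at t)) \<and>
     set_integrable lebesgue {0..1} (\<lambda>t. (norm (vector_derivative k (at t)))\<^sup>2)}"

definition bm_ip :: "(real \<Rightarrow> 'a::euclidean_space) \<Rightarrow> (real \<Rightarrow> 'a) \<Rightarrow> real" where
  "bm_ip f k = set_lebesgue_integral lebesgue {0..1}
     (\<lambda>t. vector_derivative f (at t) \<bullet> vector_derivative k (at t))"


section \<open>Paths of finite variation and Young integrals\<close>

definition var_sums :: "real \<Rightarrow> (real \<Rightarrow> 'a::real_normed_vector) \<Rightarrow> real set" where
  "var_sums r x = {(\<Sum>K\<in>d. norm (x (Sup K) - x (Inf K)) powr r) | d. d division_of {0..1}}"

definition finite_var :: "real \<Rightarrow> (real \<Rightarrow> 'a::real_normed_vector) \<Rightarrow> bool"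
  where "finite_var r x \<longleftrightarrow> bdd_above (var_sums r x)"

definition var_norm :: "real \<Rightarrow> (real \<Rightarrow> 'a::real_normed_vector) \<Rightarrow> real"
  where "var_norm r x = (Sup (var_sums r x)) powr (1 / r)"

definition C0_var :: "real \<Rightarrow> (real \<Rightarrow> 'a::real_normed_vector) set" where
  "C0_var r = {x. continuous_on {0..1} x \<and> x 0 = 0 \<and> finite_var r x \<and>
                  (\<forall>t. t \<notin> {0..1} \<longrightarrow> x t = 0)}"

text \<open>\<open>\<integral>\<^sub>a\<^sup>b f\<^sub>s dg\<^sub>s\<close> as the limit of Riemann--Stieltjes sums when the mesh tends to 0. The integrand is
  an operator acting on the increments of \<open>g\<close>.\<close>

definition has_young_integral ::
    "(real \<Rightarrow> 'b::real_normed_vector \<Rightarrow> 'c::real_normed_vector) \<Rightarrow> (real \<Rightarrow> 'b) \<Rightarrow> real \<Rightarrow> real \<Rightarrow> 'c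
      \<Rightarrow> bool" where
  "has_young_integral f g a b I \<longleftrightarrow>
     (\<forall>\<epsilon>>0. \<exists>\<delta>>0. \<forall>D. D tagged_division_of {a..b} \<and> (\<forall>(x, K)\<in>D. Sup K - Inf K < \<delta>)
        \<longrightarrow> norm ((\<Sum>(x, K)\<in>D. f x (g (Sup K) - g (Inf K))) - I) < \<epsilon>)"

definition young_integral ::
    "(real \<Rightarrow> 'b::real_normed_vector \<Rightarrow> 'c::real_normed_vector) \<Rightarrow> (real \<Rightarrow> 'b) \<Rightarrow> real \<Rightarrow> real \<Rightarrow> 'c"
  where "young_integral f g a b = (THE I. has_young_integral f g a b I)"


section \<open>Frechet derivatives on a normed space given by a carrier\<close>

text \<open>Derivatives of order \<open>j\<close> are \<open>j\<close>-linear forms, written as functions of lists of length \<open>j\<close>;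
  the norm on them is the usual norm of bounded multilinear forms.\<close>

definition bounded_multilinear_on ::
    "'v::real_vector set \<Rightarrow> ('v \<Rightarrow> real) \<Rightarrow> nat \<Rightarrow> ('v list \<Rightarrow> real) \<Rightarrow> bool" where
  "bounded_multilinear_on V N j A \<longleftrightarrow>
     (\<forall>xs ys. \<forall>x\<in>V. \<forall>y\<in>V. \<forall>a.
        set xs \<subseteq> V \<and> set ys \<subseteq> V \<and> length xs + length ys + 1 = j \<longrightarrow>
        A (xs @ (a *\<^sub>R x + y) # ys) = a * A (xs @ x # ys) + A (xs @ y # ys)) \<and>
     (\<exists>C. \<forall>xs. set xs \<subseteq> V \<and> length xs = j \<longrightarrow> \<bar>A xs\<bar> \<le> C * prod_list (map N xs))"

definition has_frechet_derivative_form ::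
    "'v::real_vector set \<Rightarrow> ('v \<Rightarrow> real) \<Rightarrow> nat \<Rightarrow> ('v \<Rightarrow> 'v list \<Rightarrow> real) \<Rightarrow> 'v
      \<Rightarrow> ('v list \<Rightarrow> real) \<Rightarrow> bool" where
  "has_frechet_derivative_form V N j G y A \<longleftrightarrow>
     bounded_multilinear_on V N (Suc j) A \<and>
     (\<forall>\<epsilon>>0. \<exists>\<delta>>0. \<forall>z\<in>V. N z < \<delta> \<longrightarrow>
        (\<forall>xs. set xs \<subseteq> V \<and> length xs = j \<longrightarrow>
           \<bar>G (y + z) xs - G y xs - A (z # xs)\<bar> \<le> \<epsilon> * N z * prod_list (map N xs)))"

definition open_in_normed :: "'v::real_vector set \<Rightarrow> ('v \<Rightarrow> real) \<Rightarrow> 'v set \<Rightarrow> bool" where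
  "open_in_normed V N U \<longleftrightarrow> U \<subseteq> V \<and> (\<forall>y\<in>U. \<exists>r>0. \<forall>z\<in>V. N (z - y) < r \<longrightarrow> z \<in> U)"

text \<open>\<open>F\<close> is \<open>m\<close> times Frechet differentiable on the open set \<open>U\<close>, and \<open>D j y\<close> is its \<open>j\<close>-th
  derivative at \<open>y\<close>.\<close>

definition frechet_derivatives_on ::
    "'v::real_vector set \<Rightarrow> ('v \<Rightarrow> real) \<Rightarrow> nat \<Rightarrow> 'v set \<Rightarrow> ('v \<Rightarrow> real)
      \<Rightarrow> (nat \<Rightarrow> 'v \<Rightarrow> 'v list \<Rightarrow> real) \<Rightarrow> bool" where
  "frechet_derivatives_on V N m U F D \<longleftrightarrow>
     (\<forall>y\<in>U. D 0 y [] = F y) \<and>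
     (\<forall>j<m. \<forall>y\<in>U. has_frechet_derivative_form V N j (D j) y (D (Suc j) y))"

definition continuous_on_normed ::
    "'v::real_vector set \<Rightarrow> ('v \<Rightarrow> real) \<Rightarrow> ('v \<Rightarrow> real) \<Rightarrow> bool" where
  "continuous_on_normed V N F \<longleftrightarrow>
     (\<forall>x\<in>V. \<forall>\<epsilon>>0. \<exists>\<delta>>0. \<forall>y\<in>V. N (y - x) < \<delta> \<longrightarrow> \<bar>F y - F x\<bar> < \<epsilon>)"


section \<open>Coefficients\<close>

text \<open>Derivatives are taken within \<open>X\<close>, which gives one-sided derivatives at boundary points; they are
  unique for the sets used below, the whole space and \<open>[0,1] \<times> \<real>\<^sup>n\<close>.\<close>

primrec iterated_derivative ::
    "'a::euclidean_space set \<Rightarrow> ('a \<Rightarrow> 'b::euclidean_space) \<Rightarrow> 'a list \<Rightarrow> 'a \<Rightarrow> 'b" where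
  "iterated_derivative X f [] = f"
| "iterated_derivative X f (v # vs) =
     (\<lambda>x. frechet_derivative (iterated_derivative X f vs) (at x within X) v)"

definition Cb_infinity_on :: "'a::euclidean_space set \<Rightarrow> ('a \<Rightarrow> 'b::euclidean_space) \<Rightarrow> bool" where
  "Cb_infinity_on X f \<longleftrightarrow>
     (\<forall>vs. iterated_derivative X f vs differentiable_on X \<and> bounded (iterated_derivative X f vs ` X))"

definition block_matrix :: "real^'d1^'n \<Rightarrow> real^'d2^'n \<Rightarrow> real^('d1 + 'd2)^'n" where
  "block_matrix A B = (\<chi> i j. case j of Inl a \<Rightarrow> A $ i $ a | Inr b \<Rightarrow> B $ i $ b)"

definition stack_path :: "(real \<Rightarrow> real^'d1) \<Rightarrow> (real \<Rightarrow> real^'d2) \<Rightarrow> real \<Rightarrow> real^('d1 + 'd2)" where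
  "stack_path f g t = (\<chi> j. case j of Inl a \<Rightarrow> f t $ a | Inr b \<Rightarrow> g t $ b)"

text \<open>Directional derivatives \<open>\<nabla>g(y)\<langle>v\<rangle>\<close> and \<open>\<nabla>\<^sup>2g(y)\<langle>u,v\<rangle>\<close>.\<close>

definition grad :: "('a::real_normed_vector \<Rightarrow> 'b::real_normed_vector) \<Rightarrow> 'a \<Rightarrow> 'a \<Rightarrow> 'b"
  where "grad g y v = frechet_derivative g (at y) v"

definition grad2 :: "('a::real_normed_vector \<Rightarrow> 'b::real_normed_vector) \<Rightarrow> 'a \<Rightarrow> 'a \<Rightarrow> 'a \<Rightarrow> 'b"
  where "grad2 g y u v = frechet_derivative (\<lambda>x. grad g x v) (at y) u"


section \<open>The Young ODE and the derivatives of its solution map\<close>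

text \<open>Below, \<open>z\<close> is the driving path \<open>(\<gamma>,\<eta>)\<^sup>T\<close>, \<open>S\<close> the block matrix coefficient and \<open>b0\<close> the drift.\<close>

definition young_ode_solution ::
    "real \<Rightarrow> (real^'n \<Rightarrow> real^'m^'n) \<Rightarrow> (real^'n \<Rightarrow> real^'n) \<Rightarrow> (real \<Rightarrow> real^'m)
      \<Rightarrow> (real \<Rightarrow> real^'n) \<Rightarrow> bool" where
  "young_ode_solution q S b0 z \<phi> \<longleftrightarrow>
     \<phi> \<in> C0_var q \<and>
     (\<forall>t\<in>{0..1}. \<phi> t = young_integral (\<lambda>s w. S (\<phi> s) *v w) z 0 t + integral {0..t} (\<lambda>s. b0 (\<phi> s)))"

definition Omega ::
    "(real^'n \<Rightarrow> real^'m^'n) \<Rightarrow> (real^'n \<Rightarrow> real^'n) \<Rightarrow> (real \<Rightarrow> real^'m) \<Rightarrow> (real \<Rightarrow> real^'n)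
      \<Rightarrow> real \<Rightarrow> real^'n^'n" where
  "Omega S b0 z \<phi> t = matrix (\<lambda>v.
     young_integral (\<lambda>s w. grad S (\<phi> s) v *v w) z 0 t + integral {0..t} (\<lambda>s. grad b0 (\<phi> s) v))"

definition jacobian_flow ::
    "real \<Rightarrow> (real^'n \<Rightarrow> real^'m^'n) \<Rightarrow> (real^'n \<Rightarrow> real^'n) \<Rightarrow> (real \<Rightarrow> real^'m)
      \<Rightarrow> (real \<Rightarrow> real^'n) \<Rightarrow> (real \<Rightarrow> real^'n^'n) \<Rightarrow> bool" where
  "jacobian_flow q S b0 z \<phi> M \<longleftrightarrow>
     continuous_on {0..1} M \<and> finite_var q M \<and>
     (\<forall>t\<in>{0..1}. M t = mat 1 + young_integral (\<lambda>s A. A ** M s) (Omega S b0 z \<phi>) 0 t)"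

text \<open>\<open>\<nabla>\<Psi>(z)\<langle>k\<rangle>\<close>\<close>

definition chi ::
    "(real^'n \<Rightarrow> real^'m^'n) \<Rightarrow> (real \<Rightarrow> real^'n) \<Rightarrow> (real \<Rightarrow> real^'n^'n) \<Rightarrow> (real \<Rightarrow> real^'m)
      \<Rightarrow> real \<Rightarrow> real^'n" where
  "chi S \<phi> M k = on_unit (\<lambda>t.
     M t *v young_integral (\<lambda>s w. matrix_inv (M s) *v (S (\<phi> s) *v w)) k 0 t)"

definition V1 ::
    "(real^'n \<Rightarrow> real^'m^'n) \<Rightarrow> (real \<Rightarrow> real^'n) \<Rightarrow> (real \<Rightarrow> real^'n^'n)
      \<Rightarrow> (real \<Rightarrow> real^'m) \<Rightarrow> (real \<Rightarrow> real^'m) \<Rightarrow> real \<Rightarrow> real^'n" where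
  "V1 S \<phi> M f k = on_unit (\<lambda>t. M t *v
     (young_integral (\<lambda>s w. matrix_inv (M s) *v (grad S (\<phi> s) (chi S \<phi> M f s) *v w)) k 0 t +
      young_integral (\<lambda>s w. matrix_inv (M s) *v (grad S (\<phi> s) (chi S \<phi> M k s) *v w)) f 0 t))"

definition V2 ::
    "(real^'n \<Rightarrow> real^'m^'n) \<Rightarrow> (real^'n \<Rightarrow> real^'n) \<Rightarrow> (real \<Rightarrow> real^'m) \<Rightarrow> (real \<Rightarrow> real^'n)
      \<Rightarrow> (real \<Rightarrow> real^'n^'n) \<Rightarrow> (real \<Rightarrow> real^'m) \<Rightarrow> (real \<Rightarrow> real^'m) \<Rightarrow> real \<Rightarrow> real^'n" where
  "V2 S b0 z \<phi> M f k = on_unit (\<lambda>t. M t *v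
     (young_integral
        (\<lambda>s w. matrix_inv (M s) *v (grad2 S (\<phi> s) (chi S \<phi> M f s) (chi S \<phi> M k s) *v w)) z 0 t +
      integral {0..t}
        (\<lambda>s. matrix_inv (M s) *v grad2 b0 (\<phi> s) (chi S \<phi> M f s) (chi S \<phi> M k s))))"

text \<open>\<open>\<nabla>\<^sup>2(F \<circ> \<Psi>)(z)\<langle>(f, fh), (k, kh)\<rangle>\<close>, where \<open>\<phi> = \<Psi>(z)\<close> and \<open>D j\<close> is the \<open>j\<close>-th derivative of \<open>F\<close>.\<close>

definition hessian ::
    "(real^'n \<Rightarrow> real^('d1 + 'd2)^'n) \<Rightarrow> (real^'n \<Rightarrow> real^'n) \<Rightarrow> (real \<Rightarrow> real^('d1 + 'd2))
      \<Rightarrow> (real \<Rightarrow> real^'n) \<Rightarrow> (real \<Rightarrow> real^'n^'n)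
      \<Rightarrow> (nat \<Rightarrow> (real \<Rightarrow> real^'n) \<Rightarrow> (real \<Rightarrow> real^'n) list \<Rightarrow> real)
      \<Rightarrow> (real \<Rightarrow> real^'d1) \<times> (real \<Rightarrow> real^'d2) \<Rightarrow> (real \<Rightarrow> real^'d1) \<times> (real \<Rightarrow> real^'d2) \<Rightarrow> real" where
  "hessian S b0 z \<phi> M D x y =
     (let f = stack_path (fst x) (snd x); k = stack_path (fst y) (snd y)
      in D 1 \<phi> [V1 S \<phi> M f k + V2 S b0 z \<phi> M f k] + D 2 \<phi> [chi S \<phi> M f, chi S \<phi> M k])"

end

theory Submission
  imports Defs
begin

text \<open>
  The Hessian extends to paths of finite \<open>3/2\<close>-variation vanishing at \<open>0\<close>, where Young's inequality
  bounds it by \<open>C \<parallel>f\<parallel> \<parallel>k\<parallel>\<close> in \<open>3/2\<close>-variation norm. Regularity is measured by monotone controls \<open>F\<close>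
  with \<open>\<bar>x\<^sub>t - x\<^sub>s\<bar>\<^sup>r \<le> F t - F s\<close>.

  Every Cameron--Martin path \<open>h\<close> satisfies \<open>\<Sum> \<bar>h(I)\<bar>\<^sup>2 / \<bar>I\<bar>\<^sup>2\<^sup>H \<le> 2 \<parallel>h\<parallel>\<^sup>2\<close> over any division of \<open>[0,1]\<close>,
  because increments of fractional Brownian motion with \<open>H < 1/2\<close> are negatively correlated. Hence \<open>h\<close> has
  finite \<open>q\<close>-variation, and its Faber--Schauder coefficients at level \<open>m\<close> have square sum at most a
  constant times \<open>2\<^sup>-\<^sup>2\<^sup>H\<^sup>m \<parallel>h\<parallel>\<^sup>2\<close>. The matrix of the Hessian between the tents of levels \<open>m\<close> and \<open>n\<close> has
  squared Frobenius norm of order \<open>2\<^bsup>2(m+n)/3\<^esup>\<close>, since a single tent has bounded \<open>3/2\<close>-variation and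
  a row of the matrix is tested against a combination of tents. Bessel's inequality therefore bounds
  the Hilbert--Schmidt norm of the \<open>(m,n)\<close> block by a multiple of \<open>2\<^bsup>(1/3-H)(m+n)\<^esup>\<close>, which is summable as
  \<open>H > 1/3\<close>.
\<close>

section \<open>Paths of finite variation\<close>

text \<open>The exponents are used as \<open>1 < q < 6/5\<close> and \<open>3/2 \<le> p'\<close>.
  Between the two lies \<open>3/2\<close>: driver, solution and flow have finite
  \<open>3/2\<close>-variation, two such paths can be integrated against each other because 2/3 +
  2/3 > 1, and \<open>3/2\<close>-variation dominates the norm in which the functional is
  differentiable. A combination of N tents with coefficients of unit Euclidean length has
  \<open>3/2\<close>-variation of order N^(1/6), the exponent being 2/3 - 1/2; so a row has squared
  length of order 2^(n/3), and the coarser level \<open>m\<close> has about 2^m rows.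

  A gap between two exponents is spent again and again: bounded s-variation and small oscillation
  make the r-variation small when r > s. This yields convergence of Riemann sums, the spreading of
  zeros of a linear flow, and convergence of the Faber-Schauder series.

  The flow is given only by its linear equation, and \<open>D 2\<close> only as a derivative of
  \<open>D 1\<close>. So invertibility of \<open>M t\<close>, finite variation of the inverse and
  symmetry of both kinds of second derivatives have to be proved before the form can be
  estimated.\<close>

lemma division_of_interval_elem:
  fixes K :: "real set"
  assumes "d division_of {a..b}" "K \<in> d"
  shows "K = {Inf K..Sup K}" "Inf K \<le> Sup K" "a \<le> Inf K" "Sup K \<le> b"
proof -
  obtain u v where K: "K = cbox u v" "K \<noteq> {}" "K \<subseteq> {a..b}"
    using division_ofD(2-4)[OF assms(1)] assms(2) by metis
  then have "u \<le> v" by simp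
  then show "K = {Inf K..Sup K}" "Inf K \<le> Sup K" "a \<le> Inf K" "Sup K \<le> b"
    using K by auto
qed

text \<open>Tagging every cell by its left end turns the division into a tagged one, over which
  increments are additive. One-point cells contribute 0, so arbitrary divisions are allowed.\<close>

lemma sum_telescope_division:
  fixes F :: "real \<Rightarrow> 'a::real_normed_vector"
  assumes "d division_of {a..b}" "a \<le> b"
  shows "(\<Sum>K\<in>d. F (Sup K) - F (Inf K)) = F b - F a"
proof -
  note e = division_of_interval_elem[OF assms(1)]
  let ?p = "(\<lambda>K. (Inf K, K)) ` d"
  have "?p tagged_division_of {a..b}"
  proof (rule tagged_division_ofI)
    show "finite ?p" using assms by (auto simp: division_of_def)
    show "x \<in> K" "K \<subseteq> {a..b}" "\<exists>a b. K = cbox a b" if "(x, K) \<in> ?p" for x K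
      using that e[of K] assms(1) by (auto simp: division_of_def)
    show "interior K1 \<inter> interior K2 = {}"
      if "(x1, K1) \<in> ?p" "(x2, K2) \<in> ?p" "(x1, K1) \<noteq> (x2, K2)" for x1 K1 x2 K2
    proof -
      have "K1 \<in> d" "K2 \<in> d" "K1 \<noteq> K2" using that by auto
      then show ?thesis using assms(1) by (simp add: division_of_def)
    qed
    have "{K. \<exists>x. (x, K) \<in> ?p} = d" by auto
    then show "\<Union> {K. \<exists>x. (x, K) \<in> ?p} = {a..b}"
      using assms(1) by (simp add: division_of_def)
  qed
  from additive_tagged_division_1[OF assms(2) this, of F]
  show ?thesis by (subst (asm) sum.reindex) (auto simp: inj_on_def)
qed

lemma division_of_self_interval: "a \<le> b \<Longrightarrow> {{a..b}} division_of {a..b::real}"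
  using division_of_self[of a b] by simp

section \<open>Monotone controls of a path\<close>

text \<open>A one-variable encoding of the usual two-variable control: \<open>F t - F s\<close> is
  additive over adjacent intervals, so superadditivity is built in, and a sum of controls is handled
  by adding functions.\<close>

definition controls :: "real \<Rightarrow> (real \<Rightarrow> real) \<Rightarrow> (real \<Rightarrow> 'a::real_normed_vector) \<Rightarrow> real \<Rightarrow> real \<Rightarrow> bool"
  where "controls r F x a b \<longleftrightarrow>
    (\<forall>s t. a \<le> s \<longrightarrow> s \<le> t \<longrightarrow> t \<le> b \<longrightarrow> norm (x t - x s) powr r \<le> F t - F s)"

lemma controlsD: "controls r F x a b \<Longrightarrow> a \<le> s \<Longrightarrow> s \<le> t \<Longrightarrow> t \<le> b \<Longrightarrow> norm (x t - x s) powr r \<le> F t - F s"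
  by (simp add: controls_def)

lemma controls_mono: "controls r F x a b \<Longrightarrow> a \<le> s \<Longrightarrow> s \<le> t \<Longrightarrow> t \<le> b \<Longrightarrow> F s \<le> F t"
  using controlsD[of r F x a b s t] powr_ge_zero[of "norm (x t - x s)" r] by linarith

lemma controls_subset:
  "controls r F x a b \<Longrightarrow> a \<le> a' \<Longrightarrow> b' \<le> b \<Longrightarrow> controls r F x a' b'"
  by (simp add: controls_def)

lemma controls_norm_le:
  assumes "controls r F x a b" "r > 0" "a \<le> s" "s \<le> t" "t \<le> b"
  shows "norm (x t - x s) \<le> (F t - F s) powr (1 / r)"
proof -
  have "norm (x t - x s) = (norm (x t - x s) powr r) powr (1 / r)"
    using assms by (simp add: powr_powr)
  also have "\<dots> \<le> (F t - F s) powr (1 / r)"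
    using assms by (intro powr_mono2 controlsD[OF assms(1)]) auto
  finally show ?thesis .
qed

lemma controls_norm_le':
  assumes "controls r F x a b" "r > 0" "a \<le> s" "s \<le> b" "a \<le> t" "t \<le> b" "F b - F a \<le> c powr r" "0 \<le> c"
  shows "norm (x t - x s) \<le> c"
proof -
  have *: "norm (x t - x s) \<le> c" if "a \<le> s" "s \<le> t" "t \<le> b" for s t
  proof -
    have "norm (x t - x s) \<le> (F t - F s) powr (1 / r)"
      by (rule controls_norm_le[OF assms(1,2) that])
    also have "\<dots> \<le> (c powr r) powr (1 / r)"
      using controls_mono[OF assms(1), of a s] controls_mono[OF assms(1), of t b]
        controls_mono[OF assms(1), of s t] that assms by (intro powr_mono2) auto
    also have "\<dots> = c" using assms by (simp add: powr_powr)
    finally show ?thesis .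
  qed
  show ?thesis
    using *[of s t] *[of t s] assms by (cases "s \<le> t") (auto simp: norm_minus_commute)
qed

text \<open>Sums over a division telescope in \<open>F\<close>, so a single increment of the control
  bounds all of them at once.\<close>

lemma finite_var_controls:
  assumes "controls r F x 0 1"
  shows "finite_var r x" "Sup (var_sums r x) \<le> F 1 - F 0"
proof -
  have *: "y \<le> F 1 - F 0" if "y \<in> var_sums r x" for y
  proof -
    from that obtain d where d: "d division_of {0..1}"
      and y: "y = (\<Sum>K\<in>d. norm (x (Sup K) - x (Inf K)) powr r)"
      by (auto simp: var_sums_def)
    have "y \<le> (\<Sum>K\<in>d. F (Sup K) - F (Inf K))"
      unfolding y using division_of_interval_elem[OF d]
      by (intro sum_mono controlsD[OF assms]) auto
    also have "\<dots> = F 1 - F 0" by (rule sum_telescope_division[OF d]) simp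
    finally show ?thesis .
  qed
  show "finite_var r x" unfolding finite_var_def using * by (rule bdd_aboveI)
  have "{{0..1::real}} division_of {0..1}" by (intro division_of_self_interval) auto
  then have "var_sums r x \<noteq> {}" unfolding var_sums_def by blast
  then show "Sup (var_sums r x) \<le> F 1 - F 0" using * by (rule cSup_least)
qed

text \<open>The control at \<open>t\<close> is the variation over \<open>{0..t}\<close>: appending
  the cell \<open>{s..t}\<close> to a division of \<open>{0..s}\<close> gives a division of
  \<open>{0..t}\<close>, which is the superadditivity that is required.\<close>

lemma controls_finite_var:
  fixes x :: "real \<Rightarrow> 'a::real_normed_vector"
  assumes "finite_var r x"
  obtains F where "controls r F x 0 1" "F 1 - F 0 \<le> Sup (var_sums r x)"
proof -
  define \<nu> where "\<nu> d = (\<Sum>K\<in>d. norm (x (Sup K) - x (Inf K)) powr r)" for d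
  define V where "V t = {\<nu> d | d. d division_of {0..t}}" for t :: real
  define F where "F t = Sup (V t)" for t
  have V1: "V 1 = var_sums r x" by (simp add: V_def var_sums_def \<nu>_def)
  have ext: "\<nu> d + norm (x t - x s) powr r \<in> V t"
    if st: "0 \<le> s" "s \<le> t" and d: "d division_of {0..s}" for s t d
  proof -
    have "(d \<union> {{s..t}}) division_of ({0..s} \<union> {s..t})"
      using st by (intro division_disjoint_union d division_of_self_interval) auto
    moreover have "{0..s} \<union> {s..t} = {0..t}" using st by auto
    moreover have "\<nu> (d \<union> {{s..t}}) = \<nu> d + norm (x t - x s) powr r"
    \<comment> \<open>A union of sets cannot count a cell twice. The new cell already occurs only if
      \<open>s = t\<close>, and then its increment is 0.\<close>
    proof (cases "{s..t} \<in> d")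
      case True
      then have "{s..t} \<subseteq> {0..s}" using d by (auto simp: division_of_def)
      then have "s = t" using st by auto
      then show ?thesis using True by (simp add: insert_absorb)
    next
      case False
      then show ?thesis using st division_of_finite[OF d] by (simp add: \<nu>_def)
    qed
    ultimately have "(d \<union> {{s..t}}) division_of {0..t}" "\<nu> d + norm (x t - x s) powr r = \<nu> (d \<union> {{s..t}})"
      by (metis, metis)
    then show ?thesis unfolding V_def by blast
  qed
  have ne: "V t \<noteq> {}" if "0 \<le> t" for t
  proof -
    have "{{0..t}} division_of {0..t}" using that by (intro division_of_self_interval) auto
    then show ?thesis unfolding V_def by blast
  qed
  have bd: "bdd_above (V t)" if "0 \<le> t" "t \<le> 1" for t
  proof -
    from assms obtain B where B: "\<And>y. y \<in> V 1 \<Longrightarrow> y \<le> B"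
      by (auto simp: finite_var_def V1 bdd_above_def)
    have "y \<le> B" if y: "y \<in> V t" for y
    proof -
      from y obtain d where d: "d division_of {0..t}" "y = \<nu> d" by (auto simp: V_def)
      have "\<nu> d + norm (x 1 - x t) powr r \<le> B"
        using \<open>0 \<le> t\<close> \<open>t \<le> 1\<close> by (intro B ext d)
      then show ?thesis using d powr_ge_zero[of "norm (x 1 - x t)" r] by linarith
    qed
    then show ?thesis by (rule bdd_aboveI)
  qed
  have "controls r F x 0 1"
    unfolding controls_def
  proof (intro allI impI)
    fix s t :: real assume st: "0 \<le> s" "s \<le> t" "t \<le> 1"
    have "F s \<le> F t - norm (x t - x s) powr r"
      unfolding F_def[of s]
    proof (rule cSup_least)
      show "V s \<noteq> {}" using ne st by auto
      fix y assume "y \<in> V s"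
      then obtain d where d: "d division_of {0..s}" "y = \<nu> d" by (auto simp: V_def)
      then have "y + norm (x t - x s) powr r \<in> V t" using ext st by auto
      then have "y + norm (x t - x s) powr r \<le> F t"
        unfolding F_def using bd[of t] st by (intro cSup_upper) auto
      then show "y \<le> F t - norm (x t - x s) powr r" by linarith
    qed
    then show "norm (x t - x s) powr r \<le> F t - F s" by linarith
  qed
  \<comment> \<open>\<open>F 0\<close> enters with a minus sign, so this lower bound lets
    \<open>F 1\<close>, the full variation, bound the increment.\<close>
  moreover have "0 \<le> F 0"
  proof -
    obtain y where y: "y \<in> V 0" using ne[of 0] by auto
    then have "0 \<le> y" by (auto simp: V_def \<nu>_def intro!: sum_nonneg)
    also have "y \<le> F 0" unfolding F_def using y bd[of 0] by (intro cSup_upper) auto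
    finally show ?thesis .
  qed
  ultimately show ?thesis using that[of F] by (simp add: F_def V1)
qed

section \<open>Variation bounds and the operations that preserve them\<close>

text \<open>A bound instead of a norm, so that constants can be chained through nested constructions
  without computing a supremum. The same \<open>c\<close> also bounds the sup norm, since products
  and Young integrals need both.\<close>

definition var_bounded :: "real \<Rightarrow> (real \<Rightarrow> 'a::real_normed_vector) \<Rightarrow> real \<Rightarrow> bool"
  where "var_bounded r x c \<longleftrightarrow> continuous_on {0..1} x \<and> 0 \<le> c \<and> (\<forall>t\<in>{0..1}. norm (x t) \<le> c) \<and>
    (\<exists>F. controls r F x 0 1 \<and> F 1 - F 0 \<le> c powr r)"

lemma var_boundedD:
  assumes "var_bounded r x c"
  shows "continuous_on {0..1} x" "0 \<le> c" "t \<in> {0..1} \<Longrightarrow> norm (x t) \<le> c"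
  using assms by (auto simp: var_bounded_def)

lemma var_bounded_controls:
  assumes "var_bounded r x c"
  obtains F where "controls r F x 0 1" "F 1 - F 0 \<le> c powr r"
  using assms by (auto simp: var_bounded_def)

lemma var_boundedI:
  assumes "continuous_on {0..1} x" "0 \<le> c" "\<And>t. t \<in> {0..1} \<Longrightarrow> norm (x t) \<le> c"
    "\<And>s t. 0 \<le> s \<Longrightarrow> s \<le> t \<Longrightarrow> t \<le> 1 \<Longrightarrow> norm (x t - x s) powr r \<le> F t - F s"
    "F 1 - F 0 \<le> c powr r"
  shows "var_bounded r x c"
  using assms unfolding var_bounded_def controls_def by blast

lemma var_bounded_mono: "var_bounded r x c \<Longrightarrow> c \<le> c' \<Longrightarrow> 0 \<le> r \<Longrightarrow> var_bounded r x c'"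
  unfolding var_bounded_def using powr_mono2[of r c c'] by force

lemma var_bounded_cong:
  assumes "var_bounded r x c" "\<And>t. t \<in> {0..1} \<Longrightarrow> x t = y t"
  shows "var_bounded r y c"
proof -
  obtain F where F: "controls r F x 0 1" "F 1 - F 0 \<le> c powr r"
    using var_bounded_controls[OF assms(1)] .
  show ?thesis
  proof (rule var_boundedI[OF _ _ _ _ F(2)])
    show "continuous_on {0..1} y"
      by (rule continuous_on_eq[OF var_boundedD(1)[OF assms(1)]]) (rule assms(2))
    show "norm (y t) \<le> c" if "t \<in> {0..1}" for t
      using var_boundedD(3)[OF assms(1) that] assms(2)[OF that] by simp
    show "norm (y t - y s) powr r \<le> F t - F s" if "0 \<le> s" "s \<le> t" "t \<le> 1" for s t
      using controlsD[OF F(1) that] assms(2)[of s] assms(2)[of t] that by simp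
  qed (use var_boundedD[OF assms(1)] in auto)
qed

lemma powr_add_le:
  fixes u v r :: real
  assumes "0 \<le> u" "0 \<le> v" "0 \<le> r"
  shows "(u + v) powr r \<le> 2 powr r * (u powr r + v powr r)"
proof -
  have "(u + v) powr r \<le> (2 * max u v) powr r"
    using assms by (intro powr_mono2) auto
  also have "\<dots> = 2 powr r * max u v powr r" using assms by (simp add: powr_mult)
  also have "\<dots> \<le> 2 powr r * (u powr r + v powr r)"
    by (intro mult_left_mono) (auto simp: max_def)
  finally show ?thesis .
qed

text \<open>Source of the factors 4 below: for \<open>r \<ge> 1\<close> a factor 2 in front of a
  power is at most \<open>2 powr r\<close>. So the \<open>2 powr r\<close> from adding two
  increments and the 2 from adding two controls merge into one factor 4 inside the power.\<close>

lemma four_powr: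
  fixes a r :: real
  assumes "0 \<le> a" "1 \<le> r"
  shows "2 powr r * (2 * a powr r) \<le> (4 * a) powr r"
proof -
  have "(2::real) \<le> 2 powr r" using assms powr_mono[of 1 r 2] by simp
  then have "2 powr r * (2 * a powr r) \<le> 2 powr r * (2 powr r * a powr r)"
    by (intro mult_left_mono mult_right_mono) auto
  also have "\<dots> = (4 * a) powr r" using assms powr_mult[of 2 "2 * a" r] powr_mult[of 2 a r] by simp
  finally show ?thesis .
qed

lemma var_bounded_add:
  assumes "var_bounded r x a" "var_bounded r y b" "1 \<le> r"
  shows "var_bounded r (\<lambda>t. x t + y t) (4 * (a + b))"
proof -
  obtain F where F: "controls r F x 0 1" "F 1 - F 0 \<le> a powr r"
    using var_bounded_controls[OF assms(1)] .
  obtain G where G: "controls r G y 0 1" "G 1 - G 0 \<le> b powr r"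
    using var_bounded_controls[OF assms(2)] .
  note x = var_boundedD[OF assms(1)] and y = var_boundedD[OF assms(2)]
  show ?thesis
  proof (rule var_boundedI[where F = "\<lambda>t. 2 powr r * (F t + G t)"])
    show "continuous_on {0..1} (\<lambda>t. x t + y t)" by (intro continuous_intros x y)
    show "0 \<le> 4 * (a + b)" using x y by simp
    show "norm (x t + y t) \<le> 4 * (a + b)" if "t \<in> {0..1}" for t
    proof -
      have "norm (x t + y t) \<le> a + b"
        using x(3)[OF that] y(3)[OF that] by (intro norm_triangle_le add_mono)
      also have "\<dots> \<le> 4 * (a + b)" using x(2) y(2) by simp
      finally show ?thesis .
    qed
    show "norm (x t + y t - (x s + y s)) powr r \<le> 2 powr r * (F t + G t) - 2 powr r * (F s + G s)"
      if st: "0 \<le> s" "s \<le> t" "t \<le> 1" for s t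
    proof -
      have "norm (x t + y t - (x s + y s)) \<le> norm (x t - x s) + norm (y t - y s)"
        by norm
      then have "norm (x t + y t - (x s + y s)) powr r \<le> (norm (x t - x s) + norm (y t - y s)) powr r"
        using assms by (intro powr_mono2) auto
      also have "\<dots> \<le> 2 powr r * (norm (x t - x s) powr r + norm (y t - y s) powr r)"
        using assms by (intro powr_add_le) auto
      also have "\<dots> \<le> 2 powr r * ((F t - F s) + (G t - G s))"
        using controlsD[OF F(1) st] controlsD[OF G(1) st] by (intro mult_left_mono add_mono) auto
      finally show ?thesis by (simp add: algebra_simps)
    qed
    have "2 powr r * (F 1 + G 1) - 2 powr r * (F 0 + G 0) \<le> 2 powr r * (a powr r + b powr r)"
      using F(2) G(2) by (simp flip: right_diff_distrib)
    also have "\<dots> \<le> 2 powr r * (2 * (a + b) powr r)"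
      using powr_mono2[of r a "a + b"] powr_mono2[of r b "a + b"] x y assms
      by (intro mult_left_mono) auto
    also have "\<dots> \<le> (4 * (a + b)) powr r" using x y assms by (intro four_powr) auto
    finally show "2 powr r * (F 1 + G 1) - 2 powr r * (F 0 + G 0) \<le> (4 * (a + b)) powr r" .
  qed
qed

text \<open>The increment of the product splits by Leibniz into two terms, each a sup norm times an
  increment; up to a factor the control is therefore
  \<open>b powr r * F t + a powr r * G t\<close>.\<close>

lemma var_bounded_bilinear:
  assumes x: "var_bounded r x a" and y: "var_bounded r y b" and r: "1 \<le> r"
    and p: "bounded_bilinear pr" and K: "\<And>u v. norm (pr u v) \<le> K * norm u * norm v" "0 \<le> K"
  shows "var_bounded r (\<lambda>t. pr (x t) (y t)) (4 * K * a * b)"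
proof -
  interpret bounded_bilinear pr by (rule p)
  obtain F where F: "controls r F x 0 1" "F 1 - F 0 \<le> a powr r"
    using var_bounded_controls[OF assms(1)] .
  obtain G where G: "controls r G y 0 1" "G 1 - G 0 \<le> b powr r"
    using var_bounded_controls[OF assms(2)] .
  note x = var_boundedD[OF x] and y = var_boundedD[OF y]
  let ?H = "\<lambda>t. 2 powr r * K powr r * (b powr r * F t + a powr r * G t)"
  show ?thesis
  proof (rule var_boundedI[where F = ?H])
    show "continuous_on {0..1} (\<lambda>t. pr (x t) (y t))" by (intro continuous_on x y)
    show "0 \<le> 4 * K * a * b" using x y K by simp
    show "norm (pr (x t) (y t)) \<le> 4 * K * a * b" if "t \<in> {0..1}" for t
    proof -
      have "norm (pr (x t) (y t)) \<le> K * norm (x t) * norm (y t)" by (rule K)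
      also have "\<dots> \<le> K * a * b"
        using x(2,3) y(2,3) that K by (intro mult_mono) auto
      also have "\<dots> \<le> 4 * (K * a * b)" using x(2) y(2) K by simp
      finally show ?thesis by (simp add: mult.assoc)
    qed
    show "norm (pr (x t) (y t) - pr (x s) (y s)) powr r \<le> ?H t - ?H s"
      if st: "0 \<le> s" "s \<le> t" "t \<le> 1" for s t
    proof -
      have "pr (x t) (y t) - pr (x s) (y s) = pr (x t - x s) (y t) + pr (x s) (y t - y s)"
        by (simp add: diff_left diff_right)
      then have "norm (pr (x t) (y t) - pr (x s) (y s))
          \<le> K * norm (x t - x s) * norm (y t) + K * norm (x s) * norm (y t - y s)"
        using norm_triangle_le[OF add_mono[OF K(1)[of "x t - x s" "y t"] K(1)[of "x s" "y t - y s"]]] by simp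
      also have "\<dots> \<le> K * norm (x t - x s) * b + K * a * norm (y t - y s)"
        using x(3)[of s] y(3)[of t] x(2) y(2) st K by (intro add_mono mult_mono) auto
      finally have "norm (pr (x t) (y t) - pr (x s) (y s)) powr r
          \<le> (K * norm (x t - x s) * b + K * a * norm (y t - y s)) powr r"
        using r by (intro powr_mono2) auto
      also have "\<dots> \<le> 2 powr r * ((K * norm (x t - x s) * b) powr r + (K * a * norm (y t - y s)) powr r)"
        using r x(2) y(2) K by (intro powr_add_le) auto
      also have "\<dots> = 2 powr r * K powr r * (b powr r * norm (x t - x s) powr r + a powr r * norm (y t - y s) powr r)"
        using x(2) y(2) K by (simp add: powr_mult algebra_simps)
      also have "\<dots> \<le> 2 powr r * K powr r * (b powr r * (F t - F s) + a powr r * (G t - G s))"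
        using controlsD[OF F(1) st] controlsD[OF G(1) st] by (intro mult_left_mono add_mono) auto
      finally show ?thesis by (simp add: algebra_simps)
    qed
    have "?H 1 - ?H 0 = 2 powr r * K powr r * (b powr r * (F 1 - F 0) + a powr r * (G 1 - G 0))"
      by (simp add: algebra_simps)
    also have "\<dots> \<le> 2 powr r * K powr r * (b powr r * a powr r + a powr r * b powr r)"
      using F(2) G(2) by (intro mult_left_mono add_mono) auto
    also have "\<dots> = 2 powr r * (2 * (K * a * b) powr r)"
      using x(2) y(2) K by (simp add: powr_mult algebra_simps)
    also have "\<dots> \<le> (4 * (K * a * b)) powr r"
      using x y r K by (intro four_powr) auto
    finally show "?H 1 - ?H 0 \<le> (4 * K * a * b) powr r" by (simp add: mult.assoc)
  qed
qed

text \<open>The control sees increments only, so the value of \<open>g\<close> at 0 enters the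
  constant through the sup norm alone.\<close>

lemma var_bounded_lipschitz:
  assumes x: "var_bounded r x a" and r: "1 \<le> r"
    and L: "\<And>u v. norm (g u - g v) \<le> L * norm (u - v)" "0 \<le> L"
  shows "var_bounded r (\<lambda>t. g (x t)) (norm (g 0) + L * a)"
proof -
  obtain F where F: "controls r F x 0 1" "F 1 - F 0 \<le> a powr r"
    using var_bounded_controls[OF assms(1)] .
  note x = var_boundedD[OF x]
  have g: "continuous_on UNIV g"
    using L by (intro lipschitz_on_continuous_on[of L] lipschitz_onI) (auto simp: dist_norm)
  show ?thesis
  proof (rule var_boundedI[where F = "\<lambda>t. L powr r * F t"])
    show "continuous_on {0..1} (\<lambda>t. g (x t))"
      using continuous_on_compose2[OF g x(1)] by simp
    show "0 \<le> norm (g 0) + L * a" using x(2) L by simp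
    show "norm (g (x t)) \<le> norm (g 0) + L * a" if "t \<in> {0..1}" for t
    proof -
      have "norm (g (x t)) \<le> norm (g 0) + norm (g (x t) - g 0)" by norm
      also have "norm (g (x t) - g 0) \<le> L * norm (x t)" using L(1)[of "x t" 0] by simp
      also have "\<dots> \<le> L * a" using x(3)[OF that] L by (intro mult_left_mono) auto
      finally show ?thesis by simp
    qed
    show "norm (g (x t) - g (x s)) powr r \<le> L powr r * F t - L powr r * F s"
      if st: "0 \<le> s" "s \<le> t" "t \<le> 1" for s t
    proof -
      have "norm (g (x t) - g (x s)) powr r \<le> (L * norm (x t - x s)) powr r"
        using L r by (intro powr_mono2) auto
      also have "\<dots> = L powr r * norm (x t - x s) powr r" using L by (simp add: powr_mult)
      also have "\<dots> \<le> L powr r * (F t - F s)" using controlsD[OF F(1) st] by (intro mult_left_mono) auto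
      finally show ?thesis by (simp add: algebra_simps)
    qed
    have "L powr r * F 1 - L powr r * F 0 \<le> L powr r * a powr r"
      using F(2) by (simp add: mult_left_mono flip: right_diff_distrib)
    also have "\<dots> = (L * a) powr r" using L x(2) by (simp add: powr_mult)
    also have "\<dots> \<le> (norm (g 0) + L * a) powr r" using L x(2) r by (intro powr_mono2) auto
    finally show "L powr r * F 1 - L powr r * F 0 \<le> (norm (g 0) + L * a) powr r" .
  qed
qed

lemma var_bounded_linear:
  assumes "var_bounded r x a" "1 \<le> r" "linear g" "\<And>u. norm (g u) \<le> L * norm u" "0 \<le> L"
  shows "var_bounded r (\<lambda>t. g (x t)) (L * a)"
  using var_bounded_lipschitz[OF assms(1,2), of g L] assms
  by (simp add: linear_0 flip: linear_diff)

lemma var_bounded_const: "1 \<le> r \<Longrightarrow> var_bounded r (\<lambda>_. a) (norm a)"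
  by (rule var_boundedI[where F = "\<lambda>_. 0"]) auto

text \<open>Each addition costs a factor 4, and \<open>a\<close> is itself at most
  \<open>8 ^ card I * a\<close>, so a factor 8 per summand suffices. The index sets in use are the
  coordinates of a fixed space, hence the exponential growth is harmless.\<close>

lemma var_bounded_sum:
  assumes "finite I" "1 \<le> r" "\<And>i. i \<in> I \<Longrightarrow> var_bounded r (x i) a" "0 \<le> a"
  shows "var_bounded r (\<lambda>t. \<Sum>i\<in>I. x i t) (8 ^ card I * a)"
  using assms
proof (induction I rule: finite_induct)
  case empty
  then show ?case using var_bounded_mono[OF var_bounded_const[of r 0], of a] by simp
next
  case (insert i I)
  have "var_bounded r (\<lambda>t. x i t + (\<Sum>i\<in>I. x i t)) (4 * (a + 8 ^ card I * a))"
    using insert by (intro var_bounded_add) auto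
  moreover have "4 * (a + 8 ^ card I * a) \<le> 8 ^ card (insert i I) * a"
    using insert mult_right_mono[of 1 "8 ^ card I" a] by (simp add: mult.commute)
  ultimately have "var_bounded r (\<lambda>t. x i t + (\<Sum>i\<in>I. x i t)) (8 ^ card (insert i I) * a)"
    by (rule var_bounded_mono) (use insert in auto)
  then show ?case using insert by simp
qed

text \<open>The factor \<open>norm (x t - x s) powr (r' - r)\<close> is bounded by the full
  variation, the remaining one by the control. The constant is unchanged, so bounds at
  \<open>q\<close> carry over to \<open>3/2\<close> and from there to \<open>p'\<close>.\<close>

lemma var_bounded_exponent:
  assumes x: "var_bounded r x a" and r: "1 \<le> r" "r \<le> r'"
  shows "var_bounded r' x a"
proof -
  obtain F where F: "controls r F x 0 1" "F 1 - F 0 \<le> a powr r"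
    using var_bounded_controls[OF assms(1)] .
  note x = var_boundedD[OF x]
  show ?thesis
  proof (rule var_boundedI[where F = "\<lambda>t. a powr (r' - r) * F t"])
    show "norm (x t - x s) powr r' \<le> a powr (r' - r) * F t - a powr (r' - r) * F s"
      if st: "0 \<le> s" "s \<le> t" "t \<le> 1" for s t
    proof -
      have "norm (x t - x s) powr r' = norm (x t - x s) powr (r' - r) * norm (x t - x s) powr r"
        by (simp flip: powr_add)
      also have "\<dots> \<le> a powr (r' - r) * (F t - F s)"
        using controlsD[OF F(1) st] st r x(2) controls_norm_le'[OF F(1) _ _ _ _ _ F(2)]
        by (intro mult_mono powr_mono2) auto
      finally show ?thesis by (simp add: algebra_simps)
    qed
    have "a powr (r' - r) * F 1 - a powr (r' - r) * F 0 \<le> a powr (r' - r) * a powr r"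
      using F(2) by (simp add: mult_left_mono flip: right_diff_distrib)
    also have "\<dots> = a powr r'" by (simp flip: powr_add)
    finally show "a powr (r' - r) * F 1 - a powr (r' - r) * F 0 \<le> a powr r'" .
  qed (use x in auto)
qed

lemma var_bounded_C0_var:
  assumes x: "var_bounded r x a" and r: "1 \<le> r" "r \<le> r'"
    and 0: "x 0 = 0" "\<And>t. t \<notin> {0..1} \<Longrightarrow> x t = 0"
  shows "x \<in> C0_var r'" "var_norm r' x \<le> a"
proof -
  have x: "var_bounded r' x a" using var_bounded_exponent assms by blast
  obtain F where F: "controls r' F x 0 1" "F 1 - F 0 \<le> a powr r'"
    using var_bounded_controls[OF x] .
  note v = finite_var_controls[OF F(1)]
  show "x \<in> C0_var r'" using 0 v var_boundedD(1)[OF x] by (auto simp: C0_var_def)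
  have "0 \<le> Sup (var_sums r' x)"
  proof -
    have "{{0..1::real}} division_of {0..1}" by (intro division_of_self_interval) auto
    then have "norm (x 1 - x 0) powr r' \<in> var_sums r' x"
      unfolding var_sums_def by (intro CollectI exI[of _ "{{0..1}}"]) simp
    then have "norm (x 1 - x 0) powr r' \<le> Sup (var_sums r' x)"
      using v(1) by (intro cSup_upper) (auto simp: finite_var_def)
    then show ?thesis using powr_ge_zero order_trans by blast
  qed
  then have "var_norm r' x \<le> (a powr r') powr (1 / r')"
    unfolding var_norm_def using v(2) F(2) r by (intro powr_mono2) auto
  then show "var_norm r' x \<le> a" using r var_boundedD(2)[OF x] by (simp add: powr_powr)
qed

lemma finite_var_var_bounded:
  assumes "continuous_on {0..1} x" "finite_var r x" "1 \<le> r"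
  obtains c where "var_bounded r x c"
proof -
  obtain F where F: "controls r F x 0 1" using controls_finite_var[OF assms(2)] by metis
  have F01: "0 \<le> F 1 - F 0" using controls_mono[OF F, of 0 1] by simp
  define b where "b = (F 1 - F 0) powr (1 / r)"
  have b: "0 \<le> b" "b powr r = F 1 - F 0" using F01 assms by (auto simp: b_def powr_powr)
  show ?thesis
  proof (rule that[of "norm (x 0) + b"], rule var_boundedI[OF assms(1) _ _ controlsD[OF F]])
    show "norm (x t) \<le> norm (x 0) + b" if "t \<in> {0..1}" for t
    proof -
      have "norm (x t - x 0) \<le> b"
        using that b assms(3) by (intro controls_norm_le'[OF F]) auto
      then show ?thesis by norm
    qed
    show "F 1 - F 0 \<le> (norm (x 0) + b) powr r"
      unfolding b(2)[symmetric] using b assms by (intro powr_mono2) auto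
  qed (use b in auto)
qed

text \<open>A path starting at 0 has its sup norm bounded by its variation, so the variation norm
  can serve as the single constant.\<close>

lemma C0_var_var_bounded:
  assumes "x \<in> C0_var r" "1 \<le> r"
  shows "var_bounded r x (var_norm r x)"
proof -
  have x: "continuous_on {0..1} x" "x 0 = 0" "finite_var r x" using assms by (auto simp: C0_var_def)
  obtain F where F: "controls r F x 0 1" "F 1 - F 0 \<le> Sup (var_sums r x)"
    using controls_finite_var[OF x(3)] by metis
  have F01: "0 \<le> F 1 - F 0" using controls_mono[OF F(1), of 0 1] by simp
  have n: "0 \<le> var_norm r x" "var_norm r x powr r = Sup (var_sums r x)"
    using F01 F(2) assms by (auto simp: var_norm_def powr_powr)
  show ?thesis
  proof (rule var_boundedI[OF x(1) _ _ controlsD[OF F(1)]])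
    show "norm (x t) \<le> var_norm r x" if "t \<in> {0..1}" for t
      using controls_norm_le'[OF F(1), of 0 t "var_norm r x"] that n F x assms by auto
  qed (use n F in auto)
qed

text \<open>The indefinite integral is Lipschitz with constant \<open>a\<close>, and
  \<open>(t - s) powr r \<le> t - s\<close> on the unit interval.\<close>

lemma var_bounded_integral:
  fixes f :: "real \<Rightarrow> 'a::euclidean_space"
  assumes f: "var_bounded r f a" and r: "1 \<le> r"
  shows "var_bounded r (\<lambda>t. integral {0..t} f) a"
proof -
  note f = var_boundedD[OF f]
  have int: "f integrable_on {0..1}" using f by (intro integrable_continuous_interval)
  have inc: "norm (integral {0..t} f - integral {0..s} f) \<le> a * (t - s)" if st: "0 \<le> s" "s \<le> t" "t \<le> 1" for s t
  proof -
    have "f integrable_on {0..t}" using st by (intro integrable_on_subinterval[OF int]) auto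
    then have "integral {0..t} f - integral {0..s} f = integral {s..t} f"
      using Henstock_Kurzweil_Integration.integral_combine[of 0 s t f] st by (simp add: algebra_simps)
    also have "norm \<dots> \<le> a * (t - s)"
      using st f by (intro integral_bound) (auto intro: continuous_on_subset)
    finally show ?thesis .
  qed
  show ?thesis
  proof (rule var_boundedI[where F = "\<lambda>t. a powr r * t"])
    show "continuous_on {0..1} (\<lambda>t. integral {0..t} f)"
      by (rule indefinite_integral_continuous_1[OF int])
    show "norm (integral {0..t} f) \<le> a" if "t \<in> {0..1}" for t
      using inc[of 0 t] that f(2) mult_left_mono[of t 1 a] by auto
    show "norm (integral {0..t} f - integral {0..s} f) powr r \<le> a powr r * t - a powr r * s"
      if st: "0 \<le> s" "s \<le> t" "t \<le> 1" for s t
    proof -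
      have "norm (integral {0..t} f - integral {0..s} f) powr r \<le> (a * (t - s)) powr r"
        using inc[OF st] r by (intro powr_mono2) auto
      also have "\<dots> = a powr r * (t - s) powr r" using f st by (simp add: powr_mult)
      also have "\<dots> \<le> a powr r * (t - s) powr 1"
        using powr_mono'[of 1 r "t - s"] st r by (intro mult_left_mono) auto
      finally show ?thesis using st by (simp add: algebra_simps)
    qed
  qed (use f in auto)
qed

section \<open>Sewing\<close>

text \<open>The solution \<open>C\<close> of \<open>C = 2 powr (1 - \<theta>) * C + 2\<close>:
  cutting an interval at half of its control leaves two pieces with weight
  \<open>2 powr (- \<theta>)\<close> each, plus two defects.\<close>

definition sewing_const :: "real \<Rightarrow> real"
  where "sewing_const \<theta> = 2 / (1 - 2 powr (1 - \<theta>))"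

lemma sewing_const:
  assumes "1 < \<theta>"
  shows "0 < sewing_const \<theta>" "sewing_const \<theta> * 2 powr (1 - \<theta>) + 2 = sewing_const \<theta>"
proof -
  have "2 powr (1 - \<theta>) < (1::real)" using assms powr_less_mono[of "1 - \<theta>" 0 2] by simp
  then have *: "0 < 1 - 2 powr (1 - \<theta>)" by simp
  have "2 / x * (1 - x) + 2 = 2 / x" if "0 < x" for x :: real
    using that by (simp add: field_simps)
  from this[OF *] * show "0 < sewing_const \<theta>" "sewing_const \<theta> * 2 powr (1 - \<theta>) + 2 = sewing_const \<theta>"
    by (auto simp: sewing_const_def)
qed

text \<open>Strong induction on the number of steps. Let \<open>m\<close> be the last index at which
  at most half of the control has been used; superadditivity leaves at most half to the right of
  \<open>Suc m\<close>, and the single step from \<open>m\<close> to \<open>Suc m\<close> is itself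
  a term of the sum. Only two defects arise, however fine the partition is.\<close>

lemma discrete_sewing:
  fixes \<Xi> :: "nat \<Rightarrow> nat \<Rightarrow> 'a::real_normed_vector" and \<omega> :: "nat \<Rightarrow> nat \<Rightarrow> real"
  assumes \<theta>: "1 < \<theta>" and A: "0 \<le> A"
    and refl: "\<And>i. \<Xi> i i = 0"
    and delta: "\<And>i j k. i \<le> j \<Longrightarrow> j \<le> k \<Longrightarrow> k \<le> n \<Longrightarrow> norm (\<Xi> i k - \<Xi> i j - \<Xi> j k) \<le> A * \<omega> i k powr \<theta>"
    and nonneg: "\<And>i j. i \<le> j \<Longrightarrow> j \<le> n \<Longrightarrow> 0 \<le> \<omega> i j"
    and super: "\<And>i j k. i \<le> j \<Longrightarrow> j \<le> k \<Longrightarrow> k \<le> n \<Longrightarrow> \<omega> i j + \<omega> j k \<le> \<omega> i k"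
  shows "i \<le> j \<Longrightarrow> j \<le> n \<Longrightarrow>
    norm ((\<Sum>k=i..<j. \<Xi> k (Suc k)) - \<Xi> i j) \<le> A * sewing_const \<theta> * \<omega> i j powr \<theta>"
proof (induction "j - i" arbitrary: i j rule: less_induct)
  case less
  let ?C = "sewing_const \<theta>"
  show ?case
  proof (cases "i = j")
    case True
    then show ?thesis using sewing_const[OF \<theta>] A by (simp add: refl)
  next
    case False
    \<comment> \<open>\<open>i\<close> itself belongs to \<open>P\<close>, since superadditivity and
      nonnegativity force \<open>\<omega> i i = 0\<close>; so the maximum exists.\<close>
    define P where "P = {k\<in>{i..<j}. \<omega> i k \<le> \<omega> i j / 2}"
    define m where "m = Max P"
    have zero: "\<omega> k k = 0" if "k \<le> n" for k using super[of k k k] nonneg[of k k] that by simp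
    have iP: "i \<in> P" using less.prems False zero[of i] nonneg[of i j] by (simp add: P_def)
    have fP: "finite P" by (simp add: P_def)
    have mP: "m \<in> P" unfolding m_def using fP iP by (intro Max_in) auto
    have m: "i \<le> m" "m < j" "\<omega> i m \<le> \<omega> i j / 2" using mP by (auto simp: P_def)
    have m': "\<omega> (Suc m) j \<le> \<omega> i j / 2"
    proof (cases "Suc m = j")
      case True
      then show ?thesis using zero[of j] nonneg[of i j] less.prems by simp
    next
      case False
      have "Suc m \<notin> P" using Max_ge[OF fP, of "Suc m"] unfolding m_def by auto
      then have "\<omega> i j / 2 < \<omega> i (Suc m)" using False m by (auto simp: P_def)
      then show ?thesis using super[of i "Suc m" j] m less.prems by simp
    qed
    have half: "\<omega> k l powr \<theta> \<le> 2 powr (-\<theta>) * \<omega> i j powr \<theta>"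
      if "\<omega> k l \<le> \<omega> i j / 2" "k \<le> l" "l \<le> n" for k l
    proof -
      have "\<omega> k l powr \<theta> \<le> (\<omega> i j / 2) powr \<theta>" using that \<theta> nonneg[of k l] by (intro powr_mono2) auto
      also have "\<dots> = 2 powr (-\<theta>) * \<omega> i j powr \<theta>"
        using nonneg[of i j] less.prems by (simp add: powr_divide powr_minus field_simps)
      finally show ?thesis .
    qed
    have AC: "0 \<le> A * ?C" using A sewing_const(1)[OF \<theta>] by simp
    have 1: "norm ((\<Sum>k=i..<m. \<Xi> k (Suc k)) - \<Xi> i m) \<le> A * ?C * (2 powr (-\<theta>) * \<omega> i j powr \<theta>)"
      using m less.prems by (intro order_trans[OF less.hyps] mult_left_mono half AC) auto
    have 2: "norm ((\<Sum>k=Suc m..<j. \<Xi> k (Suc k)) - \<Xi> (Suc m) j) \<le> A * ?C * (2 powr (-\<theta>) * \<omega> i j powr \<theta>)"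
      using m m' less.prems by (intro order_trans[OF less.hyps] mult_left_mono half AC) auto
    have 3: "norm (\<Xi> i j - \<Xi> i m - \<Xi> m j) \<le> A * \<omega> i j powr \<theta>"
      using m less.prems by (intro delta) auto
    have "norm (\<Xi> m j - \<Xi> m (Suc m) - \<Xi> (Suc m) j) \<le> A * \<omega> m j powr \<theta>"
      using m less.prems by (intro delta) auto
    also have "\<dots> \<le> A * \<omega> i j powr \<theta>"
      using super[of i m j] nonneg[of i m] nonneg[of m j] m less.prems \<theta> A
      by (intro mult_left_mono powr_mono2) auto
    finally have 4: "norm (\<Xi> m j - \<Xi> m (Suc m) - \<Xi> (Suc m) j) \<le> A * \<omega> i j powr \<theta>" .
    have "(\<Sum>k=i..<j. \<Xi> k (Suc k)) = (\<Sum>k=i..<m. \<Xi> k (Suc k)) + (\<Sum>k=m..<j. \<Xi> k (Suc k))"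
      using m by (intro sum.atLeastLessThan_concat[symmetric]) auto
    also have "(\<Sum>k=m..<j. \<Xi> k (Suc k)) = \<Xi> m (Suc m) + (\<Sum>k=Suc m..<j. \<Xi> k (Suc k))"
      using m by (simp add: sum.atLeast_Suc_lessThan)
    finally have "(\<Sum>k=i..<j. \<Xi> k (Suc k)) - \<Xi> i j =
      ((\<Sum>k=i..<m. \<Xi> k (Suc k)) - \<Xi> i m) + ((\<Sum>k=Suc m..<j. \<Xi> k (Suc k)) - \<Xi> (Suc m) j)
        - (\<Xi> i j - \<Xi> i m - \<Xi> m j) - (\<Xi> m j - \<Xi> m (Suc m) - \<Xi> (Suc m) j)"
      by simp
    also have "norm \<dots> \<le> A * ?C * (2 powr (-\<theta>) * \<omega> i j powr \<theta>) + A * ?C * (2 powr (-\<theta>) * \<omega> i j powr \<theta>)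
        + A * \<omega> i j powr \<theta> + A * \<omega> i j powr \<theta>"
      by (intro norm_triangle_le_diff norm_triangle_le add_mono 1 2 3 4)
    also have "\<dots> = A * (?C * (2 * 2 powr (-\<theta>)) + 2) * \<omega> i j powr \<theta>"
      by (simp add: algebra_simps)
    also have "2 * 2 powr (-\<theta>) = 2 powr (1 - \<theta>)" by (simp add: powr_diff powr_minus field_simps)
    finally show ?thesis using sewing_const(2)[OF \<theta>] by simp
  qed
qed

text \<open>Cauchy-Schwarz in the plane; it makes the geometric mean of two controls superadditive
  again.\<close>

lemma sqrt_mult_superadd:
  fixes a b c d :: real
  assumes "0 \<le> a" "0 \<le> b" "0 \<le> c" "0 \<le> d"
  shows "sqrt (a * b) + sqrt (c * d) \<le> sqrt ((a + c) * (b + d))"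
proof (rule real_le_rsqrt)
  have "2 * (sqrt (a * d) * sqrt (c * b)) \<le> (sqrt (a * d))\<^sup>2 + (sqrt (c * b))\<^sup>2"
    using sum_squares_bound[of "sqrt (a * d)" "sqrt (c * b)"] by simp
  then show "(sqrt (a * b) + sqrt (c * d))\<^sup>2 \<le> (a + c) * (b + d)"
    using assms by (simp add: power2_sum real_sqrt_mult algebra_simps)
qed

text \<open>The constant \<open>K\<close> is fixed along with the product so that Young's bound can
  name it. The target is complete because the integral is obtained as a limit.\<close>

locale young_product = bounded_bilinear pr
  for pr :: "'a::real_normed_vector \<Rightarrow> 'b::real_normed_vector \<Rightarrow> 'c::{real_normed_vector, complete_space}" +
  fixes K :: real
  assumes K0: "0 \<le> K" and K: "norm (pr u v) \<le> K * norm u * norm v"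
begin

text \<open>The defect of \<open>pr (f s) (g t - g s)\<close> is the product of an increment of
  \<open>f\<close> and one of \<open>g\<close>, hence at most \<open>K\<close> times the power
  \<open>2 / r\<close> of the geometric mean of the two controls. Young's condition
  \<open>r < 2\<close> is exactly \<open>1 < 2 / r\<close>.\<close>

lemma young_sum_bound:
  assumes r: "1 \<le> r" "r < 2"
    and F: "controls r F f a b" and G: "controls r G g a b"
    and c: "mono c" "a \<le> c i" "c j \<le> b" "i \<le> (j::nat)"
  shows "norm ((\<Sum>k=i..<j. pr (f (c k)) (g (c (Suc k)) - g (c k))) - pr (f (c i)) (g (c j) - g (c i)))
    \<le> K * sewing_const (2 / r) * ((F (c j) - F (c i)) * (G (c j) - G (c i))) powr (1 / r)"
proof -
  \<comment> \<open>Indices are clamped to the range from \<open>i\<close> to \<open>j\<close>, so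
    that all points stay in \<open>{a..b}\<close> and the hypotheses of the sewing lemma hold for
    every index.\<close>
  define d where "d k = c (max i (min j k))" for k
  define \<Xi> where "\<Xi> k l = pr (f (d k)) (g (d l) - g (d k))" for k l
  define \<omega> where "\<omega> k l = sqrt ((F (d l) - F (d k)) * (G (d l) - G (d k)))" for k l
  have dm: "d k \<le> d l" if "k \<le> l" for k l
    unfolding d_def using that by (intro monoD[OF c(1)]) auto
  have dr: "a \<le> d k" "d k \<le> b" for k
  proof -
    have "c i \<le> d k" "d k \<le> c j" unfolding d_def using c(4) by (auto intro!: monoD[OF c(1)])
    then show "a \<le> d k" "d k \<le> b" using c by auto
  qed
  have Fm: "0 \<le> F (d l) - F (d k)" and Gm: "0 \<le> G (d l) - G (d k)" if "k \<le> l" for k l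
    using controls_mono[OF F dr(1) dm[OF that] dr(2)] controls_mono[OF G dr(1) dm[OF that] dr(2)] by auto
  have pow: "\<omega> k l powr (2 / r) = ((F (d l) - F (d k)) * (G (d l) - G (d k))) powr (1 / r)" if "k \<le> l" for k l
  proof -
    have "\<omega> k l powr (2 / r) = (((F (d l) - F (d k)) * (G (d l) - G (d k))) powr (1/2)) powr (2 / r)"
      unfolding \<omega>_def using Fm[OF that] Gm[OF that] by (subst powr_half_sqrt) auto
    then show ?thesis by (simp add: powr_powr)
  qed
  have "norm ((\<Sum>k=i..<j. \<Xi> k (Suc k)) - \<Xi> i j) \<le> K * sewing_const (2 / r) * \<omega> i j powr (2 / r)"
  proof (rule discrete_sewing[where n = j])
    show "1 < 2 / r" using r by simp
    show "\<Xi> k k = 0" for k by (simp add: \<Xi>_def zero_right)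
    show "0 \<le> \<omega> k l" if "k \<le> l" for k l using Fm[OF that] Gm[OF that] by (simp add: \<omega>_def)
    show "\<omega> k l + \<omega> l m \<le> \<omega> k m" if "k \<le> l" "l \<le> m" for k l m
      using sqrt_mult_superadd[OF Fm[OF that(1)] Gm[OF that(1)] Fm[OF that(2)] Gm[OF that(2)]]
      by (simp add: \<omega>_def)
    show "norm (\<Xi> k m - \<Xi> k l - \<Xi> l m) \<le> K * \<omega> k m powr (2 / r)" if "k \<le> l" "l \<le> m" for k l m
    proof -
      have "\<Xi> k m - \<Xi> k l - \<Xi> l m = pr (f (d k) - f (d l)) (g (d m) - g (d l))"
        by (simp add: \<Xi>_def diff_left diff_right algebra_simps)
      also have "norm \<dots> \<le> K * norm (f (d k) - f (d l)) * norm (g (d m) - g (d l))" by (rule K)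
      also have "\<dots> = K * (norm (f (d l) - f (d k)) * norm (g (d m) - g (d l)))"
        by (simp add: norm_minus_commute)
      also have "\<dots> \<le> K * ((F (d l) - F (d k)) powr (1 / r) * (G (d m) - G (d l)) powr (1 / r))"
        using r K0 dr dm that by (intro mult_left_mono mult_mono controls_norm_le[OF F] controls_norm_le[OF G]) auto
      also have "\<dots> \<le> K * ((F (d m) - F (d k)) powr (1 / r) * (G (d m) - G (d k)) powr (1 / r))"
        using r K0 Fm[OF that(1)] Gm[OF that(1)] Fm[OF that(2)] Gm[OF that(2)]
        by (intro mult_left_mono mult_mono powr_mono2) auto
      also have "\<dots> = K * \<omega> k m powr (2 / r)"
        using Fm[of k m] Gm[of k m] that by (subst pow) (auto simp: powr_mult)
      finally show ?thesis .
    qed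
  qed (use K0 c in auto)
  moreover have "d i = c i" "d j = c j" using c by (auto simp: d_def)
  moreover have "(\<Sum>k=i..<j. \<Xi> k (Suc k)) = (\<Sum>k=i..<j. pr (f (c k)) (g (c (Suc k)) - g (c k)))"
  proof (intro sum.cong refl)
    fix k assume "k \<in> {i..<j}"
    then have "max i (min j k) = k" "max i (min j (Suc k)) = Suc k" by auto
    then show "\<Xi> k (Suc k) = pr (f (c k)) (g (c (Suc k)) - g (c k))" by (simp add: \<Xi>_def d_def)
  qed
  ultimately show ?thesis using c(4) by (simp add: pow) (simp add: \<Xi>_def)
qed

end

text \<open>Passing to a slightly larger exponent makes the controls small on short intervals, so the
  continuity of the control of a continuous path is not needed.\<close>

lemma fine_controls:
  assumes F: "controls r F f 0 1" and G: "controls r G g 0 1"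
    and f: "continuous_on {0..1} f" and g: "continuous_on {0..1} g"
    and r: "1 \<le> r" "r < r'" "r' < 2" and e: "0 < (e::real)"
  obtains \<delta> where "0 < \<delta>" "\<And>s t. 0 \<le> s \<Longrightarrow> s \<le> t \<Longrightarrow> t \<le> 1 \<Longrightarrow> t - s < \<delta> \<Longrightarrow>
    \<exists>F' G'. controls r' F' f s t \<and> controls r' G' g s t \<and>
      ((F' t - F' s) * (G' t - G' s)) powr (1 / r') \<le> e * ((F t + G t) - (F s + G s))"
proof -
  define h where "h t = F t + G t" for t
  define H where "H = h 1 - h 0 + 1"
  have hm: "h s \<le> h t" if "0 \<le> s" "s \<le> t" "t \<le> 1" for s t
    using controls_mono[OF F that] controls_mono[OF G that] by (simp add: h_def)
  have H: "1 \<le> H" using hm[of 0 1] by (simp add: H_def)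
  \<comment> \<open>Raising the exponent from \<open>r\<close> to \<open>r'\<close> gains
    \<open>\<epsilon> powr (r' - r)\<close> in each of the two controls; after the power
    \<open>1 / r'\<close> of their product the gain is \<open>\<epsilon> powr \<kappa>\<close>. The
    choice of \<epsilon> solves
    \<open>\<epsilon> powr \<kappa> * H powr (2 / r' - 1) = e\<close>.\<close>
  define \<kappa> where "\<kappa> = 2 * (r' - r) / r'"
  have \<kappa>: "0 < \<kappa>" using r by (simp add: \<kappa>_def)
  define \<epsilon> where "\<epsilon> = (e / H powr (2 / r' - 1)) powr (1 / \<kappa>)"
  have \<epsilon>: "0 < \<epsilon>" "\<epsilon> powr \<kappa> * H powr (2 / r' - 1) = e"
    using e H \<kappa> by (auto simp: \<epsilon>_def powr_powr)
  have uf: "uniformly_continuous_on {0..1} f" and ug: "uniformly_continuous_on {0..1} g"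
    using f g by (auto intro: compact_uniformly_continuous)
  obtain d1 where d1: "0 < d1" "\<And>s t. s \<in> {0..1} \<Longrightarrow> t \<in> {0..1} \<Longrightarrow> dist t s < d1 \<Longrightarrow> dist (f t) (f s) < \<epsilon>"
    by (rule uniformly_continuous_onE[OF uf \<epsilon>(1)]) blast
  obtain d2 where d2: "0 < d2" "\<And>s t. s \<in> {0..1} \<Longrightarrow> t \<in> {0..1} \<Longrightarrow> dist t s < d2 \<Longrightarrow> dist (g t) (g s) < \<epsilon>"
    by (rule uniformly_continuous_onE[OF ug \<epsilon>(1)]) blast
  show ?thesis
  proof (rule that[of "min d1 d2"])
    show "0 < min d1 d2" using d1 d2 by simp
    fix s t :: real assume st: "0 \<le> s" "s \<le> t" "t \<le> 1" "t - s < min d1 d2"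
    have small: "norm (f v - f u) \<le> \<epsilon>" "norm (g v - g u) \<le> \<epsilon>" if "s \<le> u" "u \<le> v" "v \<le> t" for u v
      using d1(2)[of u v] d2(2)[of u v] that st by (auto simp: dist_norm)
    have up: "norm z powr r' \<le> \<epsilon> powr (r' - r) * \<Delta>" if "norm z \<le> \<epsilon>" "norm z powr r \<le> \<Delta>"
      for z :: "'z::real_normed_vector" and \<Delta>
    proof -
      have "norm z powr r' = norm z powr (r' - r) * norm z powr r" by (simp flip: powr_add)
      also have "\<dots> \<le> \<epsilon> powr (r' - r) * \<Delta>" using that r by (intro mult_mono powr_mono2) auto
      finally show ?thesis .
    qed
    let ?F = "\<lambda>t. \<epsilon> powr (r' - r) * F t" and ?G = "\<lambda>t. \<epsilon> powr (r' - r) * G t"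
    have "controls r' ?F f s t" "controls r' ?G g s t"
      unfolding controls_def right_diff_distrib[symmetric]
      using st by (auto intro!: up small controlsD[OF F] controlsD[OF G])
    moreover have "((?F t - ?F s) * (?G t - ?G s)) powr (1 / r') \<le> e * (h t - h s)"
    proof -
      have D: "0 \<le> F t - F s" "0 \<le> G t - G s" "F t - F s \<le> h t - h s" "G t - G s \<le> h t - h s"
        using controls_mono[OF F st(1-3)] controls_mono[OF G st(1-3)] by (auto simp: h_def)
      have "(?F t - ?F s) * (?G t - ?G s) = \<epsilon> powr (2 * (r' - r)) * ((F t - F s) * (G t - G s))"
        by (simp add: algebra_simps flip: powr_add)
      also have "\<dots> \<le> \<epsilon> powr (2 * (r' - r)) * ((h t - h s) * (h t - h s))"
        using D by (intro mult_left_mono mult_mono) auto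
      finally have "((?F t - ?F s) * (?G t - ?G s)) powr (1 / r')
          \<le> (\<epsilon> powr (2 * (r' - r)) * ((h t - h s) * (h t - h s))) powr (1 / r')"
      proof (intro powr_mono2)
        show "0 \<le> (?F t - ?F s) * (?G t - ?G s)"
          unfolding right_diff_distrib[symmetric] using D by (intro mult_nonneg_nonneg) auto
      qed (use r in auto)
      also have "\<dots> = \<epsilon> powr \<kappa> * (h t - h s) powr (2 / r')"
      proof -
        have "(h t - h s) powr (1 / r') * (h t - h s) powr (1 / r') = (h t - h s) powr (2 / r')"
          by (simp flip: powr_add)
        then show ?thesis
          by (simp only: powr_mult powr_powr \<kappa>_def) simp
      qed
      \<comment> \<open>One full power of \<open>h t - h s\<close> is split off, because it
        telescopes over a partition; the remaining positive power \<open>2 / r' - 1\<close> is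
        bounded by that of the total \<open>H\<close>.\<close>
      also have "\<dots> = \<epsilon> powr \<kappa> * ((h t - h s) powr (2 / r' - 1) * (h t - h s))"
      proof -
        have "(h t - h s) powr (2 / r') = (h t - h s) powr ((2 / r' - 1) + 1)" by simp
        also have "\<dots> = (h t - h s) powr (2 / r' - 1) * (h t - h s) powr 1"
          by (rule powr_add)
        finally show ?thesis using D by simp
      qed
      also have "\<dots> \<le> \<epsilon> powr \<kappa> * (H powr (2 / r' - 1) * (h t - h s))"
        using D r hm[of t 1] hm[of 0 s] st
        by (intro mult_left_mono mult_right_mono powr_mono2) (auto simp: H_def)
      also have "\<dots> = e * (h t - h s)" using \<epsilon>(2) by (simp flip: mult.assoc)
      finally show ?thesis .
    qed
    ultimately show "\<exists>F' G'. controls r' F' f s t \<and> controls r' G' g s t \<and>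
      ((F' t - F' s) * (G' t - G' s)) powr (1 / r') \<le> e * ((F t + G t) - (F s + G s))"
      unfolding h_def by blast
  qed
qed

section \<open>The Young integral\<close>

text \<open>Both limits are tested on one tagged division of small mesh, which exists by Cousin's
  lemma. Balls of radius a quarter of the smaller mesh bound force cells of less than half of
  it.\<close>

lemma has_young_integral_unique:
  assumes "has_young_integral f g a b I" "has_young_integral f g a b I'"
  shows "I = I'"
proof (rule ccontr)
  assume "I \<noteq> I'"
  then have e: "0 < norm (I - I') / 2" by simp
  obtain d1 where d1: "0 < d1" "\<And>D. D tagged_division_of {a..b} \<Longrightarrow> \<forall>(x, K)\<in>D. Sup K - Inf K < d1 \<Longrightarrow>
      norm ((\<Sum>(x, K)\<in>D. f x (g (Sup K) - g (Inf K))) - I) < norm (I - I') / 2"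
    using assms(1)[unfolded has_young_integral_def, rule_format, OF e] by blast
  obtain d2 where d2: "0 < d2" "\<And>D. D tagged_division_of {a..b} \<Longrightarrow> \<forall>(x, K)\<in>D. Sup K - Inf K < d2 \<Longrightarrow>
      norm ((\<Sum>(x, K)\<in>D. f x (g (Sup K) - g (Inf K))) - I') < norm (I - I') / 2"
    using assms(2)[unfolded has_young_integral_def, rule_format, OF e] by blast
  define d where "d = min d1 d2 / 4"
  have d: "0 < d" using d1 d2 by (simp add: d_def)
  obtain D where D: "D tagged_division_of cbox a b" "(\<lambda>x. ball x d) fine D"
    using fine_division_exists[OF gauge_ball[OF d]] by blast
  have mesh: "Sup K - Inf K < min d1 d2" if "(x, K) \<in> D" for x K
  proof -
    have K: "x \<in> K" "\<exists>u v. K = cbox u v" "K \<subseteq> ball x d"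
      using D that by (auto simp: tagged_division_of fine_def)
    then obtain u v where uv: "K = {u..v}" "u \<le> v" by force
    then have "u \<in> K" "v \<in> K" by auto
    then have "u \<in> ball x d" "v \<in> ball x d" using K(3) by blast+
    then have "v - u < 2 * d" by (auto simp: dist_real_def)
    then show ?thesis using uv d1(1) d2(1) by (simp add: d_def)
  qed
  let ?S = "\<Sum>(x, K)\<in>D. f x (g (Sup K) - g (Inf K))"
  have "norm (?S - I) < norm (I - I') / 2" "norm (?S - I') < norm (I - I') / 2"
    using D(1) mesh by (intro d1(2) d2(2); force)+
  then show False using norm_triangle_ineq4[of "?S - I'" "?S - I"] by simp
qed

lemma young_integral_eqI: "has_young_integral f g a b I \<Longrightarrow> young_integral f g a b = I"
  unfolding young_integral_def using has_young_integral_unique by blast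

lemma divide_mult_half_le:
  fixes e x :: real
  assumes "0 \<le> x" "0 < e"
  shows "e / (2 * (x + 1)) * x \<le> e / 2"
proof -
  have "e * x \<le> e * (x + 1)" using assms by simp
  then show ?thesis using assms by (simp add: divide_simps)
qed

context young_product
begin

text \<open>A single primitive \<open>J\<close> is built, as the limit of left-point sums over
  dyadic grids cut off at \<open>t\<close>, and represents the integral over every subinterval. The
  error bound is stated for arbitrary local controls, on which \<open>J\<close> does not depend;
  estimates on short intervals rely on this.\<close>

lemma young_path_exists:
  assumes r: "1 \<le> r" "r < 2"
    and f: "continuous_on {0..1} f" and g: "continuous_on {0..1} g"
    and F: "controls r F f 0 1" and G: "controls r G g 0 1"
  obtains J where
    "\<And>a b. 0 \<le> a \<Longrightarrow> a \<le> b \<Longrightarrow> b \<le> 1 \<Longrightarrow> has_young_integral (\<lambda>s. pr (f s)) g a b (J b - J a)"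
    "\<And>a b F G. 0 \<le> a \<Longrightarrow> a \<le> b \<Longrightarrow> b \<le> 1 \<Longrightarrow> controls r F f a b \<Longrightarrow> controls r G g a b \<Longrightarrow>
      norm (J b - J a - pr (f a) (g b - g a))
        \<le> K * sewing_const (2 / r) * ((F b - F a) * (G b - G a)) powr (1 / r)"
    "continuous_on {0..1} J"
proof -
  define H where "H t = F t + G t" for t
  have Hm: "H s \<le> H t" if "0 \<le> s" "s \<le> t" "t \<le> 1" for s t
    using controls_mono[OF F that] controls_mono[OF G that] by (simp add: H_def)
  define \<Xi> where "\<Xi> s t = pr (f s) (g t - g s)" for s t
  have \<Xi>_refl: "\<Xi> s s = 0" for s by (simp add: \<Xi>_def zero_right)
  \<comment> \<open>No partition of \<open>{s..t}\<close> changes the left-point sum by more than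
    \<open>e\<close> times the control. Smallness proportional to the control is what survives
    summation over cells.\<close>
  define refined where "refined e s t \<longleftrightarrow> (\<forall>c i j. mono c \<longrightarrow> c i = s \<longrightarrow> c (j::nat) = t \<longrightarrow> i \<le> j \<longrightarrow>
      norm ((\<Sum>k=i..<j. \<Xi> (c k) (c (Suc k))) - \<Xi> s t) \<le> e * (H t - H s))" for e s t
  have fine: "\<exists>\<delta>>0. \<forall>s t. 0 \<le> s \<longrightarrow> s \<le> t \<longrightarrow> t \<le> 1 \<longrightarrow> t - s < \<delta> \<longrightarrow> refined e s t \<and>
      K * (norm (f t - f s) * norm (g t - g s)) \<le> e * (H t - H s)"
    if e: "0 < e" for e
  proof -
    define r' where "r' = (r + 2) / 2"
    have r': "1 \<le> r'" "r < r'" "r' < 2" using r by (auto simp: r'_def)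
    have sc: "0 < sewing_const (2 / r')" using r' by (intro sewing_const) auto
    \<comment> \<open>\<open>Q\<close> dominates the constant of the sewing bound and that of the
      plain product, so that one \<delta> serves both claims.\<close>
    define Q where "Q = K * sewing_const (2 / r') + K + 1"
    have "0 \<le> K * sewing_const (2 / r')" using sc K0 by simp
    then have Q: "0 < Q" "K * sewing_const (2 / r') \<le> Q" "K \<le> Q" using K0 by (auto simp: Q_def)
    obtain \<delta> where \<delta>: "0 < \<delta>" "\<And>s t. 0 \<le> s \<Longrightarrow> s \<le> t \<Longrightarrow> t \<le> 1 \<Longrightarrow> t - s < \<delta> \<Longrightarrow>
      \<exists>F' G'. controls r' F' f s t \<and> controls r' G' g s t \<and>
        ((F' t - F' s) * (G' t - G' s)) powr (1 / r') \<le> e / Q * ((F t + G t) - (F s + G s))"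
      using fine_controls[OF F G f g r(1) r'(2,3), of "e / Q"] e Q by auto
    show ?thesis
    proof (intro exI[of _ \<delta>] conjI \<delta> allI impI)
      fix s t :: real assume st: "0 \<le> s" "s \<le> t" "t \<le> 1" "t - s < \<delta>"
      obtain F' G' where F': "controls r' F' f s t" and G': "controls r' G' g s t"
        and FG: "((F' t - F' s) * (G' t - G' s)) powr (1 / r') \<le> e / Q * (H t - H s)"
        using \<delta>(2)[OF st] unfolding H_def by blast
      have Q': "A * ((F' t - F' s) * (G' t - G' s)) powr (1 / r') \<le> e * (H t - H s)" if "A \<le> Q" for A
      proof -
        have "A * ((F' t - F' s) * (G' t - G' s)) powr (1 / r') \<le> Q * (e / Q * (H t - H s))"
          using FG Q that by (intro mult_mono) auto
        then show ?thesis using Q by simp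
      qed
      show "refined e s t"
        unfolding refined_def
      proof (intro allI impI)
        fix c :: "nat \<Rightarrow> real" and i j assume c: "mono c" "c i = s" "c j = t" "i \<le> j"
        show "norm ((\<Sum>k=i..<j. \<Xi> (c k) (c (Suc k))) - \<Xi> s t) \<le> e * (H t - H s)"
          using young_sum_bound[OF r'(1,3) F' G' c(1), of i j] c Q'[OF Q(2)] by (simp add: \<Xi>_def)
      qed
      have "K * (norm (f t - f s) * norm (g t - g s))
          \<le> K * ((F' t - F' s) powr (1 / r') * (G' t - G' s) powr (1 / r'))"
        using st r' K0 by (intro mult_left_mono mult_mono controls_norm_le[OF F'] controls_norm_le[OF G']) auto
      also have "\<dots> = K * ((F' t - F' s) * (G' t - G' s)) powr (1 / r')"
        using controls_mono[OF F', of s t] controls_mono[OF G', of s t] st by (simp add: powr_mult)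
      also have "\<dots> \<le> e * (H t - H s)" by (rule Q'[OF Q(3)])
      finally show "K * (norm (f t - f s) * norm (g t - g s)) \<le> e * (H t - H s)" .
    qed
  qed
  define D where "D n k = real k / 2 ^ n" for n k :: nat
  have Dm: "D n k \<le> D n l" if "k \<le> l" for n k l using that by (simp add: D_def divide_right_mono)
  have D0: "D n 0 = 0" and D1: "D n (2 ^ n) = 1" for n by (simp_all add: D_def)
  have Dpos: "0 \<le> D n k" for n k by (simp add: D_def)
  have Dle: "D n k \<le> 1" if "k \<le> 2 ^ n" for n k using Dm[OF that, of n] by (simp add: D1)
  have Dstep: "D n (Suc k) - D n k = (1 / 2) ^ n" for n k by (simp add: D_def field_simps)
  \<comment> \<open>Cells beyond \<open>t\<close> collapse to a point and contribute
    \<open>\<Xi> t t = 0\<close>, so all sums run over the full dyadic grid.\<close>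
  define J' where "J' n t = (\<Sum>k<2^n. \<Xi> (min t (D n k)) (min t (D n (Suc k))))" for n t
  define L where "L n s t = (\<Sum>k<2^n. \<Xi> (max s (min t (D n k))) (max s (min t (D n (Suc k)))))" for n s t
  have ev: "eventually (\<lambda>n. (1 / 2) ^ n < \<delta>) sequentially" if "0 < \<delta>" for \<delta> :: real
    using LIMSEQ_power_zero[of "1 / 2 :: real"] that by (intro order_tendstoD(2)) auto
  \<comment> \<open>The finer dyadic sum is grouped by coarse cells; each group refines one cell,
    and the errors telescope to \<open>e * (H t - H 0)\<close>.\<close>
  have cau: "\<exists>N. \<forall>m n. N \<le> n \<longrightarrow> n \<le> m \<longrightarrow> norm (J' m t - J' n t) \<le> e * (H 1 - H 0)"
    if t: "0 \<le> t" "t \<le> 1" and e: "0 < e" for t e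
  proof -
    obtain \<delta> where \<delta>: "0 < \<delta>" "\<And>s t. 0 \<le> s \<Longrightarrow> s \<le> t \<Longrightarrow> t \<le> 1 \<Longrightarrow> t - s < \<delta> \<Longrightarrow> refined e s t"
      using fine[OF e] by blast
    obtain N where N: "\<And>n. N \<le> n \<Longrightarrow> (1 / 2) ^ n < \<delta>"
      using ev[OF \<delta>(1)] unfolding eventually_sequentially by blast
    have "norm (J' m t - J' n t) \<le> e * (H 1 - H 0)" if nm: "N \<le> n" "n \<le> m" for n m
    proof -
      define p :: nat where "p = 2 ^ (m - n)"
      define c where "c j = min t (D m j)" for j
      have np: "2 ^ n * p = 2 ^ m" using nm by (simp add: p_def flip: power_add)
      have ck: "c (k * p) = min t (D n k)" for k
      proof -
        have "real p * 2 ^ n = 2 ^ m" using np by (metis mult.commute of_nat_mult of_nat_numeral of_nat_power)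
        then have "D m (k * p) = D n k" by (simp add: D_def field_simps)
        then show ?thesis by (simp add: c_def)
      qed
      have "J' m t = (\<Sum>j<2 ^ n * p. \<Xi> (c j) (c (Suc j)))" by (simp add: J'_def c_def np)
      also have "\<dots> = (\<Sum>k<2 ^ n. \<Sum>j=k * p..<k * p + p. \<Xi> (c j) (c (Suc j)))"
        by (rule sum.nat_group[symmetric])
      finally have "J' m t - J' n t = (\<Sum>k<2 ^ n. (\<Sum>j=k * p..<k * p + p. \<Xi> (c j) (c (Suc j)))
          - \<Xi> (min t (D n k)) (min t (D n (Suc k))))"
        by (simp add: J'_def sum_subtractf)
      also have "norm \<dots> \<le> (\<Sum>k<2 ^ n. e * (H (min t (D n (Suc k))) - H (min t (D n k))))"
      proof (rule sum_norm_le)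
        fix k :: nat assume "k \<in> {..<2 ^ n}"
        have "refined e (min t (D n k)) (min t (D n (Suc k)))"
        proof (rule \<delta>(2))
          have "min t (D n (Suc k)) - min t (D n k) \<le> (1 / 2) ^ n"
            using Dstep[of n k] Dm[of k "Suc k" n] by linarith
          also have "\<dots> < \<delta>" using N nm by simp
          finally show "min t (D n (Suc k)) - min t (D n k) < \<delta>" .
        next
          show "0 \<le> min t (D n k)" using t(1) Dpos[of n k] by (rule min.boundedI)
          show "min t (D n k) \<le> min t (D n (Suc k))" using Dm[of k "Suc k" n] by linarith
          show "min t (D n (Suc k)) \<le> 1" using t(2) by (rule min.coboundedI1)
        qed
        moreover have "mono c" unfolding c_def by (intro monoI min.mono order_refl Dm)
        ultimately show "norm ((\<Sum>j=k * p..<k * p + p. \<Xi> (c j) (c (Suc j)))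
          - \<Xi> (min t (D n k)) (min t (D n (Suc k)))) \<le> e * (H (min t (D n (Suc k))) - H (min t (D n k)))"
          using ck[of k] ck[of "Suc k"] by (simp add: refined_def add.commute)
      qed
      also have "\<dots> = e * (H t - H 0)"
        using t sum_lessThan_telescope[of "\<lambda>k. H (min t (D n k))" "2 ^ n"]
        by (simp add: D0 D1 flip: sum_distrib_left)
      also have "\<dots> \<le> e * (H 1 - H 0)" using Hm[of t 1] t e by simp
      finally show ?thesis .
    qed
    then show ?thesis by blast
  qed
  define J where "J t = lim (\<lambda>n. J' n t)" for t
  have lim: "(\<lambda>n. J' n t) \<longlonglongrightarrow> J t" if t: "0 \<le> t" "t \<le> 1" for t
  proof -
    have "Cauchy (\<lambda>n. J' n t)"
    proof (rule metric_CauchyI)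
      fix e :: real assume e: "0 < e"
      have H: "0 \<le> H 1 - H 0" using Hm[of 0 1] by simp
      define e' where "e' = e / (2 * (H 1 - H 0 + 1))"
      have "0 < e'" using e H by (simp add: e'_def)
      then obtain N where N: "\<And>m n. N \<le> n \<Longrightarrow> n \<le> m \<Longrightarrow> norm (J' m t - J' n t) \<le> e' * (H 1 - H 0)"
        using cau[OF t] by blast
      have "e' * (H 1 - H 0) \<le> e / 2" unfolding e'_def by (rule divide_mult_half_le[OF H e])
      then have "norm (J' m t - J' n t) < e" if "N \<le> n" "n \<le> m" for m n
        using N[OF that] e by simp
      then show "\<exists>M. \<forall>m\<ge>M. \<forall>n\<ge>M. dist (J' m t) (J' n t) < e"
        by (intro exI[of _ N]) (metis dist_commute dist_norm nle_le)
    qed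
    then show ?thesis unfolding J_def by (simp add: Cauchy_convergent convergent_LIMSEQ_iff[symmetric])
  qed
  \<comment> \<open>The truncated sums are additive up to one cell. Cells on either side of
    \<open>s\<close> cancel exactly; a cell from \<open>u\<close> to \<open>v\<close> containing
    \<open>s\<close> inside is compared with the partition \<open>u\<close>, \<open>s\<close>,
    \<open>w\<close>, where \<open>w\<close> is \<open>v\<close> cut off at
    \<open>t\<close>.\<close>
  have add: "(\<lambda>n. J' n t - J' n s - L n s t) \<longlonglongrightarrow> 0" if st: "0 \<le> s" "s \<le> t" "t \<le> 1" for s t
  proof (rule LIMSEQ_I)
    fix e0 :: real assume e0: "0 < e0"
    have H: "0 \<le> H 1 - H 0" using Hm[of 0 1] by simp
    define e where "e = e0 / (2 * (H 1 - H 0 + 1))"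
    have e: "0 < e" using e0 H by (simp add: e_def)
    have "e * (H 1 - H 0) \<le> e0 / 2" unfolding e_def by (rule divide_mult_half_le[OF H e0])
    then have ee0: "e * (H 1 - H 0) < e0" using e0 by simp
    obtain \<delta> where \<delta>: "0 < \<delta>" "\<And>s t. 0 \<le> s \<Longrightarrow> s \<le> t \<Longrightarrow> t \<le> 1 \<Longrightarrow> t - s < \<delta> \<Longrightarrow> refined e s t"
      using fine[OF e] by blast
    obtain N where N: "\<And>n. N \<le> n \<Longrightarrow> (1 / 2) ^ n < \<delta>"
      using ev[OF \<delta>(1)] unfolding eventually_sequentially by blast
    have "norm (J' n t - J' n s - L n s t) \<le> e * (H 1 - H 0)" if n: "N \<le> n" for n
    proof -
      have "J' n t - J' n s - L n s t = (\<Sum>k<2 ^ n. \<Xi> (min t (D n k)) (min t (D n (Suc k)))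
          - \<Xi> (min s (D n k)) (min s (D n (Suc k)))
          - \<Xi> (max s (min t (D n k))) (max s (min t (D n (Suc k)))))"
        by (simp add: J'_def L_def sum_subtractf)
      also have "norm \<dots> \<le> (\<Sum>k<2 ^ n. e * (H (D n (Suc k)) - H (D n k)))"
      proof (rule sum_norm_le)
        fix k :: nat assume k: "k \<in> {..<2 ^ n}"
        define u v where "u = D n k" and "v = D n (Suc k)"
        have uv: "0 \<le> u" "u \<le> v" "v \<le> 1" "v - u < \<delta>"
          using k Dpos[of n k] Dm[of k "Suc k" n] Dle[of "Suc k" n] Dstep[of n k] N[OF n]
          by (auto simp: u_def v_def)
        have H': "0 \<le> e * (H v - H u)" using Hm[OF uv(1-3)] e by simp
        consider "v \<le> s" | "s \<le> u" | "u < s" "s < v" by linarith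
        then have "norm (\<Xi> (min t u) (min t v) - \<Xi> (min s u) (min s v)
          - \<Xi> (max s (min t u)) (max s (min t v))) \<le> e * (H v - H u)"
        proof cases
          case 1
          then have "min t u = u" "min t v = v" "min s u = u" "min s v = v" "max s u = s" "max s v = s"
            using uv st by auto
          then show ?thesis using H' by (simp add: \<Xi>_refl)
        next
          case 2
          then have "min s u = s" "min s v = s" "max s (min t u) = min t u" "max s (min t v) = min t v"
            using uv st by auto
          then show ?thesis using H' by (simp add: \<Xi>_refl)
        next
          case 3
          define w where "w = min t v"
          have w: "s \<le> w" "w \<le> v" using 3 st by (auto simp: w_def)
          have eq: "min t u = u" "min t v = w" "min s u = u" "min s v = s" "max s u = s" "max s w = w"
            using 3 uv st w by (auto simp: w_def)
          have "refined e u w" using uv w 3 by (intro \<delta>(2)) auto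
          moreover define c where "c k = (if k = 0 then u else if k = Suc 0 then s else w)" for k :: nat
          have "mono c" using 3 w by (auto simp: mono_def c_def)
          moreover have "c 0 = u" "c 2 = w" "(\<Sum>k=0..<2. \<Xi> (c k) (c (Suc k))) = \<Xi> u s + \<Xi> s w"
            by (auto simp: c_def numeral_2_eq_2)
          ultimately have "norm (\<Xi> u s + \<Xi> s w - \<Xi> u w) \<le> e * (H w - H u)"
            unfolding refined_def by (metis zero_le)
          also have "\<dots> \<le> e * (H v - H u)" using Hm[of w v] w uv 3 st e by simp
          finally have "norm (\<Xi> u w - \<Xi> u s - \<Xi> s w) \<le> e * (H v - H u)"
            by (simp add: norm_minus_commute algebra_simps)
          then show ?thesis by (simp add: eq)
        qed
        then show "norm (\<Xi> (min t (D n k)) (min t (D n (Suc k)))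
          - \<Xi> (min s (D n k)) (min s (D n (Suc k)))
          - \<Xi> (max s (min t (D n k))) (max s (min t (D n (Suc k))))) \<le> e * (H (D n (Suc k)) - H (D n k))"
          by (simp add: u_def v_def)
      qed
      also have "\<dots> = e * (H 1 - H 0)"
        using sum_lessThan_telescope[of "\<lambda>k. H (D n k)" "2 ^ n"]
        by (simp add: D0 D1 flip: sum_distrib_left)
      finally show ?thesis .
    qed
    then show "\<exists>no. \<forall>n\<ge>no. norm (J' n t - J' n s - L n s t - 0) < e0"
      using ee0 by (intro exI[of _ N]) (auto intro: le_less_trans)
  qed
  have Llim: "(\<lambda>n. L n s t) \<longlonglongrightarrow> J t - J s" if st: "0 \<le> s" "s \<le> t" "t \<le> 1" for s t
    using tendsto_diff[OF tendsto_diff[OF lim lim] add[OF st], of t s] st by simp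
  \<comment> \<open>A bound valid for all partitions passes to the limit, because the clamped sums
    \<open>L n s t\<close> belong to partitions of \<open>{s..t}\<close>.\<close>
  have Jbound: "norm (J t - J s - \<Xi> s t) \<le> B"
    if st: "0 \<le> s" "s \<le> t" "t \<le> 1"
      and B: "\<And>c n. mono c \<Longrightarrow> c 0 = s \<Longrightarrow> c n = t \<Longrightarrow> norm ((\<Sum>k=0..<n. \<Xi> (c k) (c (Suc k))) - \<Xi> s t) \<le> B"
    for s t B
  proof (rule LIMSEQ_le_const2)
    show "(\<lambda>n. norm (L n s t - \<Xi> s t)) \<longlonglongrightarrow> norm (J t - J s - \<Xi> s t)"
      by (intro tendsto_intros Llim st)
    show "\<exists>N. \<forall>n\<ge>N. norm (L n s t - \<Xi> s t) \<le> B"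
    proof (intro exI allI impI)
      fix n
      define c where "c k = max s (min t (D n k))" for k
      have "mono c" unfolding c_def by (intro monoI min.mono max.mono order_refl Dm)
      moreover have "c 0 = s" "c (2 ^ n) = t" using st by (auto simp: c_def D0 D1)
      ultimately show "norm (L n s t - \<Xi> s t) \<le> B"
        using B[of c "2 ^ n"] by (simp add: L_def c_def lessThan_atLeast0)
    qed
  qed
  \<comment> \<open>The increment of \<open>J\<close> is \<open>\<Xi> s t\<close> up to a small
    error, and \<open>\<Xi> s t\<close> is small because \<open>g\<close> is uniformly continuous
    and \<open>f\<close> is bounded.\<close>
  have Jcont: "continuous_on {0..1} J"
  proof (rule uniformly_continuous_imp_continuous, unfold uniformly_continuous_on_def, intro allI impI)
    fix e0 :: real assume e0: "0 < e0"
    have H: "0 \<le> H 1 - H 0" using Hm[of 0 1] by simp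
    define e where "e = (e0 / 2) / (2 * (H 1 - H 0 + 1))"
    have e: "0 < e" using e0 H by (simp add: e_def)
    have ee0: "e * (H 1 - H 0) \<le> e0 / 2 / 2" unfolding e_def by (rule divide_mult_half_le[OF H]) (use e0 in simp)
    obtain \<delta> where \<delta>: "0 < \<delta>" "\<And>s t. 0 \<le> s \<Longrightarrow> s \<le> t \<Longrightarrow> t \<le> 1 \<Longrightarrow> t - s < \<delta> \<Longrightarrow> refined e s t"
      using fine[OF e] by blast
    have "bounded (f ` {0..1})" by (intro compact_imp_bounded compact_continuous_image f) auto
    then obtain B where "0 < B" "\<forall>x\<in>f ` {0..1}. norm x \<le> B" unfolding bounded_pos by blast
    then have B: "0 < B" "\<And>t. t \<in> {0..1} \<Longrightarrow> norm (f t) \<le> B" by auto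
    have KB: "0 \<le> K * B" using K0 B by simp
    have "0 < e0 / (2 * (K * B + 1))" using e0 KB by simp
    then obtain d where d: "0 < d" "\<And>s t. s \<in> {0..1} \<Longrightarrow> t \<in> {0..1} \<Longrightarrow> dist t s < d \<Longrightarrow>
      dist (g t) (g s) < e0 / (2 * (K * B + 1))"
      by (rule uniformly_continuous_onE[OF compact_uniformly_continuous[OF g compact_Icc]]) blast
    have *: "dist (J t) (J s) < e0" if st: "0 \<le> s" "s \<le> t" "t \<le> 1" "t - s < min d \<delta>" for s t
    proof -
      have "norm (J t - J s - \<Xi> s t) \<le> e * (H t - H s)"
        using \<delta>(2)[of s t] st by (intro Jbound) (auto simp: refined_def)
      also have "e * (H t - H s) \<le> e * (H 1 - H 0)"
        using Hm[of 0 s] Hm[of t 1] st e by (intro mult_left_mono) auto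
      finally have 1: "norm (J t - J s - \<Xi> s t) \<le> e0 / 2 / 2" using ee0 by linarith
      have "norm (\<Xi> s t) \<le> K * norm (f s) * norm (g t - g s)" unfolding \<Xi>_def by (rule K)
      also have "\<dots> \<le> K * B * (e0 / (2 * (K * B + 1)))"
      proof (intro mult_mono)
        have "dist (g t) (g s) < e0 / (2 * (K * B + 1))"
          using st by (intro d(2)) (auto simp: dist_real_def)
        then show "norm (g t - g s) \<le> e0 / (2 * (K * B + 1))" by (simp add: dist_norm)
      qed (use B(2)[of s] st K0 B(1) in auto)
      also have "\<dots> \<le> e0 / 2" using divide_mult_half_le[OF KB e0] by (simp only: mult.commute)
      finally have 2: "norm (\<Xi> s t) \<le> e0 / 2" .
      have "norm (J t - J s) \<le> norm (J t - J s - \<Xi> s t) + norm (\<Xi> s t)" by norm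
      with 1 2 e0 have "norm (J t - J s) < e0" by linarith
      then show ?thesis by (simp only: dist_norm)
    qed
    show "\<exists>d>0. \<forall>x\<in>{0..1}. \<forall>x'\<in>{0..1}. dist x' x < d \<longrightarrow> dist (J x') (J x) < e0"
    proof (intro exI[of _ "min d \<delta>"] conjI ballI impI)
      fix s t :: real assume "s \<in> {0..1}" "t \<in> {0..1}" "dist t s < min d \<delta>"
      then show "dist (J t) (J s) < e0"
        using *[of s t] *[of t s] by (cases "s \<le> t") (auto simp: dist_commute dist_real_def)
    qed (use d \<delta> in auto)
  qed
  show ?thesis
  proof (rule that[of J])
    fix a b F G assume ab: "0 \<le> a" "a \<le> b" "b \<le> 1" and F': "controls r F f a b" "controls r G g a b"
    show "norm (J b - J a - pr (f a) (g b - g a))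
        \<le> K * sewing_const (2 / r) * ((F b - F a) * (G b - G a)) powr (1 / r)"
      unfolding \<Xi>_def[symmetric]
    proof (rule Jbound[OF ab])
      fix c :: "nat \<Rightarrow> real" and n assume c: "mono c" "c 0 = a" "c n = b"
      show "norm ((\<Sum>k=0..<n. \<Xi> (c k) (c (Suc k))) - \<Xi> a b)
        \<le> K * sewing_const (2 / r) * ((F b - F a) * (G b - G a)) powr (1 / r)"
        using young_sum_bound[OF r F' c(1), of 0 n] c by (simp add: \<Xi>_def)
    qed
  next
    show "continuous_on {0..1} J" by (rule Jcont)
  next
    fix a b :: real assume ab: "0 \<le> a" "a \<le> b" "b \<le> 1"
    show "has_young_integral (\<lambda>s. pr (f s)) g a b (J b - J a)"
      unfolding has_young_integral_def
    proof (intro allI impI)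
      fix e0 :: real assume e0: "0 < e0"
      have H: "0 \<le> H b - H a" using Hm[OF ab] by simp
      \<comment> \<open>Three errors per cell: one for each of the two pieces into which the tag
        cuts the cell, and one for moving the evaluation point of the left piece from its left end
        to the tag.\<close>
      define e where "e = (e0 / 3) / (2 * (H b - H a + 1))"
      have e: "0 < e" using e0 H by (simp add: e_def)
      have "e * (H b - H a) \<le> e0 / 3 / 2" unfolding e_def by (rule divide_mult_half_le[OF H]) (use e0 in simp)
      then have ee0: "3 * e * (H b - H a) < e0" using e0 by simp
      obtain \<delta> where \<delta>: "0 < \<delta>" "\<And>s t. 0 \<le> s \<Longrightarrow> s \<le> t \<Longrightarrow> t \<le> 1 \<Longrightarrow> t - s < \<delta> \<Longrightarrow> refined e s t"
        "\<And>s t. 0 \<le> s \<Longrightarrow> s \<le> t \<Longrightarrow> t \<le> 1 \<Longrightarrow> t - s < \<delta> \<Longrightarrow>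
          K * (norm (f t - f s) * norm (g t - g s)) \<le> e * (H t - H s)"
        using fine[OF e] by blast
      have Jfine: "norm (J t - J s - \<Xi> s t) \<le> e * (H t - H s)"
        if st: "0 \<le> s" "s \<le> t" "t \<le> 1" "t - s < \<delta>" for s t
        using \<delta>(2)[OF st] by (intro Jbound st(1-3)) (auto simp: refined_def)
      show "\<exists>\<delta>>0. \<forall>D. D tagged_division_of {a..b} \<and> (\<forall>(x, K)\<in>D. Sup K - Inf K < \<delta>) \<longrightarrow>
        norm ((\<Sum>(x, K)\<in>D. pr (f x) (g (Sup K) - g (Inf K))) - (J b - J a)) < e0"
      proof (intro exI[of _ \<delta>] conjI \<delta>(1) allI impI, elim conjE)
        fix T assume T: "T tagged_division_of {a..b}" "\<forall>(x, K)\<in>T. Sup K - Inf K < \<delta>"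
        have "(\<Sum>(x, K)\<in>T. pr (f x) (g (Sup K) - g (Inf K))) - (J b - J a)
          = (\<Sum>(x, K)\<in>T. pr (f x) (g (Sup K) - g (Inf K)) - (J (Sup K) - J (Inf K)))"
          using additive_tagged_division_1[OF ab(2) T(1), of J]
          by (simp add: case_prod_unfold sum_subtractf)
        also have "norm \<dots> \<le> (\<Sum>(x, K)\<in>T. 3 * e * (H (Sup K) - H (Inf K)))"
        proof (rule sum_norm_le, clarify)
          fix x C assume xC: "(x, C) \<in> T"
          obtain l u where C: "C = cbox l u" "x \<in> C" "C \<subseteq> {a..b}"
            using tagged_division_ofD(2-4)[OF T(1) xC] by metis
          then have lu: "l \<le> x" "x \<le> u" "a \<le> l" "u \<le> b" "Inf C = l" "Sup C = u" by auto
          have "u - l < \<delta>" using T(2) xC lu by auto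
          then have fin: "x - l < \<delta>" "u - x < \<delta>" using lu by auto
          have "pr (f x) (g u - g l) - (J u - J l)
            = - (J u - J x - \<Xi> x u) - (J x - J l - \<Xi> l x) + pr (f x - f l) (g x - g l)"
            by (simp add: \<Xi>_def diff_left diff_right algebra_simps)
          also have "norm \<dots> \<le> norm (J u - J x - \<Xi> x u) + norm (J x - J l - \<Xi> l x) + norm (pr (f x - f l) (g x - g l))"
            by norm
          also have "\<dots> \<le> e * (H u - H x) + e * (H x - H l) + e * (H x - H l)"
          proof (intro add_mono)
            show "norm (J u - J x - \<Xi> x u) \<le> e * (H u - H x)"
              using lu fin ab by (intro Jfine) auto
            show "norm (J x - J l - \<Xi> l x) \<le> e * (H x - H l)"
              using lu fin ab by (intro Jfine) auto
            have "norm (pr (f x - f l) (g x - g l)) \<le> K * (norm (f x - f l) * norm (g x - g l))"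
              using K[of "f x - f l" "g x - g l"] by (simp add: mult.assoc)
            also have "\<dots> \<le> e * (H x - H l)" using lu fin ab by (intro \<delta>(3)) auto
            finally show "norm (pr (f x - f l) (g x - g l)) \<le> e * (H x - H l)" .
          qed
          also have "\<dots> \<le> 3 * e * (H u - H l)"
          proof -
            have "H x - H l \<le> H u - H l" using Hm[of x u] lu ab by simp
            then have "e * (H x - H l) \<le> e * (H u - H l)" using e by simp
            moreover have "0 \<le> e * (H u - H l)" using Hm[of l u] lu ab e by simp
            ultimately show ?thesis by (simp add: algebra_simps)
          qed
          finally show "norm (pr (f x) (g (Sup C) - g (Inf C)) - (J (Sup C) - J (Inf C)))
            \<le> 3 * e * (H (Sup C) - H (Inf C))" by (simp add: lu)
        qed
        also have "\<dots> = 3 * e * (H b - H a)"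
          using additive_tagged_division_1[OF ab(2) T(1), of H]
          by (simp add: case_prod_unfold flip: sum_distrib_left)
        also have "\<dots> < e0" by (rule ee0)
        finally show "norm ((\<Sum>(x, K)\<in>T. pr (f x) (g (Sup K) - g (Inf K))) - (J b - J a)) < e0" .
      qed
    qed
  qed
qed

end

section \<open>Linearity, existence and bounds of Young integrals\<close>

text \<open>The hypothesis \<open>eq\<close> speaks of values on increments, so the same lemma gives
  linearity in the integrand and in the integrator.\<close>

lemma has_young_integral_linear_combination:
  assumes "has_young_integral f1 g1 a b I1" "has_young_integral f2 g2 a b I2"
    and eq: "\<And>x s t. f x (g t - g s) = c *\<^sub>R f1 x (g1 t - g1 s) + f2 x (g2 t - g2 s)"
  shows "has_young_integral f g a b (c *\<^sub>R I1 + I2)"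
  unfolding has_young_integral_def
proof (intro allI impI)
  fix e :: real assume e: "0 < e"
  define e' where "e' = e / (\<bar>c\<bar> + 1)"
  have c: "0 < \<bar>c\<bar> + 1" by simp
  have e': "0 < e'" using e c by (simp add: e'_def)
  have "(\<bar>c\<bar> + 1) * e' = e" unfolding e'_def using c by simp
  then have ce: "\<bar>c\<bar> * e' + e' = e" by (simp add: distrib_right)
  obtain d1 where d1: "0 < d1" "\<And>D. D tagged_division_of {a..b} \<Longrightarrow> \<forall>(x, K)\<in>D. Sup K - Inf K < d1 \<Longrightarrow>
      norm ((\<Sum>(x, K)\<in>D. f1 x (g1 (Sup K) - g1 (Inf K))) - I1) < e'"
    using assms(1)[unfolded has_young_integral_def, rule_format, OF e'] by blast
  obtain d2 where d2: "0 < d2" "\<And>D. D tagged_division_of {a..b} \<Longrightarrow> \<forall>(x, K)\<in>D. Sup K - Inf K < d2 \<Longrightarrow>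
      norm ((\<Sum>(x, K)\<in>D. f2 x (g2 (Sup K) - g2 (Inf K))) - I2) < e'"
    using assms(2)[unfolded has_young_integral_def, rule_format, OF e'] by blast
  show "\<exists>\<delta>>0. \<forall>D. D tagged_division_of {a..b} \<and> (\<forall>(x, K)\<in>D. Sup K - Inf K < \<delta>) \<longrightarrow>
    norm ((\<Sum>(x, K)\<in>D. f x (g (Sup K) - g (Inf K))) - (c *\<^sub>R I1 + I2)) < e"
  proof (intro exI[of _ "min d1 d2"] conjI allI impI, goal_cases)
    case 1
    then show ?case using d1 d2 by simp
  next
    case (2 D)
    let ?S1 = "\<Sum>(x, K)\<in>D. f1 x (g1 (Sup K) - g1 (Inf K))"
    let ?S2 = "\<Sum>(x, K)\<in>D. f2 x (g2 (Sup K) - g2 (Inf K))"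
    have S1: "norm (?S1 - I1) < e'" using 2 by (intro d1(2)) auto
    have S2: "norm (?S2 - I2) < e'" using 2 by (intro d2(2)) auto
    have "(\<Sum>(x, K)\<in>D. f x (g (Sup K) - g (Inf K))) - (c *\<^sub>R I1 + I2)
      = c *\<^sub>R (?S1 - I1) + (?S2 - I2)"
      by (simp add: eq case_prod_unfold sum.distrib scaleR_sum_right algebra_simps)
    also have "norm \<dots> \<le> \<bar>c\<bar> * norm (?S1 - I1) + norm (?S2 - I2)"
      using norm_triangle_ineq[of "c *\<^sub>R (?S1 - I1)" "?S2 - I2"] by simp
    also have "\<dots> < \<bar>c\<bar> * e' + e'"
      using S1 S2 by (intro add_le_less_mono mult_left_mono) auto
    finally show ?case using ce by simp
  qed
qed

lemma has_young_integral_linear_image: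
  assumes "has_young_integral f g a b I" "bounded_linear h"
  shows "has_young_integral (\<lambda>s w. h (f s w)) g a b (h I)"
  unfolding has_young_integral_def
proof (intro allI impI)
  interpret bounded_linear h by fact
  fix e :: real assume e: "0 < e"
  obtain C where C: "0 < C" "\<And>x. norm (h x) \<le> norm x * C" using pos_bounded by blast
  obtain \<delta> where \<delta>: "0 < \<delta>" "\<And>D. D tagged_division_of {a..b} \<Longrightarrow> \<forall>(x, K)\<in>D. Sup K - Inf K < \<delta> \<Longrightarrow>
      norm ((\<Sum>(x, K)\<in>D. f x (g (Sup K) - g (Inf K))) - I) < e / C"
    using assms(1)[unfolded has_young_integral_def, rule_format, of "e / C"] e C by auto
  show "\<exists>\<delta>>0. \<forall>D. D tagged_division_of {a..b} \<and> (\<forall>(x, K)\<in>D. Sup K - Inf K < \<delta>) \<longrightarrow>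
    norm ((\<Sum>(x, K)\<in>D. h (f x (g (Sup K) - g (Inf K)))) - h I) < e"
  proof (intro exI[of _ \<delta>] conjI \<delta>(1) allI impI)
    fix D assume D: "D tagged_division_of {a..b} \<and> (\<forall>(x, K)\<in>D. Sup K - Inf K < \<delta>)"
    let ?S = "\<Sum>(x, K)\<in>D. f x (g (Sup K) - g (Inf K))"
    have "(\<Sum>(x, K)\<in>D. h (f x (g (Sup K) - g (Inf K)))) - h I = h (?S - I)"
      by (simp add: diff sum case_prod_unfold)
    also have "norm \<dots> \<le> norm (?S - I) * C" by (rule C)
    also have "\<dots> < e" using \<delta>(2)[of D] D C by (simp add: field_simps)
    finally show "norm ((\<Sum>(x, K)\<in>D. h (f x (g (Sup K) - g (Inf K)))) - h I) < e" .
  qed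
qed

lemma bounded_bilinear_young_product:
  assumes "bounded_bilinear pr"
  obtains K where "young_product pr K"
proof -
  interpret bounded_bilinear pr by fact
  obtain K where "0 \<le> K" "\<And>a b. norm (pr a b) \<le> norm a * norm b * K" using nonneg_bounded by blast
  then have "young_product pr K"
    by unfold_locales (auto simp: mult.commute mult.left_commute)
  then show ?thesis by (rule that)
qed

lemma var_bounded_product_exists:
  assumes "bounded_bilinear pr" "1 \<le> r"
  obtains C where "0 \<le> C"
    "\<And>f g a b. var_bounded r f a \<Longrightarrow> var_bounded r g b \<Longrightarrow> var_bounded r (\<lambda>t. pr (f t) (g t)) (C * a * b)"
proof -
  interpret bounded_bilinear pr by fact
  obtain K where "0 \<le> K" "\<And>a b. norm (pr a b) \<le> norm a * norm b * K" using nonneg_bounded by blast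
  then show ?thesis
    using that[of "4 * K"] var_bounded_bilinear[OF _ _ assms(2,1), of _ _ _ _ K]
    by (simp add: mult.commute mult.left_commute)
qed

text \<open>\<open>young_integral\<close> is a definite description, so every computation with it
  starts from existence; uniqueness identifies it with an increment of the primitive
  \<open>J\<close>.\<close>

lemma young_integral_exists:
  fixes pr :: "'a::real_normed_vector \<Rightarrow> 'b::real_normed_vector \<Rightarrow> 'c::{real_normed_vector, complete_space}"
  assumes "bounded_bilinear pr" "1 \<le> r" "r < 2" "var_bounded r f a" "var_bounded r g b" "t \<in> {0..1}"
  shows "has_young_integral (\<lambda>s. pr (f s)) g 0 t (young_integral (\<lambda>s. pr (f s)) g 0 t)"
proof -
  obtain K where "young_product pr K" using bounded_bilinear_young_product[OF assms(1)] .
  then interpret young_product pr K .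
  obtain F where F: "controls r F f 0 1" using var_bounded_controls[OF assms(4)] by metis
  obtain G where G: "controls r G g 0 1" using var_bounded_controls[OF assms(5)] by metis
  obtain J where J: "\<And>a b. 0 \<le> a \<Longrightarrow> a \<le> b \<Longrightarrow> b \<le> 1 \<Longrightarrow> has_young_integral (\<lambda>s. pr (f s)) g a b (J b - J a)"
    by (rule young_path_exists[OF assms(2,3) var_boundedD(1)[OF assms(4)] var_boundedD(1)[OF assms(5)] F G]) blast
  have "has_young_integral (\<lambda>s. pr (f s)) g 0 t (J t - J 0)" using assms(6) by (intro J) auto
  then show ?thesis using young_integral_eqI by fastforce
qed

text \<open>Young's inequality gives
  \<open>norm (I t - I s) \<le> C * a * (G t - G s) powr (1 / r)\<close>: the integral inherits its
  control from the integrator, scaled by \<open>(C * a) powr r\<close>. Continuity is carried over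
  from \<open>J\<close> separately, since a control need not be continuous.\<close>

lemma young_integral_bounded:
  fixes pr :: "'a::real_normed_vector \<Rightarrow> 'b::real_normed_vector \<Rightarrow> 'c::{real_normed_vector, complete_space}"
  assumes pr: "bounded_bilinear pr" and r: "1 \<le> r" "r < 2"
  obtains C where "0 \<le> C"
    "\<And>f g a b. var_bounded r f a \<Longrightarrow> var_bounded r g b \<Longrightarrow>
      var_bounded r (\<lambda>t. young_integral (\<lambda>s. pr (f s)) g 0 t) (C * a * b)"
proof -
  obtain K where "young_product pr K" using bounded_bilinear_young_product[OF pr] .
  then interpret young_product pr K .
  define C where "C = K * (1 + sewing_const (2 / r))"
  have sc: "0 < sewing_const (2 / r)" using r by (intro sewing_const) auto
  have C: "0 \<le> C" using K0 sc by (simp add: C_def)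
  show ?thesis
  proof (rule that[OF C])
    fix f :: "real \<Rightarrow> 'a" and g :: "real \<Rightarrow> 'b" and a b
    assume fa: "var_bounded r f a" and gb: "var_bounded r g b"
    obtain F where F: "controls r F f 0 1" "F 1 - F 0 \<le> a powr r" using var_bounded_controls[OF fa] by metis
    obtain G where G: "controls r G g 0 1" "G 1 - G 0 \<le> b powr r" using var_bounded_controls[OF gb] by metis
    note f = var_boundedD[OF fa] and g = var_boundedD[OF gb]
    obtain J where J: "\<And>a b. 0 \<le> a \<Longrightarrow> a \<le> b \<Longrightarrow> b \<le> 1 \<Longrightarrow> has_young_integral (\<lambda>s. pr (f s)) g a b (J b - J a)"
      "\<And>a b F G. 0 \<le> a \<Longrightarrow> a \<le> b \<Longrightarrow> b \<le> 1 \<Longrightarrow> controls r F f a b \<Longrightarrow> controls r G g a b \<Longrightarrow>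
        norm (J b - J a - pr (f a) (g b - g a))
          \<le> K * sewing_const (2 / r) * ((F b - F a) * (G b - G a)) powr (1 / r)"
      "continuous_on {0..1} J"
      by (rule young_path_exists[OF r f(1) g(1) F(1) G(1)]) blast
    define I where "I t = young_integral (\<lambda>s. pr (f s)) g 0 t" for t
    have I: "I t = J t - J 0" if "0 \<le> t" "t \<le> 1" for t
      unfolding I_def by (rule young_integral_eqI[OF J(1)]) (use that in auto)
    have Fa: "(F t - F s) powr (1 / r) \<le> a" if st: "0 \<le> s" "s \<le> t" "t \<le> 1" for s t
    proof -
      have "(F t - F s) powr (1 / r) \<le> (a powr r) powr (1 / r)"
        using controls_mono[OF F(1), of 0 s] controls_mono[OF F(1), of t 1] controls_mono[OF F(1), of s t] st r F(2)
        by (intro powr_mono2) auto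
      then show ?thesis using f(2) r by (simp add: powr_powr)
    qed
    have inc: "norm (I t - I s) \<le> C * a * (G t - G s) powr (1 / r)" if st: "0 \<le> s" "s \<le> t" "t \<le> 1" for s t
    proof -
      have FG: "0 \<le> F t - F s" "0 \<le> G t - G s"
        using controls_mono[OF F(1) st] controls_mono[OF G(1) st] by auto
      have "I t - I s = (J t - J s - pr (f s) (g t - g s)) + pr (f s) (g t - g s)"
        using st by (simp add: I)
      also have "norm \<dots> \<le> norm (J t - J s - pr (f s) (g t - g s)) + norm (pr (f s) (g t - g s))"
        by (rule norm_triangle_ineq)
      also have "\<dots> \<le> K * sewing_const (2 / r) * ((F t - F s) * (G t - G s)) powr (1 / r)
          + K * norm (f s) * norm (g t - g s)"
        using st by (intro add_mono K J(2) controls_subset[OF F(1)] controls_subset[OF G(1)]) auto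
      also have "((F t - F s) * (G t - G s)) powr (1 / r) = (F t - F s) powr (1 / r) * (G t - G s) powr (1 / r)"
        by (rule powr_mult)
      also have "K * sewing_const (2 / r) * ((F t - F s) powr (1 / r) * (G t - G s) powr (1 / r))
          + K * norm (f s) * norm (g t - g s)
        \<le> K * sewing_const (2 / r) * (a * (G t - G s) powr (1 / r)) + K * a * (G t - G s) powr (1 / r)"
        using st sc K0 f(2) f(3)[of s] r Fa[OF st]
        by (intro add_mono mult_mono controls_norm_le[OF G(1)]) auto
      also have "\<dots> = C * a * (G t - G s) powr (1 / r)" by (simp add: C_def algebra_simps)
      finally show ?thesis .
    qed
    have inc': "norm (I t - I s) powr r \<le> (C * a) powr r * (G t - G s)" if st: "0 \<le> s" "s \<le> t" "t \<le> 1" for s t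
    proof -
      have "norm (I t - I s) powr r \<le> (C * a * (G t - G s) powr (1 / r)) powr r"
        using inc[OF st] r by (intro powr_mono2) auto
      also have "\<dots> = (C * a) powr r * (G t - G s)"
        using controls_mono[OF G(1) st] C f(2) r by (simp add: powr_mult powr_powr)
      finally show ?thesis .
    qed
    have cont: "continuous_on {0..1} I"
    proof (rule continuous_on_eq)
      show "continuous_on {0..1} (\<lambda>t. J t - J 0)" by (intro continuous_intros J(3))
    qed (simp add: I)
    have I0: "I 0 = 0" by (simp add: I)
    have bnd: "C * a * (G 1 - G 0) powr (1 / r) \<le> C * a * b"
    proof -
      have "(G 1 - G 0) powr (1 / r) \<le> (b powr r) powr (1 / r)"
        using controls_mono[OF G(1), of 0 1] G(2) r by (intro powr_mono2) auto
      then show ?thesis using C f(2) g(2) r by (intro mult_left_mono) (auto simp: powr_powr)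
    qed
    have "var_bounded r I (C * a * b)"
    proof (rule var_boundedI[where F = "\<lambda>t. (C * a) powr r * G t"])
      show "norm (I t) \<le> C * a * b" if "t \<in> {0..1}" for t
      proof -
        have "norm (I t - I 0) \<le> C * a * (G t - G 0) powr (1 / r)" using inc[of 0 t] that by simp
        also have "\<dots> \<le> C * a * (G 1 - G 0) powr (1 / r)"
          using controls_mono[OF G(1), of 0 t] controls_mono[OF G(1), of t 1] that C f(2) r
          by (intro mult_left_mono powr_mono2) auto
        finally show ?thesis using bnd I0 by simp
      qed
      have "(C * a) powr r * G 1 - (C * a) powr r * G 0 = (C * a) powr r * (G 1 - G 0)"
        by (simp add: right_diff_distrib)
      also have "\<dots> \<le> (C * a) powr r * b powr r" using G(2) by (intro mult_left_mono) auto
      also have "\<dots> = (C * a * b) powr r" by (rule powr_mult[symmetric])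
      finally show "(C * a) powr r * G 1 - (C * a) powr r * G 0 \<le> (C * a * b) powr r" .
    qed (use cont C f(2) g(2) inc' in \<open>auto simp: right_diff_distrib\<close>)
    then show "var_bounded r (\<lambda>t. young_integral (\<lambda>s. pr (f s)) g 0 t) (C * a * b)"
      by (simp add: I_def[abs_def])
  qed
qed

section \<open>Linear Young equations\<close>

lemma bounded_bilinear_matrix_vector_mult:
  "bounded_bilinear ((*v) :: real^'m^'n \<Rightarrow> real^'m \<Rightarrow> real^'n)"
  unfolding bilinear_conv_bounded_bilinear[symmetric] bilinear_def linear_iff
  by (simp add: vec_eq_iff matrix_vector_mult_def sum.distrib sum_distrib_left algebra_simps)

lemma bounded_bilinear_matrix_matrix_mult:
  "bounded_bilinear ((**) :: real^'m^'n \<Rightarrow> real^'k^'m \<Rightarrow> real^'k^'n)"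
  unfolding bilinear_conv_bounded_bilinear[symmetric] bilinear_def linear_iff
  by (simp add: vec_eq_iff matrix_matrix_mult_def sum.distrib sum_distrib_left algebra_simps)

text \<open>A path driven linearly by \<open>\<Omega>\<close> that vanishes somewhere vanishes nearby: otherwise its variation
  on a short interval would be a small multiple of itself.\<close>

lemma linear_flow_zero_near:
  fixes x :: "real \<Rightarrow> 'b::real_normed_vector" and \<Omega> :: "real \<Rightarrow> 'a::real_normed_vector"
  assumes r: "1 \<le> q" "q < r" "r < 2"
    and \<Omega>: "var_bounded q \<Omega> c" and x: "finite_var r x"
    and K: "0 \<le> K" "\<And>A y. norm (pr A y) \<le> K * norm A * norm y" and C: "0 \<le> C"
    and inc: "\<And>a b X G. 0 \<le> a \<Longrightarrow> a \<le> b \<Longrightarrow> b \<le> 1 \<Longrightarrow> controls r X x a b \<Longrightarrow> controls r G \<Omega> a b \<Longrightarrow>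
      norm (x b - x a - pr (\<Omega> b - \<Omega> a) (x a)) \<le> C * ((X b - X a) * (G b - G a)) powr (1 / r)"
  obtains \<delta> where "0 < \<delta>" "\<And>a b t u. 0 \<le> a \<Longrightarrow> a \<le> b \<Longrightarrow> b \<le> 1 \<Longrightarrow> b - a < \<delta> \<Longrightarrow>
    t \<in> {a..b} \<Longrightarrow> x t = 0 \<Longrightarrow> u \<in> {a..b} \<Longrightarrow> x u = 0"
proof -
  obtain F where F: "controls q F \<Omega> 0 1" using var_bounded_controls[OF \<Omega>] by metis
  have FF: "0 \<le> F 1 - F 0" using controls_mono[OF F, of 0 1] by simp
  \<comment> \<open>The factor 2 becomes the factor 1/2 in the final self-estimate of the variation.
    \<open>\<eta>\<close> is chosen so that the control of the driver on a short interval is at most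
    \<open>inverse Q\<close>.\<close>
  define Q where "Q = 2 * (K + C + 1) powr r"
  have Q: "0 < Q" using K C by (simp add: Q_def)
  define \<eta> where "\<eta> = inverse Q powr (2 / r) / (2 * (F 1 - F 0) + 1)"
  have \<eta>: "0 < \<eta>" using Q FF by (simp add: \<eta>_def)
  have \<eta>le: "\<eta> * (2 * (F 1 - F 0)) \<le> inverse Q powr (2 / r)"
  proof -
    have "\<eta> * (2 * (F 1 - F 0)) \<le> \<eta> * (2 * (F 1 - F 0) + 1)" using \<eta> by simp
    also have "\<dots> = inverse Q powr (2 / r)" using FF by (simp add: \<eta>_def)
    finally show ?thesis .
  qed
  obtain \<delta> where \<delta>: "0 < \<delta>" "\<And>s t. 0 \<le> s \<Longrightarrow> s \<le> t \<Longrightarrow> t \<le> 1 \<Longrightarrow> t - s < \<delta> \<Longrightarrow>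
    \<exists>F' G'. controls r F' \<Omega> s t \<and> controls r G' \<Omega> s t \<and>
      ((F' t - F' s) * (G' t - G' s)) powr (1 / r) \<le> \<eta> * ((F t + F t) - (F s + F s))"
    using fine_controls[OF F F var_boundedD(1)[OF \<Omega>] var_boundedD(1)[OF \<Omega>] r \<eta>] by blast
  show ?thesis
  proof (rule that[OF \<delta>(1)])
    fix a b t u :: real
    assume ab: "0 \<le> a" "a \<le> b" "b \<le> 1" "b - a < \<delta>" and t: "t \<in> {a..b}" "x t = 0" and u: "u \<in> {a..b}"
    obtain F1 F2 where F12: "controls r F1 \<Omega> a b" "controls r F2 \<Omega> a b"
      "((F1 b - F1 a) * (F2 b - F2 a)) powr (1 / r) \<le> \<eta> * ((F b + F b) - (F a + F a))"
      using \<delta>(2)[OF ab] by blast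
    \<comment> \<open>The driver was paired with itself, which yields two controls; the one with the
      smaller increment has its square below their product.\<close>
    define G where "G = (if F1 b - F1 a \<le> F2 b - F2 a then F1 else F2)"
    have G: "controls r G \<Omega> a b" using F12 by (simp add: G_def)
    have Gpos: "0 \<le> G t - G s" if "a \<le> s" "s \<le> t" "t \<le> b" for s t
      using controls_mono[OF G that] by simp
    have Gsmall: "Q * (G b - G a) \<le> 1"
    proof -
      have "(G b - G a) powr (2 / r) = ((G b - G a) * (G b - G a)) powr (1 / r)"
        by (simp add: powr_mult flip: powr_add)
      also have "\<dots> \<le> ((F1 b - F1 a) * (F2 b - F2 a)) powr (1 / r)"
        using controls_mono[OF F12(1), of a b] controls_mono[OF F12(2), of a b] ab r
        by (intro powr_mono2 mult_mono mult_nonneg_nonneg) (auto simp: G_def)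
      also have "\<dots> \<le> \<eta> * ((F b + F b) - (F a + F a))" by (rule F12)
      also have "\<dots> \<le> \<eta> * (2 * (F 1 - F 0))"
        using controls_mono[OF F, of 0 a] controls_mono[OF F, of b 1] ab \<eta> by (intro mult_left_mono) auto
      also have "\<dots> \<le> inverse Q powr (2 / r)" by (rule \<eta>le)
      finally have "G b - G a \<le> inverse Q"
        using powr_less_mono2[of "2 / r" "inverse Q" "G b - G a"] r Q by force
      then show ?thesis using Q by (simp add: field_simps)
    qed
    \<comment> \<open>Freezing the path outside \<open>{a..b}\<close> expresses its variation there
      through \<open>var_sums\<close>, which refers to the whole unit interval.\<close>
    define cl where "cl s = max a (min b s)" for s
    have cl: "a \<le> cl s" "cl s \<le> b" "s \<le> s' \<Longrightarrow> cl s \<le> cl s'" "s \<in> {a..b} \<Longrightarrow> cl s = s" for s s'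
      using ab by (auto simp: cl_def)
    define y where "y s = x (cl s)" for s
    obtain X0 where X0: "controls r X0 x 0 1" using controls_finite_var[OF x] by metis
    have "controls r (\<lambda>s. X0 (cl s)) y 0 1"
      unfolding controls_def y_def using cl(1,2) ab by (intro allI impI controlsD[OF X0] cl(3)) (auto intro: order_trans)
    then have "finite_var r y" by (rule finite_var_controls)
    then obtain X where X: "controls r X y 0 1" "X 1 - X 0 \<le> Sup (var_sums r y)"
      by (rule controls_finite_var)
    define V where "V = Sup (var_sums r y)"
    have V: "0 \<le> V" "X 1 - X 0 \<le> V" using X controls_mono[OF X(1), of 0 1] by (auto simp: V_def)
    define v where "v = V powr (1 / r)"
    have v: "0 \<le> v" "v powr r = V" using V r by (auto simp: v_def powr_powr)
    have XS: "X s - X s' \<le> V" if "a \<le> s'" "s' \<le> s" "s \<le> b" for s s'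
      using controls_mono[OF X(1), of 0 s'] controls_mono[OF X(1), of s 1] that ab V by linarith
    have Xx: "controls r X x a b"
      unfolding controls_def
    proof (intro allI impI)
      fix s t assume st: "a \<le> s" "s \<le> t" "t \<le> b"
      then show "norm (x t - x s) powr r \<le> X t - X s"
        using controlsD[OF X(1), of s t] cl(4)[of s] cl(4)[of t] ab by (simp add: y_def)
    qed
    have xs: "norm (x s) \<le> v" if "s \<in> {a..b}" for s
      using controls_norm_le'[OF Xx, of t s v] that t v r XS[of a b] ab by simp
    have step: "norm (x t - x s) powr r \<le> (K + C + 1) powr r * V * (G t - G s)" if st: "a \<le> s" "s \<le> t" "t \<le> b" for s t
    proof -
      define g where "g = (G t - G s) powr (1 / r)"
      have g: "0 \<le> g" "g powr r = G t - G s" using Gpos[OF st] r by (auto simp: g_def powr_powr)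
      have "norm (x t - x s - pr (\<Omega> t - \<Omega> s) (x s)) \<le> C * ((X t - X s) * (G t - G s)) powr (1 / r)"
        using st ab by (intro inc controls_subset[OF Xx] controls_subset[OF G]) auto
      also have "((X t - X s) * (G t - G s)) powr (1 / r) = (X t - X s) powr (1 / r) * g"
        by (simp add: g_def powr_mult)
      also have "C * ((X t - X s) powr (1 / r) * g) \<le> C * (v * g)"
        unfolding v_def using C g r XS[OF st] controls_mono[OF Xx st]
        by (intro mult_left_mono mult_right_mono powr_mono2) auto
      finally have 1: "norm (x t - x s - pr (\<Omega> t - \<Omega> s) (x s)) \<le> C * (v * g)" .
      have "norm (pr (\<Omega> t - \<Omega> s) (x s)) \<le> K * norm (\<Omega> t - \<Omega> s) * norm (x s)" by (rule K)
      also have "\<dots> \<le> K * g * v"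
        unfolding g_def using st r K xs[of s] by (intro mult_mono controls_norm_le[OF G]) auto
      finally have 2: "norm (pr (\<Omega> t - \<Omega> s) (x s)) \<le> K * g * v" .
      have "norm (x t - x s) \<le> norm (x t - x s - pr (\<Omega> t - \<Omega> s) (x s)) + norm (pr (\<Omega> t - \<Omega> s) (x s))"
        by norm
      also have "\<dots> \<le> C * (v * g) + K * g * v" by (rule add_mono[OF 1 2])
      also have "\<dots> \<le> (K + C + 1) * v * g" using g v by (simp add: algebra_simps)
      finally have "norm (x t - x s) powr r \<le> ((K + C + 1) * v * g) powr r" using r by (intro powr_mono2) auto
      also have "\<dots> = (K + C + 1) powr r * V * (G t - G s)" by (simp only: powr_mult v(2) g(2))
      finally show ?thesis .
    qed
    let ?Z = "\<lambda>s. (K + C + 1) powr r * V * G (cl s)"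
    have "controls r ?Z y 0 1"
      unfolding controls_def y_def right_diff_distrib[symmetric]
      by (intro allI impI step cl)
    from finite_var_controls(2)[OF this] have "V \<le> (K + C + 1) powr r * V * (G (cl 1) - G (cl 0))"
      unfolding V_def[symmetric] by (simp add: right_diff_distrib)
    also have "\<dots> = V * ((K + C + 1) powr r * (G b - G a))"
      using ab by (simp add: cl_def)
    also have "\<dots> \<le> V * (1 / 2)"
      using Gsmall V by (intro mult_left_mono) (auto simp: Q_def)
    \<comment> \<open>The variation of \<open>y\<close> is finite and at most half of
      itself.\<close>
    finally have "V = 0" using V by simp
    then have "v = 0" by (simp add: v_def)
    then show "x u = 0" using xs[OF u] by simp
  qed
qed

text \<open>Zeros are carried to the left in equal steps shorter than \<delta>. The step is an exact
  fraction of \<open>c\<close>, so that the last one ends at 0.\<close>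

lemma linear_flow_zero_backward:
  fixes x :: "real \<Rightarrow> 'b::real_normed_vector"
  assumes \<delta>: "0 < \<delta>" "\<And>a b t u. 0 \<le> a \<Longrightarrow> a \<le> b \<Longrightarrow> b \<le> 1 \<Longrightarrow> b - a < \<delta> \<Longrightarrow>
    t \<in> {a..b} \<Longrightarrow> x t = 0 \<Longrightarrow> u \<in> {a..b} \<Longrightarrow> x u = 0"
    and c: "c \<in> {0..1}" "x c = 0"
  shows "x 0 = 0"
proof -
  obtain n :: nat where n: "inverse (real (Suc n)) < \<delta>" using reals_Archimedean[OF \<delta>(1)] by blast
  define h where "h = c / real (Suc n)"
  have h: "0 \<le> h" "h < \<delta>" "h * real (Suc n) = c"
  proof -
    have "h \<le> inverse (real (Suc n))" using c by (simp add: h_def inverse_eq_divide divide_right_mono)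
    then show "h < \<delta>" using n by simp
  qed (use c in \<open>auto simp: h_def\<close>)
  have "x (c - h * real k) = 0" if "k \<le> Suc n" for k
    using that
  proof (induction k)
    case 0
    then show ?case using c by simp
  next
    case (Suc k)
    have "h * real (Suc k) \<le> h * real (Suc n)" using h(1) Suc.prems by (intro mult_left_mono) auto
    then have 1: "0 \<le> c - h * real (Suc k)" unfolding h(3) by simp
    have 2: "0 \<le> h * real k" "c \<le> 1" using h(1) c by simp_all
    have 3: "c - h * real k = c - h * real (Suc k) + h" by (simp add: algebra_simps)
    have 4: "x (c - h * real k) = 0" by (rule Suc.IH) (use Suc.prems in simp)
    show ?case
    proof (rule \<delta>(2)[OF 1 _ _ _ _ 4])
      show "c - h * real (Suc k) \<le> c - h * real k" using 3 h by linarith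
      show "c - h * real k \<le> 1" using 2 by linarith
      show "c - h * real k - (c - h * real (Suc k)) < \<delta>" using 3 h by linarith
    qed (use 3 h in auto)
  qed
  from this[of "Suc n"] show ?thesis using h(3) by simp
qed

text \<open>A kernel vector \<open>v\<close> of \<open>M t\<close> gives the path
  \<open>M s *v v\<close>, which solves the same linear equation and vanishes at \<open>t\<close>.
  Its zeros spread back to time 0, where it equals \<open>v\<close>. No second flow for the inverse
  has to be constructed.\<close>

lemma linear_flow_invertible:
  fixes M \<Omega> :: "real \<Rightarrow> real^'n^'n"
  assumes r: "1 \<le> q" "q < r" "r < 2"
    and \<Omega>: "var_bounded q \<Omega> c" and M: "var_bounded r M m"
    and eq: "\<And>t. t \<in> {0..1} \<Longrightarrow> M t = mat 1 + young_integral (\<lambda>s A. A ** M s) \<Omega> 0 t"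
    and t: "t \<in> {0..1}"
  shows "invertible (M t)"
proof -
  have r': "1 \<le> r" using r by simp
  have \<Omega>r: "var_bounded r \<Omega> c" using var_bounded_exponent[OF \<Omega> r(1)] r by simp
  \<comment> \<open>In \<open>A ** M s\<close> the increment of the driver is the left factor, so
    the products are flipped to put the integrand first.\<close>
  note flip1 = bounded_bilinear.flip[OF bounded_bilinear_matrix_matrix_mult]
  note flip2 = bounded_bilinear.flip[OF bounded_bilinear_matrix_vector_mult]
  have zero: "v = 0" if v: "M t *v v = 0" for v
  proof -
    define x where "x s = M s *v v" for s
    have lin: "bounded_linear (\<lambda>A. A *v v)" for v :: "real^'n"
      by (rule bounded_bilinear.bounded_linear_left[OF bounded_bilinear_matrix_vector_mult])
    obtain L where L: "0 < L" "\<And>A. norm (A *v v) \<le> norm (A :: real^'n^'n) * L"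
      using bounded_linear.pos_bounded[OF lin] by blast
    have xv: "var_bounded r x (L * m)"
      unfolding x_def using L bounded_linear.linear[OF lin]
      by (intro var_bounded_linear[OF M r']) (auto simp: mult.commute)
    obtain X where X: "controls r X x 0 1" using var_bounded_controls[OF xv] by metis
    obtain F where F: "controls r F M 0 1" using var_bounded_controls[OF M] by metis
    obtain G where G: "controls r G \<Omega> 0 1" using var_bounded_controls[OF \<Omega>r] by metis
    obtain K where "young_product (\<lambda>y A. (A :: real^'n^'n) *v y) K"
      using bounded_bilinear_young_product[OF flip2] .
    then interpret young_product "\<lambda>y A. (A :: real^'n^'n) *v y" K .
    obtain J where J: "\<And>a b. 0 \<le> a \<Longrightarrow> a \<le> b \<Longrightarrow> b \<le> 1 \<Longrightarrow> has_young_integral (\<lambda>s A. A *v x s) \<Omega> a b (J b - J a)"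
      "\<And>a b F G. 0 \<le> a \<Longrightarrow> a \<le> b \<Longrightarrow> b \<le> 1 \<Longrightarrow> controls r F x a b \<Longrightarrow> controls r G \<Omega> a b \<Longrightarrow>
        norm (J b - J a - (\<Omega> b - \<Omega> a) *v x a)
          \<le> K * sewing_const (2 / r) * ((F b - F a) * (G b - G a)) powr (1 / r)"
      by (rule young_path_exists[OF r' r(3) var_boundedD(1)[OF xv] var_boundedD(1)[OF \<Omega>r] X G]) blast
    have xJ: "x s = v + (J s - J 0)" if s: "s \<in> {0..1}" for s
    proof -
      have "has_young_integral (\<lambda>s A. A ** M s) \<Omega> 0 s (young_integral (\<lambda>s A. A ** M s) \<Omega> 0 s)"
        by (rule young_integral_exists[OF flip1 r' r(3) M \<Omega>r s])
      \<comment> \<open>Evaluation at \<open>v\<close> is linear and commutes with the integral, so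
        \<open>x\<close> is \<open>v\<close> plus an increment of the primitive
        \<open>J\<close>.\<close>
      from has_young_integral_linear_image[OF this lin[of v]]
      have "has_young_integral (\<lambda>s A. A *v x s) \<Omega> 0 s (young_integral (\<lambda>s A. A ** M s) \<Omega> 0 s *v v)"
        by (simp add: x_def matrix_vector_mul_assoc)
      then have "young_integral (\<lambda>s A. A ** M s) \<Omega> 0 s *v v = J s - J 0"
        using has_young_integral_unique J(1)[of 0 s] s by fastforce
      then show ?thesis using eq[OF s] by (simp add: x_def matrix_vector_mult_add_rdistrib)
    qed
    have fx: "finite_var r x" by (rule finite_var_controls[OF X])
    have Kd: "norm (A *v y) \<le> K * norm A * norm y" for A :: "real^'n^'n" and y
      using K[of A y] by (simp add: mult.assoc mult.commute[of "norm y"])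
    have C: "0 \<le> K * sewing_const (2 / r)" using K0 sewing_const(1)[of "2 / r"] r by simp
    have inc: "norm (x b - x a - (\<Omega> b - \<Omega> a) *v x a) \<le> K * sewing_const (2 / r) * ((X b - X a) * (G b - G a)) powr (1 / r)"
      if "0 \<le> a" "a \<le> b" "b \<le> 1" "controls r X x a b" "controls r G \<Omega> a b" for a b X G
    proof -
      have "x b - x a = J b - J a" using xJ[of a] xJ[of b] that by simp
      then show ?thesis using J(2)[OF that] by simp
    qed
    obtain \<delta> where \<delta>: "0 < \<delta>" "\<And>a b t u. 0 \<le> a \<Longrightarrow> a \<le> b \<Longrightarrow> b \<le> 1 \<Longrightarrow> b - a < \<delta> \<Longrightarrow>
      t \<in> {a..b} \<Longrightarrow> x t = 0 \<Longrightarrow> u \<in> {a..b} \<Longrightarrow> x u = 0"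
      by (rule linear_flow_zero_near[OF r \<Omega> fx K0 Kd C inc]) blast+
    have "x 0 = 0" by (rule linear_flow_zero_backward[OF \<delta> t]) (use v in \<open>auto simp: x_def\<close>)
    then show "v = 0" using xJ[of 0] by simp
  qed
  then have "\<exists>B. B ** M t = mat 1" unfolding matrix_left_invertible_ker by blast
  then show ?thesis using invertible_left_inverse by blast
qed

section \<open>The inverse of the flow\<close>

text \<open>The norm on matrices is the Euclidean norm of all entries, not the operator norm; the
  entries are bounded by testing on basis vectors.\<close>

lemma norm_matrix_le_of_operator_bound:
  fixes A :: "real^'n^'m"
  assumes "\<And>v. norm (A *v v) \<le> c * norm v"
  shows "norm A \<le> real (CARD('m) * CARD('n)) * c"
proof -
  have "\<bar>A $ i $ j\<bar> \<le> c" for i j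
  proof -
    have "A $ i $ j = (A *v axis j 1) $ i" by (simp add: matrix_vector_mult_basis column_def)
    also have "\<bar>\<dots>\<bar> \<le> norm (A *v axis j 1)" by (rule component_le_norm_cart)
    also have "\<dots> \<le> c * norm (axis j 1 :: real^'n)" by (rule assms)
    finally show ?thesis by simp
  qed
  then have "norm (A $ i) \<le> real CARD('n) * c" for i
    using norm_le_l1_cart[of "A $ i"] sum_bounded_above[of UNIV "\<lambda>j. \<bar>A $ i $ j\<bar>" c] by fastforce
  then have "(\<Sum>i\<in>UNIV. norm (A $ i)) \<le> real CARD('m) * (real CARD('n) * c)"
    using sum_bounded_above[of UNIV "\<lambda>i. norm (A $ i)" "real CARD('n) * c"] by simp
  moreover have "norm A \<le> (\<Sum>i\<in>UNIV. norm (A $ i))"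
    unfolding norm_vec_def by (rule L2_set_le_sum) simp
  ultimately show ?thesis by simp
qed

lemma matrix_inv_works:
  fixes A :: "real^'n^'n"
  assumes "invertible A"
  shows "A ** matrix_inv A = mat 1" "matrix_inv A ** A = mat 1"
  using assms someI_ex[of "\<lambda>B. A ** B = mat 1 \<and> B ** A = mat 1"]
  unfolding invertible_def matrix_inv_def by auto

text \<open>Compactness of the unit interval times the unit sphere turns pointwise invertibility
  into a uniform lower bound \<open>\<kappa>\<close>. The identity M_t^(-1) - M_s^(-1) = - M_t^(-1)
  (M_t - M_s) M_s^(-1) then makes inversion Lipschitz along the flow, so a multiple of the control
  of \<open>M\<close> serves for the inverse.\<close>

lemma var_bounded_matrix_inv:
  fixes M :: "real \<Rightarrow> real^'n^'n"
  assumes M: "var_bounded r M m" and r: "1 \<le> r"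
    and inv: "\<And>t. t \<in> {0..1} \<Longrightarrow> invertible (M t)"
  obtains c where "var_bounded r (\<lambda>t. matrix_inv (M t)) c"
proof -
  note bb = bounded_bilinear_matrix_vector_mult
  note Mc = var_boundedD(1)[OF M]
  define S :: "(real \<times> (real^'n)) set" where "S = {0..1} \<times> sphere 0 1"
  have cont: "continuous_on S (\<lambda>(t, v). norm (M t *v v))"
    unfolding S_def case_prod_unfold
    by (intro continuous_on_norm bounded_bilinear.continuous_on[OF bb] continuous_on_compose2[OF Mc] continuous_intros) auto
  have "compact S" unfolding S_def by (intro compact_Times compact_sphere) auto
  moreover have "S \<noteq> {}" unfolding S_def by (auto intro!: exI[of _ "axis undefined 1"])
  ultimately obtain p where p: "p \<in> S" "\<And>z. z \<in> S \<Longrightarrow> (case p of (t, v) \<Rightarrow> norm (M t *v v)) \<le> (case z of (t, v) \<Rightarrow> norm (M t *v v))"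
    using continuous_attains_inf[OF _ _ cont] by metis
  define \<kappa> where "\<kappa> = (case p of (t, v) \<Rightarrow> norm (M t *v v))"
  have \<kappa>: "0 < \<kappa>"
  proof -
    obtain t v where tv: "p = (t, v)" "t \<in> {0..1}" "norm v = 1" using p(1) by (auto simp: S_def)
    have "M t *v v \<noteq> 0"
    proof
      assume "M t *v v = 0"
      then have "matrix_inv (M t) *v (M t *v v) = 0" by simp
      then show False using matrix_inv_works(2)[OF inv[OF tv(2)]] tv(3) by (simp add: matrix_vector_mul_assoc)
    qed
    then show ?thesis by (simp add: \<kappa>_def tv)
  qed
  have lower: "\<kappa> * norm v \<le> norm (M t *v v)" if t: "t \<in> {0..1}" for t v
  proof (cases "v = 0")
    case False
    have "\<kappa> \<le> norm (M t *v (v /\<^sub>R norm v))"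
      using p(2)[of "(t, v /\<^sub>R norm v)"] t False by (simp add: \<kappa>_def S_def)
    also have "\<dots> = norm (M t *v v) / norm v"
      by (simp add: bounded_bilinear.scaleR_right[OF bb] divide_inverse mult.commute)
    finally show ?thesis using False by (simp add: field_simps)
  qed simp
  have upper: "norm (matrix_inv (M t) *v w) \<le> norm w / \<kappa>" if t: "t \<in> {0..1}" for t w
  proof -
    have "\<kappa> * norm (matrix_inv (M t) *v w) \<le> norm (M t *v (matrix_inv (M t) *v w))" by (rule lower[OF t])
    also have "\<dots> = norm w" using matrix_inv_works(1)[OF inv[OF t]] by (simp add: matrix_vector_mul_assoc)
    finally show ?thesis using \<kappa> by (simp add: field_simps)
  qed
  obtain K where K: "0 \<le> K" "\<And>(A :: real^'n^'n) v. norm (A *v v) \<le> norm A * norm v * K"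
    using bounded_bilinear.nonneg_bounded[OF bb] by blast
  define N where "N = real (CARD('n) * CARD('n))"
  define L where "L = N * (K / \<kappa> / \<kappa>)"
  have N: "0 \<le> N" and L: "0 \<le> L" using K \<kappa> by (auto simp: N_def L_def)
  have lip: "norm (matrix_inv (M t) - matrix_inv (M s)) \<le> L * norm (M t - M s)"
    if st: "s \<in> {0..1}" "t \<in> {0..1}" for s t
  proof -
    have "matrix_inv (M t) - matrix_inv (M s) = - (matrix_inv (M t) ** ((M t - M s) ** matrix_inv (M s)))"
    proof -
      interpret mm: bounded_bilinear "(**) :: real^'n^'n \<Rightarrow> real^'n^'n \<Rightarrow> real^'n^'n"
        by (rule bounded_bilinear_matrix_matrix_mult)
      show ?thesis
        using matrix_inv_works[OF inv[OF st(1)]] matrix_inv_works[OF inv[OF st(2)]]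
        by (simp add: mm.diff_left mm.diff_right matrix_mul_assoc)
    qed
    then have "norm (matrix_inv (M t) - matrix_inv (M s)) = norm (matrix_inv (M t) ** ((M t - M s) ** matrix_inv (M s)))"
      by simp
    also have "\<dots> \<le> real (CARD('n) * CARD('n)) * (K / \<kappa> / \<kappa> * norm (M t - M s))"
    proof (rule norm_matrix_le_of_operator_bound)
      fix v
      have "norm ((matrix_inv (M t) ** ((M t - M s) ** matrix_inv (M s))) *v v)
        = norm (matrix_inv (M t) *v ((M t - M s) *v (matrix_inv (M s) *v v)))"
        by (simp add: matrix_vector_mul_assoc matrix_mul_assoc)
      also have "\<dots> \<le> norm ((M t - M s) *v (matrix_inv (M s) *v v)) / \<kappa>" by (rule upper[OF st(2)])
      also have "\<dots> \<le> (norm (M t - M s) * norm (matrix_inv (M s) *v v) * K) / \<kappa>"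
        using \<kappa> by (intro divide_right_mono K(2)) auto
      also have "\<dots> \<le> (norm (M t - M s) * (norm v / \<kappa>) * K) / \<kappa>"
        using \<kappa> K(1) upper[OF st(1)] by (intro divide_right_mono mult_right_mono mult_left_mono) auto
      finally show "norm ((matrix_inv (M t) ** ((M t - M s) ** matrix_inv (M s))) *v v)
        \<le> K / \<kappa> / \<kappa> * norm (M t - M s) * norm v" by (simp add: field_simps)
    qed
    finally show ?thesis by (simp add: L_def N_def)
  qed
  obtain F where F: "controls r F M 0 1" "F 1 - F 0 \<le> m powr r" using var_bounded_controls[OF M] by metis
  have m: "0 \<le> m" using var_boundedD[OF M] by simp
  show ?thesis
  proof (rule that[of "N * (1 / \<kappa>) + L * m"], rule var_boundedI[where F = "\<lambda>t. L powr r * F t"])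
    show "continuous_on {0..1} (\<lambda>t. matrix_inv (M t))"
      unfolding continuous_on_iff
    proof (intro ballI allI impI)
      fix s e :: real assume s: "s \<in> {0..1}" and e: "0 < e"
      have "0 < e / (L + 1)" using e L by simp
      then obtain d where d: "0 < d" "\<And>t. t \<in> {0..1} \<Longrightarrow> dist t s < d \<Longrightarrow> dist (M t) (M s) < e / (L + 1)"
        using Mc s unfolding continuous_on_iff by blast
      have "dist (matrix_inv (M t)) (matrix_inv (M s)) < e" if t: "t \<in> {0..1}" "dist t s < d" for t
      proof -
        have "dist (matrix_inv (M t)) (matrix_inv (M s)) \<le> (L + 1) * dist (M t) (M s)"
          using lip[OF s t(1)] L by (simp add: dist_norm algebra_simps add_increasing)
        also have "\<dots> < (L + 1) * (e / (L + 1))" using d(2)[OF t] L by (intro mult_strict_left_mono) auto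
        finally show ?thesis using L by simp
      qed
      then show "\<exists>d>0. \<forall>t\<in>{0..1}. dist t s < d \<longrightarrow> dist (matrix_inv (M t)) (matrix_inv (M s)) < e"
        using d(1) by blast
    qed
    show "norm (matrix_inv (M t)) \<le> N * (1 / \<kappa>) + L * m" if t: "t \<in> {0..1}" for t
    proof -
      have "norm (matrix_inv (M t)) \<le> N * (1 / \<kappa>)"
        unfolding N_def using upper[OF t] by (intro norm_matrix_le_of_operator_bound) simp
      then show ?thesis using L m by (simp add: add_increasing2)
    qed
    show "norm (matrix_inv (M t) - matrix_inv (M s)) powr r \<le> L powr r * F t - L powr r * F s"
      if st: "0 \<le> s" "s \<le> t" "t \<le> 1" for s t
    proof -
      have "norm (matrix_inv (M t) - matrix_inv (M s)) powr r \<le> (L * norm (M t - M s)) powr r"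
        using lip[of s t] st r by (intro powr_mono2) auto
      also have "\<dots> = L powr r * norm (M t - M s) powr r" by (rule powr_mult)
      also have "\<dots> \<le> L powr r * (F t - F s)" using controlsD[OF F(1) st] by (intro mult_left_mono) auto
      finally show ?thesis by (simp add: right_diff_distrib)
    qed
    have "L powr r * F 1 - L powr r * F 0 \<le> L powr r * m powr r"
      using F(2) by (simp add: mult_left_mono flip: right_diff_distrib)
    also have "\<dots> = (L * m) powr r" by (rule powr_mult[symmetric])
    also have "\<dots> \<le> (N * (1 / \<kappa>) + L * m) powr r" using N \<kappa> L m r by (intro powr_mono2) auto
    finally show "L powr r * F 1 - L powr r * F 0 \<le> (N * (1 / \<kappa>) + L * m) powr r" .
  qed (use N \<kappa> L m in auto)
qed

section \<open>Piecewise linear interpolation\<close>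

text \<open>\<open>N\<close> equal cells on the unit interval. At \<open>t = 1\<close> the index is
  \<open>N\<close>, and \<open>c (Suc N)\<close> gets weight 0. Controls are interpolated by the
  same function as paths.\<close>

definition interp :: "nat \<Rightarrow> (nat \<Rightarrow> 'a::real_vector) \<Rightarrow> real \<Rightarrow> 'a" where
  "interp N c t = (let k = nat \<lfloor>real N * t\<rfloor>; v = real N * t - real k
     in (1 - v) *\<^sub>R c k + v *\<^sub>R c (Suc k))"

text \<open>The right end \<open>\<nu> = 1\<close> is included: there the formula of a cell agrees
  with that of the next one.\<close>

lemma interp_eval:
  assumes "0 < N" "0 \<le> \<nu>" "\<nu> \<le> 1"
  shows "interp N c ((real k + \<nu>) / real N) = (1 - \<nu>) *\<^sub>R c k + \<nu> *\<^sub>R c (Suc k)"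
proof (cases "\<nu> = 1")
  case True
  have "nat \<lfloor>real k + 1\<rfloor> = Suc k" by linarith
  then show ?thesis using assms True by (simp add: interp_def Let_def)
next
  case False
  then have "nat \<lfloor>real k + \<nu>\<rfloor> = k" using assms by linarith
  then show ?thesis using assms by (simp add: interp_def Let_def)
qed

lemma interp_grid: "0 < N \<Longrightarrow> interp N c (real k / real N) = c k"
  using interp_eval[of N 0 c k] by simp

lemma grid_cell:
  assumes "0 < N" "t \<in> {0..1}"
  obtains k \<nu> where "k < N" "0 \<le> \<nu>" "\<nu> \<le> 1" "t = (real k + \<nu>) / real N"
proof (cases "t = 1")
  case True
  \<comment> \<open>The end point 1 is put into the last cell, so that \<open>k < N\<close> always
    holds.\<close>
  show ?thesis by (rule that[of "N - 1" 1]) (use assms True in \<open>auto simp: of_nat_diff\<close>)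
next
  case False
  define k where "k = nat \<lfloor>real N * t\<rfloor>"
  have "0 \<le> real N * t" "real N * t < real N" using assms False by auto
  then have "real k \<le> real N * t" "real N * t < real k + 1" "k < N" unfolding k_def by linarith+
  then show ?thesis using assms by (intro that[of k "real N * t - real k"]) auto
qed

lemma interp_linear: "interp N (\<lambda>i. a *\<^sub>R c i + d i) t = a *\<^sub>R interp N c t + interp N d t"
  by (simp add: interp_def Let_def algebra_simps)

lemma interp_sum: "interp N (\<lambda>i. \<Sum>j\<in>J. c j i) t = (\<Sum>j\<in>J. interp N (c j) t)"
  by (simp add: interp_def Let_def scaleR_sum_right sum.distrib)

lemma interp_scaleR: "interp N (\<lambda>i. a *\<^sub>R c i) t = a *\<^sub>R interp N c t"
  using interp_linear[of N a c "\<lambda>_. 0" t] by (simp add: interp_def)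

lemma powr_add3_le:
  fixes a b c r :: real
  assumes "0 \<le> a" "0 \<le> b" "0 \<le> c" "0 \<le> r"
  shows "(a + b + c) powr r \<le> 3 powr r * (a powr r + b powr r + c powr r)"
proof -
  define m where "m = max a (max b c)"
  have "(a + b + c) powr r \<le> (3 * m) powr r"
    using assms by (intro powr_mono2) (auto simp: m_def)
  also have "\<dots> = 3 powr r * m powr r" by (rule powr_mult)
  also have "\<dots> \<le> 3 powr r * (a powr r + b powr r + c powr r)"
    by (intro mult_left_mono) (auto simp: m_def max_def)
  finally show ?thesis .
qed

text \<open>The increment is cut at the grid points next to \<open>s\<close> and \<open>t\<close>
  into three pieces, whence \<open>3 powr r\<close>. Inside a cell
  \<open>norm (a *\<^sub>R z) powr r \<le> a * norm z powr r\<close> for \<open>a\<close> between 0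
  and 1, which matches linear interpolation of the control.\<close>

lemma interp_increment:
  fixes c :: "nat \<Rightarrow> 'a::real_normed_vector" and F :: "nat \<Rightarrow> real"
  assumes N: "0 < N" and r: "1 \<le> r"
    and F: "\<And>i j. i \<le> j \<Longrightarrow> j \<le> N \<Longrightarrow> norm (c j - c i) powr r \<le> F j - F i"
    and st: "0 \<le> s" "s \<le> t" "t \<le> 1"
  shows "norm (interp N c t - interp N c s) powr r \<le> 3 powr r * (interp N F t - interp N F s)"
proof -
  obtain k \<nu> where k: "k < N" "0 \<le> \<nu>" "\<nu> \<le> 1" "s = (real k + \<nu>) / real N"
    using grid_cell[OF N, of s] st by auto
  obtain l \<mu> where l: "l < N" "0 \<le> \<mu>" "\<mu> \<le> 1" "t = (real l + \<mu>) / real N"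
    using grid_cell[OF N, of t] st by auto
  note ev = interp_eval[OF N k(2,3), of _ k, folded k(4)] interp_eval[OF N l(2,3), of _ l, folded l(4)]
  have kl: "real k + \<nu> \<le> real l + \<mu>" using st(2) N k(4) l(4) by (simp add: divide_le_cancel)
  have three: "(1::real) \<le> 3 powr r" using r by (intro ge_one_powr_ge_zero) auto
  have sub: "norm (a *\<^sub>R z) powr r \<le> a * norm z powr r" if "0 \<le> a" "a \<le> 1" for a and z :: 'a
  proof -
    have "a powr r \<le> a powr 1" using that r by (intro powr_mono') auto
    then show ?thesis using that by (simp add: powr_mult mult_right_mono)
  qed
  consider "k = l" "\<nu> \<le> \<mu>" | "k < l" | "s = t"
  proof -
    assume *: "k = l \<Longrightarrow> \<nu> \<le> \<mu> \<Longrightarrow> thesis" "k < l \<Longrightarrow> thesis" "s = t \<Longrightarrow> thesis"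
    show thesis
    proof (cases k l rule: linorder_cases)
      \<comment> \<open>For \<open>s \<le> t\<close> the cell of \<open>s\<close> can come later
        than that of \<open>t\<close> only when both points are the common end of two adjacent
        cells.\<close>
      case greater
      then have "real l + 1 \<le> real k" by linarith
      then have "real k + \<nu> = real l + \<mu>" using kl k l by linarith
      then show ?thesis using *(3) k(4) l(4) by simp
    qed (use * kl in auto)
  qed
  then show ?thesis
  proof cases
    case 1
    have "interp N c t - interp N c s = (\<mu> - \<nu>) *\<^sub>R (c (Suc k) - c k)"
      unfolding ev using 1 by (simp add: algebra_simps)
    then have "norm (interp N c t - interp N c s) powr r \<le> (\<mu> - \<nu>) * norm (c (Suc k) - c k) powr r"
      using sub[of "\<mu> - \<nu>" "c (Suc k) - c k"] 1 k l by simp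
    also have "\<dots> \<le> (\<mu> - \<nu>) * (F (Suc k) - F k)"
      using F[of k "Suc k"] k 1 by (intro mult_left_mono) auto
    also have "\<dots> = interp N F t - interp N F s"
      unfolding ev using 1 by (simp add: algebra_simps)
    finally have *: "norm (interp N c t - interp N c s) powr r \<le> interp N F t - interp N F s" .
    then have "0 \<le> interp N F t - interp N F s" using powr_ge_zero order_trans by blast
    from mult_right_mono[OF three this]
    have "interp N F t - interp N F s \<le> 3 powr r * (interp N F t - interp N F s)"
      by (simp only: mult_1)
    with * show ?thesis by (rule order_trans)
  next
    case 2
    have "interp N c t - interp N c s = (1 - \<nu>) *\<^sub>R (c (Suc k) - c k) + (c l - c (Suc k)) + \<mu> *\<^sub>R (c (Suc l) - c l)"
      unfolding ev by (simp add: algebra_simps)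
    then have "norm (interp N c t - interp N c s) \<le> norm ((1 - \<nu>) *\<^sub>R (c (Suc k) - c k)) + norm (c l - c (Suc k))
        + norm (\<mu> *\<^sub>R (c (Suc l) - c l))"
      by (simp only:) (intro norm_triangle_le add_right_mono norm_triangle_ineq)
    then have "norm (interp N c t - interp N c s) powr r \<le> (norm ((1 - \<nu>) *\<^sub>R (c (Suc k) - c k)) + norm (c l - c (Suc k))
        + norm (\<mu> *\<^sub>R (c (Suc l) - c l))) powr r"
      using r by (intro powr_mono2) auto
    also have "\<dots> \<le> 3 powr r * (norm ((1 - \<nu>) *\<^sub>R (c (Suc k) - c k)) powr r + norm (c l - c (Suc k)) powr r
        + norm (\<mu> *\<^sub>R (c (Suc l) - c l)) powr r)"
      using r by (intro powr_add3_le) auto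
    also have "\<dots> \<le> 3 powr r * ((1 - \<nu>) * (F (Suc k) - F k) + (F l - F (Suc k)) + \<mu> * (F (Suc l) - F l))"
      using F[of k "Suc k"] F[of l "Suc l"] F[of "Suc k" l] 2 k l
      by (intro mult_left_mono add_mono order_trans[OF sub]) auto
    also have "(1 - \<nu>) * (F (Suc k) - F k) + (F l - F (Suc k)) + \<mu> * (F (Suc l) - F l) = interp N F t - interp N F s"
      unfolding ev by (simp add: algebra_simps)
    finally show ?thesis .
  next
    case 3
    then show ?thesis by simp
  qed
qed

text \<open>The increment bound with exponent 1 and a linear control shows that the interpolant is
  Lipschitz.\<close>

lemma interp_continuous:
  fixes c :: "nat \<Rightarrow> 'a::real_normed_vector"
  assumes N: "0 < N"
  shows "continuous_on {0..1} (interp N c)"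
proof -
  define S where "S = (\<Sum>i<N. norm (c (Suc i) - c i))"
  have S: "0 \<le> S" by (simp add: S_def sum_nonneg)
  have inc: "norm (c j - c i) \<le> S * (real j - real i)" if "i \<le> j" "j \<le> N" for i j
    using that
  proof (induction j rule: dec_induct)
    case base
    then show ?case by simp
  next
    case (step j)
    have "norm (c (Suc j) - c j) \<le> S"
      unfolding S_def using step.prems by (intro member_le_sum) auto
    moreover have "norm (c j - c i) \<le> S * (real j - real i)" using step by simp
    moreover have "norm (c (Suc j) - c i) \<le> norm (c (Suc j) - c j) + norm (c j - c i)" by norm
    ultimately show ?case by (simp add: algebra_simps)
  qed
  have "norm (interp N c t - interp N c s) powr 1 \<le> 3 powr 1 * (interp N (\<lambda>i. S * real i) t - interp N (\<lambda>i. S * real i) s)"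
    if "0 \<le> s" "s \<le> t" "t \<le> 1" for s t
    using inc by (intro interp_increment[OF N order_refl _ that]) (auto simp: right_diff_distrib)
  moreover have "interp N (\<lambda>i. S * real i) t = S * (real N * t)" for t
    by (simp add: interp_def Let_def algebra_simps)
  ultimately have L: "norm (interp N c t - interp N c s) \<le> 3 * S * real N * (t - s)"
    if "0 \<le> s" "s \<le> t" "t \<le> 1" for s t
    using that by (fastforce simp: algebra_simps)
  have "(3 * S * real N)-lipschitz_on {0..1} (interp N c)"
  proof (rule lipschitz_onI)
    fix s t :: real assume "s \<in> {0..1}" "t \<in> {0..1}"
    then show "dist (interp N c s) (interp N c t) \<le> 3 * S * real N * dist s t"
      using L[of s t] L[of t s] by (cases "s \<le> t") (auto simp: dist_norm norm_minus_commute)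
  qed (use S in simp)
  then show ?thesis by (rule lipschitz_on_continuous_on)
qed

lemma var_bounded_interp:
  fixes c :: "nat \<Rightarrow> 'a::real_normed_vector" and F :: "nat \<Rightarrow> real"
  assumes N: "0 < N" and r: "1 \<le> r"
    and F: "\<And>i j. i \<le> j \<Longrightarrow> j \<le> N \<Longrightarrow> norm (c j - c i) powr r \<le> F j - F i"
    and b: "F N - F 0 \<le> b powr r" "0 \<le> b" and c0: "c 0 = 0"
  shows "var_bounded r (interp N c) (3 * b)"
proof -
  define G where "G t = 3 powr r * interp N F t" for t
  have G: "controls r G (interp N c) 0 1"
    unfolding controls_def G_def right_diff_distrib[symmetric]
    by (intro allI impI interp_increment[OF N r F])
  have "interp N F 1 = F N" "interp N F 0 = F 0"
    using interp_grid[OF N, of F N] interp_grid[OF N, of F 0] N by auto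
  then have "G 1 - G 0 = 3 powr r * (F N - F 0)" by (simp add: G_def right_diff_distrib)
  also have "\<dots> \<le> 3 powr r * b powr r" using b by (intro mult_left_mono) auto
  also have "\<dots> = (3 * b) powr r" by (rule powr_mult[symmetric])
  finally have G01: "G 1 - G 0 \<le> (3 * b) powr r" .
  have c0': "interp N c 0 = 0" using interp_grid[OF N, of c 0] c0 by simp
  show ?thesis
  proof (rule var_boundedI[OF _ _ _ controlsD[OF G] G01])
    show "norm (interp N c t) \<le> 3 * b" if "t \<in> {0..1}" for t
      using controls_norm_le'[OF G, of 0 t "3 * b"] that G01 r b c0' by simp
  qed (use b interp_continuous[OF N] in auto)
qed

text \<open>No cancellation between nodes is used. In \<open>F\<close> every node is charged once as
  a right end and once as a left end, so that \<open>F j - F i\<close> contains the values at both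
  \<open>j\<close> and \<open>i\<close>. The constant is 3 from interpolation times 4 from
  \<open>four_powr\<close>.\<close>

lemma var_bounded_interp_sum:
  fixes c :: "nat \<Rightarrow> 'a::real_normed_vector"
  assumes N: "0 < N" and r: "1 \<le> r" and c0: "c 0 = 0"
    and b: "(\<Sum>i\<le>N. norm (c i) powr r) \<le> b powr r" "0 \<le> b"
  shows "var_bounded r (interp N c) (12 * b)"
proof -
  define F where "F j = 2 powr r * ((\<Sum>i\<le>j. norm (c i) powr r) + (\<Sum>i<j. norm (c i) powr r))" for j
  have "var_bounded r (interp N c) (3 * (4 * b))"
  proof (rule var_bounded_interp[where F = F, OF N r])
    fix i j assume ij: "i \<le> j" "j \<le> N"
    show "norm (c j - c i) powr r \<le> F j - F i"
    proof (cases "i = j")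
      case False
      then have ij: "i < j" using ij by simp
      have "norm (c j - c i) powr r \<le> (norm (c j) + norm (c i)) powr r"
        using r by (intro powr_mono2 norm_triangle_ineq4) auto
      also have "\<dots> \<le> 2 powr r * (norm (c j) powr r + norm (c i) powr r)"
        using r by (intro powr_add_le) auto
      also have "\<dots> \<le> F j - F i"
      proof -
        have "(\<Sum>k\<le>i. norm (c k) powr r) + norm (c j) powr r \<le> (\<Sum>k\<le>j. norm (c k) powr r)"
        proof -
          have "(\<Sum>k\<in>insert j {..i}. norm (c k) powr r) \<le> (\<Sum>k\<le>j. norm (c k) powr r)"
            using ij by (intro sum_mono2) auto
          then show ?thesis using ij by simp
        qed
        moreover have "(\<Sum>k<i. norm (c k) powr r) + norm (c i) powr r \<le> (\<Sum>k<j. norm (c k) powr r)"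
        proof -
          have "(\<Sum>k\<in>insert i {..<i}. norm (c k) powr r) \<le> (\<Sum>k<j. norm (c k) powr r)"
            using ij by (intro sum_mono2) auto
          then show ?thesis by simp
        qed
        ultimately show ?thesis
          unfolding F_def right_diff_distrib[symmetric] by (intro mult_left_mono) auto
      qed
      finally show ?thesis .
    qed simp
  next
    have "(\<Sum>i<N. norm (c i) powr r) \<le> (\<Sum>i\<le>N. norm (c i) powr r)" by (intro sum_mono2) auto
    then have "F N - F 0 \<le> 2 powr r * (2 * b powr r)"
      unfolding F_def right_diff_distrib[symmetric] using b(1) by (intro mult_left_mono) (auto simp: c0)
    also have "\<dots> \<le> (4 * b) powr r" using b r by (intro four_powr) auto
    finally show "F N - F 0 \<le> (4 * b) powr r" .
  qed (use b c0 in auto)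
  then show ?thesis by simp
qed

text \<open>Hoelder's inequality between the exponents \<open>r\<close> and 2, obtained from
  \<open>x powr r \<le> x\<^sup>2 + 1\<close> at the scale \<open>\<rho>\<close> of the root mean
  square. As \<open>c 0 = 0\<close>, the count of terms is \<open>N\<close> and not
  \<open>N + 1\<close>.\<close>

lemma sum_powr_le_of_sum_squares:
  fixes c :: "nat \<Rightarrow> real"
  assumes r: "1 \<le> r" "r \<le> 2" and N: "0 < N" and c: "\<And>i. 0 \<le> c i" "c 0 = 0"
    and \<sigma>: "(\<Sum>i\<le>N. (c i)\<^sup>2) \<le> \<sigma>\<^sup>2" "0 \<le> \<sigma>"
  shows "(\<Sum>i\<le>N. c i powr r) \<le> (2 * real N powr (1 / r - 1 / 2) * \<sigma>) powr r"
proof (cases "\<sigma> = 0")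
  case True
  then have "(\<Sum>i\<le>N. (c i)\<^sup>2) = 0" using \<sigma> by (intro antisym sum_nonneg) auto
  then have "c i = 0" if "i \<le> N" for i using that by (simp add: sum_nonneg_eq_0_iff)
  then show ?thesis by simp
next
  case False
  then have \<sigma>0: "0 < \<sigma>" using \<sigma> by simp
  define \<rho> where "\<rho> = \<sigma> / sqrt (real N)"
  have \<rho>: "0 < \<rho>" "\<rho>\<^sup>2 = \<sigma>\<^sup>2 / real N" using \<sigma>0 N by (auto simp: \<rho>_def power_divide)
  have pt: "c i powr r \<le> \<rho> powr r * ((c i)\<^sup>2 / \<rho>\<^sup>2 + (if i = 0 then 0 else 1))" for i
  proof (cases "i = 0")
    case True
    then show ?thesis using c by simp
  next
    case i: False
    define x where "x = c i / \<rho>"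
    have x: "0 \<le> x" "c i = \<rho> * x" using c(1)[of i] \<rho> by (auto simp: x_def)
    have "x powr r \<le> x\<^sup>2 + 1"
    proof (cases "x \<le> 1")
      case True
      then have "x powr r \<le> 1" using x r powr_mono2[of r x 1] by simp
      then show ?thesis using zero_le_power2[of x] by linarith
    next
      case False
      then have "x powr r \<le> x powr 2" using r by (intro powr_mono) auto
      then show ?thesis using False by simp
    qed
    then have "\<rho> powr r * x powr r \<le> \<rho> powr r * (x\<^sup>2 + 1)" by (intro mult_left_mono) auto
    moreover have "(c i)\<^sup>2 / \<rho>\<^sup>2 = x\<^sup>2" using \<rho>(1) by (simp add: x_def power_divide)
    ultimately show ?thesis using i x(2) by (simp add: powr_mult)
  qed
  have "(\<Sum>i\<le>N. c i powr r) \<le> (\<Sum>i\<le>N. \<rho> powr r * ((c i)\<^sup>2 / \<rho>\<^sup>2 + (if i = 0 then 0 else 1)))"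
    by (intro sum_mono pt)
  also have "\<dots> = \<rho> powr r * ((\<Sum>i\<le>N. (c i)\<^sup>2) / \<rho>\<^sup>2 + real N)"
  proof -
    have "(\<Sum>i\<le>N. (if i = 0 then 0 else 1 :: real)) = real N"
      by (simp add: sum.atMost_shift)
    then show ?thesis by (simp add: sum.distrib flip: sum_distrib_left sum_divide_distrib)
  qed
  also have "\<dots> \<le> \<rho> powr r * (\<sigma>\<^sup>2 / \<rho>\<^sup>2 + real N)"
    using \<sigma> by (intro mult_left_mono add_right_mono divide_right_mono) auto
  also have "\<dots> = \<rho> powr r * (2 * real N)" using \<sigma>0 N by (simp add: \<rho>(2))
  also have "\<dots> \<le> 2 powr r * (\<rho> powr r * real N)"
  proof -
    have "(2::real) \<le> 2 powr r" using r powr_mono[of 1 r 2] by simp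
    then have "2 * (\<rho> powr r * real N) \<le> 2 powr r * (\<rho> powr r * real N)" by (intro mult_right_mono) auto
    then show ?thesis by (simp add: mult_ac)
  qed
  also have "\<dots> = (2 * real N powr (1 / r - 1 / 2) * \<sigma>) powr r"
  proof -
    have "real N powr ((1 / r - 1 / 2) * r) = real N powr (1 - r / 2)"
      using r by (simp add: left_diff_distrib)
    also have "\<dots> = real N / sqrt (real N) powr r"
      using N by (simp add: powr_diff powr_half_sqrt[symmetric] powr_powr)
    finally show ?thesis
      using N \<sigma>0 by (simp add: \<rho>_def powr_mult powr_divide powr_powr)
  qed
  finally show ?thesis .
qed

text \<open>A function linear on the coarse cells is linear on their halves. This is what makes the
  levels of the Faber-Schauder expansion telescope.\<close>

lemma interp_refine:
  assumes N: "0 < N" and t: "t \<in> {0..1}"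
  shows "interp (2 * N) (\<lambda>i. interp N c (real i / real (2 * N))) t = interp N c t"
proof -
  have N2: "0 < 2 * N" using N by simp
  obtain k \<nu> where k: "k < 2 * N" "0 \<le> \<nu>" "\<nu> \<le> 1" "t = (real k + \<nu>) / real (2 * N)"
    using grid_cell[OF N2 t] by metis
  have half: "interp N c (real (2 * m) / real (2 * N)) = c m"
    "interp N c (real (2 * m + 1) / real (2 * N)) = (1/2) *\<^sub>R c m + (1/2) *\<^sub>R c (Suc m)" for m
  proof -
    show "interp N c (real (2 * m) / real (2 * N)) = c m" using interp_grid[OF N, of c m] by simp
    have "real (2 * m + 1) / real (2 * N) = (real m + 1/2) / real N" using N by (simp add: field_simps)
    then show "interp N c (real (2 * m + 1) / real (2 * N)) = (1/2) *\<^sub>R c m + (1/2) *\<^sub>R c (Suc m)"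
      using interp_eval[OF N, of "1/2" c m] by simp
  qed
  have lhs: "interp (2 * N) (\<lambda>i. interp N c (real i / real (2 * N))) t
    = (1 - \<nu>) *\<^sub>R interp N c (real k / real (2 * N)) + \<nu> *\<^sub>R interp N c (real (Suc k) / real (2 * N))"
    unfolding k(4) by (rule interp_eval[OF N2 k(2,3)])
  show ?thesis
  proof (cases "even k")
    case True
    then obtain m where m: "k = 2 * m" by blast
    have "t = (real m + \<nu> / 2) / real N" using N k(4) m by (simp add: field_simps)
    then have *: "interp N c t = (1 - \<nu> / 2) *\<^sub>R c m + (\<nu> / 2) *\<^sub>R c (Suc m)"
      using interp_eval[OF N, of "\<nu> / 2" c m] k by simp
    have m2: "Suc (2 * m) = 2 * m + 1" by simp
    have "(1 - \<nu>) *\<^sub>R c m + \<nu> *\<^sub>R ((1 / 2) *\<^sub>R c m + (1 / 2) *\<^sub>R c (Suc m))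
      = ((1 - \<nu>) + \<nu> * (1 / 2)) *\<^sub>R c m + (\<nu> * (1 / 2)) *\<^sub>R c (Suc m)"
      by (simp only: scaleR_add_right scaleR_add_left scaleR_scaleR add.assoc)
    also have "(1 - \<nu>) + \<nu> * (1 / 2) = 1 - \<nu> / 2" by (simp add: field_simps)
    also have "\<nu> * (1 / 2) = \<nu> / 2" by simp
    finally show ?thesis unfolding lhs m m2 half * .
  next
    case False
    then obtain m where m: "k = 2 * m + 1" using oddE by blast
    have "t = (real m + (1 + \<nu>) / 2) / real N" using N k(4) m by (simp add: field_simps)
    then have *: "interp N c t = (1 - (1 + \<nu>) / 2) *\<^sub>R c m + ((1 + \<nu>) / 2) *\<^sub>R c (Suc m)"
      using interp_eval[OF N, of "(1 + \<nu>) / 2" c m] k by simp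
    have m2: "Suc (2 * m + 1) = 2 * Suc m" by simp
    have "(1 - \<nu>) *\<^sub>R ((1 / 2) *\<^sub>R c m + (1 / 2) *\<^sub>R c (Suc m)) + \<nu> *\<^sub>R c (Suc m)
      = ((1 - \<nu>) * (1 / 2)) *\<^sub>R c m + ((1 - \<nu>) * (1 / 2) + \<nu>) *\<^sub>R c (Suc m)"
      by (simp only: scaleR_add_right scaleR_add_left scaleR_scaleR add.assoc)
    also have "(1 - \<nu>) * (1 / 2) = 1 - (1 + \<nu>) / 2" by (simp add: field_simps)
    also have "(1 - (1 + \<nu>) / 2) + \<nu> = (1 + \<nu>) / 2" by (simp add: field_simps)
    finally show ?thesis unfolding lhs m m2 half * .
  qed
qed

section \<open>Bessel inequalities on the Cameron--Martin space\<close>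

text \<open>The interface between the Cameron-Martin space and the estimates; \<open>energy\<close>
  is its quantitative input. \<open>path\<close> is kept apart from the elements because these are
  pairs, while the Young integrals see one stacked path.\<close>

locale energy_space =
  fixes V :: "'v::real_vector set" and ip :: "'v \<Rightarrow> 'v \<Rightarrow> real" and path :: "'v \<Rightarrow> real \<Rightarrow> real^'d" and H :: real
  assumes V: "subspace V"
    and ip_sym: "\<And>x y. x \<in> V \<Longrightarrow> y \<in> V \<Longrightarrow> ip x y = ip y x"
    and ip_lin: "\<And>a x y z. x \<in> V \<Longrightarrow> y \<in> V \<Longrightarrow> z \<in> V \<Longrightarrow> ip (a *\<^sub>R x + y) z = a * ip x z + ip y z"
    and ip_nonneg: "\<And>x. x \<in> V \<Longrightarrow> 0 \<le> ip x x"
    and H: "1/3 < H" "H < 1/2"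
    and path_lin: "\<And>a x y t. x \<in> V \<Longrightarrow> y \<in> V \<Longrightarrow> path (a *\<^sub>R x + y) t = a *\<^sub>R path x t + path y t"
    and path_0: "\<And>x. x \<in> V \<Longrightarrow> path x 0 = 0"
    and energy: "\<And>x d. x \<in> V \<Longrightarrow> d division_of {0..1} \<Longrightarrow>
      (\<Sum>K\<in>d. (norm (path x (Sup K) - path x (Inf K)))\<^sup>2 / (Sup K - Inf K) powr (2 * H)) \<le> 2 * ip x x"
begin

text \<open>The interval \<open>{s..t}\<close> is completed to a division of the unit interval, and
  the other terms of the energy, all nonnegative, are dropped.\<close>

lemma increment_square_le:
  assumes x: "x \<in> V" and st: "0 \<le> s" "s \<le> t" "t \<le> 1"
  shows "(norm (path x t - path x s))\<^sup>2 \<le> 2 * ip x x * (t - s) powr (2 * H)"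
proof (cases "s = t")
  case False
  then have st': "s < t" using st by simp
  obtain d where d: "d division_of {0..1}" "{s..t} \<in> d"
    using partial_division_extend_1[of s t 0 1] st by auto
  have "(norm (path x t - path x s))\<^sup>2 / (t - s) powr (2 * H)
    \<le> (\<Sum>K\<in>d. (norm (path x (Sup K) - path x (Inf K)))\<^sup>2 / (Sup K - Inf K) powr (2 * H))"
    using member_le_sum[OF d(2), of "\<lambda>K. (norm (path x (Sup K) - path x (Inf K)))\<^sup>2 / (Sup K - Inf K) powr (2 * H)"]
      division_of_finite[OF d(1)] st by simp
  also have "\<dots> \<le> 2 * ip x x" by (rule energy[OF x d(1)])
  finally show ?thesis using st' by (simp add: field_simps)
qed simp

lemma increment_le:
  assumes x: "x \<in> V" and st: "s \<in> {0..1}" "t \<in> {0..1}"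
  shows "norm (path x t - path x s) \<le> sqrt (2 * ip x x) * \<bar>t - s\<bar> powr H"
proof -
  have *: "norm (path x t - path x s) \<le> sqrt (2 * ip x x) * (t - s) powr H" if "0 \<le> s" "s \<le> t" "t \<le> 1" for s t
  proof (rule power2_le_imp_le)
    have "((t - s) powr H)\<^sup>2 = (t - s) powr (2 * H)"
      by (simp add: power2_eq_square flip: powr_add)
    then show "(norm (path x t - path x s))\<^sup>2 \<le> (sqrt (2 * ip x x) * (t - s) powr H)\<^sup>2"
      using increment_square_le[OF x that] ip_nonneg[OF x] by (simp add: power_mult_distrib)
  qed (use ip_nonneg[OF x] in simp)
  show ?thesis
    using *[of s t] *[of t s] st by (cases "s \<le> t") (auto simp: norm_minus_commute)
qed

lemma path_continuous:
  assumes x: "x \<in> V"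
  shows "continuous_on {0..1} (path x)"
  unfolding continuous_on_def
proof
  fix s :: real assume s: "s \<in> {0..1}"
  have "((\<lambda>t. sqrt (2 * ip x x) * \<bar>t - s\<bar> powr H) \<longlongrightarrow> sqrt (2 * ip x x) * \<bar>s - s\<bar> powr H) (at s within {0..1})"
    using H by (intro tendsto_intros tendsto_powr') auto
  then have "((\<lambda>t. sqrt (2 * ip x x) * \<bar>t - s\<bar> powr H) \<longlongrightarrow> 0) (at s within {0..1})" by simp
  moreover have "\<forall>\<^sub>F t in at s within {0..1}. norm (path x t - path x s) \<le> sqrt (2 * ip x x) * \<bar>t - s\<bar> powr H"
    using increment_le[OF x s] by (auto simp: eventually_at_filter)
  ultimately have "((\<lambda>t. path x t - path x s) \<longlongrightarrow> 0) (at s within {0..1})"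
    by (rule Lim_null_comparison[rotated])
  then show "(path x \<longlongrightarrow> path x s) (at s within {0..1})" by (rule Lim_null[THEN iffD2])
qed

text \<open>For a cell of length \<delta> and an increment \<open>u\<close> relative to
  \<open>sqrt (ip x x)\<close>, the inequality \<open>z powr s \<le> 1 + z\<^sup>2\<close> at
  \<open>z = u / \<delta> powr (1 / s)\<close> gives \<open>u powr s \<le> \<delta> + u\<^sup>2 *
  \<delta> powr (1 - 2 / s)\<close>. The hypothesis \<open>2 / s - 1 \<le> 2 * H\<close> turns the
  last term into the energy. Lengths sum to 1 and relative energies to at most 2, whence the
  constant 3.\<close>

lemma path_var_bounded:
  assumes x: "x \<in> V" and s: "1 \<le> s" "s \<le> 2" "2 / s - 1 \<le> 2 * H"
  shows "var_bounded s (path x) (3 * sqrt (ip x x))"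
proof (cases "ip x x = 0")
  case True
  then have "path x t = 0" if "t \<in> {0..1}" for t
    using increment_le[OF x _ that, of 0] path_0[OF x] by simp
  then show ?thesis
    using var_bounded_cong[OF var_bounded_const[OF s(1), of 0], of "path x"] True by simp
next
  case False
  define v where "v = sqrt (ip x x)"
  have v: "0 < v" "v\<^sup>2 = ip x x" using False ip_nonneg[OF x] by (auto simp: v_def)
  have sums: "y \<le> 3 * v powr s" if yv: "y \<in> var_sums s (path x)" for y
  proof -
    obtain d where d: "d division_of {0..1}"
      and y: "y = (\<Sum>K\<in>d. norm (path x (Sup K) - path x (Inf K)) powr s)"
      using yv unfolding var_sums_def by blast
    have "norm (path x (Sup K) - path x (Inf K)) powr s
      \<le> v powr s * ((Sup K - Inf K) + (norm (path x (Sup K) - path x (Inf K)))\<^sup>2 / (Sup K - Inf K) powr (2 * H) / v\<^sup>2)"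
      if K: "K \<in> d" for K
    proof (cases "Sup K = Inf K")
      case False
      define \<delta> where "\<delta> = Sup K - Inf K"
      define u where "u = norm (path x (Sup K) - path x (Inf K)) / v"
      have \<delta>: "0 < \<delta>" "\<delta> \<le> 1" using division_of_interval_elem[OF d K] False by (auto simp: \<delta>_def)
      have u: "0 \<le> u" using v by (simp add: u_def)
      define z where "z = u / \<delta> powr (1 / s)"
      have z: "0 \<le> z" using u by (simp add: z_def)
      have "z powr s \<le> 1 + z\<^sup>2"
      proof (cases "z \<le> 1")
        case True
        then have "z powr s \<le> 1" using z s powr_mono2[of s z 1] by simp
        then show ?thesis using zero_le_power2[of z] by linarith
      next
        case False
        then have "z powr s \<le> z powr 2" using s by (intro powr_mono) auto
        then show ?thesis using False by simp
      qed
      then have "\<delta> * z powr s \<le> \<delta> * (1 + z\<^sup>2)" using \<delta> by simp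
      moreover have "\<delta> * z powr s = u powr s"
        using \<delta> s by (simp add: z_def powr_divide powr_powr)
      moreover have "\<delta> * z\<^sup>2 = u\<^sup>2 * \<delta> powr (1 - 2 / s)"
      proof -
        have "(\<delta> powr (1 / s))\<^sup>2 = \<delta> powr (2 / s)" by (simp add: power2_eq_square flip: powr_add)
        then show ?thesis using \<delta> by (simp add: z_def power_divide powr_diff)
      qed
      moreover have "\<delta> powr (1 - 2 / s) \<le> \<delta> powr (- (2 * H))"
        using \<delta> s by (intro powr_mono') auto
      then have "u\<^sup>2 * \<delta> powr (1 - 2 / s) \<le> u\<^sup>2 * \<delta> powr (- (2 * H))" by (intro mult_left_mono) auto
      ultimately have "u powr s \<le> \<delta> + u\<^sup>2 / \<delta> powr (2 * H)"
        by (simp add: powr_minus divide_inverse distrib_left)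
      then have "v powr s * u powr s \<le> v powr s * (\<delta> + u\<^sup>2 / \<delta> powr (2 * H))" by (intro mult_left_mono) auto
      moreover have "v powr s * u powr s = norm (path x (Sup K) - path x (Inf K)) powr s"
        using v by (simp add: u_def powr_divide)
      ultimately show ?thesis by (simp add: u_def \<delta>_def power_divide mult.commute)
    qed simp
    then have "y \<le> (\<Sum>K\<in>d. v powr s * ((Sup K - Inf K) + (norm (path x (Sup K) - path x (Inf K)))\<^sup>2 / (Sup K - Inf K) powr (2 * H) / v\<^sup>2))"
      unfolding y by (rule sum_mono)
    also have "\<dots> = v powr s * ((\<Sum>K\<in>d. Sup K - Inf K)
        + (\<Sum>K\<in>d. (norm (path x (Sup K) - path x (Inf K)))\<^sup>2 / (Sup K - Inf K) powr (2 * H)) / v\<^sup>2)"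
      by (simp only: sum_distrib_left[symmetric] sum.distrib sum_divide_distrib[symmetric])
    also have "\<dots> \<le> v powr s * (1 + 2)"
    proof (intro mult_left_mono add_mono)
      show "(\<Sum>K\<in>d. Sup K - Inf K) \<le> 1" using sum_telescope_division[OF d, of "\<lambda>t. t"] by simp
      show "(\<Sum>K\<in>d. (norm (path x (Sup K) - path x (Inf K)))\<^sup>2 / (Sup K - Inf K) powr (2 * H)) / v\<^sup>2 \<le> 2"
        using energy[OF x d] v(1) unfolding v(2)[symmetric] by (subst pos_divide_le_eq) simp_all
    qed auto
    finally show ?thesis by simp
  qed
  then have fv: "finite_var s (path x)" unfolding finite_var_def by (rule bdd_aboveI)
  have ne: "var_sums s (path x) \<noteq> {}"
    using division_of_self_interval[of 0 1] unfolding var_sums_def by auto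
  obtain F where F: "controls s F (path x) 0 1" "F 1 - F 0 \<le> Sup (var_sums s (path x))"
    using controls_finite_var[OF fv] .
  have "Sup (var_sums s (path x)) \<le> 3 * v powr s" by (rule cSup_least[OF ne sums])
  also have "\<dots> \<le> 3 powr s * v powr s"
    using powr_mono[of 1 s 3] s by (intro mult_right_mono) auto
  also have "\<dots> = (3 * v) powr s" by (rule powr_mult[symmetric])
  finally have F01: "F 1 - F 0 \<le> (3 * v) powr s" using F(2) by simp
  show ?thesis
    unfolding v_def[symmetric]
  proof (rule var_boundedI[OF path_continuous[OF x] _ _ controlsD[OF F(1)] F01])
    show "norm (path x t) \<le> 3 * v" if "t \<in> {0..1}" for t
      using controls_norm_le'[OF F(1), of 0 t "3 * v"] that F01 v s path_0[OF x] by simp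
  qed (use v in auto)
qed

lemma grid_division:
  assumes "0 < N"
  shows "(\<lambda>i. {real i / real N..real (Suc i) / real N}) ` {..<N} division_of {0..1::real}"
proof (rule division_ofI)
  let ?I = "\<lambda>i. {real i / real N..real (Suc i) / real N}"
  show "finite (?I ` {..<N})" by simp
  fix K assume "K \<in> ?I ` {..<N}"
  then obtain i where i: "i < N" "K = ?I i" by auto
  have "real (Suc i) \<le> real N" using i(1) by linarith
  then have "real (Suc i) / real N \<le> 1" using assms by (simp add: divide_le_eq)
  moreover have "0 \<le> real i / real N" "real i / real N \<le> real (Suc i) / real N"
    by (auto intro: divide_right_mono)
  ultimately show "K \<subseteq> {0..1}" "K \<noteq> {}" unfolding i by auto
  show "\<exists>a b. K = cbox a b" unfolding i by (metis cbox_interval)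
next
  let ?I = "\<lambda>i. {real i / real N..real (Suc i) / real N}"
  fix K1 K2 assume "K1 \<in> ?I ` {..<N}" "K2 \<in> ?I ` {..<N}" "K1 \<noteq> K2"
  then obtain i j where ij: "K1 = ?I i" "K2 = ?I j" "i \<noteq> j" by auto
  have "interior (?I i) \<inter> interior (?I j) = {}" if "i < j" for i j
  proof -
    have "real (Suc i) / real N \<le> real j / real N" using that by (intro divide_right_mono) auto
    then show ?thesis by auto
  qed
  then show "interior K1 \<inter> interior K2 = {}"
    unfolding ij using ij(3) by (metis inf_commute linorder_neqE_nat)
next
  let ?I = "\<lambda>i. {real i / real N..real (Suc i) / real N}"
  show "\<Union> (?I ` {..<N}) = {0..1}"
  proof (intro equalityI subsetI)
    fix t :: real assume "t \<in> {0..1}"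
    then obtain k \<nu> where k: "k < N" "0 \<le> \<nu>" "\<nu> \<le> 1" "t = (real k + \<nu>) / real N" using grid_cell[OF assms] by metis
    then have "t \<in> ?I k" using assms by (auto intro: divide_right_mono)
    then show "t \<in> \<Union> (?I ` {..<N})" using k(1) by blast
  next
    fix t assume "t \<in> \<Union> (?I ` {..<N})"
    then obtain i where i: "i < N" "t \<in> ?I i" by blast
    have 1: "real (Suc i) / real N \<le> 1" "0 \<le> real i / real N" using i(1) by (simp_all add: divide_le_eq)
    have 2: "real i / real N \<le> t" "t \<le> real (Suc i) / real N" using i(2) by auto
    show "t \<in> {0..1}" using order_trans[OF 1(2) 2(1)] order_trans[OF 2(2) 1(1)] by simp
  qed
qed

lemma grid_increments_le:
  assumes x: "x \<in> V" and N: "0 < N"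
  shows "(\<Sum>i<N. (norm (path x (real (Suc i) / real N) - path x (real i / real N)))\<^sup>2)
    \<le> 2 * ip x x * real N powr (- (2 * H))"
proof -
  let ?I = "\<lambda>i. {real i / real N..real (Suc i) / real N}"
  have SI: "Sup (?I i) = real (Suc i) / real N" "Inf (?I i) = real i / real N" for i
    by (auto intro!: cSup_atLeastAtMost cInf_atLeastAtMost divide_right_mono simp del: of_nat_Suc)
  have inj: "inj_on ?I {..<N}"
  proof (rule inj_onI)
    fix i j assume "?I i = ?I j"
    then have "Inf (?I i) = Inf (?I j)" by (rule arg_cong)
    then show "i = j" unfolding SI using N by simp
  qed
  have len: "real (Suc i) / real N - real i / real N = 1 / real N" for i
    using N by (simp add: field_simps)
  have "(\<Sum>i<N. (norm (path x (real (Suc i) / real N) - path x (real i / real N)))\<^sup>2 / (1 / real N) powr (2 * H))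
    \<le> 2 * ip x x"
    using energy[OF x grid_division[OF N]] unfolding sum.reindex[OF inj] o_def SI len .
  then have "(\<Sum>i<N. (norm (path x (real (Suc i) / real N) - path x (real i / real N)))\<^sup>2) / (1 / real N) powr (2 * H)
    \<le> 2 * ip x x"
    unfolding sum_divide_distrib .
  then show ?thesis
    using N by (simp add: powr_divide powr_minus field_simps)
qed

section \<open>Bessel inequalities for finite orthonormal families\<close>

lemma linear_on_sum:
  assumes g: "\<And>a x y. x \<in> V \<Longrightarrow> y \<in> V \<Longrightarrow> g (a *\<^sub>R x + y) = a * g x + (g y :: real)"
    and A: "finite A" "A \<subseteq> V"
  shows "(\<Sum>e\<in>A. \<beta> e *\<^sub>R e) \<in> V \<and> g (\<Sum>e\<in>A. \<beta> e *\<^sub>R e) = (\<Sum>e\<in>A. \<beta> e * g e)"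
  using A
proof (induction A rule: finite_induct)
  case empty
  have "0 \<in> V" using V by (rule subspace_0)
  then show ?case using g[of 0 0 1] by simp
next
  case (insert e A)
  then show ?case using g[of e "\<Sum>e\<in>A. \<beta> e *\<^sub>R e" "\<beta> e"] V by (auto intro: subspace_add subspace_scale)
qed

definition orthonormal where
  "orthonormal A \<longleftrightarrow> A \<subseteq> V \<and> (\<forall>e\<in>A. \<forall>e'\<in>A. ip e e' = (if e = e' then 1 else 0))"

text \<open>Duality: the map from \<open>x\<close> to the family \<open>l i x\<close> has norm at
  most \<open>sqrt L\<close> into a Euclidean space, hence so has its adjoint. Concretely,
  \<open>y\<close> combines the \<open>e\<close> with coefficients \<open>\<beta> e\<close>; its
  squared norm and the value \<open>\<Sum>i\<in>I. b i * l i y\<close> are both \<open>S\<close>,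
  and Cauchy-Schwarz bounds \<open>S\<^sup>2\<close> by \<open>L * S\<close> times the squared
  length of \<open>b\<close>.\<close>

lemma bessel:
  assumes A: "finite A" "orthonormal A"
    and l: "\<And>i a x y. i \<in> I \<Longrightarrow> x \<in> V \<Longrightarrow> y \<in> V \<Longrightarrow> l i (a *\<^sub>R x + y) = a * l i x + (l i y :: real)"
    and L: "\<And>x. x \<in> V \<Longrightarrow> (\<Sum>i\<in>I. (l i x)\<^sup>2) \<le> L * ip x x" "0 \<le> L"
  shows "(\<Sum>e\<in>A. (\<Sum>i\<in>I. b i * l i e)\<^sup>2) \<le> L * (\<Sum>i\<in>I. (b i)\<^sup>2)"
proof -
  have AV: "A \<subseteq> V" using A by (simp add: orthonormal_def)
  define \<beta> where "\<beta> e = (\<Sum>i\<in>I. b i * l i e)" for e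
  define y where "y = (\<Sum>e\<in>A. \<beta> e *\<^sub>R e)"
  define S where "S = (\<Sum>e\<in>A. (\<beta> e)\<^sup>2)"
  have S: "0 \<le> S" by (simp add: S_def sum_nonneg)
  have yV: "y \<in> V" unfolding y_def using linear_on_sum[of "\<lambda>x. ip x 0" A] ip_lin A AV subspace_0[OF V] by blast
  have ipy: "ip y z = (\<Sum>e\<in>A. \<beta> e * ip e z)" if "z \<in> V" for z
    unfolding y_def using linear_on_sum[of "\<lambda>x. ip x z" A \<beta>] ip_lin that A(1) AV by blast
  have "ip y y = (\<Sum>e\<in>A. \<beta> e * ip e y)" by (rule ipy[OF yV])
  also have "\<dots> = (\<Sum>e\<in>A. \<beta> e * \<beta> e)"
  proof (intro sum.cong refl)
    fix e assume e: "e \<in> A"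
    have "ip e y = ip y e" using e AV yV by (intro ip_sym) auto
    also have "\<dots> = (\<Sum>e'\<in>A. \<beta> e' * ip e' e)" using e AV by (intro ipy) auto
    also have "\<dots> = (\<Sum>e'\<in>A. if e' = e then \<beta> e else 0)"
      using A(2) e by (intro sum.cong refl) (auto simp: orthonormal_def)
    also have "\<dots> = \<beta> e" using A(1) e by simp
    finally show "\<beta> e * ip e y = \<beta> e * \<beta> e" by simp
  qed
  finally have ipS: "ip y y = S" by (simp add: S_def power2_eq_square)
  have "S = (\<Sum>e\<in>A. \<beta> e * (\<Sum>i\<in>I. b i * l i e))" by (simp add: S_def power2_eq_square \<beta>_def)
  also have "\<dots> = (\<Sum>i\<in>I. b i * (\<Sum>e\<in>A. \<beta> e * l i e))"
    unfolding sum_distrib_left by (subst sum.swap) (simp add: mult_ac)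
  also have "\<dots> = (\<Sum>i\<in>I. b i * l i y)"
  proof (intro sum.cong refl)
    fix i assume i: "i \<in> I"
    have "l i y = (\<Sum>e\<in>A. \<beta> e * l i e)"
      unfolding y_def using linear_on_sum[of "l i" A \<beta>, OF l[OF i] A(1) AV] by blast
    then show "b i * (\<Sum>e\<in>A. \<beta> e * l i e) = b i * l i y" by simp
  qed
  finally have "S\<^sup>2 = (\<Sum>i\<in>I. b i * l i y)\<^sup>2" by simp
  also have "\<dots> \<le> (\<Sum>i\<in>I. (b i)\<^sup>2) * (\<Sum>i\<in>I. (l i y)\<^sup>2)" by (rule Cauchy_Schwarz_ineq_sum)
  also have "\<dots> \<le> (\<Sum>i\<in>I. (b i)\<^sup>2) * (L * S)"
    using L(1)[OF yV] ipS by (intro mult_left_mono) (auto simp: sum_nonneg)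
  finally have SS: "S * S \<le> L * (\<Sum>i\<in>I. (b i)\<^sup>2) * S" by (simp add: power2_eq_square mult_ac)
  have "S \<le> L * (\<Sum>i\<in>I. (b i)\<^sup>2)"
  proof (cases "S = 0")
    case True
    then show ?thesis using L(2) by (simp add: sum_nonneg)
  next
    case False
    then have "0 < S" using S by simp
    then show ?thesis using SS by simp
  qed
  then show ?thesis by (simp add: S_def \<beta>_def)
qed

text \<open>The previous inequality is applied once in each variable: for fixed \<open>e'\<close>
  with the coefficients already summed over \<open>j\<close>, then for fixed
  \<open>i\<close>.\<close>

lemma bessel_bilinear:
  assumes A: "finite A" "orthonormal A"
    and l: "\<And>i a x y. i \<in> I \<Longrightarrow> x \<in> V \<Longrightarrow> y \<in> V \<Longrightarrow> l i (a *\<^sub>R x + y) = a * l i x + (l i y :: real)"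
    and L: "\<And>x. x \<in> V \<Longrightarrow> (\<Sum>i\<in>I. (l i x)\<^sup>2) \<le> L * ip x x" "0 \<le> L"
    and l': "\<And>i a x y. i \<in> I' \<Longrightarrow> x \<in> V \<Longrightarrow> y \<in> V \<Longrightarrow> l' i (a *\<^sub>R x + y) = a * l' i x + (l' i y :: real)"
    and L': "\<And>x. x \<in> V \<Longrightarrow> (\<Sum>i\<in>I'. (l' i x)\<^sup>2) \<le> L' * ip x x" "0 \<le> L'"
  shows "(\<Sum>e\<in>A. \<Sum>e'\<in>A. (\<Sum>i\<in>I. \<Sum>j\<in>I'. b i j * l i e * l' j e')\<^sup>2) \<le> L * L' * (\<Sum>i\<in>I. \<Sum>j\<in>I'. (b i j)\<^sup>2)"
proof -
  have "(\<Sum>j\<in>I'. b i j * l i e * l' j e') = (\<Sum>j\<in>I'. b i j * l' j e') * l i e" for i e e'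
    unfolding sum_distrib_right by (intro sum.cong) (simp_all add: mult_ac)
  then have "(\<Sum>e\<in>A. \<Sum>e'\<in>A. (\<Sum>i\<in>I. \<Sum>j\<in>I'. b i j * l i e * l' j e')\<^sup>2)
    = (\<Sum>e'\<in>A. \<Sum>e\<in>A. (\<Sum>i\<in>I. (\<Sum>j\<in>I'. b i j * l' j e') * l i e)\<^sup>2)"
    by (simp only:) (rule sum.swap)
  also have "\<dots> \<le> (\<Sum>e'\<in>A. L * (\<Sum>i\<in>I. (\<Sum>j\<in>I'. b i j * l' j e')\<^sup>2))"
    by (intro sum_mono bessel[OF A l L])
  also have "\<dots> = L * (\<Sum>i\<in>I. \<Sum>e'\<in>A. (\<Sum>j\<in>I'. b i j * l' j e')\<^sup>2)"
    unfolding sum_distrib_left[symmetric] by (subst sum.swap) simp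
  also have "\<dots> \<le> L * (\<Sum>i\<in>I. L' * (\<Sum>j\<in>I'. (b i j)\<^sup>2))"
    by (intro mult_left_mono sum_mono bessel[OF A l' L'] L(2))
  finally show ?thesis by (simp add: sum_distrib_left mult_ac)
qed

end

section \<open>Faber-Schauder details\<close>

lemma interp_cong:
  assumes "0 < N" "t \<in> {0..1}" "\<And>i. i \<le> N \<Longrightarrow> c i = d i"
  shows "interp N c t = interp N d t"
proof -
  obtain k \<nu> where k: "k < N" "0 \<le> \<nu>" "\<nu> \<le> 1" "t = (real k + \<nu>) / real N"
    using grid_cell[OF assms(1,2)] .
  show ?thesis unfolding k(4) interp_eval[OF assms(1) k(2,3)] using assms(3)[of k] assms(3)[of "Suc k"] k(1) by simp
qed

text \<open>Faber--Schauder coefficients of \<open>h\<close> at level \<open>L\<close>, at all grid points of that level; they vanish at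
  the points that belong to a coarser grid.\<close>

definition detail :: "nat \<Rightarrow> (real \<Rightarrow> 'a::real_vector) \<Rightarrow> nat \<Rightarrow> 'a" where
  "detail L h i = (if i \<in> {1..2 ^ L} then h (real i / 2 ^ L) -
     (case L of 0 \<Rightarrow> 0 | Suc m \<Rightarrow> interp (2 ^ m) (\<lambda>j. h (real j / 2 ^ m)) (real i / 2 ^ L)) else 0)"

text \<open>The detail of level \<open>Suc n\<close> is what the interpolant of level
  \<open>n\<close> misses at the finer nodes, and that interpolant is reproduced exactly on the
  finer grid.\<close>

lemma sum_details:
  assumes h0: "h 0 = 0" and t: "t \<in> {0..1}"
  shows "(\<Sum>L\<le>n. interp (2 ^ L) (detail L h) t) = interp (2 ^ n) (\<lambda>i. h (real i / 2 ^ n)) t"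
proof (induction n)
  case 0
  have "interp 1 (detail 0 h) t = interp 1 (\<lambda>i. h (real i)) t"
  proof (rule interp_cong[OF _ t])
    fix i :: nat assume "i \<le> 1"
    then show "detail 0 h i = h (real i)" using h0 by (cases i) (auto simp: detail_def)
  qed simp
  then show ?case by simp
next
  case (Suc n)
  define g where "g = interp (2 ^ n) (\<lambda>i. h (real i / 2 ^ n))"
  have g0: "g 0 = 0" using interp_grid[of "2 ^ n" "\<lambda>i. h (real i / 2 ^ n)" 0] h0 by (simp add: g_def)
  have "interp (2 ^ Suc n) (detail (Suc n) h) t
    = interp (2 ^ Suc n) (\<lambda>i. (-1) *\<^sub>R g (real i / real (2 * 2 ^ n)) + h (real i / 2 ^ Suc n)) t"
  proof (rule interp_cong[OF _ t])
    fix i :: nat assume "i \<le> 2 ^ Suc n"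
    then show "detail (Suc n) h i = (-1) *\<^sub>R g (real i / real (2 * 2 ^ n)) + h (real i / 2 ^ Suc n)"
      using h0 g0 by (cases "i = 0") (auto simp: detail_def g_def)
  qed simp
  also have "\<dots> = (-1) *\<^sub>R interp (2 ^ Suc n) (\<lambda>i. g (real i / real (2 * 2 ^ n))) t
      + interp (2 ^ Suc n) (\<lambda>i. h (real i / 2 ^ Suc n)) t"
    by (rule interp_linear)
  also have "interp (2 ^ Suc n) (\<lambda>i. g (real i / real (2 * 2 ^ n))) t = g t"
    using interp_refine[of "2 ^ n" t "\<lambda>i. h (real i / 2 ^ n)"] t by (simp add: g_def)
  finally show ?case using Suc by (simp add: g_def)
qed

lemma detail_linear:
  assumes "\<And>t. h t = a *\<^sub>R f t + g t"
  shows "detail L h i = a *\<^sub>R detail L f i + detail L g i"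
  unfolding detail_def assms interp_linear
  by (cases L) (auto simp: interp_linear algebra_simps)

text \<open>At an odd node the detail is half the difference of the two adjacent increments, at an
  even node it vanishes; so a level is bounded by the squared increments on its own grid. Level 0
  consists of the end value alone.\<close>

lemma (in energy_space) detail_square_sum:
  assumes x: "x \<in> V"
  shows "(\<Sum>i\<le>2 ^ L. (norm (detail L (path x) i))\<^sup>2) \<le> 2 * (2 ^ L) powr (- (2 * H)) * ip x x"
proof (cases L)
  case 0
  have "(\<Sum>i\<le>1. (norm (detail 0 (path x) i))\<^sup>2) = (norm (path x 1))\<^sup>2" by (simp add: detail_def)
  also have "\<dots> \<le> 2 * ip x x" using increment_square_le[OF x, of 0 1] path_0[OF x] by simp
  finally show ?thesis using 0 by simp
next
  case (Suc m)
  define N :: nat where "N = 2 ^ m"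
  have N: "0 < N" "2 ^ L = 2 * N" "(2::real) ^ L = real (2 * N)" by (auto simp: N_def Suc)
  define h where "h i = path x (real i / real (2 * N))" for i
  define \<Delta> where "\<Delta> i = h (Suc i) - h i" for i
  have grid: "real (2 * k) / real (2 * N) = real k / real N" for k by simp
  have even: "detail L (path x) (2 * k) = 0" for k
    using interp_grid[OF N(1), of "\<lambda>j. path x (real j / real N)" k]
    by (auto simp: detail_def Suc N_def)
  have odd: "(norm (detail L (path x) (2 * k + 1)))\<^sup>2 \<le> (norm (\<Delta> (2 * k)))\<^sup>2 + (norm (\<Delta> (2 * k + 1)))\<^sup>2" if k: "k < N" for k
  proof -
    have pt: "real (2 * k + 1) / real (2 * N) = (real k + 1/2) / real N" using N by (simp add: field_simps)
    have in_range: "2 * k + 1 \<in> {1..2 ^ L}" unfolding N(2) using k by auto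
    have "detail L (path x) (2 * k + 1) = h (2 * k + 1) - interp N (\<lambda>j. path x (real j / real N)) ((real k + 1/2) / real N)"
    proof -
      have "interp (2 ^ m) (\<lambda>j. path x (real j / 2 ^ m)) (real (2 * k + 1) / 2 ^ L)
        = interp N (\<lambda>j. path x (real j / real N)) ((real k + 1/2) / real N)"
        unfolding N(3) pt by (simp add: N_def)
      then show ?thesis unfolding detail_def using in_range by (simp add: Suc h_def N_def)
    qed
    also have "interp N (\<lambda>j. path x (real j / real N)) ((real k + 1/2) / real N) = (1/2) *\<^sub>R h (2 * k) + (1/2) *\<^sub>R h (2 * k + 2)"
      using interp_eval[OF N(1), of "1/2" "\<lambda>j. path x (real j / real N)" k] grid[of k] grid[of "Suc k"]
      by (simp add: h_def)
    also have "h (2 * k + 1) - ((1/2) *\<^sub>R h (2 * k) + (1/2) *\<^sub>R h (2 * k + 2)) = (1/2) *\<^sub>R (\<Delta> (2 * k) - \<Delta> (2 * k + 1))"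
    proof -
      have "a - ((1/2) *\<^sub>R b + (1/2) *\<^sub>R c) = (1/2) *\<^sub>R ((a - b) - (c - a))" for a b c :: "real^'d"
        by (simp add: vec_eq_iff field_simps)
      then show ?thesis by (simp add: \<Delta>_def)
    qed
    finally have "norm (detail L (path x) (2 * k + 1)) = norm (\<Delta> (2 * k) - \<Delta> (2 * k + 1)) / 2" by simp
    also have "\<dots> \<le> (norm (\<Delta> (2 * k)) + norm (\<Delta> (2 * k + 1))) / 2"
      by (intro divide_right_mono norm_triangle_ineq4) auto
    finally have "(norm (detail L (path x) (2 * k + 1)))\<^sup>2 \<le> ((norm (\<Delta> (2 * k)) + norm (\<Delta> (2 * k + 1))) / 2)\<^sup>2"
      by (intro power_mono) auto
    also have "\<dots> \<le> (norm (\<Delta> (2 * k)))\<^sup>2 + (norm (\<Delta> (2 * k + 1)))\<^sup>2"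
    proof -
      have "((a + b) / 2)\<^sup>2 \<le> a\<^sup>2 + b\<^sup>2" for a b :: real
      proof -
        have *: "(u + v + w) / 4 \<le> u + v" if "w \<le> u + v" "0 \<le> u" "0 \<le> v" for u v w :: real
          using that by simp
        have "((a + b) / 2)\<^sup>2 = (a\<^sup>2 + b\<^sup>2 + 2 * a * b) / 4" by (simp add: power2_sum power_divide)
        also have "\<dots> \<le> a\<^sup>2 + b\<^sup>2" by (rule *[OF sum_squares_bound zero_le_power2 zero_le_power2])
        finally show ?thesis .
      qed
      then show ?thesis .
    qed
    finally show ?thesis .
  qed
  have pair: "{k * 2..<k * 2 + 2} = {2 * k, 2 * k + 1}" for k :: nat by auto
  \<comment> \<open>The last node is even and contributes 0; without it the indices group into
    pairs.\<close>
  have "(\<Sum>i\<le>2 ^ L. (norm (detail L (path x) i))\<^sup>2) = (\<Sum>i<N * 2. (norm (detail L (path x) i))\<^sup>2)"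
  proof -
    have "{..2 * N} = insert (2 * N) {..<N * 2}" by auto
    then show ?thesis unfolding N(2) using even[of N] by simp
  qed
  also have "\<dots> = (\<Sum>k<N. \<Sum>i=k * 2..<k * 2 + 2. (norm (detail L (path x) i))\<^sup>2)"
    by (rule sum.nat_group[symmetric])
  also have "\<dots> \<le> (\<Sum>k<N. \<Sum>i=k * 2..<k * 2 + 2. (norm (\<Delta> i))\<^sup>2)"
  proof (rule sum_mono)
    fix k assume "k \<in> {..<N}"
    then show "(\<Sum>i=k * 2..<k * 2 + 2. (norm (detail L (path x) i))\<^sup>2) \<le> (\<Sum>i=k * 2..<k * 2 + 2. (norm (\<Delta> i))\<^sup>2)"
      unfolding pair using odd[of k] even[of k] by simp
  qed
  also have "\<dots> = (\<Sum>i<N * 2. (norm (\<Delta> i))\<^sup>2)" by (rule sum.nat_group)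
  also have "\<dots> \<le> 2 * ip x x * real (2 * N) powr (- (2 * H))"
    using grid_increments_le[OF x, of "2 * N"] N by (simp add: \<Delta>_def h_def mult.commute)
  finally show ?thesis unfolding N(3) by (simp add: mult_ac)
qed

section \<open>Tents and their combinations\<close>

text \<open>Coefficients are indexed by node and coordinate together, so that a vector-valued level
  becomes an ordinary finite family of reals. Node 0 gets the value 0, hence every interpolant
  starts at 0.\<close>

definition vec_of :: "nat \<Rightarrow> (nat \<times> 'd \<Rightarrow> real) \<Rightarrow> nat \<Rightarrow> real^'d" where
  "vec_of N b j = (if j \<in> {1..N} then \<chi> c. b (j, c) else 0)"

text \<open>The hat function at node \<open>fst p\<close> in direction \<open>snd p\<close>. Hats at
  all nodes of the level are kept, also at those of coarser grids, where details vanish; this costs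
  only a constant factor.\<close>

definition tent :: "nat \<Rightarrow> nat \<times> 'd \<Rightarrow> real \<Rightarrow> real^'d" where
  "tent N p = interp N (vec_of N (\<lambda>p'. if p' = p then 1 else 0))"

definition tents :: "nat \<Rightarrow> (nat \<times> 'd::finite) set" where
  "tents N = {1..N} \<times> UNIV"

lemma finite_tents: "finite (tents N)" and card_tents: "card (tents N :: (nat \<times> 'd::finite) set) = N * CARD('d)"
  by (simp_all add: tents_def card_cartesian_product)

lemma interp_vec_of:
  fixes b :: "nat \<times> 'd::finite \<Rightarrow> real"
  shows "interp N (vec_of N b) t = (\<Sum>p\<in>tents N. b p *\<^sub>R tent N p t)"
proof -
  have "vec_of N b = (\<lambda>j. \<Sum>p\<in>tents N. b p *\<^sub>R vec_of N (\<lambda>p'. if p' = p then 1 else 0) j)"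
  proof (intro ext, unfold vec_eq_iff, intro allI)
    fix j and c :: 'd
    show "vec_of N b j $ c = (\<Sum>p\<in>tents N. b p *\<^sub>R vec_of N (\<lambda>p'. if p' = p then 1 else 0) j) $ c"
    proof (cases "j \<in> {1..N}")
      case True
      then have "(\<Sum>p\<in>tents N. b p *\<^sub>R vec_of N (\<lambda>p'. if p' = p then 1 else 0) j) $ c
        = (\<Sum>p\<in>tents N. if p = (j, c) then b p else 0)"
        by (auto simp: vec_of_def intro!: sum.cong)
      also have "\<dots> = b (j, c)" using True finite_tents[of N] by (auto simp: tents_def)
      finally show ?thesis using True by (simp add: vec_of_def)
    next
      case False
      then have "vec_of N f j = 0" for f :: "nat \<times> 'd \<Rightarrow> real" by (auto simp: vec_of_def)
      then show ?thesis by simp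
    qed
  qed
  then have "interp N (vec_of N b) t = interp N (\<lambda>j. \<Sum>p\<in>tents N. b p *\<^sub>R vec_of N (\<lambda>p'. if p' = p then 1 else 0) j) t"
    by simp
  then show ?thesis by (simp add: interp_sum interp_scaleR tent_def)
qed

lemma norm_vec_of_sum:
  fixes b :: "nat \<times> 'd::finite \<Rightarrow> real"
  shows "(\<Sum>j\<le>N. (norm (vec_of N b j))\<^sup>2) = (\<Sum>p\<in>tents N. (b p)\<^sup>2)"
proof -
  have "(\<Sum>j\<le>N. (norm (vec_of N b j))\<^sup>2) = (\<Sum>j\<in>{1..N}. (norm (vec_of N b j))\<^sup>2)"
    by (intro sum.mono_neutral_right) (auto simp: vec_of_def)
  also have "\<dots> = (\<Sum>j\<in>{1..N}. \<Sum>c\<in>UNIV. (b (j, c))\<^sup>2)"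
    by (intro sum.cong) (auto simp: vec_of_def norm_vec_def L2_set_def real_sqrt_pow2 sum_nonneg)
  also have "\<dots> = (\<Sum>p\<in>tents N. (b p)\<^sup>2)"
    by (simp add: tents_def sum.cartesian_product)
  finally show ?thesis .
qed

lemma vec_of_0 [simp]: "vec_of N b 0 = 0"
  by (simp add: vec_of_def)

text \<open>A single node carries a nonzero value, of unit length, so the bound does not depend on
  the mesh.\<close>

lemma tent_var_bounded:
  fixes p :: "nat \<times> 'd::finite"
  assumes N: "0 < N" and r: "1 \<le> r" and p: "p \<in> tents N"
  shows "var_bounded r (tent N p) 12"
proof -
  let ?b = "\<lambda>p'. if p' = p then 1 else 0 :: real"
  have "norm (vec_of N ?b j) powr r = (if j = fst p then 1 else 0)" for j
  proof (cases "j = fst p")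
    case True
    then have "vec_of N ?b j = axis (snd p) 1"
      using p by (auto simp: vec_of_def tents_def vec_eq_iff axis_def prod_eq_iff)
    then show ?thesis using True by simp
  next
    case False
    then have "vec_of N ?b j = 0" by (auto simp: vec_of_def vec_eq_iff prod_eq_iff)
    then show ?thesis using False by simp
  qed
  then have "(\<Sum>j\<le>N. norm (vec_of N ?b j) powr r) \<le> 1 powr r"
    by simp
  from var_bounded_interp_sum[OF N r _ this] show ?thesis by (simp add: tent_def)
qed

lemma tent_0: "0 < N \<Longrightarrow> tent N p 0 = 0"
  using interp_grid[of N "vec_of N (\<lambda>p'. if p' = p then 1 else 0)" 0] by (simp add: tent_def)

text \<open>The exponent 1/6 is \<open>1 / r - 1 / 2\<close> at \<open>r = 3/2\<close>, the price of
  passing from square sums to \<open>3/2\<close>-sums over \<open>N\<close> nodes. The constant is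
  12 from interpolation times 2 from Hoelder.\<close>

lemma vec_of_var_bounded:
  fixes b :: "nat \<times> 'd::finite \<Rightarrow> real"
  assumes N: "0 < N"
  shows "var_bounded (3/2) (interp N (vec_of N b)) (24 * real N powr (1/6) * sqrt (\<Sum>p\<in>tents N. (b p)\<^sup>2))"
proof -
  define \<sigma> where "\<sigma> = sqrt (\<Sum>p\<in>tents N. (b p)\<^sup>2)"
  have \<sigma>: "0 \<le> \<sigma>" "\<sigma>\<^sup>2 = (\<Sum>p\<in>tents N. (b p)\<^sup>2)" by (auto simp: \<sigma>_def sum_nonneg)
  have "(\<Sum>i\<le>N. norm (vec_of N b i) powr (3/2)) \<le> (2 * real N powr (1 / (3/2) - 1 / 2) * \<sigma>) powr (3/2)"
    using N \<sigma> by (intro sum_powr_le_of_sum_squares) (auto simp: norm_vec_of_sum)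
  from var_bounded_interp_sum[OF N _ _ this] \<sigma>(1)
  have "var_bounded (3/2) (interp N (vec_of N b)) (12 * (2 * real N powr (1 / (3/2) - 1 / 2) * \<sigma>))" by simp
  then show ?thesis by (simp add: \<sigma>_def mult.assoc)
qed

lemma vec_of_detail: "vec_of (2 ^ L) (\<lambda>p. detail L h (fst p) $ snd p) = detail L h"
proof
  fix j
  show "vec_of (2 ^ L) (\<lambda>p. detail L h (fst p) $ snd p) j = detail L h j"
  proof (cases "j \<in> {1..2 ^ L}")
    case True
    then have "vec_of (2 ^ L) (\<lambda>p. detail L h (fst p) $ snd p) j = (\<chi> c. detail L h j $ c)"
      by (simp only: vec_of_def if_True fst_conv snd_conv)
    then show ?thesis by (simp add: vec_lambda_eta)
  next
    case False
    then show ?thesis by (auto simp: vec_of_def detail_def)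
  qed
qed

lemma interp_detail:
  fixes h :: "real \<Rightarrow> real^'d"
  shows "interp (2 ^ L) (detail L h) t = (\<Sum>p\<in>tents (2 ^ L). (detail L h (fst p) $ snd p) *\<^sub>R tent (2 ^ L) p t)"
  using interp_vec_of[of "2 ^ L" "\<lambda>p. detail L h (fst p) $ snd p" t] by (simp add: vec_of_detail)

lemma (in energy_space) detail_coefficients_sum:
  assumes x: "x \<in> V"
  shows "(\<Sum>p\<in>tents (2 ^ L). (detail L (path x) (fst p) $ snd p)\<^sup>2) \<le> 2 * (2 ^ L) powr (- (2 * H)) * ip x x"
  using norm_vec_of_sum[of "2 ^ L" "\<lambda>p. detail L (path x) (fst p) $ snd p"] detail_square_sum[OF x, of L]
  by (simp add: vec_of_detail)

section \<open>Young-bounded forms are Hilbert--Schmidt\<close>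

text \<open>Interpolation between sup norm and variation: of the power \<open>r\<close> of an
  increment, the part \<open>r - s\<close> is bounded by the oscillation \<open>2 * \<sigma>\<close>
  and the part \<open>s\<close> by the control. One \<sigma> serves all paths with the bound
  \<open>b\<close>; the given path \<open>y\<close> supplies \<open>0 \<le> b\<close>.\<close>

lemma small_variation:
  fixes y :: "real \<Rightarrow> 'a::real_normed_vector"
  assumes s: "1 \<le> s" "s < r" and y: "var_bounded s y b" and e: "0 < e"
  shows "\<exists>\<sigma>>0. \<forall>z :: real \<Rightarrow> 'a. var_bounded s z b \<longrightarrow> (\<forall>t\<in>{0..1}. norm (z t) \<le> \<sigma>) \<longrightarrow> var_bounded r z e"
proof -
  have b: "0 \<le> b" using var_boundedD(2)[OF y] .
  \<comment> \<open>\<open>A\<close> satisfies \<open>A * b powr s \<le> e powr r\<close>, and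
    \<open>\<sigma>\<close> is chosen to make
    \<open>(2 * \<sigma>) powr (r - s) \<le> A\<close>.\<close>
  define A where "A = e powr r / (b powr s + 1)"
  have b1: "0 < b powr s + 1" by (rule add_nonneg_pos) auto
  then have A: "0 < A" using e by (simp add: A_def)
  define \<sigma> where "\<sigma> = min e (A powr (1 / (r - s)) / 2)"
  have \<sigma>: "0 < \<sigma>" "\<sigma> \<le> e" using e A by (auto simp: \<sigma>_def)
  have "(2 * \<sigma>) powr (r - s) \<le> (A powr (1 / (r - s))) powr (r - s)"
    using \<sigma>(1) s by (intro powr_mono2) (auto simp: \<sigma>_def)
  also have "\<dots> = A" using A s by (simp add: powr_powr)
  finally have \<sigma>A: "(2 * \<sigma>) powr (r - s) \<le> A" .
  show ?thesis
  proof (intro exI[of _ \<sigma>] conjI \<sigma>(1) allI impI)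
    fix z :: "real \<Rightarrow> 'a" assume z: "var_bounded s z b" and small: "\<forall>t\<in>{0..1}. norm (z t) \<le> \<sigma>"
    obtain F where F: "controls s F z 0 1" "F 1 - F 0 \<le> b powr s" using var_bounded_controls[OF z] .
    show "var_bounded r z e"
    proof (rule var_boundedI[where F = "\<lambda>t. A * F t"])
      show "norm (z v - z u) powr r \<le> A * F v - A * F u" if uv: "0 \<le> u" "u \<le> v" "v \<le> 1" for u v
      proof -
        have "norm (z v - z u) \<le> norm (z v) + norm (z u)" by (rule norm_triangle_ineq4)
        also have "\<dots> \<le> 2 * \<sigma>" using small[rule_format, of u] small[rule_format, of v] uv by simp
        finally have d: "norm (z v - z u) \<le> 2 * \<sigma>" .
        have "norm (z v - z u) powr r = norm (z v - z u) powr (r - s) * norm (z v - z u) powr s"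
          by (simp flip: powr_add)
        also have "\<dots> \<le> (2 * \<sigma>) powr (r - s) * (F v - F u)"
          using d s by (intro mult_mono powr_mono2 controlsD[OF F(1) uv]) auto
        also have "\<dots> \<le> A * (F v - F u)"
          using controls_mono[OF F(1) uv] by (intro mult_right_mono \<sigma>A) auto
        finally show ?thesis by (simp add: right_diff_distrib)
      qed
      have "A * F 1 - A * F 0 \<le> A * b powr s" using F(2) A by (simp add: mult_left_mono flip: right_diff_distrib)
      also have "\<dots> \<le> A * (b powr s + 1)" using A by simp
      also have "\<dots> = e powr r" using b1 by (simp add: A_def)
      finally show "A * F 1 - A * F 0 \<le> e powr r" .
    qed (use var_boundedD[OF z] e small \<sigma> in fastforce)+
  qed
qed

lemma L2_set_sum_le:
  "finite I \<Longrightarrow> L2_set (\<lambda>z. \<Sum>k\<in>I. f k z) A \<le> (\<Sum>k\<in>I. L2_set (f k) A)"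
proof (induction I rule: finite_induct)
  case empty
  then show ?case by (simp add: L2_set_def)
next
  case (insert k I)
  have "L2_set (\<lambda>z. f k z + (\<Sum>k\<in>I. f k z)) A \<le> L2_set (f k) A + L2_set (\<lambda>z. \<Sum>k\<in>I. f k z) A"
    by (rule L2_set_triangle_ineq)
  then show ?case using insert by simp
qed

lemma geometric_sum_le:
  assumes "0 \<le> x" "x < (1::real)"
  shows "(\<Sum>k\<le>n. x ^ k) \<le> 1 / (1 - x)"
  using sum_le_suminf[OF summable_geometric, of x "{..n}"] suminf_geometric[of x] assms by simp

text \<open>The form lives on all paths of finite \<open>3/2\<close>-variation starting at 0. So it
  can be evaluated on tents and interpolants without reference to their energy.\<close>

locale young_form = energy_space V ip path H
  for V :: "'v::real_vector set" and ip and path :: "'v \<Rightarrow> real \<Rightarrow> real^'d" and H +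
  fixes B :: "(real \<Rightarrow> real^'d) \<Rightarrow> (real \<Rightarrow> real^'d) \<Rightarrow> real" and C :: real
  assumes C: "0 \<le> C"
    and B_lin: "\<And>a x y z b c d. var_bounded (3/2) x b \<Longrightarrow> x 0 = 0 \<Longrightarrow> var_bounded (3/2) y c \<Longrightarrow> y 0 = 0 \<Longrightarrow>
      var_bounded (3/2) z d \<Longrightarrow> z 0 = 0 \<Longrightarrow> B (\<lambda>t. a *\<^sub>R x t + y t) z = a * B x z + B y z"
    and B_sym: "\<And>x y b c. var_bounded (3/2) x b \<Longrightarrow> x 0 = 0 \<Longrightarrow> var_bounded (3/2) y c \<Longrightarrow> y 0 = 0 \<Longrightarrow> B x y = B y x"
    and B_bound: "\<And>x y b c. var_bounded (3/2) x b \<Longrightarrow> x 0 = 0 \<Longrightarrow> var_bounded (3/2) y c \<Longrightarrow> y 0 = 0 \<Longrightarrow>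
      \<bar>B x y\<bar> \<le> C * b * c"
begin

definition rough :: "(real \<Rightarrow> real^'d) \<Rightarrow> bool" where
  "rough x \<longleftrightarrow> x 0 = 0 \<and> (\<exists>b. var_bounded (3/2) x b)"

lemma rough_lin: "rough x \<Longrightarrow> rough y \<Longrightarrow> rough (\<lambda>t. a *\<^sub>R x t + y t)"
proof -
  assume "rough x" "rough y"
  then obtain b c where x: "x 0 = 0" "var_bounded (3/2) x b" and y: "y 0 = 0" "var_bounded (3/2) y c"
    by (auto simp: rough_def)
  have "var_bounded (3/2) (\<lambda>t. a *\<^sub>R x t) (\<bar>a\<bar> * b)"
    by (rule var_bounded_linear[OF x(2), of "\<lambda>v. a *\<^sub>R v" "\<bar>a\<bar>"]) (auto simp: linear_scaleR)
  from var_bounded_add[OF this y(2)] show ?thesis using x y by (auto simp: rough_def)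
qed

lemma rough_zero: "rough (\<lambda>_. 0)"
  using var_bounded_const[of "3/2" 0] by (auto simp: rough_def)

lemma rough_sum: "finite I \<Longrightarrow> (\<And>p. p \<in> I \<Longrightarrow> rough (T p)) \<Longrightarrow> rough (\<lambda>t. \<Sum>p\<in>I. b p *\<^sub>R T p t)"
  by (induction I rule: finite_induct) (auto intro: rough_zero rough_lin)

lemma B_lin': "rough x \<Longrightarrow> rough y \<Longrightarrow> rough z \<Longrightarrow> B (\<lambda>t. a *\<^sub>R x t + y t) z = a * B x z + B y z"
  unfolding rough_def using B_lin by blast

lemma B_sym': "rough x \<Longrightarrow> rough y \<Longrightarrow> B x y = B y x"
  unfolding rough_def using B_sym by blast

lemma B_zero: "rough z \<Longrightarrow> B (\<lambda>_. 0) z = 0"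
  using B_lin'[OF rough_zero rough_zero, of z 1] by simp

lemma B_sum_left:
  "finite I \<Longrightarrow> (\<And>p. p \<in> I \<Longrightarrow> rough (T p)) \<Longrightarrow> rough z \<Longrightarrow>
    B (\<lambda>t. \<Sum>p\<in>I. b p *\<^sub>R T p t) z = (\<Sum>p\<in>I. b p * B (T p) z)"
  by (induction I rule: finite_induct) (auto simp: B_zero B_lin' rough_sum)

lemma B_sum_right:
  assumes "finite I" "\<And>p. p \<in> I \<Longrightarrow> rough (T p)" "rough z"
  shows "B z (\<lambda>t. \<Sum>p\<in>I. b p *\<^sub>R T p t) = (\<Sum>p\<in>I. b p * B z (T p))"
proof -
  have "B z (\<lambda>t. \<Sum>p\<in>I. b p *\<^sub>R T p t) = B (\<lambda>t. \<Sum>p\<in>I. b p *\<^sub>R T p t) z"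
    using assms by (intro B_sym' rough_sum)
  also have "\<dots> = (\<Sum>p\<in>I. b p * B (T p) z)" using assms by (rule B_sum_left)
  also have "\<dots> = (\<Sum>p\<in>I. b p * B z (T p))"
    using assms by (intro sum.cong refl) (simp add: B_sym')
  finally show ?thesis .
qed

lemma rough_tent: "0 < N \<Longrightarrow> p \<in> tents N \<Longrightarrow> rough (tent N p)"
  using tent_var_bounded[of N "3/2" p] tent_0[of N p] by (auto simp: rough_def)

text \<open>A row is tested on the combination of tents whose coefficients are the entries of the
  row. The value of the form is then \<open>\<beta>\<^sup>2\<close>, while its bound is linear in
  \<open>\<beta>\<close>, so one factor cancels.\<close>

lemma tent_row_sum:
  assumes N: "0 < N" and x: "var_bounded (3/2) x a" "x 0 = 0"
  shows "(\<Sum>p\<in>tents N. (B x (tent N p))\<^sup>2) \<le> (C * a * 24 * real N powr (1/6))\<^sup>2"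
proof -
  define b where "b p = B x (tent N p)" for p
  define \<beta> where "\<beta> = sqrt (\<Sum>p\<in>tents N. (b p)\<^sup>2)"
  have \<beta>: "0 \<le> \<beta>" "\<beta>\<^sup>2 = (\<Sum>p\<in>tents N. (b p)\<^sup>2)" by (auto simp: \<beta>_def sum_nonneg)
  have a: "0 \<le> a" using var_boundedD(2)[OF x(1)] .
  define w where "w = interp N (vec_of N b)"
  have w: "var_bounded (3/2) w (24 * real N powr (1/6) * \<beta>)"
    unfolding w_def \<beta>_def by (rule vec_of_var_bounded[OF N])
  have w0: "w 0 = 0" using interp_grid[OF N, of "vec_of N b" 0] by (simp add: w_def)
  have w_eq: "w = (\<lambda>t. \<Sum>p\<in>tents N. b p *\<^sub>R tent N p t)" by (simp add: w_def fun_eq_iff interp_vec_of)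
  have "rough x" using x by (auto simp: rough_def)
  then have "B x w = \<beta>\<^sup>2"
    unfolding w_eq \<beta>(2) using N by (subst B_sum_right) (auto simp: finite_tents rough_tent b_def power2_eq_square)
  then have *: "\<beta>\<^sup>2 \<le> C * a * (24 * real N powr (1/6) * \<beta>)" using B_bound[OF x w w0] by simp
  have "\<beta> \<le> C * a * 24 * real N powr (1/6)"
  proof (cases "\<beta> = 0")
    case True
    then show ?thesis using C a by simp
  next
    case False
    then have "0 < \<beta>" using \<beta> by simp
    moreover have "\<beta> * \<beta> \<le> (C * a * 24 * real N powr (1/6)) * \<beta>" using * by (simp add: power2_eq_square mult_ac)
    ultimately show ?thesis by simp
  qed
  then have "\<beta>\<^sup>2 \<le> (C * a * 24 * real N powr (1/6))\<^sup>2" using \<beta>(1) by (intro power_mono)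
  then show ?thesis using \<beta>(2) by (simp add: b_def)
qed

text \<open>For \<open>m \<le> n\<close> the rows are indexed by the coarser level: there are
  \<open>2 ^ m * CARD('d)\<close> of them, each with square sum of order 2^(n/3), and m + n/3 is at
  most 2(m + n)/3. Symmetry of the form covers the other case. The number 288 is 12 for a tent times
  24 for a row.\<close>

lemma tent_matrix_sum:
  "(\<Sum>p\<in>tents (2 ^ m). \<Sum>q\<in>tents (2 ^ n). (B (tent (2 ^ m) p) (tent (2 ^ n) q))\<^sup>2)
    \<le> real CARD('d) * (288 * C)\<^sup>2 * (2 ^ m * 2 ^ n) powr (2/3)"
proof -
  have *: "(\<Sum>p\<in>tents (2 ^ m). \<Sum>q\<in>tents (2 ^ n). (B (tent (2 ^ m) p) (tent (2 ^ n) q))\<^sup>2)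
    \<le> real CARD('d) * (288 * C)\<^sup>2 * (2 ^ m * 2 ^ n) powr (2/3)" if mn: "m \<le> n" for m n
  proof -
    have "(\<Sum>p\<in>tents (2 ^ m). \<Sum>q\<in>tents (2 ^ n). (B (tent (2 ^ m) p) (tent (2 ^ n) q))\<^sup>2)
      \<le> real (card (tents (2 ^ m) :: (nat \<times> 'd) set)) * (C * 12 * 24 * real (2 ^ n) powr (1/6))\<^sup>2"
      by (intro sum_bounded_above tent_row_sum tent_var_bounded tent_0) auto
    also have "\<dots> = real CARD('d) * (288 * C)\<^sup>2 * (2 ^ m * (2 ^ n) powr (1/3))"
    proof -
      have "(real (2 ^ n) powr (1/6))\<^sup>2 = (2 ^ n) powr (1/3)" by (simp add: power2_eq_square flip: powr_add)
      then show ?thesis by (simp add: card_tents power_mult_distrib)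
    qed
    also have "\<dots> \<le> real CARD('d) * (288 * C)\<^sup>2 * (2 ^ m * 2 ^ n) powr (2/3)"
    proof (rule mult_left_mono)
      have "(2::real) ^ m * (2 ^ n) powr (1/3) = 2 powr (real m + real n * (1/3))"
        by (simp add: powr_add powr_powr flip: powr_realpow)
      also have "\<dots> \<le> 2 powr ((real m + real n) * (2/3))" using mn by (intro powr_mono) auto
      also have "\<dots> = (2 ^ m * 2 ^ n) powr (2/3)"
        by (simp add: powr_powr powr_add[symmetric] flip: powr_realpow)
      finally show "(2::real) ^ m * (2 ^ n) powr (1/3) \<le> (2 ^ m * 2 ^ n) powr (2/3)" .
    qed simp
    finally show ?thesis .
  qed
  show ?thesis
  proof (cases "m \<le> n")
    case False
    have "(\<Sum>p\<in>tents (2 ^ m). \<Sum>q\<in>tents (2 ^ n). (B (tent (2 ^ m) p) (tent (2 ^ n) q))\<^sup>2)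
      = (\<Sum>q\<in>tents (2 ^ n). \<Sum>p\<in>tents (2 ^ m). (B (tent (2 ^ n) q) (tent (2 ^ m) p))\<^sup>2)"
      by (subst sum.swap) (auto intro!: sum.cong simp: B_sym' rough_tent)
    then show ?thesis using *[of n m] False by (simp add: mult.commute)
  qed (rule *)
qed

section \<open>Blocks between two levels\<close>

definition level :: "nat \<Rightarrow> 'v \<Rightarrow> real \<Rightarrow> real^'d" where
  "level L x = interp (2 ^ L) (detail L (path x))"

lemma level_tents: "level L x = (\<lambda>t. \<Sum>p\<in>tents (2 ^ L). (detail L (path x) (fst p) $ snd p) *\<^sub>R tent (2 ^ L) p t)"
  by (simp add: level_def fun_eq_iff interp_detail)

lemma rough_level: "rough (level L x)"
  unfolding level_tents by (intro rough_sum finite_tents rough_tent) auto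

text \<open>Bessel turns the decay \<open>2 * (2 ^ m) powr (- (2 * H))\<close> of the coefficients
  of a level into a factor in front of the matrix of tents. The exponents add up to
  \<open>2/3 - 2 * H\<close> for each of the two levels, which is negative exactly when
  \<open>H > 1/3\<close>.\<close>

lemma level_hilbert_schmidt:
  assumes A: "finite A" "orthonormal A"
  shows "(\<Sum>e\<in>A. \<Sum>e'\<in>A. (B (level m e) (level n e'))\<^sup>2)
    \<le> 4 * (real CARD('d) * (288 * C)\<^sup>2) * ((2 powr (1/3 - H)) ^ m * (2 powr (1/3 - H)) ^ n)\<^sup>2"
proof -
  let ?l = "\<lambda>L p x. detail L (path x) (fst p) $ snd p"
  have lin: "?l L p (a *\<^sub>R x + y) = a * ?l L p x + ?l L p y" if "x \<in> V" "y \<in> V" for L p a x y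
    using detail_linear[of "path (a *\<^sub>R x + y)" a "path x" "path y" L "fst p", OF path_lin[OF that]] by simp
  have form: "B (level m e) (level n e') = (\<Sum>p\<in>tents (2 ^ m). \<Sum>q\<in>tents (2 ^ n).
    B (tent (2 ^ m) p) (tent (2 ^ n) q) * ?l m p e * ?l n q e')" for e e'
  proof -
    have "B (level m e) (level n e') = (\<Sum>p\<in>tents (2 ^ m). ?l m p e * B (tent (2 ^ m) p) (level n e'))"
      unfolding level_tents[of m] by (rule B_sum_left) (auto simp: finite_tents rough_tent rough_level)
    also have "\<dots> = (\<Sum>p\<in>tents (2 ^ m). ?l m p e * (\<Sum>q\<in>tents (2 ^ n). ?l n q e' * B (tent (2 ^ m) p) (tent (2 ^ n) q)))"
      unfolding level_tents[of n] by (intro sum.cong refl arg_cong2[where f = "(*)"] B_sum_right) (auto simp: finite_tents rough_tent)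
    finally show ?thesis by (simp add: sum_distrib_left mult_ac)
  qed
  have "(\<Sum>e\<in>A. \<Sum>e'\<in>A. (B (level m e) (level n e'))\<^sup>2)
    \<le> (2 * (2 ^ m) powr (- (2 * H))) * (2 * (2 ^ n) powr (- (2 * H)))
      * (\<Sum>p\<in>tents (2 ^ m). \<Sum>q\<in>tents (2 ^ n). (B (tent (2 ^ m) p) (tent (2 ^ n) q))\<^sup>2)"
    unfolding form using lin detail_coefficients_sum by (intro bessel_bilinear[OF A]) auto
  also have "\<dots> \<le> (2 * (2 ^ m) powr (- (2 * H))) * (2 * (2 ^ n) powr (- (2 * H)))
      * (real CARD('d) * (288 * C)\<^sup>2 * (2 ^ m * 2 ^ n) powr (2/3))"
    by (intro mult_left_mono tent_matrix_sum) auto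
  also have "\<dots> = 4 * (real CARD('d) * (288 * C)\<^sup>2) * ((2 ^ m) powr (2/3 - 2 * H) * (2 ^ n) powr (2/3 - 2 * H))"
  proof -
    have "x powr (2/3 - 2 * H) = x powr (- (2 * H)) * x powr (2/3)" for x :: real
      by (simp flip: powr_add)
    then show ?thesis by (simp only: powr_mult) (simp only: mult_ac)
  qed
  also have "(2 ^ m) powr (2/3 - 2 * H) * (2 ^ n) powr (2/3 - 2 * H) = ((2 powr (1/3 - H)) ^ m * (2 powr (1/3 - H)) ^ n)\<^sup>2"
  proof -
    have "(2 ^ k) powr (2/3 - 2 * H) = ((2 powr (1/3 - H)) ^ k)\<^sup>2" for k :: nat
    proof -
      have "(2 ^ k) powr (2/3 - 2 * H) = 2 powr (real k * (2/3 - 2 * H))"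
        by (simp add: powr_powr flip: powr_realpow)
      also have "\<dots> = (2 powr (real k * (1/3 - H)))\<^sup>2"
        by (simp add: power2_eq_square algebra_simps flip: powr_add)
      also have "2 powr (real k * (1/3 - H)) = (2 powr (1/3 - H)) ^ k"
        by (simp add: powr_powr mult.commute flip: powr_realpow)
      finally show ?thesis .
    qed
    then show ?thesis by (simp add: power_mult_distrib)
  qed
  finally show ?thesis .
qed

section \<open>Partial sums and passage to the limit\<close>

definition partial :: "nat \<Rightarrow> 'v \<Rightarrow> real \<Rightarrow> real^'d" where
  "partial n x t = (\<Sum>L\<le>n. level L x t)"

text \<open>The triangle inequality in the Euclidean space indexed by \<open>A \<times> A\<close>
  reduces the form to its blocks, whose norms are bounded by products of two geometric sequences.
  The bound depends neither on \<open>n\<close> nor on \<open>A\<close>, as the limit and the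
  passage to an infinite basis require.\<close>

lemma partial_hilbert_schmidt:
  assumes A: "finite A" "orthonormal A"
  shows "(\<Sum>e\<in>A. \<Sum>e'\<in>A. (B (partial n e) (partial n e'))\<^sup>2)
    \<le> (2 * sqrt (real CARD('d)) * (288 * C) * (1 / (1 - 2 powr (1/3 - H)))\<^sup>2)\<^sup>2"
proof -
  define \<rho> where "\<rho> = 2 powr (1/3 - H)"
  have \<rho>: "0 \<le> \<rho>" "\<rho> < 1" using H powr_less_mono[of "1/3 - H" 0 2] by (auto simp: \<rho>_def)
  define Q where "Q = 2 * sqrt (real CARD('d)) * (288 * C)"
  have Q: "0 \<le> Q" using C by (simp add: Q_def)
  have QQ: "Q\<^sup>2 = 4 * (real CARD('d) * (288 * C)\<^sup>2)" by (simp add: Q_def power_mult_distrib)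
  have p1: "partial n x = (\<lambda>t. \<Sum>L\<in>{..n}. 1 *\<^sub>R level L x t)" for x
    by (simp add: partial_def fun_eq_iff)
  have rp: "rough (partial n x)" for x unfolding p1 by (intro rough_sum rough_level) auto
  have form: "B (partial n x) (partial n y) = (\<Sum>k\<le>n. \<Sum>l\<le>n. B (level k x) (level l y))" for x y
  proof -
    have "B (partial n x) (partial n y) = (\<Sum>k\<le>n. 1 * B (level k x) (partial n y))"
      unfolding p1[of x] by (intro B_sum_left rough_level rp) auto
    also have "\<dots> = (\<Sum>k\<le>n. 1 * (\<Sum>l\<le>n. 1 * B (level k x) (level l y)))"
      unfolding p1[of y] by (intro sum.cong refl arg_cong2[where f = "(*)"] B_sum_right rough_level) auto
    finally show ?thesis by simp
  qed
  have blk: "L2_set (\<lambda>z. B (level k (fst z)) (level l (snd z))) (A \<times> A) \<le> Q * (\<rho> ^ k * \<rho> ^ l)" for k l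
  proof -
    have "L2_set (\<lambda>z. B (level k (fst z)) (level l (snd z))) (A \<times> A)
      = sqrt (\<Sum>e\<in>A. \<Sum>e'\<in>A. (B (level k e) (level l e'))\<^sup>2)"
      by (simp add: L2_set_def sum.cartesian_product case_prod_unfold)
    also have "\<dots> \<le> sqrt ((Q * (\<rho> ^ k * \<rho> ^ l))\<^sup>2)"
      unfolding real_sqrt_le_iff using level_hilbert_schmidt[OF A, of k l]
      by (simp add: power_mult_distrib[of Q] QQ \<rho>_def)
    also have "\<dots> = Q * (\<rho> ^ k * \<rho> ^ l)" using Q \<rho> by simp
    finally show ?thesis .
  qed
  have "sqrt (\<Sum>e\<in>A. \<Sum>e'\<in>A. (B (partial n e) (partial n e'))\<^sup>2)
    = L2_set (\<lambda>z. \<Sum>k\<le>n. \<Sum>l\<le>n. B (level k (fst z)) (level l (snd z))) (A \<times> A)"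
    by (simp add: L2_set_def sum.cartesian_product case_prod_unfold form)
  also have "\<dots> \<le> (\<Sum>k\<le>n. L2_set (\<lambda>z. \<Sum>l\<le>n. B (level k (fst z)) (level l (snd z))) (A \<times> A))"
    by (intro L2_set_sum_le) auto
  also have "\<dots> \<le> (\<Sum>k\<le>n. \<Sum>l\<le>n. L2_set (\<lambda>z. B (level k (fst z)) (level l (snd z))) (A \<times> A))"
    by (intro sum_mono L2_set_sum_le) auto
  also have "\<dots> \<le> (\<Sum>k\<le>n. \<Sum>l\<le>n. Q * (\<rho> ^ k * \<rho> ^ l))" by (intro sum_mono blk)
  also have "\<dots> = Q * ((\<Sum>k\<le>n. \<rho> ^ k) * (\<Sum>l\<le>n. \<rho> ^ l))"
    by (subst sum_product) (simp only: sum_distrib_left)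
  also have "\<dots> \<le> Q * ((1 / (1 - \<rho>)) * (1 / (1 - \<rho>)))"
    using \<rho> Q by (intro mult_left_mono mult_mono geometric_sum_le sum_nonneg) auto
  finally have "sqrt (\<Sum>e\<in>A. \<Sum>e'\<in>A. (B (partial n e) (partial n e'))\<^sup>2) \<le> Q * (1 / (1 - \<rho>))\<^sup>2"
    by (simp add: power2_eq_square)
  then have "(sqrt (\<Sum>e\<in>A. \<Sum>e'\<in>A. (B (partial n e) (partial n e'))\<^sup>2))\<^sup>2 \<le> (Q * (1 / (1 - \<rho>))\<^sup>2)\<^sup>2"
    by (intro power_mono) (auto simp: sum_nonneg)
  then show ?thesis by (simp add: sum_nonneg Q_def \<rho>_def)
qed

lemma path_rough: "x \<in> V \<Longrightarrow> var_bounded (3/2) (path x) (3 * sqrt (ip x x))"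
  using H by (intro path_var_bounded) auto

lemma form_bounded:
  assumes "x \<in> V" "y \<in> V"
  shows "\<bar>B (path x) (path y)\<bar> \<le> 9 * C * sqrt (ip x x) * sqrt (ip y y)"
  using B_bound[OF path_rough[OF assms(1)] path_0[OF assms(1)] path_rough[OF assms(2)] path_0[OF assms(2)]]
  by (simp add: mult_ac)

text \<open>Paths are Hoelder of order \<open>H\<close>, so the partial sums converge uniformly;
  they stay bounded in \<open>6/5\<close>-variation. Together these force convergence in
  \<open>3/2\<close>-variation.\<close>

lemma partial_remainder:
  assumes x: "x \<in> V" and e: "0 < e"
  shows "\<forall>\<^sub>F n in sequentially. var_bounded (3/2) (\<lambda>t. path x t - partial n x t) e"
proof -
  define v where "v = sqrt (ip x x)"
  have v: "0 \<le> v" using ip_nonneg[OF x] by (simp add: v_def)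
  \<comment> \<open>For this exponent the condition reads \<open>2/3 \<le> 2 * H\<close>, so
    \<open>6/5\<close> is the smallest exponent admissible for every \<open>H > 1/3\<close>.\<close>
  have xs: "var_bounded (6/5) (path x) (3 * v)"
    unfolding v_def using H by (intro path_var_bounded[OF x]) auto
  obtain F where F: "controls (6/5) F (path x) 0 1" "F 1 - F 0 \<le> (3 * v) powr (6/5)"
    using var_bounded_controls[OF xs] .
  have p_eq: "partial n x t = interp (2 ^ n) (\<lambda>i. path x (real i / 2 ^ n)) t" if "t \<in> {0..1}" for n t
    unfolding partial_def level_def by (rule sum_details[where h = "path x", OF path_0[OF x] that])
  have ps: "var_bounded (6/5) (partial n x) (3 * (3 * v))" for n
  proof (rule var_bounded_cong)
    show "var_bounded (6/5) (interp (2 ^ n) (\<lambda>i. path x (real i / 2 ^ n))) (3 * (3 * v))"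
    proof (rule var_bounded_interp[where F = "\<lambda>i. F (real i / 2 ^ n)"])
      show "norm (path x (real j / 2 ^ n) - path x (real i / 2 ^ n)) powr (6/5) \<le> F (real j / 2 ^ n) - F (real i / 2 ^ n)"
        if "i \<le> j" "j \<le> 2 ^ n" for i j
      proof (rule controlsD[OF F(1)])
        have "real j \<le> 2 ^ n" using that(2) by (metis of_nat_le_iff of_nat_numeral of_nat_power)
        then show "real j / 2 ^ n \<le> 1" by simp
      qed (use that in \<open>auto intro: divide_right_mono\<close>)
    qed (use F(2) v path_0[OF x] in auto)
  qed (simp add: p_eq)
  have neg: "var_bounded (6/5) (\<lambda>t. - partial n x t) (1 * (3 * (3 * v)))" for n
    by (rule var_bounded_linear[OF ps, of uminus 1]) (auto simp: linear_uminus)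
  \<comment> \<open>The sum of the bounds \<open>3 * v\<close> and \<open>9 * v\<close>, times the
    factor 4 of an addition.\<close>
  have diff: "var_bounded (6/5) (\<lambda>t. path x t - partial n x t) (48 * v)" for n
    using var_bounded_add[OF xs neg[of n]] by simp
  obtain \<sigma> where \<sigma>: "0 < \<sigma>" "\<And>z :: real \<Rightarrow> real^'d. var_bounded (6/5) z (48 * v) \<Longrightarrow>
      (\<forall>t\<in>{0..1}. norm (z t) \<le> \<sigma>) \<Longrightarrow> var_bounded (3/2) z e"
    using small_variation[of "6/5" "3/2", OF _ _ diff e] by auto
  \<comment> \<open>The error of linear interpolation inside a cell is at most two increments, each
    over a distance of at most one cell.\<close>
  have near: "norm (path x t - partial n x t) \<le> 2 * (sqrt (2 * ip x x) * (1 / 2 ^ n) powr H)" if t: "t \<in> {0..1}" for n t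
  proof -
    obtain k \<nu> where k: "k < 2 ^ n" "0 \<le> \<nu>" "\<nu> \<le> 1" "t = (real k + \<nu>) / real (2 ^ n)"
      using grid_cell[of "2 ^ n" t] t by auto
    define a where "a = path x (real k / 2 ^ n)"
    define b where "b = path x (real (Suc k) / 2 ^ n)"
    have "partial n x t = (1 - \<nu>) *\<^sub>R a + \<nu> *\<^sub>R b"
      unfolding p_eq[OF t] unfolding k(4) a_def b_def by (rule interp_eval) (use k in auto)
    then have "path x t - partial n x t = (path x t - a) - \<nu> *\<^sub>R (b - a)"
      by (simp add: algebra_simps)
    then have "norm (path x t - partial n x t) \<le> norm (path x t - a) + norm (\<nu> *\<^sub>R (b - a))"
      by (simp only: norm_triangle_ineq4)
    also have "\<dots> \<le> norm (path x t - a) + norm (b - a)"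
      using k mult_right_mono[of \<nu> 1 "norm (b - a)"] by simp
    also have "\<dots> \<le> sqrt (2 * ip x x) * (1 / 2 ^ n) powr H + sqrt (2 * ip x x) * (1 / 2 ^ n) powr H"
    proof (rule add_mono)
      have k1: "real (Suc k) \<le> 2 ^ n" using k(1) by (metis Suc_leI of_nat_le_iff of_nat_numeral of_nat_power)
      have "k \<le> 2 ^ n" using k(1) by simp
      then have kr: "real k / 2 ^ n \<in> {0..1}" "real (Suc k) / 2 ^ n \<in> {0..1}" using k1 by auto
      have "t - real k / 2 ^ n = \<nu> / 2 ^ n" unfolding k(4) by (simp add: add_divide_distrib)
      then have "\<bar>t - real k / 2 ^ n\<bar> \<le> 1 / 2 ^ n" using k by (simp add: divide_right_mono)
      then have "\<bar>t - real k / 2 ^ n\<bar> powr H \<le> (1 / 2 ^ n) powr H" using H by (intro powr_mono2) auto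
      then show "norm (path x t - a) \<le> sqrt (2 * ip x x) * (1 / 2 ^ n) powr H"
        unfolding a_def using ip_nonneg[OF x]
        by (intro order_trans[OF increment_le[OF x kr(1) t]] mult_left_mono) auto
      have "real (Suc k) / 2 ^ n - real k / 2 ^ n = 1 / 2 ^ n" by (simp add: field_simps)
      then show "norm (b - a) \<le> sqrt (2 * ip x x) * (1 / 2 ^ n) powr H"
        unfolding a_def b_def using increment_le[OF x kr(1,2)] by simp
    qed
    finally show ?thesis by simp
  qed
  have "(\<lambda>n. 2 * (sqrt (2 * ip x x) * (1 / 2 ^ n) powr H)) \<longlonglongrightarrow> 2 * (sqrt (2 * ip x x) * 0)"
  proof (intro tendsto_intros)
    have "(1 / 2 ^ n) powr H = ((1/2) powr H) ^ n" for n :: nat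
    proof -
      have "(1 / 2 ^ n :: real) = (1/2) powr real n" by (simp add: powr_realpow power_one_over)
      then have "(1 / 2 ^ n) powr H = (1/2) powr (H * real n)" by (simp add: powr_powr mult.commute)
      also have "\<dots> = ((1/2) powr H) powr real n" by (simp add: powr_powr)
      finally show ?thesis by (simp add: powr_realpow)
    qed
    moreover have "(\<lambda>n. ((1/2 :: real) powr H) ^ n) \<longlonglongrightarrow> 0"
      using H powr_less_mono'[of "1/2" 0 H] by (intro LIMSEQ_power_zero) simp
    ultimately show "(\<lambda>n. (1 / 2 ^ n) powr H) \<longlonglongrightarrow> 0" by simp
  qed
  then have "\<forall>\<^sub>F n in sequentially. 2 * (sqrt (2 * ip x x) * (1 / 2 ^ n) powr H) < \<sigma>"
    using \<sigma>(1) by (intro order_tendstoD(2)) auto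
  then show ?thesis
  proof eventually_elim
    case (elim n)
    have "norm (path x t - partial n x t) \<le> \<sigma>" if "t \<in> {0..1}" for t
      by (rule order_trans[OF near[OF that] less_imp_le[OF elim]])
    then show ?case by (intro \<sigma>(2) diff) auto
  qed
qed

lemma partial_bounded:
  assumes x: "x \<in> V"
  obtains b where "\<And>n. rough (partial n x)" "\<forall>\<^sub>F n in sequentially. var_bounded (3/2) (partial n x) b"
proof -
  have r: "rough (partial n x)" for n
    using rough_sum[of "{..n}" "\<lambda>L. level L x" "\<lambda>_. 1"] by (simp add: rough_level partial_def[abs_def])
  have "\<forall>\<^sub>F n in sequentially. var_bounded (3/2) (partial n x) (4 * (1 + 3 * sqrt (ip x x)))"
    using partial_remainder[OF x, of 1, OF zero_less_one]
  proof eventually_elim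
    case (elim n)
    have "var_bounded (3/2) (\<lambda>t. - (path x t - partial n x t)) (1 * 1)"
      by (rule var_bounded_linear[OF elim, of uminus 1]) (auto simp: linear_uminus)
    from var_bounded_add[OF this path_rough[OF x]] show ?case by simp
  qed
  then show ?thesis by (rule that[OF r])
qed

text \<open>Remainders tend to 0 and partial sums stay bounded in \<open>3/2\<close>-variation, so
  the bound on the form makes it continuous along the approximation. Symmetry transfers linearity to
  the second argument.\<close>

lemma partial_form_limit:
  assumes x: "x \<in> V" and y: "y \<in> V"
  shows "(\<lambda>n. B (partial n x) (partial n y)) \<longlonglongrightarrow> B (path x) (path y)"
proof (rule tendstoI)
  fix e :: real assume e: "0 < e"
  obtain b where b: "\<And>n. rough (partial n x)" "\<forall>\<^sub>F n in sequentially. var_bounded (3/2) (partial n x) b"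
    by (rule partial_bounded[OF x]) blast
  have b': "\<And>n. rough (partial n y)"
    by (rule partial_bounded[OF y]) blast
  define c where "c = 3 * sqrt (ip y y)"
  define Q where "Q = C * c + C * \<bar>b\<bar> + 1"
  have c: "0 \<le> c" using ip_nonneg[OF y] by (simp add: c_def)
  have Q: "0 < Q" using C c by (simp add: Q_def add_nonneg_pos)
  define e' where "e' = e / Q"
  have e': "0 < e'" using e Q by (simp add: e'_def)
  have yc: "var_bounded (3/2) (path y) c" unfolding c_def by (rule path_rough[OF y])
  have rx: "rough (path x)" "rough (path y)" using path_rough x y path_0 by (auto simp: rough_def)
  have x0: "partial n x 0 = 0" "partial n y 0 = 0" for n using b(1)[of n] b'[of n] by (auto simp: rough_def)
  show "\<forall>\<^sub>F n in sequentially. dist (B (partial n x) (partial n y)) (B (path x) (path y)) < e"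
    using b(2) partial_remainder[OF x e'] partial_remainder[OF y e']
  proof eventually_elim
    case (elim n)
    have bpos: "0 \<le> b" using var_boundedD(2)[OF elim(1)] .
    have d0: "path x 0 - partial n x 0 = 0" "path y 0 - partial n y 0 = 0" using x0 path_0 x y by auto
    have rd: "rough (\<lambda>t. path x t - partial n x t)" "rough (\<lambda>t. path y t - partial n y t)"
      using elim d0 by (auto simp: rough_def)
    have "path x = (\<lambda>t. 1 *\<^sub>R (path x t - partial n x t) + partial n x t)" by simp
    then have "B (path x) (path y) = 1 * B (\<lambda>t. path x t - partial n x t) (path y) + B (partial n x) (path y)"
      using B_lin'[OF rd(1) b(1)[of n] rx(2), of 1] by simp
    moreover have "B (partial n x) (path y) = B (partial n x) (\<lambda>t. path y t - partial n y t) + B (partial n x) (partial n y)"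
    proof -
      have "B (partial n x) (path y) = B (path y) (partial n x)" by (rule B_sym'[OF b(1) rx(2)])
      also have "\<dots> = B (\<lambda>t. 1 *\<^sub>R (path y t - partial n y t) + partial n y t) (partial n x)" by simp
      also have "\<dots> = 1 * B (\<lambda>t. path y t - partial n y t) (partial n x) + B (partial n y) (partial n x)"
        by (rule B_lin'[OF rd(2) b'[of n] b(1)[of n]])
      finally show ?thesis using B_sym'[OF rd(2) b(1)[of n]] B_sym'[OF b'[of n] b(1)[of n]] by simp
    qed
    ultimately have "B (path x) (path y) - B (partial n x) (partial n y)
      = B (\<lambda>t. path x t - partial n x t) (path y) + B (partial n x) (\<lambda>t. path y t - partial n y t)" by simp
    then have "\<bar>B (path x) (path y) - B (partial n x) (partial n y)\<bar> \<le> C * e' * c + C * b * e'"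
      using B_bound[OF elim(2) d0(1) yc path_0[OF y]] B_bound[OF elim(1) x0(1) elim(3) d0(2)] by linarith
    also have "\<dots> = (C * c + C * \<bar>b\<bar>) * e'" using bpos by (simp add: algebra_simps)
    also have "\<dots> < Q * e'" using e' by (intro mult_strict_right_mono) (auto simp: Q_def)
    also have "\<dots> = e" using Q by (simp add: e'_def)
    finally show ?case by (simp add: dist_real_def abs_minus_commute)
  qed
qed

theorem form_hilbert_schmidt:
  assumes A: "finite A" "orthonormal A"
  shows "(\<Sum>e\<in>A. \<Sum>e'\<in>A. (B (path e) (path e'))\<^sup>2)
    \<le> (2 * sqrt (real CARD('d)) * (288 * C) * (1 / (1 - 2 powr (1/3 - H)))\<^sup>2)\<^sup>2"
proof (rule LIMSEQ_le_const2)
  have "A \<subseteq> V" using A by (simp add: orthonormal_def)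
  then show "(\<lambda>n. \<Sum>e\<in>A. \<Sum>e'\<in>A. (B (partial n e) (partial n e'))\<^sup>2) \<longlonglongrightarrow> (\<Sum>e\<in>A. \<Sum>e'\<in>A. (B (path e) (path e'))\<^sup>2)"
    by (intro tendsto_sum tendsto_power partial_form_limit) auto
  show "\<exists>N. \<forall>n\<ge>N. (\<Sum>e\<in>A. \<Sum>e'\<in>A. (B (partial n e) (partial n e'))\<^sup>2)
    \<le> (2 * sqrt (real CARD('d)) * (288 * C) * (1 / (1 - 2 powr (1/3 - H)))\<^sup>2)\<^sup>2"
    using partial_hilbert_schmidt[OF A] by blast
qed

end

section \<open>Fractional Brownian motion\<close>

text \<open>Concavity: \<open>(y + p) powr a - y powr a\<close> decreases in \<open>y\<close>, and
  is compared here at \<open>x\<close> and \<open>x + s\<close>. The sign of the derivative is used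
  only inside the interval, so that \<open>x = 0\<close> is allowed.\<close>

lemma powr_concave_exchange:
  fixes a x p s :: real
  assumes a: "0 < a" "a \<le> 1" and "0 \<le> x" "0 \<le> p" "0 \<le> s"
  shows "x powr a + (x + p + s) powr a \<le> (x + s) powr a + (x + p) powr a"
proof -
  have "(x + s + p) powr a - (x + s) powr a \<le> (x + p) powr a - x powr a"
  proof (rule DERIV_nonpos_imp_decreasing_open[of x "x + s" "\<lambda>y. (y + p) powr a - y powr a"])
    fix y assume "x < y" "y < x + s"
    then have y: "0 < y" using assms by simp
    have "((\<lambda>y. (y + p) powr a - y powr a) has_real_derivative (a * (y + p) powr (a - 1) - a * y powr (a - 1))) (at y)"
      using y assms by (auto intro!: derivative_eq_intros)
    moreover have "(y + p) powr (a - 1) \<le> y powr (a - 1)" using y assms by (intro powr_mono2') auto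
    then have "a * (y + p) powr (a - 1) - a * y powr (a - 1) \<le> 0" using a by simp
    ultimately show "\<exists>d. ((\<lambda>y. (y + p) powr a - y powr a) has_real_derivative d) (at y) \<and> d \<le> 0" by blast
  next
    show "continuous_on {x..x + s} (\<lambda>y. (y + p) powr a - y powr a)"
      using assms by (intro continuous_intros continuous_on_powr') auto
  qed (use assms in simp)
  then show ?thesis by (simp add: algebra_simps)
qed

section \<open>Covariances of increments\<close>

text \<open>The covariance of the increments over \<open>K\<close> and \<open>L\<close> of a scalar
  fractional Brownian motion.\<close>

definition cov_increment :: "real \<Rightarrow> real set \<Rightarrow> real set \<Rightarrow> real" where
  "cov_increment H K L = fbm_cov H (Sup K) (Sup L) - fbm_cov H (Sup K) (Inf L)
     - fbm_cov H (Inf K) (Sup L) + fbm_cov H (Inf K) (Inf L)"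

lemma fbm_cov_sym: "fbm_cov H s t = fbm_cov H t s"
  by (simp add: fbm_cov_def abs_minus_commute)

lemma cov_increment_sym: "cov_increment H K L = cov_increment H L K"
  by (simp add: cov_increment_def fbm_cov_sym[of H "Sup K"] fbm_cov_sym[of H "Inf K"])

lemma cov_increment_eq:
  "cov_increment H K L = (\<bar>Inf L - Sup K\<bar> powr (2 * H) + \<bar>Sup L - Inf K\<bar> powr (2 * H)
    - \<bar>Sup L - Sup K\<bar> powr (2 * H) - \<bar>Inf L - Inf K\<bar> powr (2 * H)) / 2"
  by (simp add: cov_increment_def fbm_cov_def field_simps)

lemma cov_increment_self:
  assumes "0 < H" "Inf K \<le> Sup K"
  shows "cov_increment H K K = (Sup K - Inf K) powr (2 * H)"
  using assms by (simp add: cov_increment_eq)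

text \<open>With gap \<open>x\<close> and lengths \<open>p\<close> and \<open>s\<close>, negative
  correlation of separated increments is the exchange inequality for the concave power
  \<open>2 * H\<close>.\<close>

lemma cov_increment_nonpos:
  assumes H: "0 < H" "H < 1/2" and K: "Inf K \<le> Sup K" and L: "Inf L \<le> Sup L" and sep: "Sup K \<le> Inf L"
  shows "cov_increment H K L \<le> 0"
proof -
  define x p s where "x = Inf L - Sup K" and "p = Sup K - Inf K" and "s = Sup L - Inf L"
  have "x powr (2 * H) + (x + p + s) powr (2 * H) \<le> (x + s) powr (2 * H) + (x + p) powr (2 * H)"
    using assms by (intro powr_concave_exchange) (auto simp: x_def p_def s_def)
  moreover have "\<bar>Inf L - Sup K\<bar> = x" "\<bar>Sup L - Inf K\<bar> = x + p + s" "\<bar>Sup L - Sup K\<bar> = x + s" "\<bar>Inf L - Inf K\<bar> = x + p"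
    using assms by (auto simp: x_def p_def s_def)
  ultimately show ?thesis by (simp add: cov_increment_eq)
qed

text \<open>Diagonal dominance: the off-diagonal entries of a row are nonpositive and the whole row
  has a nonnegative sum, so the off-diagonal mass is at most the diagonal entry.\<close>

lemma cov_increment_sum:
  assumes H: "0 < H" "H < 1/2" and d: "d division_of {0..1}" and K: "K \<in> d"
  shows "(\<Sum>L\<in>d. \<bar>cov_increment H K L\<bar>) \<le> 2 * (Sup K - Inf K) powr (2 * H)"
proof -
  note e = division_of_interval_elem[OF d]
  have neg: "cov_increment H K L \<le> 0" if L: "L \<in> d" "L \<noteq> K" for L
  \<comment> \<open>A one-point cell has empty interior and may lie inside another cell, but all its
    covariances vanish.\<close>
  proof (cases "Inf K = Sup K \<or> Inf L = Sup L")
    case True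
    then show ?thesis by (auto simp: cov_increment_def)
  next
    case False
    then have lt: "Inf K < Sup K" "Inf L < Sup L" using e[OF K] e[OF L(1)] by auto
    have "interior K \<inter> interior L = {}" using d K L by (auto simp: division_of_def)
    then have int: "{Inf K<..<Sup K} \<inter> {Inf L<..<Sup L} = {}"
      using e(1)[OF K] e(1)[OF L(1)] by (metis interior_atLeastAtMost_real)
    have "Sup K \<le> Inf L \<or> Sup L \<le> Inf K"
    proof (rule ccontr)
      assume "\<not> ?thesis"
      then have "max (Inf K) (Inf L) < min (Sup K) (Sup L)" using lt by auto
      then obtain z where "max (Inf K) (Inf L) < z" "z < min (Sup K) (Sup L)" using dense by blast
      then show False using int by auto
    qed
    then show ?thesis
      using cov_increment_nonpos[OF H, of K L] cov_increment_nonpos[OF H, of L K] lt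
      by (auto simp: cov_increment_sym[of H L K])
  qed
  \<comment> \<open>Summed over \<open>L\<close>, the increments telescope to the covariance with
    the increment over \<open>{0..1}\<close>, which is nonnegative because powers with positive
    exponent increase.\<close>
  have total: "0 \<le> (\<Sum>L\<in>d. cov_increment H K L)"
  proof -
    have "(\<Sum>L\<in>d. cov_increment H K L) = (\<Sum>L\<in>d. (fbm_cov H (Sup K) (Sup L) - fbm_cov H (Inf K) (Sup L))
        - (fbm_cov H (Sup K) (Inf L) - fbm_cov H (Inf K) (Inf L)))"
      by (intro sum.cong) (auto simp: cov_increment_def)
    also have "\<dots> = (fbm_cov H (Sup K) 1 - fbm_cov H (Inf K) 1) - (fbm_cov H (Sup K) 0 - fbm_cov H (Inf K) 0)"
      by (rule sum_telescope_division[OF d, of "\<lambda>t. fbm_cov H (Sup K) t - fbm_cov H (Inf K) t"]) simp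
    also have "0 \<le> \<dots>"
    proof -
      have "(1 - Sup K) powr (2 * H) \<le> (1 - Inf K) powr (2 * H)" "Inf K powr (2 * H) \<le> Sup K powr (2 * H)"
        using e[OF K] H by (auto intro!: powr_mono2)
      then show ?thesis using e[OF K] H by (simp add: fbm_cov_def)
    qed
    finally show ?thesis .
  qed
  have self: "cov_increment H K K = (Sup K - Inf K) powr (2 * H)" using cov_increment_self e[OF K] H by blast
  have "(\<Sum>L\<in>d. \<bar>cov_increment H K L\<bar>) = \<bar>cov_increment H K K\<bar> + (\<Sum>L\<in>d - {K}. \<bar>cov_increment H K L\<bar>)"
    using d K by (intro sum.remove) (auto simp: division_of_def)
  also have "(\<Sum>L\<in>d - {K}. \<bar>cov_increment H K L\<bar>) = (\<Sum>L\<in>d - {K}. - cov_increment H K L)"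
    using neg by (intro sum.cong) auto
  also have "\<dots> = cov_increment H K K - (\<Sum>L\<in>d. cov_increment H K L)"
    using sum.remove[OF division_of_finite[OF d] K, of "cov_increment H K"] by (simp add: sum_negf)
  finally show ?thesis using total self by simp
qed

lemma rkhs_ip_sum:
  assumes "hilbert_space_on V ip" "finite A" "\<And>i. i \<in> A \<Longrightarrow> k i \<in> V" "h \<in> V"
  shows "sum k A \<in> V \<and> ip (sum k A) h = (\<Sum>i\<in>A. ip (k i) h)"
  using assms(2,3)
proof (induction A rule: finite_induct)
  case empty
  have V: "subspace V" and lin: "\<And>x y z a. x \<in> V \<Longrightarrow> y \<in> V \<Longrightarrow> z \<in> V \<Longrightarrow> ip (a *\<^sub>R x + y) z = a * ip x z + ip y z"
    using assms(1) by (auto simp: hilbert_space_on_def)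
  have "0 \<in> V" using V by (rule subspace_0)
  then show ?case using lin[of 0 0 h 1] assms(4) by simp
next
  case (insert i A)
  have V: "subspace V" and lin: "\<And>x y z a. x \<in> V \<Longrightarrow> y \<in> V \<Longrightarrow> z \<in> V \<Longrightarrow> ip (a *\<^sub>R x + y) z = a * ip x z + ip y z"
    using assms(1) by (auto simp: hilbert_space_on_def)
  show ?case using insert lin[of "k i" "sum k A" h 1] V assms(4) by (auto intro: subspace_add)
qed

lemma hilbert_space_onD:
  assumes "hilbert_space_on V ip"
  shows "subspace V" "x \<in> V \<Longrightarrow> y \<in> V \<Longrightarrow> ip x y = ip y x"
    "x \<in> V \<Longrightarrow> y \<in> V \<Longrightarrow> z \<in> V \<Longrightarrow> ip (a *\<^sub>R x + y) z = a * ip x z + ip y z"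
    "x \<in> V \<Longrightarrow> 0 \<le> ip x x"
proof -
  show V: "subspace V" and "x \<in> V \<Longrightarrow> y \<in> V \<Longrightarrow> ip x y = ip y x"
    and lin: "x \<in> V \<Longrightarrow> y \<in> V \<Longrightarrow> z \<in> V \<Longrightarrow> ip (a *\<^sub>R x + y) z = a * ip x z + ip y z" for x y z a
    using assms by (auto simp: hilbert_space_on_def)
  show "0 \<le> ip x x" if x: "x \<in> V"
  proof (cases "x = 0")
    case True
    have "0 \<in> V" using V by (rule subspace_0)
    then show ?thesis using lin[of 0 0 0 1] True by simp
  next
    case False
    have "\<forall>x\<in>V. x \<noteq> 0 \<longrightarrow> ip x x > 0" using assms unfolding hilbert_space_on_def by (elim conjE)
    then show ?thesis using False x by (simp add: less_imp_le)
  qed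
qed

text \<open>Duality again. Let \<open>s\<close> represent the functional that sums the increments of
  a path weighted by those of \<open>h\<close>. Then \<open>ip h s = Q\<close>, the energy of
  \<open>h\<close>, and diagonal dominance gives \<open>ip s s \<le> 2 * Q\<close>. Nonnegativity of
  the squared norm of \<open>h - s / 2\<close> reads \<open>Q \<le> ip h h + ip s s / 4\<close>,
  hence \<open>Q \<le> 2 * ip h h\<close>.\<close>

lemma fbm_energy:
  fixes V :: "(real \<Rightarrow> 'a::euclidean_space) set"
  assumes H: "0 < H" "H < 1/2" and cm: "fbm_cameron_martin H V ip" and h: "h \<in> V"
    and d: "d division_of {0..1}"
  shows "(\<Sum>K\<in>d. (norm (h (Sup K) - h (Inf K)))\<^sup>2 / (Sup K - Inf K) powr (2 * H)) \<le> 2 * ip h h"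
proof -
  have hs: "hilbert_space_on V ip" using cm by (simp add: fbm_cameron_martin_def is_rkhs_def)
  note V = hilbert_space_onD[OF hs]
  note e = division_of_interval_elem[OF d]
  have fd: "finite d" using division_of_finite[OF d] .
  define \<kappa> :: "real \<Rightarrow> 'a \<Rightarrow> real \<Rightarrow> 'a" where "\<kappa> t a = (\<lambda>s. if s \<in> {0..1} then fbm_cov H s t *\<^sub>R a else 0)" for t a
  have \<kappa>: "\<kappa> t a \<in> V" "g \<in> V \<Longrightarrow> ip g (\<kappa> t a) = g t \<bullet> a" if "t \<in> {0..1}" for t a g
    using cm that unfolding fbm_cameron_martin_def is_rkhs_def \<kappa>_def by blast+
  define \<delta> where "\<delta> K = (Sup K - Inf K) powr (2 * H)" for K :: "real set"
  define w where "w K = (1 / \<delta> K) *\<^sub>R (h (Sup K) - h (Inf K))" for K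
  define k where "k K = (-1) *\<^sub>R \<kappa> (Inf K) (w K) + \<kappa> (Sup K) (w K)" for K
  have pts: "Inf K \<in> {0..1}" "Sup K \<in> {0..1}" if "K \<in> d" for K using e[OF that] by auto
  have kV: "k K \<in> V" if "K \<in> d" for K
    unfolding k_def using V(1) \<kappa>(1) pts[OF that] by (intro subspace_add subspace_scale)
  have ipk: "ip g (k K) = (g (Sup K) - g (Inf K)) \<bullet> w K" if "K \<in> d" "g \<in> V" for g K
  proof -
    note p = pts[OF that(1)]
    have "ip g (k K) = ip (k K) g" by (rule V(2)[OF that(2) kV[OF that(1)]])
    also have "\<dots> = -1 * ip (\<kappa> (Inf K) (w K)) g + ip (\<kappa> (Sup K) (w K)) g"
      unfolding k_def by (rule V(3)) (use \<kappa>(1) p that in auto)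
    also have "\<dots> = - (g (Inf K) \<bullet> w K) + g (Sup K) \<bullet> w K"
      using V(2)[OF \<kappa>(1) that(2)] \<kappa>(2)[OF _ that(2)] p by simp
    finally show ?thesis by (simp add: inner_diff_left)
  qed
  define s where "s = sum k d"
  have sV: "s \<in> V" using rkhs_ip_sum[OF hs fd, of k, OF kV h] unfolding s_def by blast
  have ips: "ip s g = (\<Sum>K\<in>d. ip (k K) g)" if "g \<in> V" for g
    using rkhs_ip_sum[OF hs fd, of k, OF kV that] unfolding s_def by blast
  have ips': "ip g s = (\<Sum>K\<in>d. (g (Sup K) - g (Inf K)) \<bullet> w K)" if g: "g \<in> V" for g
  proof -
    have "ip g s = (\<Sum>K\<in>d. ip (k K) g)" using V(2)[OF g sV] ips[OF g] by simp
    also have "\<dots> = (\<Sum>K\<in>d. ip g (k K))" using V(2)[OF kV g] by (intro sum.cong) auto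
    finally show ?thesis using ipk[OF _ g] by simp
  qed
  define Q where "Q = (\<Sum>K\<in>d. (norm (h (Sup K) - h (Inf K)))\<^sup>2 / \<delta> K)"
  have hQ: "ip h s = Q"
    unfolding ips'[OF h] Q_def by (intro sum.cong) (auto simp: w_def power2_norm_eq_inner)
  \<comment> \<open>For a one-point cell \<open>\<delta> K\<close> is 0 and so is
    \<open>w K\<close>, by the convention on division by 0; both sides vanish.\<close>
  have wQ: "(norm (w K))\<^sup>2 * \<delta> K = (norm (h (Sup K) - h (Inf K)))\<^sup>2 / \<delta> K" for K
    by (cases "\<delta> K = 0") (auto simp: w_def power2_eq_square)
  have s_at: "s t = (\<Sum>L\<in>d. (fbm_cov H t (Sup L) - fbm_cov H t (Inf L)) *\<^sub>R w L)" if "t \<in> {0..1}" for t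
  proof -
    have "s t = (\<Sum>L\<in>d. k L t)"
      unfolding s_def using fd by (induction d rule: finite_induct) (auto simp: plus_fun_def zero_fun_def)
    then show ?thesis
      using that by (auto simp: k_def \<kappa>_def plus_fun_def scaleR_fun_def scaleR_diff_left intro!: sum.cong)
  qed
  have "ip s s = (\<Sum>K\<in>d. \<Sum>L\<in>d. cov_increment H K L * (w L \<bullet> w K))"
  proof -
    have "(s (Sup K) - s (Inf K)) \<bullet> w K = (\<Sum>L\<in>d. cov_increment H K L * (w L \<bullet> w K))" if K: "K \<in> d" for K
    proof -
      have "s (Sup K) - s (Inf K) = (\<Sum>L\<in>d. cov_increment H K L *\<^sub>R w L)"
        unfolding s_at[OF pts(1)[OF K]] s_at[OF pts(2)[OF K]] sum_subtractf[symmetric]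
        by (intro sum.cong) (auto simp: cov_increment_def algebra_simps)
      then show ?thesis by (simp add: inner_sum_left)
    qed
    then show ?thesis unfolding ips'[OF sV] by (intro sum.cong) auto
  qed
  \<comment> \<open>Schur's test: each product is split evenly between its two factors, and symmetry
    of the covariances lets both halves be summed by rows.\<close>
  also have "\<dots> \<le> (\<Sum>K\<in>d. \<Sum>L\<in>d. \<bar>cov_increment H K L\<bar> * ((norm (w L))\<^sup>2 / 2) + \<bar>cov_increment H K L\<bar> * ((norm (w K))\<^sup>2 / 2))"
  proof (intro sum_mono)
    fix K L
    have "cov_increment H K L * (w L \<bullet> w K) \<le> \<bar>cov_increment H K L\<bar> * \<bar>w L \<bullet> w K\<bar>"
      by (metis abs_ge_self abs_mult)
    also have "\<dots> \<le> \<bar>cov_increment H K L\<bar> * ((norm (w L))\<^sup>2 / 2 + (norm (w K))\<^sup>2 / 2)"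
    proof (rule mult_left_mono)
      have "\<bar>w L \<bullet> w K\<bar> \<le> norm (w L) * norm (w K)" by (rule Cauchy_Schwarz_ineq2)
      then show "\<bar>w L \<bullet> w K\<bar> \<le> (norm (w L))\<^sup>2 / 2 + (norm (w K))\<^sup>2 / 2"
        using sum_squares_bound[of "norm (w L)" "norm (w K)"] by simp
    qed simp
    finally show "cov_increment H K L * (w L \<bullet> w K)
      \<le> \<bar>cov_increment H K L\<bar> * ((norm (w L))\<^sup>2 / 2) + \<bar>cov_increment H K L\<bar> * ((norm (w K))\<^sup>2 / 2)"
      by (simp add: distrib_left)
  qed
  also have "\<dots> = (\<Sum>L\<in>d. \<Sum>K\<in>d. \<bar>cov_increment H L K\<bar> * ((norm (w L))\<^sup>2 / 2))
      + (\<Sum>K\<in>d. \<Sum>L\<in>d. \<bar>cov_increment H K L\<bar> * ((norm (w K))\<^sup>2 / 2))"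
    unfolding sum.distrib by (subst sum.swap) (simp add: cov_increment_sym)
  also have "\<dots> = (\<Sum>K\<in>d. (\<Sum>L\<in>d. \<bar>cov_increment H K L\<bar>) * (norm (w K))\<^sup>2)"
    by (simp add: sum_distrib_right[symmetric] flip: sum.distrib)
  also have "\<dots> \<le> (\<Sum>K\<in>d. 2 * \<delta> K * (norm (w K))\<^sup>2)"
    unfolding \<delta>_def by (intro sum_mono mult_right_mono cov_increment_sum[OF H d]) auto
  also have "\<dots> = 2 * Q"
    unfolding Q_def sum_distrib_left wQ[symmetric] by (intro sum.cong) (auto simp: mult_ac)
  finally have ss: "ip s s \<le> 2 * Q" .
  define y where "y = (-1/2) *\<^sub>R s + h"
  have yV: "y \<in> V" unfolding y_def using V(1) sV h by (intro subspace_add subspace_scale)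
  have "ip y y = (-1/2) * ip s y + ip h y" unfolding y_def by (rule V(3)) (use sV h yV y_def in auto)
  also have "ip s y = (-1/2) * ip s s + Q"
    using V(2)[OF sV yV] V(3)[OF sV h sV, of "-1/2"] hQ by (simp add: y_def)
  also have "ip h y = (-1/2) * Q + ip h h"
    using V(2)[OF h yV] V(3)[OF sV h h, of "-1/2"] V(2)[OF sV h] hQ by (simp add: y_def)
  finally have "0 \<le> ip s s / 4 - Q + ip h h" using V(4)[OF yV] by simp
  then show ?thesis using ss by (simp add: Q_def \<delta>_def)
qed

text \<open>The kernel section at time 0 is the zero function, so the reproducing property pairs
  \<open>h 0\<close> to 0 with every vector.\<close>

lemma fbm_vanishes_at_0:
  assumes "fbm_cameron_martin H V ip" "h \<in> V"
  shows "h 0 = 0"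
proof -
  have hs: "hilbert_space_on V ip" using assms by (simp add: fbm_cameron_martin_def is_rkhs_def)
  have "h 0 \<bullet> a = 0" for a
  proof -
    have z: "(\<lambda>s. if s \<in> {0..1} then fbm_cov H s 0 *\<^sub>R a else 0) = 0"
      by (intro ext) (simp add: fbm_cov_def)
    have "ip h (\<lambda>s. if s \<in> {0..1} then fbm_cov H s 0 *\<^sub>R a else 0) = h 0 \<bullet> a"
    proof -
      have "(0::real) \<in> {0..1}" by simp
      then show ?thesis using assms unfolding fbm_cameron_martin_def is_rkhs_def by blast
    qed
    then have "h 0 \<bullet> a = ip h 0" unfolding z by simp
    moreover have "0 \<in> V" using hilbert_space_onD(1)[OF hs] by (rule subspace_0)
    then have "ip 0 h = 0" using hilbert_space_onD(3)[OF hs, of 0 0 h 1] assms(2) by simp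
    ultimately show ?thesis using hilbert_space_onD(2)[OF hs assms(2) \<open>0 \<in> V\<close>] by simp
  qed
  from this[of "h 0"] show ?thesis by simp
qed

section \<open>Brownian motion\<close>

text \<open>Cells of a partial division do not overlap, so their lengths add up to the measure of
  their union, which lies in \<open>U\<close>. This supplies the smallness that absolute continuity
  asks for.\<close>

lemma sum_length_lt_of_cover:
  fixes p :: "(real \<times> real set) set"
  assumes p: "p tagged_partial_division_of S" and U: "\<And>x K. (x, K) \<in> p \<Longrightarrow> K \<subseteq> U"
    and mU: "U \<in> sets lebesgue" "emeasure lebesgue U < ennreal \<delta>"
  shows "(snd ` p) division_of \<Union> (snd ` p)" "(\<Sum>K\<in>snd ` p. Sup K - Inf K) < \<delta>"
proof -
  show div: "(snd ` p) division_of \<Union> (snd ` p)" by (rule partial_division_of_tagged_division[OF p])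
  have meas: "\<Union> (snd ` p) \<in> lmeasurable" using div by (rule lmeasurable_division)
  have "(\<Sum>K\<in>snd ` p. Sup K - Inf K) = (\<Sum>K\<in>snd ` p. measure lebesgue K)"
  proof (rule sum.cong[OF refl])
    fix K assume K: "K \<in> snd ` p"
    then obtain a b where "K = cbox a b" "K \<noteq> {}" using division_ofD(3,4)[OF div] by metis
    then show "Sup K - Inf K = measure lebesgue K" by auto
  qed
  also have "\<dots> = measure lebesgue (\<Union> (snd ` p))" by (rule content_division[OF div])
  also have "\<dots> < \<delta>"
  proof -
    have "\<Union> (snd ` p) \<subseteq> U" using U by fastforce
    then have "emeasure lebesgue (\<Union> (snd ` p)) \<le> emeasure lebesgue U"
      using mU(1) by (rule emeasure_mono)
    then have "emeasure lebesgue (\<Union> (snd ` p)) < ennreal \<delta>" using mU(2) by simp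
    then have "ennreal (measure lebesgue (\<Union> (snd ` p))) < ennreal \<delta>"
      using emeasure_eq_measure2[OF meas] by simp
    then show ?thesis by (simp add: ennreal_less_iff)
  qed
  finally show "(\<Sum>K\<in>snd ` p. Sup K - Inf K) < \<delta>" .
qed

text \<open>The straddle lemma of gauge integration: the remainders at both ends are small relative
  to their distances from \<open>t\<close>, and for \<open>u \<le> t \<le> v\<close> these distances
  add up to \<open>v - u\<close>.\<close>

lemma has_vector_derivative_straddle:
  fixes k :: "real \<Rightarrow> 'a::real_normed_vector"
  assumes "(k has_vector_derivative D) (at t)" "0 < e"
  obtains d where "0 < d" "\<And>u v. u \<le> t \<Longrightarrow> t \<le> v \<Longrightarrow> {u..v} \<subseteq> ball t d \<Longrightarrow>
    norm ((v - u) *\<^sub>R D - (k v - k u)) \<le> e * (v - u)"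
proof -
  obtain d where d: "0 < d" "\<And>y. norm (y - t) < d \<Longrightarrow> norm (k y - k t - (y - t) *\<^sub>R D) \<le> e * norm (y - t)"
    using assms unfolding has_vector_derivative_def has_derivative_at_alt by blast
  show ?thesis
  proof (rule that[OF d(1)])
    fix u v assume uv: "u \<le> t" "t \<le> v" "{u..v} \<subseteq> ball t d"
    then have "u \<in> {u..v}" "v \<in> {u..v}" by auto
    then have "u \<in> ball t d" "v \<in> ball t d" using uv(3) by blast+
    then have n: "norm (u - t) < d" "norm (v - t) < d" by (auto simp: dist_norm norm_minus_commute)
    have "(v - u) *\<^sub>R D - (k v - k u) = (k u - k t - (u - t) *\<^sub>R D) - (k v - k t - (v - t) *\<^sub>R D)"
      by (simp add: algebra_simps)
    also have "norm \<dots> \<le> e * norm (u - t) + e * norm (v - t)"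
      by (rule order_trans[OF norm_triangle_ineq4 add_mono[OF d(2)[OF n(1)] d(2)[OF n(2)]]])
    also have "\<dots> = e * (v - u)" using uv by (simp add: algebra_simps)
    finally show "norm ((v - u) *\<^sub>R D - (k v - k u)) \<le> e * (v - u)" .
  qed
qed

text \<open>On the exceptional null set the gauge confines the division to an open set of small measure, where
  absolute continuity controls the increments.\<close>

lemma absolutely_continuous_path_FTC:
  fixes k :: "real \<Rightarrow> 'a::euclidean_space"
  assumes ac: "absolutely_continuous_path k"
    and diff: "AE t in lebesgue. t \<in> {0..1} \<longrightarrow> k differentiable (at t)"
    and ab: "0 \<le> a" "a \<le> b" "b \<le> 1"
  shows "((\<lambda>t. vector_derivative k (at t)) has_integral (k b - k a)) {a..b}"
proof -
  obtain N where N: "N \<in> null_sets lebesgue" "{t \<in> space lebesgue. \<not> (t \<in> {0..1} \<longrightarrow> k differentiable (at t))} \<subseteq> N"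
    using diff by (auto elim: AE_E3 simp: eventually_ae_filter)
  have dN: "k differentiable (at t)" if "t \<in> {0..1}" "t \<notin> N" for t using N(2) that by auto
  \<comment> \<open>With the integrand set to 0 on the exceptional set, only increments of
    \<open>k\<close> remain to be estimated there.\<close>
  define f where "f t = (if t \<in> N then 0 else vector_derivative k (at t))" for t
  have "(f has_integral (k b - k a)) {a..b}"
    unfolding has_integral_real
  proof (intro allI impI)
    fix e :: real assume e: "0 < e"
    then have "0 < e / 2" by simp
    then obtain \<delta> where \<delta>: "0 < \<delta>" "\<And>d T. d division_of T \<Longrightarrow> T \<subseteq> {0..1} \<Longrightarrow> (\<Sum>K\<in>d. Sup K - Inf K) < \<delta> \<Longrightarrow>
      (\<Sum>K\<in>d. norm (k (Sup K) - k (Inf K))) < e / 2"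
      using ac unfolding absolutely_continuous_path_def by metis
    have Nl: "N \<in> sets lebesgue" using N(1) by auto
    obtain U where U: "open U" "N \<subseteq> U" "U - N \<in> lmeasurable" "emeasure lebesgue (U - N) < ennreal \<delta>"
      using sets_lebesgue_outer_open[OF Nl \<delta>(1)] by metis
    have Ul: "U \<in> sets lebesgue" using U(1) by (simp add: borel_open)
    \<comment> \<open>The outer open set exceeds \<open>N\<close> by little, and \<open>N\<close> is
      null, so the open set itself is small.\<close>
    have mU: "emeasure lebesgue U < ennreal \<delta>"
      using U(4) emeasure_Diff_null_set[OF N(1) Ul] by simp
    define \<epsilon> where "\<epsilon> = e / 4"
    have \<epsilon>: "0 < \<epsilon>" using e by (simp add: \<epsilon>_def)
    have "\<exists>d. 0 < d \<and> (t \<in> {0..1} - N \<longrightarrow> (\<forall>u v. u \<le> t \<longrightarrow> t \<le> v \<longrightarrow> {u..v} \<subseteq> ball t d \<longrightarrow>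
      norm ((v - u) *\<^sub>R vector_derivative k (at t) - (k v - k u)) \<le> \<epsilon> * (v - u)))" for t
    proof (cases "t \<in> {0..1} - N")
      case True
      then have "(k has_vector_derivative vector_derivative k (at t)) (at t)"
        using dN[of t] vector_derivative_works by auto
      from has_vector_derivative_straddle[OF this \<epsilon>] show ?thesis by metis
    next
      case False
      then show ?thesis using zero_less_one by blast
    qed
    then obtain d where d: "\<And>t. 0 < d t" "\<And>t u v. t \<in> {0..1} - N \<Longrightarrow> u \<le> t \<Longrightarrow> t \<le> v \<Longrightarrow> {u..v} \<subseteq> ball t (d t) \<Longrightarrow>
      norm ((v - u) *\<^sub>R vector_derivative k (at t) - (k v - k u)) \<le> \<epsilon> * (v - u)"
      by metis
    define \<gamma> where "\<gamma> t = (if t \<in> N then U else ball t (d t))" for t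
    have g: "gauge \<gamma>" using U(1,2) d(1) by (auto simp: gauge_def \<gamma>_def)
    show "\<exists>\<gamma>. gauge \<gamma> \<and> (\<forall>\<D>. \<D> tagged_division_of {a..b} \<and> \<gamma> fine \<D> \<longrightarrow>
        norm ((\<Sum>(x, K)\<in>\<D>. measure lborel K *\<^sub>R f x) - (k b - k a)) < e)"
    proof (intro exI[of _ \<gamma>] conjI g allI impI)
      fix p assume "p tagged_division_of {a..b} \<and> \<gamma> fine p"
      then have p: "p tagged_division_of {a..b}" and fine: "\<gamma> fine p" by auto
      have fp: "finite p" using p by blast
      define p1 where "p1 = {z \<in> p. fst z \<in> N}"
      define p2 where "p2 = {z \<in> p. fst z \<notin> N}"
      have p12: "p = p1 \<union> p2" "p1 \<inter> p2 = {}" "p1 \<subseteq> p" "p2 \<subseteq> p" by (auto simp: p1_def p2_def)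
      define \<Delta> where "\<Delta> K = k (Sup K) - k (Inf K)" for K
      have elem: "K = {Inf K..Sup K} \<and> Inf K \<le> x \<and> x \<le> Sup K \<and> a \<le> Inf K \<and> Sup K \<le> b \<and> measure lborel K = Sup K - Inf K"
        if xK: "(x, K) \<in> p" for x K
      proof -
        obtain l u where K: "K = cbox l u" "x \<in> K" "K \<subseteq> {a..b}" using tagged_division_ofD(2-4)[OF p xK] by metis
        then have "l \<le> u" by auto
        then show ?thesis using K by auto
      qed
      have "(\<Sum>(x, K)\<in>p. measure lborel K *\<^sub>R f x) - (k b - k a) = (\<Sum>(x, K)\<in>p. measure lborel K *\<^sub>R f x - \<Delta> K)"
        using additive_tagged_division_1[OF ab(2) p, of k]
        by (simp add: \<Delta>_def case_prod_unfold sum_subtractf)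
      also have "\<dots> = (\<Sum>(x, K)\<in>p1. measure lborel K *\<^sub>R f x - \<Delta> K) + (\<Sum>(x, K)\<in>p2. measure lborel K *\<^sub>R f x - \<Delta> K)"
        using p12 fp by (subst p12(1)) (intro sum.union_disjoint, auto intro: finite_subset)
      finally have split: "norm ((\<Sum>(x, K)\<in>p. measure lborel K *\<^sub>R f x) - (k b - k a))
        \<le> norm (\<Sum>(x, K)\<in>p1. measure lborel K *\<^sub>R f x - \<Delta> K) + norm (\<Sum>(x, K)\<in>p2. measure lborel K *\<^sub>R f x - \<Delta> K)"
        by (simp only: norm_triangle_ineq)
      have part: "p1 tagged_partial_division_of {a..b}"
        using p p12(3) unfolding tagged_division_of_def by (meson tagged_partial_division_subset)
      have "norm (\<Sum>(x, K)\<in>p1. measure lborel K *\<^sub>R f x - \<Delta> K) \<le> (\<Sum>(x, K)\<in>p1. norm (\<Delta> K))"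
        by (rule sum_norm_le) (auto simp: p1_def f_def)
      \<comment> \<open>The guard for the empty set makes the summand vanish on every box of empty
        interior, which the passage from tagged pairs to cells requires.\<close>
      also have "\<dots> = (\<Sum>(x, K)\<in>p1. if K = {} then 0 else norm (\<Delta> K))"
        using tagged_partial_division_ofD(2)[OF part] by (intro sum.cong) fastforce+
      also have "\<dots> = (\<Sum>K\<in>snd ` p1. if K = {} then 0 else norm (\<Delta> K))"
      proof (rule sum.over_tagged_division_lemma[OF tagged_partial_division_of_Union_self[OF part]])
        fix u v :: real assume "box u v = {}"
        then have "v \<le> u" by simp
        then show "(if cbox u v = {} then 0 else norm (\<Delta> (cbox u v))) = 0" by (cases "u = v") (auto simp: \<Delta>_def)
      qed
      also have "\<dots> \<le> (\<Sum>K\<in>snd ` p1. norm (\<Delta> K))"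
        by (rule sum_mono) simp
      also have "\<dots> < e / 2"
        unfolding \<Delta>_def
      proof (rule \<delta>(2))
        have sub: "K \<subseteq> U" if "(x, K) \<in> p1" for x K
        proof -
          have "K \<subseteq> \<gamma> x" using fine that p12(3) by (auto simp only: fine_def)
          then show ?thesis using that by (simp add: p1_def \<gamma>_def)
        qed
        show "snd ` p1 division_of \<Union> (snd ` p1)" "(\<Sum>K\<in>snd ` p1. Sup K - Inf K) < \<delta>"
          using sum_length_lt_of_cover[OF part sub Ul mU] by auto
        have "K \<subseteq> {0..1}" if "(x, K) \<in> p" for x K
          using tagged_division_ofD(3)[OF p that] ab by auto
        then show "\<Union> (snd ` p1) \<subseteq> {0..1}" using p12(3) by fastforce
      qed
      finally have b1: "norm (\<Sum>(x, K)\<in>p1. measure lborel K *\<^sub>R f x - \<Delta> K) < e / 2" .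
      have "norm (\<Sum>(x, K)\<in>p2. measure lborel K *\<^sub>R f x - \<Delta> K) \<le> (\<Sum>(x, K)\<in>p2. \<epsilon> * measure lborel K)"
      proof (rule sum_norm_le, clarify)
        fix x K assume xK: "(x, K) \<in> p2"
        then have xp: "(x, K) \<in> p" "x \<notin> N" by (auto simp: p2_def)
        note el = elem[OF xp(1)]
        have "x \<in> {0..1} - N" using xp(2) el ab by auto
        moreover have "K \<subseteq> \<gamma> x" using fine xp(1) by (auto simp only: fine_def)
        then have "{Inf K..Sup K} \<subseteq> ball x (d x)"
          using el xp(2) by (metis \<gamma>_def)
        ultimately have "norm ((Sup K - Inf K) *\<^sub>R vector_derivative k (at x) - (k (Sup K) - k (Inf K))) \<le> \<epsilon> * (Sup K - Inf K)"
          using el by (intro d(2)) auto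
        then show "norm (measure lborel K *\<^sub>R f x - \<Delta> K) \<le> \<epsilon> * measure lborel K"
          using el xp(2) by (simp add: f_def \<Delta>_def)
      qed
      also have "\<dots> \<le> (\<Sum>(x, K)\<in>p. \<epsilon> * measure lborel K)"
        using fp p12 \<epsilon> by (intro sum_mono2) auto
      also have "\<dots> = \<epsilon> * (\<Sum>(x, K)\<in>p. measure lborel K)" by (simp add: sum_distrib_left case_prod_unfold)
      also have "(\<Sum>(x, K)\<in>p. measure lborel K) = b - a"
        using additive_content_tagged_division[of p a b] p ab by simp
      also have "\<epsilon> * (b - a) \<le> e / 4" using \<epsilon> ab mult_left_mono[of "b - a" 1 \<epsilon>] by (simp add: \<epsilon>_def)
      finally have b2: "norm (\<Sum>(x, K)\<in>p2. measure lborel K *\<^sub>R f x - \<Delta> K) \<le> e / 4" .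
      show "norm ((\<Sum>(x, K)\<in>p. measure lborel K *\<^sub>R f x) - (k b - k a)) < e"
        using split b1 b2 e by linarith
    qed
  qed
  moreover have "negligible N" using N(1) by (simp add: negligible_iff_null_sets)
  ultimately show ?thesis
    by (rule has_integral_spike[rotated 2]) (auto simp: f_def)
qed

section \<open>The Brownian space and its energy\<close>

definition unit_derivative :: "(real \<Rightarrow> 'a::euclidean_space) \<Rightarrow> real \<Rightarrow> 'a"
  where "unit_derivative k t = indicator {0..1} t *\<^sub>R vector_derivative k (at t)"

lemma bm_cameron_martinD:
  assumes "k \<in> bm_cameron_martin"
  shows "absolutely_continuous_path k" "k 0 = 0" "t \<notin> {0..1} \<Longrightarrow> k t = 0"
    "AE t in lebesgue. t \<in> {0..1} \<longrightarrow> k differentiable (at t)"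
    "set_integrable lebesgue {0..1} (\<lambda>t. (norm (vector_derivative k (at t)))\<^sup>2)"
  using assms by (auto simp: bm_cameron_martin_def)

text \<open>Measurability comes with the fundamental theorem: the derivative is gauge integrable,
  hence Lebesgue measurable.\<close>

lemma unit_derivative_measurable:
  assumes "k \<in> bm_cameron_martin"
  shows "unit_derivative k \<in> borel_measurable lebesgue"
  using has_integral_implies_lebesgue_measurable[OF absolutely_continuous_path_FTC[OF bm_cameron_martinD(1,4)[OF assms], of 0 1]]
  by (simp add: unit_derivative_def[abs_def])

lemma unit_derivative_square_integrable:
  assumes "k \<in> bm_cameron_martin"
  shows "integrable lebesgue (\<lambda>t. (norm (unit_derivative k t))\<^sup>2)"
proof -
  have "(\<lambda>t. (norm (unit_derivative k t))\<^sup>2) = (\<lambda>t. indicator {0..1} t *\<^sub>R (norm (vector_derivative k (at t)))\<^sup>2)"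
    by (auto simp: unit_derivative_def indicator_def)
  then show ?thesis using bm_cameron_martinD(5)[OF assms] by (simp add: set_integrable_def)
qed

lemma unit_derivative_inner_integrable:
  assumes "f \<in> bm_cameron_martin" "k \<in> bm_cameron_martin"
  shows "integrable lebesgue (\<lambda>t. unit_derivative f t \<bullet> unit_derivative k t)"
proof (rule Bochner_Integration.integrable_bound)
  show "integrable lebesgue (\<lambda>t. (norm (unit_derivative f t))\<^sup>2 + (norm (unit_derivative k t))\<^sup>2)"
    by (intro Bochner_Integration.integrable_add unit_derivative_square_integrable assms)
  show "(\<lambda>t. unit_derivative f t \<bullet> unit_derivative k t) \<in> borel_measurable lebesgue"
    by (intro borel_measurable_inner unit_derivative_measurable assms)
  have "\<bar>u \<bullet> v\<bar> \<le> (norm u)\<^sup>2 + (norm v)\<^sup>2" for u v :: 'a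
  proof -
    have "\<bar>u \<bullet> v\<bar> \<le> norm u * norm v" by (rule Cauchy_Schwarz_ineq2)
    moreover have "0 \<le> norm u * norm v" by simp
    ultimately show ?thesis using sum_squares_bound[of "norm u" "norm v"] by linarith
  qed
  then show "AE t in lebesgue. norm (unit_derivative f t \<bullet> unit_derivative k t)
      \<le> norm ((norm (unit_derivative f t))\<^sup>2 + (norm (unit_derivative k t))\<^sup>2)"
    by auto
qed

lemma bm_ip_eq: "bm_ip f k = (LINT t|lebesgue. unit_derivative f t \<bullet> unit_derivative k t)"
  unfolding bm_ip_def set_lebesgue_integral_def
  by (intro Bochner_Integration.integral_cong) (auto simp: unit_derivative_def indicator_def)

lemma unit_derivative_linear:
  assumes "f \<in> bm_cameron_martin" "k \<in> bm_cameron_martin"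
  shows "AE t in lebesgue. unit_derivative (a *\<^sub>R f + k) t = a *\<^sub>R unit_derivative f t + unit_derivative k t"
    "AE t in lebesgue. t \<in> {0..1} \<longrightarrow> (a *\<^sub>R f + k) differentiable (at t)"
proof -
  have fk: "a *\<^sub>R f + k = (\<lambda>t. a *\<^sub>R f t + k t)" by (simp add: fun_eq_iff scaleR_fun_def)
  have *: "((\<lambda>t. a *\<^sub>R f t + k t) has_vector_derivative (a *\<^sub>R vector_derivative f (at t) + vector_derivative k (at t))) (at t)"
    if "f differentiable (at t)" "k differentiable (at t)" for t
    using that unfolding vector_derivative_works
    by (intro has_vector_derivative_add bounded_linear.has_vector_derivative[OF bounded_linear_scaleR_right])
  show "AE t in lebesgue. unit_derivative (a *\<^sub>R f + k) t = a *\<^sub>R unit_derivative f t + unit_derivative k t"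
    using bm_cameron_martinD(4)[OF assms(1)] bm_cameron_martinD(4)[OF assms(2)]
  proof eventually_elim
    case (elim t)
    then show ?case
      unfolding fk using vector_derivative_at[OF *, of t]
      by (cases "t \<in> {0..1}") (auto simp: unit_derivative_def indicator_def)
  qed
  show "AE t in lebesgue. t \<in> {0..1} \<longrightarrow> (a *\<^sub>R f + k) differentiable (at t)"
    using bm_cameron_martinD(4)[OF assms(1)] bm_cameron_martinD(4)[OF assms(2)]
  proof eventually_elim
    case (elim t)
    then show ?case unfolding fk using * differentiableI_vector by blast
  qed
qed

lemma absolutely_continuous_path_linear:
  assumes "absolutely_continuous_path f" "absolutely_continuous_path k"
  shows "absolutely_continuous_path (a *\<^sub>R f + k)"
  unfolding absolutely_continuous_path_def
proof (intro allI impI)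
  fix e :: real assume e: "0 < e"
  define e' where "e' = e / (\<bar>a\<bar> + 1)"
  have a1: "0 < \<bar>a\<bar> + 1" by simp
  have e': "0 < e'" using e a1 by (simp add: e'_def)
  have "(\<bar>a\<bar> + 1) * e' = e" unfolding e'_def using a1 by simp
  then have ee: "\<bar>a\<bar> * e' + e' = e" by (simp add: distrib_right)
  obtain d1 where d1: "0 < d1" "\<And>d T. d division_of T \<Longrightarrow> T \<subseteq> {0..1} \<Longrightarrow> (\<Sum>K\<in>d. Sup K - Inf K) < d1 \<Longrightarrow>
      (\<Sum>K\<in>d. norm (f (Sup K) - f (Inf K))) < e'"
    using assms(1) e' unfolding absolutely_continuous_path_def by metis
  obtain d2 where d2: "0 < d2" "\<And>d T. d division_of T \<Longrightarrow> T \<subseteq> {0..1} \<Longrightarrow> (\<Sum>K\<in>d. Sup K - Inf K) < d2 \<Longrightarrow>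
      (\<Sum>K\<in>d. norm (k (Sup K) - k (Inf K))) < e'"
    using assms(2) e' unfolding absolutely_continuous_path_def by metis
  show "\<exists>\<delta>>0. \<forall>d T. d division_of T \<and> T \<subseteq> {0..1} \<and> (\<Sum>K\<in>d. Sup K - Inf K) < \<delta> \<longrightarrow>
    (\<Sum>K\<in>d. norm ((a *\<^sub>R f + k) (Sup K) - (a *\<^sub>R f + k) (Inf K))) < e"
  proof (intro exI[of _ "min d1 d2"] conjI allI impI)
    fix d and T :: "real set" assume d: "d division_of T \<and> T \<subseteq> {0..1} \<and> (\<Sum>K\<in>d. Sup K - Inf K) < min d1 d2"
    have "norm ((a *\<^sub>R f + k) (Sup K) - (a *\<^sub>R f + k) (Inf K))
      \<le> \<bar>a\<bar> * norm (f (Sup K) - f (Inf K)) + norm (k (Sup K) - k (Inf K))" for K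
    proof -
      have "(a *\<^sub>R f + k) (Sup K) - (a *\<^sub>R f + k) (Inf K) = a *\<^sub>R (f (Sup K) - f (Inf K)) + (k (Sup K) - k (Inf K))"
        by (simp add: scaleR_fun_def algebra_simps)
      then show ?thesis
        using norm_triangle_ineq[of "a *\<^sub>R (f (Sup K) - f (Inf K))" "k (Sup K) - k (Inf K)"]
        by (simp only: norm_scaleR)
    qed
    then have "(\<Sum>K\<in>d. norm ((a *\<^sub>R f + k) (Sup K) - (a *\<^sub>R f + k) (Inf K)))
      \<le> (\<Sum>K\<in>d. \<bar>a\<bar> * norm (f (Sup K) - f (Inf K)) + norm (k (Sup K) - k (Inf K)))"
      by (rule sum_mono)
    also have "\<dots> = \<bar>a\<bar> * (\<Sum>K\<in>d. norm (f (Sup K) - f (Inf K))) + (\<Sum>K\<in>d. norm (k (Sup K) - k (Inf K)))"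
      by (simp add: sum.distrib sum_distrib_left)
    also have "\<dots> < \<bar>a\<bar> * e' + e'"
      using d by (intro add_le_less_mono mult_left_mono less_imp_le[OF d1(2)] d2(2)) auto
    finally show "(\<Sum>K\<in>d. norm ((a *\<^sub>R f + k) (Sup K) - (a *\<^sub>R f + k) (Inf K))) < e" using ee by simp
  qed (use d1 d2 in auto)
qed

text \<open>Square integrability follows from |a u + v|^2 \<le> 2 a^2 |u|^2 + 2 |v|^2 almost
  everywhere. Measurability of the derivative again rests on the fundamental theorem, so absolute
  continuity of the combination comes before it.\<close>

lemma bm_cameron_martin_linear:
  assumes f: "f \<in> bm_cameron_martin" and k: "k \<in> bm_cameron_martin"
  shows "a *\<^sub>R f + k \<in> bm_cameron_martin"
proof -
  let ?g = "a *\<^sub>R f + k"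
  note F = bm_cameron_martinD[OF f] and K = bm_cameron_martinD[OF k]
  have ac: "absolutely_continuous_path ?g" by (rule absolutely_continuous_path_linear[OF F(1) K(1)])
  have diff: "AE t in lebesgue. t \<in> {0..1} \<longrightarrow> ?g differentiable (at t)" by (rule unit_derivative_linear[OF f k])
  have meas: "unit_derivative ?g \<in> borel_measurable lebesgue"
    using has_integral_implies_lebesgue_measurable[OF absolutely_continuous_path_FTC[OF ac diff, of 0 1]]
    by (simp add: unit_derivative_def[abs_def])
  have "integrable lebesgue (\<lambda>t. (norm (unit_derivative ?g t))\<^sup>2)"
  proof (rule Bochner_Integration.integrable_bound)
    show "integrable lebesgue (\<lambda>t. 2 * a\<^sup>2 * (norm (unit_derivative f t))\<^sup>2 + 2 * (norm (unit_derivative k t))\<^sup>2)"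
      by (intro Bochner_Integration.integrable_add integrable_mult_right unit_derivative_square_integrable f k)
    show "(\<lambda>t. (norm (unit_derivative ?g t))\<^sup>2) \<in> borel_measurable lebesgue"
      using meas by measurable
    show "AE t in lebesgue. norm ((norm (unit_derivative ?g t))\<^sup>2)
      \<le> norm (2 * a\<^sup>2 * (norm (unit_derivative f t))\<^sup>2 + 2 * (norm (unit_derivative k t))\<^sup>2)"
      using unit_derivative_linear(1)[OF f k, of a]
    proof eventually_elim
      case (elim t)
      let ?u = "\<bar>a\<bar> * norm (unit_derivative f t)" and ?v = "norm (unit_derivative k t)"
      have "norm (unit_derivative ?g t) \<le> ?u + ?v"
        unfolding elim using norm_triangle_ineq[of "a *\<^sub>R unit_derivative f t" "unit_derivative k t"] by simp
      then have "(norm (unit_derivative ?g t))\<^sup>2 \<le> (?u + ?v)\<^sup>2" by (intro power_mono) auto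
      also have "(?u + ?v)\<^sup>2 = ?u\<^sup>2 + ?v\<^sup>2 + 2 * ?u * ?v" by (rule power2_sum)
      also have "\<dots> \<le> ?u\<^sup>2 + ?v\<^sup>2 + (?u\<^sup>2 + ?v\<^sup>2)" by (intro add_left_mono sum_squares_bound)
      also have "\<dots> = 2 * a\<^sup>2 * (norm (unit_derivative f t))\<^sup>2 + 2 * ?v\<^sup>2" by (simp add: power_mult_distrib)
      finally show ?case by simp
    qed
  qed
  moreover have "(\<lambda>t. (norm (unit_derivative ?g t))\<^sup>2) = (\<lambda>t. indicator {0..1} t *\<^sub>R (norm (vector_derivative ?g (at t)))\<^sup>2)"
    by (auto simp: unit_derivative_def indicator_def)
  ultimately have "set_integrable lebesgue {0..1} (\<lambda>t. (norm (vector_derivative ?g (at t)))\<^sup>2)"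
    by (simp add: set_integrable_def)
  then show ?thesis
    using ac diff F(2,3) K(2,3) unfolding bm_cameron_martin_def by (simp add: scaleR_fun_def)
qed

lemma bm_cameron_martin_zero: "0 \<in> bm_cameron_martin"
proof -
  have z: "(0 :: real \<Rightarrow> 'a) = (\<lambda>_. 0)" by (simp add: fun_eq_iff)
  show ?thesis
    unfolding bm_cameron_martin_def z
    by (auto simp: absolutely_continuous_path_def set_integrable_def intro!: exI[of _ 1])
qed

lemma bm_ip_linear:
  assumes "f \<in> bm_cameron_martin" "k \<in> bm_cameron_martin" "g \<in> bm_cameron_martin"
  shows "bm_ip (a *\<^sub>R f + k) g = a * bm_ip f g + bm_ip k g"
proof -
  have "bm_ip (a *\<^sub>R f + k) g = (LINT t|lebesgue. a * (unit_derivative f t \<bullet> unit_derivative g t) + unit_derivative k t \<bullet> unit_derivative g t)"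
    unfolding bm_ip_eq
  proof (rule integral_cong_AE)
    show "AE t in lebesgue. unit_derivative (a *\<^sub>R f + k) t \<bullet> unit_derivative g t
      = a * (unit_derivative f t \<bullet> unit_derivative g t) + unit_derivative k t \<bullet> unit_derivative g t"
      using unit_derivative_linear(1)[OF assms(1,2), of a] by eventually_elim (simp add: inner_add_left)
  qed (intro borel_measurable_inner borel_measurable_add borel_measurable_times borel_measurable_const
      unit_derivative_measurable assms bm_cameron_martin_linear)+
  also have "\<dots> = a * bm_ip f g + bm_ip k g"
    unfolding bm_ip_eq
    by (simp add: unit_derivative_inner_integrable[OF assms(1,3)] unit_derivative_inner_integrable[OF assms(2,3)])
  finally show ?thesis .
qed

lemma bm_ip_sym: "bm_ip f k = bm_ip k f"
  by (simp add: bm_ip_eq inner_commute)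

lemma bm_ip_nonneg: "0 \<le> bm_ip f f"
  by (simp add: bm_ip_eq)

text \<open>With \<open>w\<close> the mean slope on a cell, integrating w . k' \<le> |w|^2 / 2 +
  |k'|^2 / 2 gives the Cauchy-Schwarz bound for that cell. The bounds are increments of the
  primitive of the squared derivative, so they telescope.\<close>

lemma bm_energy:
  fixes k :: "real \<Rightarrow> 'a::euclidean_space"
  assumes k: "k \<in> bm_cameron_martin" and d: "d division_of {0..1}"
  shows "(\<Sum>K\<in>d. (norm (k (Sup K) - k (Inf K)))\<^sup>2 / (Sup K - Inf K)) \<le> bm_ip k k"
proof -
  note D = bm_cameron_martinD[OF k]
  let ?q = "\<lambda>t. (norm (vector_derivative k (at t)))\<^sup>2"
  have q: "?q integrable_on {0..1}" and qi: "bm_ip k k = integral {0..1} ?q"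
    using set_lebesgue_integral_eq_integral[OF D(5)] by (auto simp: bm_ip_def power2_norm_eq_inner)
  have cell: "(norm (k (Sup K) - k (Inf K)))\<^sup>2 / (Sup K - Inf K) \<le> integral {0..Sup K} ?q - integral {0..Inf K} ?q"
    if K: "K \<in> d" for K
  proof (cases "Inf K = Sup K")
    case False
    define l u where "l = Inf K" and "u = Sup K"
    have lu: "0 \<le> l" "l < u" "u \<le> 1" using division_of_interval_elem[OF d K] False by (auto simp: l_def u_def)
    define w where "w = (1 / (u - l)) *\<^sub>R (k u - k l)"
    define E where "E = (norm (k u - k l))\<^sup>2 / (u - l)"
    have "((\<lambda>t. vector_derivative k (at t)) has_integral (k u - k l)) {l..u}"
      using lu by (intro absolutely_continuous_path_FTC[OF D(1,4)]) auto
    from has_integral_linear[OF this bounded_linear_inner_right[of w]]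
    have i1: "((\<lambda>t. w \<bullet> vector_derivative k (at t)) has_integral (w \<bullet> (k u - k l))) {l..u}"
      by (simp add: o_def)
    have q': "?q integrable_on {l..u}" "?q integrable_on {0..u}"
      using lu by (auto intro: integrable_subinterval_real[OF q])
    have i2: "((\<lambda>t. (norm w)\<^sup>2 / 2 + ?q t / 2) has_integral ((u - l) * ((norm w)\<^sup>2 / 2) + integral {l..u} ?q / 2)) {l..u}"
      using lu has_integral_const_real[of "(norm w)\<^sup>2 / 2" l u] integrable_integral[OF q'(1)]
      by (intro has_integral_add has_integral_divide) auto
    have "w \<bullet> (k u - k l) \<le> (u - l) * ((norm w)\<^sup>2 / 2) + integral {l..u} ?q / 2"
    proof (rule has_integral_le[OF i1 i2])
      fix t
      have "w \<bullet> vector_derivative k (at t) \<le> norm w * norm (vector_derivative k (at t))" by (rule norm_cauchy_schwarz)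
      then show "w \<bullet> vector_derivative k (at t) \<le> (norm w)\<^sup>2 / 2 + ?q t / 2"
        using sum_squares_bound[of "norm w" "norm (vector_derivative k (at t))"] by simp
    qed
    moreover have "w \<bullet> (k u - k l) = E" by (simp add: w_def E_def power2_norm_eq_inner)
    moreover have "(u - l) * ((norm w)\<^sup>2 / 2) = E / 2"
      using lu by (simp add: w_def E_def power2_eq_square)
    ultimately have "E \<le> integral {l..u} ?q" by simp
    moreover have "integral {0..l} ?q + integral {l..u} ?q = integral {0..u} ?q"
      using lu q' by (intro Henstock_Kurzweil_Integration.integral_combine) auto
    ultimately show ?thesis by (simp add: E_def l_def u_def)
  qed simp
  have "(\<Sum>K\<in>d. (norm (k (Sup K) - k (Inf K)))\<^sup>2 / (Sup K - Inf K))
    \<le> (\<Sum>K\<in>d. integral {0..Sup K} ?q - integral {0..Inf K} ?q)" by (rule sum_mono[OF cell])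
  also have "\<dots> = integral {0..1} ?q - integral {0..0} ?q"
    by (rule sum_telescope_division[OF d, of "\<lambda>t. integral {0..t} ?q"]) simp
  finally show ?thesis by (simp add: qi)
qed

section \<open>Symmetry of second derivatives\<close>

text \<open>The mean value theorem in \<open>s\<close> for \<open>g s h - g s 0\<close>, followed by
  the first-order expansion of \<open>p\<close> at the origin, in which the terms with
  \<open>A\<close> cancel. The errors at (\<xi>, h) and (\<xi>, 0) add up to at most
  \<open>3 * h\<close> times \<open>e\<close>.\<close>

lemma mixed_difference_estimate:
  fixes g p :: "real \<Rightarrow> real \<Rightarrow> real"
  assumes h: "0 < h" "h < d"
    and p: "\<And>s t. \<bar>s\<bar> < d \<Longrightarrow> \<bar>t\<bar> < d \<Longrightarrow> ((\<lambda>s. g s t) has_real_derivative p s t) (at s)"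
    and P: "\<And>s t. \<bar>s\<bar> < d \<Longrightarrow> \<bar>t\<bar> < d \<Longrightarrow> \<bar>p s t - p 0 0 - (s * A + t * B)\<bar> \<le> e * (\<bar>s\<bar> + \<bar>t\<bar>)"
    and e: "0 < e"
  shows "\<bar>g h h - g h 0 - g 0 h + g 0 0 - h * h * B\<bar> \<le> 3 * e * (h * h)"
proof -
  have "((\<lambda>s. g s h - g s 0) has_real_derivative p s h - p s 0) (at s)" if "0 \<le> s" "s \<le> h" for s
    using that h by (intro DERIV_diff p) auto
  from MVT2[OF h(1) this] obtain \<xi> where \<xi>: "0 < \<xi>" "\<xi> < h"
    "(g h h - g h 0) - (g 0 h - g 0 0) = (h - 0) * (p \<xi> h - p \<xi> 0)" by auto
  have 1: "\<bar>p \<xi> h - p 0 0 - (\<xi> * A + h * B)\<bar> \<le> e * (\<xi> + h)" using P[of \<xi> h] \<xi> h by simp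
  have 2: "\<bar>p \<xi> 0 - p 0 0 - \<xi> * A\<bar> \<le> e * \<xi>" using P[of \<xi> 0] \<xi> h by simp
  have "\<bar>p \<xi> h - p \<xi> 0 - h * B\<bar> \<le> e * (\<xi> + h) + e * \<xi>" using 1 2 by linarith
  also have "\<dots> \<le> e * (3 * h)" using \<xi> e by (simp flip: distrib_left)
  finally have "h * \<bar>p \<xi> h - p \<xi> 0 - h * B\<bar> \<le> h * (e * (3 * h))" using h by (intro mult_left_mono) auto
  moreover have "g h h - g h 0 - g 0 h + g 0 0 - h * h * B = h * (p \<xi> h - p \<xi> 0 - h * B)"
    using \<xi>(3) by (simp add: algebra_simps)
  ultimately show ?thesis using h by (simp add: abs_mult mult_ac)
qed

text \<open>The second difference of \<open>g\<close> is symmetric in its two variables, so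
  \<open>h * h * B\<close> and \<open>h * h * B'\<close> approximate the same number up to
  \<open>6 * e * (h * h)\<close>. Differentiability of the first partials at the single point 0 is
  enough for this.\<close>

lemma mixed_partials_equal:
  fixes g p q :: "real \<Rightarrow> real \<Rightarrow> real"
  assumes r: "0 < r"
    and p: "\<And>s t. \<bar>s\<bar> < r \<Longrightarrow> \<bar>t\<bar> < r \<Longrightarrow> ((\<lambda>s. g s t) has_real_derivative p s t) (at s)"
    and q: "\<And>s t. \<bar>s\<bar> < r \<Longrightarrow> \<bar>t\<bar> < r \<Longrightarrow> ((\<lambda>t. g s t) has_real_derivative q s t) (at t)"
    and P: "\<And>e. 0 < e \<Longrightarrow> \<exists>d>0. \<forall>s t. \<bar>s\<bar> < d \<longrightarrow> \<bar>t\<bar> < d \<longrightarrow> \<bar>p s t - p 0 0 - (s * A + t * B)\<bar> \<le> e * (\<bar>s\<bar> + \<bar>t\<bar>)"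
    and Q: "\<And>e. 0 < e \<Longrightarrow> \<exists>d>0. \<forall>s t. \<bar>s\<bar> < d \<longrightarrow> \<bar>t\<bar> < d \<longrightarrow> \<bar>q s t - q 0 0 - (s * B' + t * A')\<bar> \<le> e * (\<bar>s\<bar> + \<bar>t\<bar>)"
  shows "B = B'"
proof -
  have "\<bar>B - B'\<bar> \<le> 0 + 6 * e" if e: "0 < e" for e
  proof -
    obtain d1 where d1: "0 < d1" "\<And>s t. \<bar>s\<bar> < d1 \<Longrightarrow> \<bar>t\<bar> < d1 \<Longrightarrow> \<bar>p s t - p 0 0 - (s * A + t * B)\<bar> \<le> e * (\<bar>s\<bar> + \<bar>t\<bar>)"
      using P[OF e] by blast
    obtain d2 where d2: "0 < d2" "\<And>s t. \<bar>s\<bar> < d2 \<Longrightarrow> \<bar>t\<bar> < d2 \<Longrightarrow> \<bar>q s t - q 0 0 - (s * B' + t * A')\<bar> \<le> e * (\<bar>s\<bar> + \<bar>t\<bar>)"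
      using Q[OF e] by blast
    define d where "d = min r (min d1 d2)"
    define h where "h = d / 2"
    have d: "0 < h" "h < d" "d \<le> r" "d \<le> d1" "d \<le> d2" using r d1 d2 by (auto simp: d_def h_def)
    have 1: "\<bar>g h h - g h 0 - g 0 h + g 0 0 - h * h * B\<bar> \<le> 3 * e * (h * h)"
      by (rule mixed_difference_estimate[OF d(1,2) p d1(2) e]) (use d in auto)
    have 2: "\<bar>g h h - g 0 h - g h 0 + g 0 0 - h * h * B'\<bar> \<le> 3 * e * (h * h)"
    proof (rule mixed_difference_estimate[where g = "\<lambda>s t. g t s" and p = "\<lambda>s t. q t s", OF d(1,2) _ _ e])
      show "\<bar>q t s - q 0 0 - (s * A' + t * B')\<bar> \<le> e * (\<bar>s\<bar> + \<bar>t\<bar>)" if "\<bar>s\<bar> < d" "\<bar>t\<bar> < d" for s t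
        using d2(2)[of t s] that d by (simp add: add.commute)
    qed (use d q in auto)
    have "\<bar>h * h * B - h * h * B'\<bar> \<le> 6 * e * (h * h)" using 1 2 by linarith
    moreover have "\<bar>h * h * B - h * h * B'\<bar> = h * h * \<bar>B - B'\<bar>"
      unfolding right_diff_distrib[symmetric] by (simp add: abs_mult)
    ultimately have "h * h * \<bar>B - B'\<bar> \<le> h * h * (6 * e)" by (simp only: mult_ac)
    then show ?thesis using d(1) by simp
  qed
  then have "\<bar>B - B'\<bar> \<le> 0 + e" if "0 < e" for e using that[THEN divide_pos_pos, of 6] by fastforce
  then have "\<bar>B - B'\<bar> \<le> 0" by (rule field_le_epsilon)
  then show ?thesis by simp
qed

section \<open>Regularity of the coefficients\<close>

text \<open>The regularity that composition with a path of finite variation calls for. Directions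
  are fixed here; directions that vary along a path are expanded in a basis.\<close>

definition C2_lipschitz :: "('a::euclidean_space \<Rightarrow> 'b::euclidean_space) \<Rightarrow> bool" where
  "C2_lipschitz g \<longleftrightarrow> (\<forall>y. g differentiable (at y)) \<and> (\<forall>v y. (\<lambda>x. grad g x v) differentiable (at y)) \<and>
    (\<exists>L\<ge>0. \<forall>x y. norm (g x - g y) \<le> L * norm (x - y)) \<and>
    (\<forall>v. \<exists>L\<ge>0. \<forall>x y. norm (grad g x v - grad g y v) \<le> L * norm (x - y)) \<and>
    (\<forall>u v. \<exists>L\<ge>0. \<forall>x y. norm (grad2 g x u v - grad2 g y u v) \<le> L * norm (x - y))"

lemma C2_lipschitzD:
  assumes "C2_lipschitz g"
  shows "(g has_derivative grad g y) (at y)" "((\<lambda>x. grad g x v) has_derivative (\<lambda>u. grad2 g y u v)) (at y)"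
    "linear (grad g y)" "linear (\<lambda>u. grad2 g y u v)" "linear (\<lambda>v. grad2 g y u v)"
proof -
  have g: "(g has_derivative grad g y) (at y)" for y
    using assms by (simp add: C2_lipschitz_def grad_def[abs_def] frechet_derivative_works[symmetric])
  have g2: "((\<lambda>x. grad g x v) has_derivative (\<lambda>u. grad2 g y u v)) (at y)" for y v
    using assms by (simp add: C2_lipschitz_def grad2_def frechet_derivative_works[symmetric])
  have lin: "linear (grad g y)" for y by (rule has_derivative_linear[OF g])
  \<comment> \<open>Linearity in the direction differentiated first is not immediate from
    differentiability in the other one; it comes from uniqueness of derivatives.\<close>
  have "linear (\<lambda>v. grad2 g y u v)"
  proof (rule linearI)
    show "grad2 g y u (v + w) = grad2 g y u v + grad2 g y u w" for v w
    proof -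
      have "((\<lambda>x. grad g x v + grad g x w) has_derivative (\<lambda>u. grad2 g y u v + grad2 g y u w)) (at y)"
        by (intro has_derivative_add g2)
      then have "((\<lambda>x. grad g x (v + w)) has_derivative (\<lambda>u. grad2 g y u v + grad2 g y u w)) (at y)"
        by (simp add: linear_add[OF lin])
      from has_derivative_unique[OF this g2] show ?thesis by (metis (no_types))
    qed
    show "grad2 g y u (a *\<^sub>R v) = a *\<^sub>R grad2 g y u v" for a v
    proof -
      have "((\<lambda>x. a *\<^sub>R grad g x v) has_derivative (\<lambda>u. a *\<^sub>R grad2 g y u v)) (at y)"
        by (intro has_derivative_scaleR_right g2)
      then have "((\<lambda>x. grad g x (a *\<^sub>R v)) has_derivative (\<lambda>u. a *\<^sub>R grad2 g y u v)) (at y)"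
        by (simp add: linear_scale[OF lin])
      from has_derivative_unique[OF this g2] show ?thesis by (metis (no_types))
    qed
  qed
  then show "linear (\<lambda>v. grad2 g y u v)" .
  show "(g has_derivative grad g y) (at y)" "((\<lambda>x. grad g x v) has_derivative (\<lambda>u. grad2 g y u v)) (at y)"
    "linear (grad g y)" by (rule g g2 lin)+
  show "linear (\<lambda>u. grad2 g y u v)" by (rule has_derivative_linear[OF g2])
qed

lemma C2_lipschitzI:
  assumes "\<And>y. (g has_derivative G y) (at y)" "\<And>y v. ((\<lambda>x. G x v) has_derivative (\<lambda>u. G' y u v)) (at y)"
    and "\<exists>L\<ge>0. \<forall>x y. norm (g x - g y) \<le> L * norm (x - y)"
    and "\<And>v. \<exists>L\<ge>0. \<forall>x y. norm (G x v - G y v) \<le> L * norm (x - y)"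
    and "\<And>u v. \<exists>L\<ge>0. \<forall>x y. norm (G' x u v - G' y u v) \<le> L * norm (x - y)"
  shows "C2_lipschitz g"
proof -
  have 1: "grad g = G" using frechet_derivative_at[OF assms(1)] by (simp add: grad_def fun_eq_iff)
  have 2: "grad2 g = G'"
    unfolding grad2_def[abs_def] 1 using frechet_derivative_at[OF assms(2)] by (simp add: fun_eq_iff)
  show ?thesis unfolding C2_lipschitz_def 1 2 using assms differentiableI by blast
qed

text \<open>Equality of mixed partials for the two-parameter function
  \<open>g (y + s *\<^sub>R u + t *\<^sub>R v) \<bullet> b\<close>, one coordinate \<open>b\<close>
  at a time.\<close>

lemma grad2_symmetric:
  fixes g :: "'a::euclidean_space \<Rightarrow> 'b::euclidean_space"
  assumes g: "C2_lipschitz g"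
  shows "grad2 g y u v = grad2 g y v u"
proof (rule euclidean_eqI)
  fix b :: 'b assume "b \<in> Basis"
  define c where "c = norm u + norm v + 1"
  have c: "0 < c" by (simp add: c_def add_nonneg_pos)
  note D = C2_lipschitzD[OF g]
  let ?p = "\<lambda>s t. y + s *\<^sub>R u + t *\<^sub>R v"
  have first: "\<exists>d>0. \<forall>s t. \<bar>s\<bar> < d \<longrightarrow> \<bar>t\<bar> < d \<longrightarrow>
      \<bar>grad g (?p s t) w \<bullet> b - grad g (?p 0 0) w \<bullet> b - (s * (grad2 g y u w \<bullet> b) + t * (grad2 g y v w \<bullet> b))\<bar> \<le> e * (\<bar>s\<bar> + \<bar>t\<bar>)"
    if e: "0 < e" for e w
  proof -
    have "0 < e / (c * (norm b + 1))" using e c by (simp add: add_nonneg_pos)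
    then obtain d where d: "0 < d" "\<And>x. norm (x - y) < d \<Longrightarrow>
      norm (grad g x w - grad g y w - grad2 g y (x - y) w) \<le> e / (c * (norm b + 1)) * norm (x - y)"
      using D(2)[of w y] unfolding has_derivative_at_alt by blast
    show ?thesis
    proof (intro exI[of _ "d / (2 * c)"] conjI allI impI)
      show "0 < d / (2 * c)" using d c by simp
      fix s t :: real assume st: "\<bar>s\<bar> < d / (2 * c)" "\<bar>t\<bar> < d / (2 * c)"
      have z: "norm (?p s t - y) \<le> (\<bar>s\<bar> + \<bar>t\<bar>) * c"
      proof -
        have "norm (?p s t - y) \<le> \<bar>s\<bar> * norm u + \<bar>t\<bar> * norm v"
          using norm_triangle_ineq[of "s *\<^sub>R u" "t *\<^sub>R v"] by simp
        also have "\<dots> \<le> \<bar>s\<bar> * c + \<bar>t\<bar> * c" by (intro add_mono mult_left_mono) (auto simp: c_def)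
        finally show ?thesis by (simp add: distrib_right)
      qed
      have "(\<bar>s\<bar> + \<bar>t\<bar>) * c < (d / (2 * c) + d / (2 * c)) * c" using st c by (intro mult_strict_right_mono) auto
      also have "\<dots> = d" using c by simp
      finally have "norm (?p s t - y) < d" using z by simp
      from d(2)[OF this] have "norm (grad g (?p s t) w - grad g y w - grad2 g y (?p s t - y) w)
        \<le> e / (c * (norm b + 1)) * ((\<bar>s\<bar> + \<bar>t\<bar>) * c)"
        using z e c by (elim order_trans) (intro mult_left_mono, auto)
      also have "grad2 g y (?p s t - y) w = s *\<^sub>R grad2 g y u w + t *\<^sub>R grad2 g y v w"
        using linear_add[OF D(4)] linear_scale[OF D(4)] by simp
      also have "e / (c * (norm b + 1)) * ((\<bar>s\<bar> + \<bar>t\<bar>) * c) = e / (norm b + 1) * (\<bar>s\<bar> + \<bar>t\<bar>)"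
        using c by simp
      finally have n: "norm (grad g (?p s t) w - grad g y w - (s *\<^sub>R grad2 g y u w + t *\<^sub>R grad2 g y v w))
        \<le> e / (norm b + 1) * (\<bar>s\<bar> + \<bar>t\<bar>)" .
      have "\<bar>grad g (?p s t) w \<bullet> b - grad g (?p 0 0) w \<bullet> b - (s * (grad2 g y u w \<bullet> b) + t * (grad2 g y v w \<bullet> b))\<bar>
        = \<bar>(grad g (?p s t) w - grad g y w - (s *\<^sub>R grad2 g y u w + t *\<^sub>R grad2 g y v w)) \<bullet> b\<bar>"
        by (simp add: inner_diff_left inner_add_left)
      also have "\<dots> \<le> norm (grad g (?p s t) w - grad g y w - (s *\<^sub>R grad2 g y u w + t *\<^sub>R grad2 g y v w)) * norm b"
        by (rule Cauchy_Schwarz_ineq2)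
      also have "\<dots> \<le> e / (norm b + 1) * (\<bar>s\<bar> + \<bar>t\<bar>) * (norm b + 1)"
        using n e by (intro mult_mono) (auto simp: add_nonneg_pos less_imp_le)
      also have "\<dots> = e * (\<bar>s\<bar> + \<bar>t\<bar>)"
        using add_nonneg_pos[OF norm_ge_zero[of b] zero_less_one] by simp
      finally show "\<bar>grad g (?p s t) w \<bullet> b - grad g (?p 0 0) w \<bullet> b - (s * (grad2 g y u w \<bullet> b) + t * (grad2 g y v w \<bullet> b))\<bar>
        \<le> e * (\<bar>s\<bar> + \<bar>t\<bar>)" .
    qed
  qed
  have deriv: "((\<lambda>s. g (z + s *\<^sub>R w) \<bullet> b) has_real_derivative (grad g (z + s *\<^sub>R w) w \<bullet> b)) (at s)" for z w s
  proof -
    have "((\<lambda>s. z + s *\<^sub>R w) has_derivative (\<lambda>h. h *\<^sub>R w)) (at s)"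
      by (auto intro!: derivative_eq_intros)
    from has_derivative_compose[OF this D(1)]
    have "((\<lambda>s. g (z + s *\<^sub>R w) \<bullet> b) has_derivative (\<lambda>h. grad g (z + s *\<^sub>R w) (h *\<^sub>R w) \<bullet> b)) (at s)"
      by (rule has_derivative_inner_left)
    then show ?thesis
      unfolding has_field_derivative_def by (simp add: linear_scale[OF D(3)] mult.commute[of _ "grad _ _ _ \<bullet> b"])
  qed
  show "grad2 g y u v \<bullet> b = grad2 g y v u \<bullet> b"
  proof (rule mixed_partials_equal[symmetric, where r = 1 and g = "\<lambda>s t. g (?p s t) \<bullet> b"
        and p = "\<lambda>s t. grad g (?p s t) u \<bullet> b" and q = "\<lambda>s t. grad g (?p s t) v \<bullet> b"
        and A = "grad2 g y u u \<bullet> b" and A' = "grad2 g y v v \<bullet> b"])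
    show "((\<lambda>s. g (?p s t) \<bullet> b) has_real_derivative grad g (?p s t) u \<bullet> b) (at s)" for s t
      using deriv[of "y + t *\<^sub>R v" u s] by (simp add: add_ac)
    show "((\<lambda>t. g (?p s t) \<bullet> b) has_real_derivative grad g (?p s t) v \<bullet> b) (at t)" for s t
      using deriv[of "y + s *\<^sub>R u" v t] by simp
  qed (simp_all only: first zero_less_one)
qed

text \<open>Boundedness is given direction by direction; summing over a basis bounds the whole
  differential, and the mean value inequality applies on a convex set.\<close>

lemma iterated_derivative_lipschitz:
  fixes f :: "'a::euclidean_space \<Rightarrow> 'b::euclidean_space"
  assumes f: "Cb_infinity_on X f" and X: "convex X"
  shows "\<exists>L\<ge>0. \<forall>x\<in>X. \<forall>y\<in>X. norm (iterated_derivative X f vs x - iterated_derivative X f vs y) \<le> L * norm (x - y)"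
proof -
  let ?D = "iterated_derivative X f"
  have der: "(?D vs has_derivative (\<lambda>v. ?D (v # vs) x)) (at x within X)" if "x \<in> X" for x
    using f that by (simp add: Cb_infinity_on_def differentiable_on_def frechet_derivative_works)
  have "\<forall>v. \<exists>B\<ge>0. \<forall>x\<in>X. norm (?D (v # vs) x) \<le> B"
  proof
    fix v
    have "bounded (?D (v # vs) ` X)" using f by (simp only: Cb_infinity_on_def)
    then obtain B where "0 < B" "\<forall>z\<in>?D (v # vs) ` X. norm z \<le> B" unfolding bounded_pos by blast
    then show "\<exists>B\<ge>0. \<forall>x\<in>X. norm (?D (v # vs) x) \<le> B" by (intro exI[of _ B]) auto
  qed
  then obtain B where B: "\<And>v. 0 \<le> B v" "\<And>v x. x \<in> X \<Longrightarrow> norm (?D (v # vs) x) \<le> B v" by metis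
  define L where "L = (\<Sum>b\<in>Basis. B b)"
  have L: "0 \<le> L" by (simp add: L_def B sum_nonneg)
  have "onorm (\<lambda>v. ?D (v # vs) x) \<le> L" if x: "x \<in> X" for x
  proof (rule onorm_le)
    fix v
    have lin: "linear (\<lambda>v. ?D (v # vs) x)" by (rule has_derivative_linear[OF der[OF x]])
    have "?D (v # vs) x = (\<Sum>b\<in>Basis. (v \<bullet> b) *\<^sub>R ?D (b # vs) x)"
      by (subst (1) euclidean_representation[of v, symmetric])
        (simp only: linear_sum[OF lin] linear_scale[OF lin])
    also have "norm \<dots> \<le> (\<Sum>b\<in>Basis. norm v * B b)"
      using B x Basis_le_norm by (intro sum_norm_le) (auto intro!: mult_mono)
    finally show "norm (?D (v # vs) x) \<le> L * norm v" by (simp add: L_def sum_distrib_left mult.commute)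
  qed
  then show ?thesis using differentiable_bound[OF X der] L by blast
qed

text \<open>The map \<open>j\<close> is the identity for the diffusion coefficients and y \<mapsto>
  (0, y) for the drift. As it stays in \<open>X\<close>, derivatives within \<open>X\<close>,
  one-sided at time 0, compose to ordinary derivatives in \<open>y\<close>.\<close>

lemma Cb_infinity_C2_lipschitz:
  fixes f :: "'a::euclidean_space \<Rightarrow> 'b::euclidean_space" and j :: "'c::euclidean_space \<Rightarrow> 'a"
  assumes f: "Cb_infinity_on X f" and X: "convex X"
    and j: "\<And>y. j y \<in> X" "\<And>y. (j has_derivative j') (at y)" "\<And>x y. norm (j x - j y) \<le> norm (x - y)"
  shows "C2_lipschitz (\<lambda>y. f (j y))"
proof -
  let ?D = "iterated_derivative X f"
  have der: "((\<lambda>y. ?D vs (j y)) has_derivative (\<lambda>v. ?D (j' v # vs) (j y))) (at y)" for vs y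
  proof -
    have "(?D vs has_derivative (\<lambda>v. ?D (v # vs) (j y))) (at (j y) within X)"
      using f j(1) by (simp add: Cb_infinity_on_def differentiable_on_def frechet_derivative_works)
    then have "(?D vs has_derivative (\<lambda>v. ?D (v # vs) (j y))) (at (j y) within range j)"
      by (rule has_derivative_subset) (use j(1) in auto)
    from has_derivative_in_compose[OF j(2) this] show ?thesis .
  qed
  have lip: "\<exists>L\<ge>0. \<forall>x y. norm (?D vs (j x) - ?D vs (j y)) \<le> L * norm (x - y)" for vs
  proof -
    obtain L where L: "0 \<le> L" "\<And>x y. x \<in> X \<Longrightarrow> y \<in> X \<Longrightarrow> norm (?D vs x - ?D vs y) \<le> L * norm (x - y)"
      using iterated_derivative_lipschitz[OF f X, of vs] by blast
    have "norm (?D vs (j x) - ?D vs (j y)) \<le> L * norm (x - y)" for x y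
      by (rule order_trans[OF L(2)[OF j(1) j(1)] mult_left_mono[OF j(3) L(1)]])
    then show ?thesis using L(1) by blast
  qed
  show ?thesis
  proof (rule C2_lipschitzI[where G = "\<lambda>y v. ?D [j' v] (j y)" and G' = "\<lambda>y u v. ?D [j' u, j' v] (j y)"])
    show "((\<lambda>y. f (j y)) has_derivative (\<lambda>v. ?D [j' v] (j y))) (at y)" for y
      using der[of "[]" y] by simp
    show "\<exists>L\<ge>0. \<forall>x y. norm (f (j x) - f (j y)) \<le> L * norm (x - y)" using lip[of "[]"] by simp
  qed (rule der lip)+
qed

lemma C2_lipschitz_linear_combination:
  fixes f :: "'a::euclidean_space \<Rightarrow> 'b::euclidean_space" and g :: "'a \<Rightarrow> 'c::euclidean_space"
    and l1 :: "'b \<Rightarrow> 'd::euclidean_space" and l2 :: "'c \<Rightarrow> 'd"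
  assumes f: "C2_lipschitz f" and g: "C2_lipschitz g" and l: "linear l1" "linear l2"
  shows "C2_lipschitz (\<lambda>y. l1 (f y) + l2 (g y))"
proof -
  note F = C2_lipschitzD[OF f] and G = C2_lipschitzD[OF g]
  have b: "bounded_linear l1" "bounded_linear l2" using l by (auto simp: linear_conv_bounded_linear)
  obtain K1 K2 where K: "0 < K1" "\<And>x. norm (l1 x) \<le> norm x * K1" "0 < K2" "\<And>x. norm (l2 x) \<le> norm x * K2"
    using bounded_linear.pos_bounded[OF b(1)] bounded_linear.pos_bounded[OF b(2)] by blast
  have lip: "\<exists>L\<ge>0. \<forall>x y. norm ((l1 (p x) + l2 (q x)) - (l1 (p y) + l2 (q y))) \<le> L * norm (x - y)"
    if p: "\<exists>L\<ge>0. \<forall>x y. norm (p x - p y) \<le> L * norm (x - y)" and q: "\<exists>L\<ge>0. \<forall>x y. norm (q x - q y) \<le> L * norm (x - y)"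
    for p :: "'a \<Rightarrow> 'b" and q :: "'a \<Rightarrow> 'c"
  proof -
    obtain L1 L2 where L: "0 \<le> L1" "\<And>x y. norm (p x - p y) \<le> L1 * norm (x - y)"
      "0 \<le> L2" "\<And>x y. norm (q x - q y) \<le> L2 * norm (x - y)" using p q by blast
    have "norm ((l1 (p x) + l2 (q x)) - (l1 (p y) + l2 (q y))) \<le> (L1 * K1 + L2 * K2) * norm (x - y)" for x y
    proof -
      have "(l1 (p x) + l2 (q x)) - (l1 (p y) + l2 (q y)) = l1 (p x - p y) + l2 (q x - q y)"
        by (simp add: linear_diff[OF l(1)] linear_diff[OF l(2)])
      also have "norm \<dots> \<le> norm (p x - p y) * K1 + norm (q x - q y) * K2"
        by (rule order_trans[OF norm_triangle_ineq add_mono[OF K(2) K(4)]])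
      also have "\<dots> \<le> (L1 * norm (x - y)) * K1 + (L2 * norm (x - y)) * K2"
        using K L by (intro add_mono mult_right_mono) auto
      finally show ?thesis by (simp add: algebra_simps)
    qed
    then show ?thesis using L K by (intro exI[of _ "L1 * K1 + L2 * K2"]) auto
  qed
  show ?thesis
  proof (rule C2_lipschitzI[where G = "\<lambda>y v. l1 (grad f y v) + l2 (grad g y v)"
        and G' = "\<lambda>y u v. l1 (grad2 f y u v) + l2 (grad2 g y u v)"])
    show "((\<lambda>y. l1 (f y) + l2 (g y)) has_derivative (\<lambda>v. l1 (grad f y v) + l2 (grad g y v))) (at y)" for y
      by (intro has_derivative_add bounded_linear.has_derivative[OF b(1)] bounded_linear.has_derivative[OF b(2)] F G)
    show "((\<lambda>x. l1 (grad f x v) + l2 (grad g x v)) has_derivative (\<lambda>u. l1 (grad2 f y u v) + l2 (grad2 g y u v))) (at y)" for y v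
      by (intro has_derivative_add bounded_linear.has_derivative[OF b(1)] bounded_linear.has_derivative[OF b(2)] F G)
  qed (use f g in \<open>auto simp only: C2_lipschitz_def intro!: lip\<close>)
qed

section \<open>Symmetry of the second derivative of the functional\<close>

text \<open>Equality of mixed partials of \<open>D 0\<close> on the plane through \<phi> spanned by
  \<open>x\<close> and \<open>y\<close>. The hypothesis on \<open>K\<close> converts smallness of
  the two parameters into smallness in \<open>N\<close>, up to a constant.\<close>

lemma second_frechet_derivative_symmetric:
  fixes N :: "'v::real_vector \<Rightarrow> real"
  assumes V: "subspace V" and U: "open_in_normed V N U" "\<phi> \<in> U"
    and F: "frechet_derivatives_on V N m U F D" "2 \<le> m"
    and N: "\<And>z. z \<in> V \<Longrightarrow> 0 \<le> N z" and x: "x \<in> V" and y: "y \<in> V"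
    and K: "\<And>a b. N (a *\<^sub>R x + b *\<^sub>R y) \<le> K * (\<bar>a\<bar> + \<bar>b\<bar>)"
  shows "D 2 \<phi> [x, y] = D 2 \<phi> [y, x]"
proof -
  define c where "c = \<bar>K\<bar> + 1"
  have c: "0 < c" by (simp add: c_def add_nonneg_pos)
  have Kc: "N (a *\<^sub>R x + b *\<^sub>R y) \<le> c * (\<bar>a\<bar> + \<bar>b\<bar>)" for a b
  proof -
    have "K * (\<bar>a\<bar> + \<bar>b\<bar>) \<le> c * (\<bar>a\<bar> + \<bar>b\<bar>)" by (intro mult_right_mono) (auto simp: c_def)
    then show ?thesis using K[of a b] by simp
  qed
  define p where "p a b = \<phi> + a *\<^sub>R x + b *\<^sub>R y" for a b
  have lc: "a *\<^sub>R x + b *\<^sub>R y \<in> V" for a b using V x y by (intro subspace_add subspace_scale)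
  obtain \<rho> where \<rho>: "0 < \<rho>" "\<And>z. z \<in> V \<Longrightarrow> N (z - \<phi>) < \<rho> \<Longrightarrow> z \<in> U" and UV: "U \<subseteq> V"
    using U unfolding open_in_normed_def by blast
  have \<phi>V: "\<phi> \<in> V" using U UV by blast
  define d0 where "d0 = \<rho> / (2 * c)"
  have d0: "0 < d0" using \<rho> c by (simp add: d0_def)
  have small: "c * (\<bar>a\<bar> + \<bar>b\<bar>) < e" if "\<bar>a\<bar> < e / (2 * c)" "\<bar>b\<bar> < e / (2 * c)" for a b e
  proof -
    have "c * (\<bar>a\<bar> + \<bar>b\<bar>) < c * (e / (2 * c) + e / (2 * c))" using that c by (intro mult_strict_left_mono) auto
    then show ?thesis using c by simp
  qed
  have pU: "p a b \<in> U" if "\<bar>a\<bar> < d0" "\<bar>b\<bar> < d0" for a b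
  proof (rule \<rho>(2))
    show "p a b \<in> V" using subspace_add[OF V \<phi>V lc[of a b]] by (simp add: p_def add.assoc)
    have "p a b - \<phi> = a *\<^sub>R x + b *\<^sub>R y" by (simp add: p_def)
    then show "N (p a b - \<phi>) < \<rho>" using Kc[of a b] small[of a \<rho> b] that by (simp add: d0_def)
  qed
  have fd: "has_frechet_derivative_form V N k (D k) z (D (Suc k) z)" if "k < 2" "z \<in> U" for k z
    using F that unfolding frechet_derivatives_on_def by auto
  have lin1: "D 1 z [a *\<^sub>R u + v] = a * D 1 z [u] + D 1 z [v]" if "z \<in> U" "u \<in> V" "v \<in> V" for z a u v
  proof -
    have "bounded_multilinear_on V N 1 (D 1 z)" using fd[of 0 z] that by (simp add: has_frechet_derivative_form_def)
    then show ?thesis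
      unfolding bounded_multilinear_on_def using that by (elim conjE allE[of _ "[]"]) auto
  qed
  have lin2: "D 2 \<phi> [a *\<^sub>R u + v, w] = a * D 2 \<phi> [u, w] + D 2 \<phi> [v, w]" if "u \<in> V" "v \<in> V" "w \<in> V" for a u v w
  proof -
    have "bounded_multilinear_on V N 2 (D 2 \<phi>)" using fd[of 1 \<phi>] U by (simp add: has_frechet_derivative_form_def numeral_2_eq_2)
    then have "\<forall>xs ys. \<forall>x\<in>V. \<forall>y\<in>V. \<forall>a. set xs \<subseteq> V \<and> set ys \<subseteq> V \<and> length xs + length ys + 1 = 2 \<longrightarrow>
        D 2 \<phi> (xs @ (a *\<^sub>R x + y) # ys) = a * D 2 \<phi> (xs @ x # ys) + D 2 \<phi> (xs @ y # ys)"
      unfolding bounded_multilinear_on_def by (elim conjE)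
    from this[rule_format, of u v "[]" "[w]" a] show ?thesis using that by simp
  qed
  \<comment> \<open>Along a line the Frechet derivative restricts to an ordinary derivative of one
    real variable; \<open>Nw\<close> compares the displacement with the parameter.\<close>
  have deriv: "((\<lambda>s. D 0 (z + s *\<^sub>R w) []) has_real_derivative D 1 (z + s *\<^sub>R w) [w]) (at s)"
    if zs: "z + s *\<^sub>R w \<in> U" and w: "w \<in> V" and Nw: "\<And>h. N (h *\<^sub>R w) \<le> c * \<bar>h\<bar>" for z s w
    unfolding has_field_derivative_def has_derivative_at_alt
  proof (intro conjI allI impI)
    show "bounded_linear ((*) (D 1 (z + s *\<^sub>R w) [w]))" by (rule bounded_linear_mult_right)
    fix e :: real assume e: "0 < e"
    then have "0 < e / c" using c by simp
    then obtain \<delta> where \<delta>: "0 < \<delta>" "\<And>v. v \<in> V \<Longrightarrow> N v < \<delta> \<Longrightarrow>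
      \<bar>D 0 (z + s *\<^sub>R w + v) [] - D 0 (z + s *\<^sub>R w) [] - D 1 (z + s *\<^sub>R w) [v]\<bar> \<le> e / c * N v"
      using fd[of 0, OF _ zs] unfolding has_frechet_derivative_form_def by fastforce
    show "\<exists>d>0. \<forall>t. norm (t - s) < d \<longrightarrow> norm (D 0 (z + t *\<^sub>R w) [] - D 0 (z + s *\<^sub>R w) []
        - D 1 (z + s *\<^sub>R w) [w] * (t - s)) \<le> e * norm (t - s)"
    proof (intro exI[of _ "\<delta> / c"] conjI allI impI)
      show "0 < \<delta> / c" using \<delta> c by simp
      fix t assume t: "norm (t - s) < \<delta> / c"
      define v where "v = (t - s) *\<^sub>R w"
      have v: "v \<in> V" unfolding v_def using V w by (rule subspace_scale)
      have Nv: "N v \<le> c * \<bar>t - s\<bar>" unfolding v_def by (rule Nw)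
      then have "N v < \<delta>" using t c by (simp add: pos_less_divide_eq mult.commute)
      from \<delta>(2)[OF v this] have "\<bar>D 0 (z + s *\<^sub>R w + v) [] - D 0 (z + s *\<^sub>R w) [] - D 1 (z + s *\<^sub>R w) [v]\<bar> \<le> e / c * N v" .
      also have "\<dots> \<le> e / c * (c * \<bar>t - s\<bar>)" using Nv e c by (intro mult_left_mono) auto
      also have "\<dots> = e * \<bar>t - s\<bar>" using c by simp
      also have "z + s *\<^sub>R w + v = z + t *\<^sub>R w" by (simp add: v_def algebra_simps)
      also have "D 1 (z + s *\<^sub>R w) [v] = D 1 (z + s *\<^sub>R w) [w] * (t - s)"
        using lin1[OF zs w subspace_0[OF V], of "t - s"] lin1[OF zs subspace_0[OF V] subspace_0[OF V], of 1] by (simp add: v_def)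
      finally show "norm (D 0 (z + t *\<^sub>R w) [] - D 0 (z + s *\<^sub>R w) [] - D 1 (z + s *\<^sub>R w) [w] * (t - s)) \<le> e * norm (t - s)"
        by simp
    qed
  qed
  have first: "\<exists>d>0. \<forall>s t. \<bar>s\<bar> < d \<longrightarrow> \<bar>t\<bar> < d \<longrightarrow>
      \<bar>D 1 (p s t) [w] - D 1 (p 0 0) [w] - (s * D 2 \<phi> [x, w] + t * D 2 \<phi> [y, w])\<bar> \<le> e * (\<bar>s\<bar> + \<bar>t\<bar>)"
    if e: "0 < e" and w: "w \<in> V" for e w
  proof -
    have Nw: "0 \<le> N w" using N w by simp
    then have "0 < e / (c * (N w + 1))" using e c by simp
    then obtain \<delta> where \<delta>: "0 < \<delta>" "\<And>z xs. z \<in> V \<Longrightarrow> N z < \<delta> \<Longrightarrow> set xs \<subseteq> V \<Longrightarrow> length xs = 1 \<Longrightarrow>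
      \<bar>D 1 (\<phi> + z) xs - D 1 \<phi> xs - D 2 \<phi> (z # xs)\<bar> \<le> e / (c * (N w + 1)) * N z * prod_list (map N xs)"
      using fd[of 1, OF _ U(2)] unfolding has_frechet_derivative_form_def numeral_2_eq_2 by fastforce
    show ?thesis
    proof (intro exI[of _ "\<delta> / (2 * c)"] conjI allI impI)
      show "0 < \<delta> / (2 * c)" using \<delta> c by simp
      fix s t :: real assume st: "\<bar>s\<bar> < \<delta> / (2 * c)" "\<bar>t\<bar> < \<delta> / (2 * c)"
      define z where "z = s *\<^sub>R x + t *\<^sub>R y"
      have z: "z \<in> V" "N z \<le> c * (\<bar>s\<bar> + \<bar>t\<bar>)" unfolding z_def by (rule lc, rule Kc)
      have "N z < \<delta>" using z(2) small[OF st] by simp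
      from \<delta>(2)[OF z(1) this, of "[w]"] w
      have "\<bar>D 1 (\<phi> + z) [w] - D 1 \<phi> [w] - D 2 \<phi> [z, w]\<bar> \<le> e / (c * (N w + 1)) * N z * N w" by simp
      also have "\<dots> \<le> e / (c * (N w + 1)) * (c * (\<bar>s\<bar> + \<bar>t\<bar>)) * (N w + 1)"
        using z N[OF z(1)] Nw e c by (intro mult_mono mult_nonneg_nonneg) auto
      also have "\<dots> = e * (\<bar>s\<bar> + \<bar>t\<bar>)" using c Nw by simp
      also have "D 2 \<phi> [z, w] = s * D 2 \<phi> [x, w] + t * D 2 \<phi> [y, w]"
        unfolding z_def using lin2[OF x subspace_scale[OF V y] w, of s t] lin2[OF y subspace_0[OF V] w, of t]
          lin2[OF subspace_0[OF V] subspace_0[OF V] w, of 1] by simp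
      also have "\<phi> + z = p s t" by (simp add: p_def z_def add.assoc)
      also have "D 1 \<phi> [w] = D 1 (p 0 0) [w]" by (simp add: p_def)
      finally show "\<bar>D 1 (p s t) [w] - D 1 (p 0 0) [w] - (s * D 2 \<phi> [x, w] + t * D 2 \<phi> [y, w])\<bar> \<le> e * (\<bar>s\<bar> + \<bar>t\<bar>)" .
    qed
  qed
  show ?thesis
  proof (rule mixed_partials_equal[symmetric, where r = d0 and g = "\<lambda>s t. D 0 (p s t) []"
        and p = "\<lambda>s t. D 1 (p s t) [x]" and q = "\<lambda>s t. D 1 (p s t) [y]"
        and A = "D 2 \<phi> [x, x]" and A' = "D 2 \<phi> [y, y]"])
    fix s t assume st: "\<bar>s\<bar> < d0" "\<bar>t\<bar> < d0"
    have "((\<lambda>s. D 0 ((\<phi> + t *\<^sub>R y) + s *\<^sub>R x) []) has_real_derivative D 1 ((\<phi> + t *\<^sub>R y) + s *\<^sub>R x) [x]) (at s)"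
      using pU[OF st] x Kc[of _ 0] by (intro deriv) (auto simp: p_def add_ac)
    then show "((\<lambda>s. D 0 (p s t) []) has_real_derivative D 1 (p s t) [x]) (at s)" by (simp add: p_def add_ac)
    have "((\<lambda>t. D 0 ((\<phi> + s *\<^sub>R x) + t *\<^sub>R y) []) has_real_derivative D 1 ((\<phi> + s *\<^sub>R x) + t *\<^sub>R y) [y]) (at t)"
      using pU[OF st] y Kc[of 0] by (intro deriv) (auto simp: p_def add_ac)
    then show "((\<lambda>t. D 0 (p s t) []) has_real_derivative D 1 (p s t) [y]) (at t)" by (simp add: p_def add_ac)
  qed (use first x y d0 in auto)
qed

section \<open>The derivatives of the solution map\<close>

lemma linear_var_bounded:
  fixes g :: "'a::euclidean_space \<Rightarrow> 'b::real_normed_vector"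
  assumes g: "linear g" and r: "1 \<le> r"
  obtains L where "0 \<le> L" "\<And>x a. var_bounded r x a \<Longrightarrow> var_bounded r (\<lambda>t. g (x t)) (L * a)"
proof -
  obtain L where L: "0 < L" "\<And>x. norm (g x) \<le> L * norm x" using linear_bounded_pos[OF g] by blast
  show ?thesis by (rule that[of L]) (use L in \<open>auto intro: var_bounded_linear[OF _ r g]\<close>)
qed

lemma vec_expansion: "(x :: real^'n) = (\<Sum>i\<in>UNIV. (x $ i) *\<^sub>R axis i 1)"
  using basis_expansion[of x] by (simp add: scalar_mult_eq_scaleR)

lemma linear_field_term:
  assumes r: "1 \<le> r" and x: "var_bounded r x b" and y: "var_bounded r y c"
  shows "var_bounded r (\<lambda>s. (x s $ i) *\<^sub>R (y s :: 'b::real_normed_vector)) (4 * b * c)"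
proof -
  have "var_bounded r (\<lambda>s. x s $ i) (1 * b)"
    by (rule var_bounded_linear[OF x r]) (auto intro!: linearI simp: component_le_norm_cart)
  from var_bounded_bilinear[OF this y r bounded_bilinear_scaleR, of 1] show ?thesis by simp
qed

text \<open>In coordinates the field along the path is a sum of products of a scalar path with the
  field in a fixed direction, to which the product bound applies.\<close>

lemma linear_field_bounded:
  fixes G :: "real \<Rightarrow> real^'n \<Rightarrow> 'b::real_normed_vector"
  assumes r: "1 \<le> r" and lin: "\<And>s. linear (G s)" and G: "\<And>i. \<exists>c. var_bounded r (\<lambda>s. G s (axis i 1)) c"
  obtains C where "0 \<le> C" "\<And>x b. var_bounded r x b \<Longrightarrow> var_bounded r (\<lambda>s. G s (x s)) (C * b)"
proof -
  obtain c where c: "\<And>i. var_bounded r (\<lambda>s. G s (axis i 1)) (c i)" using G by metis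
  have c0: "0 \<le> c i" for i using var_boundedD(2)[OF c] .
  define m where "m = (\<Sum>i\<in>UNIV. c i)"
  have m: "0 \<le> m" "c i \<le> m" for i unfolding m_def using c0 by (auto intro: sum_nonneg member_le_sum)
  show ?thesis
  proof (rule that[of "8 ^ CARD('n) * (4 * m)"])
    fix x :: "real \<Rightarrow> real^'n" and b assume x: "var_bounded r x b"
    have b: "0 \<le> b" using var_boundedD(2)[OF x] .
    have "var_bounded r (\<lambda>s. \<Sum>i\<in>UNIV. (x s $ i) *\<^sub>R G s (axis i 1)) (8 ^ card (UNIV :: 'n set) * (4 * b * m))"
    proof (rule var_bounded_sum[OF _ r])
      show "var_bounded r (\<lambda>s. (x s $ i) *\<^sub>R G s (axis i 1)) (4 * b * m)" for i
        using linear_field_term[OF r x c] by (rule var_bounded_mono) (use b m r in \<open>auto intro: mult_left_mono\<close>)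
    qed (use b m in auto)
    moreover have "(\<Sum>i\<in>UNIV. (x s $ i) *\<^sub>R G s (axis i 1)) = G s (x s)" for s
      by (subst (2) vec_expansion) (simp add: linear_sum[OF lin] linear_scale[OF lin])
    ultimately show "var_bounded r (\<lambda>s. G s (x s)) (8 ^ CARD('n) * (4 * m) * b)" by (simp add: mult_ac)
  qed (use m in auto)
qed

text \<open>The coordinate expansion is used twice: for \<open>y\<close> with a basis direction in
  the first slot, then for \<open>x\<close>.\<close>

lemma bilinear_field_bounded:
  fixes G :: "real \<Rightarrow> real^'n \<Rightarrow> real^'n \<Rightarrow> 'b::real_normed_vector"
  assumes r: "1 \<le> r" and lin1: "\<And>s v. linear (\<lambda>u. G s u v)" and lin2: "\<And>s u. linear (\<lambda>v. G s u v)"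
    and G: "\<And>i j. \<exists>c. var_bounded r (\<lambda>s. G s (axis i 1) (axis j 1)) c"
  obtains C where "0 \<le> C"
    "\<And>x y a b. var_bounded r x a \<Longrightarrow> var_bounded r y b \<Longrightarrow> var_bounded r (\<lambda>s. G s (x s) (y s)) (C * a * b)"
proof -
  have "\<exists>C\<ge>0. \<forall>y b. var_bounded r y b \<longrightarrow> var_bounded r (\<lambda>s. G s (axis i 1) (y s)) (C * b)" for i
  proof -
    obtain C where "0 \<le> C" "\<And>x b. var_bounded r x b \<Longrightarrow> var_bounded r (\<lambda>s. G s (axis i 1) (x s)) (C * b)"
      by (rule linear_field_bounded[OF r lin2 G[of i]]) blast
    then show ?thesis by blast
  qed
  then obtain c where c: "\<And>i. 0 \<le> c i" "\<And>i y b. var_bounded r y b \<Longrightarrow> var_bounded r (\<lambda>s. G s (axis i 1) (y s)) (c i * b)"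
    by metis
  define m where "m = (\<Sum>i\<in>UNIV. c i)"
  have m: "0 \<le> m" "c i \<le> m" for i unfolding m_def using c(1) by (auto intro: sum_nonneg member_le_sum)
  show ?thesis
  proof (rule that[of "8 ^ CARD('n) * (4 * m)"])
    fix x y :: "real \<Rightarrow> real^'n" and a b assume x: "var_bounded r x a" and y: "var_bounded r y b"
    have ab: "0 \<le> a" "0 \<le> b" using var_boundedD(2)[OF x] var_boundedD(2)[OF y] by auto
    have "var_bounded r (\<lambda>s. \<Sum>i\<in>UNIV. (x s $ i) *\<^sub>R G s (axis i 1) (y s)) (8 ^ card (UNIV :: 'n set) * (4 * a * (m * b)))"
    proof (rule var_bounded_sum[OF _ r])
      show "var_bounded r (\<lambda>s. (x s $ i) *\<^sub>R G s (axis i 1) (y s)) (4 * a * (m * b))" for i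
        using linear_field_term[OF r x c(2)[OF y]]
        by (rule var_bounded_mono) (use ab m r in \<open>auto intro!: mult_left_mono mult_right_mono\<close>)
    qed (use ab m in auto)
    moreover have "(\<Sum>i\<in>UNIV. (x s $ i) *\<^sub>R G s (axis i 1) (y s)) = G s (x s) (y s)" for s
      by (subst (3) vec_expansion) (simp add: linear_sum[OF lin1] linear_scale[OF lin1])
    ultimately show "var_bounded r (\<lambda>s. G s (x s) (y s)) (8 ^ CARD('n) * (4 * m) * a * b)" by (simp add: mult_ac)
  qed (use m in auto)
qed

lemma var_bounded_C2_lipschitz:
  assumes g: "C2_lipschitz g" and x: "var_bounded r x a" and r: "1 \<le> r"
  shows "\<exists>c. var_bounded r (\<lambda>s. g (x s)) c" "\<exists>c. var_bounded r (\<lambda>s. grad g (x s) v) c"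
    "\<exists>c. var_bounded r (\<lambda>s. grad2 g (x s) u v) c"
proof -
  have *: "\<exists>c. var_bounded r (\<lambda>s. h (x s)) c" if "\<exists>L\<ge>0. \<forall>x y. norm (h x - h y) \<le> L * norm (x - y)" for h :: "'a \<Rightarrow> 'b"
    using that var_bounded_lipschitz[OF x r] by blast
  show "\<exists>c. var_bounded r (\<lambda>s. g (x s)) c" "\<exists>c. var_bounded r (\<lambda>s. grad g (x s) v) c"
    "\<exists>c. var_bounded r (\<lambda>s. grad2 g (x s) u v) c"
    using g unfolding C2_lipschitz_def by (auto intro!: *)
qed

text \<open>Only one-point cells subdivide \<open>{a..a}\<close>. This gives the derivative paths
  the value 0 at time 0.\<close>

lemma young_integral_trivial:
  assumes "\<And>s. linear (f s)"
  shows "young_integral f g a a = 0"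
proof (rule young_integral_eqI)
  show "has_young_integral f g a a 0"
    unfolding has_young_integral_def
  proof (intro allI impI)
    fix e :: real assume e: "0 < e"
    have "(\<Sum>(x, K)\<in>D. f x (g (Sup K) - g (Inf K))) = 0" if D: "D tagged_division_of {a..a}" for D
    proof (intro sum.neutral ballI, clarify)
      fix x K assume "(x, K) \<in> D"
      then have "x \<in> K" "K \<subseteq> {a}" using tagged_division_ofD(2,3)[OF D] by auto
      then have "K = {a}" by blast
      then show "f x (g (Sup K) - g (Inf K)) = 0" using linear_0[OF assms] by simp
    qed
    then show "\<exists>\<delta>>0. \<forall>D. D tagged_division_of {a..a} \<and> (\<forall>(x, K)\<in>D. Sup K - Inf K < \<delta>) \<longrightarrow>
      norm ((\<Sum>(x, K)\<in>D. f x (g (Sup K) - g (Inf K))) - 0) < e"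
      using e by (intro exI[of _ 1]) auto
  qed
qed

text \<open>The columns of \<open>Omega\<close>, each a Young integral plus an ordinary one, are
  bounded separately, put in place by linear maps and summed.\<close>

lemma Omega_var_bounded:
  fixes z :: "real \<Rightarrow> real^'m" and \<phi> :: "real \<Rightarrow> real^'n"
  assumes r: "1 \<le> r" "r < 2" and S: "C2_lipschitz S" and b0: "C2_lipschitz b0"
    and z: "var_bounded r z a" and \<phi>: "var_bounded r \<phi> b"
  shows "\<exists>c. var_bounded r (Omega S b0 z \<phi>) c"
proof -
  define col where "col j t = young_integral (\<lambda>s w. grad S (\<phi> s) (axis j 1) *v w) z 0 t
    + integral {0..t} (\<lambda>s. grad b0 (\<phi> s) (axis j 1))" for j t
  define place :: "'n \<Rightarrow> real^'n \<Rightarrow> real^'n^'n" where "place j v = (\<chi> i k. if k = j then v $ i else 0)" for j v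
  have place: "linear (place j)" for j
    by (intro linearI) (auto simp: place_def vec_eq_iff)
  have "\<exists>c. var_bounded r (\<lambda>t. place j (col j t)) c" for j
  proof -
    obtain c1 where c1: "var_bounded r (\<lambda>s. grad S (\<phi> s) (axis j 1)) c1"
      using var_bounded_C2_lipschitz(2)[OF S \<phi> r(1)] by blast
    obtain c2 where c2: "var_bounded r (\<lambda>s. grad b0 (\<phi> s) (axis j 1)) c2"
      using var_bounded_C2_lipschitz(2)[OF b0 \<phi> r(1)] by blast
    obtain C where C: "\<And>f g a b. var_bounded r f a \<Longrightarrow> var_bounded r g b \<Longrightarrow>
      var_bounded r (\<lambda>t. young_integral (\<lambda>s. (*v) (f s :: real^'m^'n)) g 0 t) (C * a * b)"
      by (rule young_integral_bounded[OF bounded_bilinear_matrix_vector_mult r]) blast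
    have "var_bounded r (col j) (4 * (C * c1 * a + c2))"
      unfolding col_def[abs_def] by (intro var_bounded_add C[OF c1 z] var_bounded_integral[OF c2] r)
    moreover obtain L where "\<And>x a. var_bounded r x a \<Longrightarrow> var_bounded r (\<lambda>t. place j (x t)) (L * a)"
      by (rule linear_var_bounded[OF place[of j] r(1)]) blast
    ultimately show ?thesis by blast
  qed
  then obtain c where c: "\<And>j. var_bounded r (\<lambda>t. place j (col j t)) (c j)" by metis
  have c0: "0 \<le> c j" for j using var_boundedD(2)[OF c] .
  have "var_bounded r (\<lambda>t. \<Sum>j\<in>UNIV. place j (col j t)) (8 ^ card (UNIV :: 'n set) * (\<Sum>j\<in>UNIV. c j))"
  proof (rule var_bounded_sum[OF _ r(1)])
    show "var_bounded r (\<lambda>t. place j (col j t)) (\<Sum>j\<in>UNIV. c j)" for j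
      using c by (rule var_bounded_mono) (use c0 r in \<open>auto intro: member_le_sum\<close>)
  qed (use c0 in \<open>auto intro: sum_nonneg\<close>)
  moreover have "(\<lambda>t. \<Sum>j\<in>UNIV. place j (col j t)) = Omega S b0 z \<phi>"
    by (simp add: fun_eq_iff Omega_def matrix_def place_def col_def vec_eq_iff)
  ultimately show ?thesis by auto
qed

section \<open>Variation of constants along the flow\<close>

locale young_flow =
  fixes \<phi> :: "real \<Rightarrow> real^'n" and M :: "real \<Rightarrow> real^'n^'n" and S :: "real^'n \<Rightarrow> real^'m^'n"
    and b0 :: "real^'n \<Rightarrow> real^'n" and z :: "real \<Rightarrow> real^'m"
  assumes \<phi>: "\<exists>c. var_bounded (3/2) \<phi> c" and M: "\<exists>c. var_bounded (3/2) M c"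
    and Mi: "\<exists>c. var_bounded (3/2) (\<lambda>t. matrix_inv (M t)) c" and z: "\<exists>c. var_bounded (3/2) z c"
    and S: "C2_lipschitz S" and b0: "C2_lipschitz b0"
begin

text \<open>The variation-of-constants operator. \<open>chi\<close>, \<open>V1\<close> and
  \<open>V2\<close> are built from it and from its drift version \<open>W0\<close>, so bounds and
  linearity are proved once.\<close>

definition W :: "(real \<Rightarrow> real^'m^'n) \<Rightarrow> (real \<Rightarrow> real^'m) \<Rightarrow> real \<Rightarrow> real^'n" where
  "W G f = on_unit (\<lambda>t. M t *v young_integral (\<lambda>s w. matrix_inv (M s) *v (G s *v w)) f 0 t)"

definition W0 :: "(real \<Rightarrow> real^'n) \<Rightarrow> real \<Rightarrow> real^'n" where
  "W0 c = on_unit (\<lambda>t. M t *v integral {0..t} (\<lambda>s. matrix_inv (M s) *v c s))"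

text \<open>Merging the two matrix actions makes the integrand a single bilinear product with a path
  of matrices, the shape of the general Young estimates.\<close>

lemma integrand_eq: "(\<lambda>s w. matrix_inv (M s) *v (G s *v w)) = (\<lambda>s. (*v) (matrix_inv (M s) ** G s))"
  by (simp add: fun_eq_iff matrix_vector_mul_assoc)

lemma W_bounded:
  obtains C where "0 \<le> C"
    "\<And>G f a b. var_bounded (3/2) G a \<Longrightarrow> var_bounded (3/2) f b \<Longrightarrow> var_bounded (3/2) (W G f) (C * a * b)"
proof -
  obtain m where m: "var_bounded (3/2) M m" using M by blast
  obtain mi where mi: "var_bounded (3/2) (\<lambda>t. matrix_inv (M t)) mi" using Mi by blast
  have m0: "0 \<le> m" "0 \<le> mi" using var_boundedD(2)[OF m] var_boundedD(2)[OF mi] by auto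
  have r: "(1::real) \<le> 3/2" "(3/2::real) < 2" by auto
  obtain C1 where C1: "0 \<le> C1" "\<And>f g a b. var_bounded (3/2) f a \<Longrightarrow> var_bounded (3/2) g b \<Longrightarrow>
    var_bounded (3/2) (\<lambda>t. (f t :: real^'n^'n) ** (g t :: real^'m^'n)) (C1 * a * b)"
    by (rule var_bounded_product_exists[OF bounded_bilinear_matrix_matrix_mult r(1)]) blast
  obtain C2 where C2: "0 \<le> C2" "\<And>f g a b. var_bounded (3/2) f a \<Longrightarrow> var_bounded (3/2) g b \<Longrightarrow>
    var_bounded (3/2) (\<lambda>t. young_integral (\<lambda>s. (*v) (f s :: real^'m^'n)) g 0 t) (C2 * a * b)"
    by (rule young_integral_bounded[OF bounded_bilinear_matrix_vector_mult r]) blast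
  obtain C3 where C3: "0 \<le> C3" "\<And>f g a b. var_bounded (3/2) f a \<Longrightarrow> var_bounded (3/2) g b \<Longrightarrow>
    var_bounded (3/2) (\<lambda>t. (f t :: real^'n^'n) *v g t) (C3 * a * b)"
    by (rule var_bounded_product_exists[OF bounded_bilinear_matrix_vector_mult r(1)]) blast
  show ?thesis
  proof (rule that[of "C3 * m * (C2 * (C1 * mi))"])
    fix G :: "real \<Rightarrow> real^'m^'n" and f :: "real \<Rightarrow> real^'m" and a b assume G: "var_bounded (3/2) G a" and f: "var_bounded (3/2) f b"
    have "var_bounded (3/2) (\<lambda>t. M t *v young_integral (\<lambda>s. (*v) (matrix_inv (M s) ** G s)) f 0 t)
      (C3 * m * (C2 * (C1 * mi * a) * b))"
      by (intro C3 m C2 C1 mi G f)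
    then show "var_bounded (3/2) (W G f) (C3 * m * (C2 * (C1 * mi)) * a * b)"
      unfolding W_def integrand_eq by (rule_tac var_bounded_cong) (auto simp: on_unit_def mult_ac)
  qed (use m0 C1 C2 C3 in auto)
qed

lemma W0_bounded:
  obtains C where "0 \<le> C" "\<And>c b. var_bounded (3/2) c b \<Longrightarrow> var_bounded (3/2) (W0 c) (C * b)"
proof -
  obtain m where m: "var_bounded (3/2) M m" using M by blast
  obtain mi where mi: "var_bounded (3/2) (\<lambda>t. matrix_inv (M t)) mi" using Mi by blast
  have m0: "0 \<le> m" "0 \<le> mi" using var_boundedD(2)[OF m] var_boundedD(2)[OF mi] by auto
  obtain C3 where C3: "0 \<le> C3" "\<And>f g a b. var_bounded (3/2) f a \<Longrightarrow> var_bounded (3/2) g b \<Longrightarrow>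
    var_bounded (3/2) (\<lambda>t. (f t :: real^'n^'n) *v g t) (C3 * a * b)"
    by (rule var_bounded_product_exists[OF bounded_bilinear_matrix_vector_mult, of "3/2"]) auto
  show ?thesis
  proof (rule that[of "C3 * m * (C3 * mi)"])
    fix c :: "real \<Rightarrow> real^'n" and b assume c: "var_bounded (3/2) c b"
    have "var_bounded (3/2) (\<lambda>t. M t *v integral {0..t} (\<lambda>s. matrix_inv (M s) *v c s)) (C3 * m * (C3 * mi * b))"
      by (intro C3 m var_bounded_integral mi c) auto
    then show "var_bounded (3/2) (W0 c) (C3 * m * (C3 * mi) * b)"
      unfolding W0_def by (rule_tac var_bounded_cong) (auto simp: on_unit_def mult_ac)
  qed (use m0 C3 in auto)
qed

lemma W_support: "W G f 0 = 0" "t \<notin> {0..1} \<Longrightarrow> W G f t = 0"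
proof -
  have "linear ((*v) A)" for A :: "real^'m^'n" by (rule matrix_vector_mul_linear)
  then show "W G f 0 = 0"
    unfolding W_def integrand_eq by (simp add: on_unit_def young_integral_trivial)
  show "t \<notin> {0..1} \<Longrightarrow> W G f t = 0" by (auto simp: W_def on_unit_def)
qed

lemma W0_support: "W0 c 0 = 0" "t \<notin> {0..1} \<Longrightarrow> W0 c t = 0"
  by (auto simp: W0_def on_unit_def)

lemma W_has_young_integral:
  fixes G :: "real \<Rightarrow> real^'m^'n"
  assumes "var_bounded (3/2) G a" "var_bounded (3/2) f b" "t \<in> {0..1}"
  shows "has_young_integral (\<lambda>s w. matrix_inv (M s) *v (G s *v w)) f 0 t
    (young_integral (\<lambda>s w. matrix_inv (M s) *v (G s *v w)) f 0 t)"
proof -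
  obtain mi where mi: "var_bounded (3/2) (\<lambda>t. matrix_inv (M t)) mi" using Mi by blast
  obtain C1 where "\<And>f g a b. var_bounded (3/2) f a \<Longrightarrow> var_bounded (3/2) g b \<Longrightarrow>
    var_bounded (3/2) (\<lambda>t. (f t :: real^'n^'n) ** (g t :: real^'m^'n)) (C1 * a * b)"
    by (rule var_bounded_product_exists[OF bounded_bilinear_matrix_matrix_mult, of "3/2"]) auto
  from this[OF mi assms(1)] have C1: "var_bounded (3/2) (\<lambda>t. matrix_inv (M t) ** G t) (C1 * mi * a)" .
  show ?thesis
    unfolding integrand_eq
    by (rule young_integral_exists[OF bounded_bilinear_matrix_vector_mult _ _ C1 assms(2,3)]) auto
qed

lemma W_linear_left:
  assumes G: "var_bounded (3/2) G1 a1" "var_bounded (3/2) G2 a2" and f: "var_bounded (3/2) f b"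
  shows "W (\<lambda>s. c *\<^sub>R G1 s + G2 s) f = (\<lambda>t. c *\<^sub>R W G1 f t + W G2 f t)"
proof
  interpret mv: bounded_bilinear "(*v) :: real^'m^'n \<Rightarrow> real^'m \<Rightarrow> real^'n" by (rule bounded_bilinear_matrix_vector_mult)
  interpret mn: bounded_bilinear "(*v) :: real^'n^'n \<Rightarrow> real^'n \<Rightarrow> real^'n" by (rule bounded_bilinear_matrix_vector_mult)
  fix t show "W (\<lambda>s. c *\<^sub>R G1 s + G2 s) f t = c *\<^sub>R W G1 f t + W G2 f t"
  proof (cases "t \<in> {0..1}")
    case True
    have "young_integral (\<lambda>s w. matrix_inv (M s) *v ((c *\<^sub>R G1 s + G2 s) *v w)) f 0 t
      = c *\<^sub>R young_integral (\<lambda>s w. matrix_inv (M s) *v (G1 s *v w)) f 0 t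
        + young_integral (\<lambda>s w. matrix_inv (M s) *v (G2 s *v w)) f 0 t"
      by (rule young_integral_eqI, rule has_young_integral_linear_combination[OF W_has_young_integral[OF G(1) f True]
          W_has_young_integral[OF G(2) f True]])
        (simp add: mv.add_left mv.scaleR_left mn.add_right mn.scaleR_right)
    then show ?thesis using True by (simp add: W_def on_unit_def mn.add_right mn.scaleR_right)
  qed (auto simp: W_def on_unit_def)
qed

lemma W_linear_right:
  assumes G: "var_bounded (3/2) G a" and f: "var_bounded (3/2) f1 b1" "var_bounded (3/2) f2 b2"
  shows "W G (\<lambda>s. c *\<^sub>R f1 s + f2 s) = (\<lambda>t. c *\<^sub>R W G f1 t + W G f2 t)"
proof
  interpret mv: bounded_bilinear "(*v) :: real^'m^'n \<Rightarrow> real^'m \<Rightarrow> real^'n" by (rule bounded_bilinear_matrix_vector_mult)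
  interpret mn: bounded_bilinear "(*v) :: real^'n^'n \<Rightarrow> real^'n \<Rightarrow> real^'n" by (rule bounded_bilinear_matrix_vector_mult)
  fix t show "W G (\<lambda>s. c *\<^sub>R f1 s + f2 s) t = c *\<^sub>R W G f1 t + W G f2 t"
  proof (cases "t \<in> {0..1}")
    case True
    have "young_integral (\<lambda>s w. matrix_inv (M s) *v (G s *v w)) (\<lambda>s. c *\<^sub>R f1 s + f2 s) 0 t
      = c *\<^sub>R young_integral (\<lambda>s w. matrix_inv (M s) *v (G s *v w)) f1 0 t
        + young_integral (\<lambda>s w. matrix_inv (M s) *v (G s *v w)) f2 0 t"
      by (rule young_integral_eqI, rule has_young_integral_linear_combination[OF W_has_young_integral[OF G f(1) True]
          W_has_young_integral[OF G f(2) True]])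
        (simp add: mv.add_right mv.scaleR_right mv.diff_right mn.add_right mn.scaleR_right mn.diff_right algebra_simps)
    then show ?thesis using True by (simp add: W_def on_unit_def mn.add_right mn.scaleR_right)
  qed (auto simp: W_def on_unit_def)
qed

lemma W0_linear:
  assumes d: "var_bounded (3/2) d1 a1" "var_bounded (3/2) d2 a2"
  shows "W0 (\<lambda>s. c *\<^sub>R d1 s + d2 s) = (\<lambda>t. c *\<^sub>R W0 d1 t + W0 d2 t)"
proof
  interpret mn: bounded_bilinear "(*v) :: real^'n^'n \<Rightarrow> real^'n \<Rightarrow> real^'n" by (rule bounded_bilinear_matrix_vector_mult)
  obtain mi where mi: "var_bounded (3/2) (\<lambda>t. matrix_inv (M t)) mi" using Mi by blast
  have int: "(\<lambda>s. matrix_inv (M s) *v d s) integrable_on {0..t}" if "var_bounded (3/2) d a" "t \<in> {0..1}" for d a t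
  proof (rule integrable_continuous_interval)
    show "continuous_on {0..t} (\<lambda>s. matrix_inv (M s) *v d s)"
      using that(2) by (intro mn.continuous_on continuous_on_subset[OF var_boundedD(1)[OF mi]]
          continuous_on_subset[OF var_boundedD(1)[OF that(1)]]) auto
  qed
  fix t show "W0 (\<lambda>s. c *\<^sub>R d1 s + d2 s) t = c *\<^sub>R W0 d1 t + W0 d2 t"
  proof (cases "t \<in> {0..1}")
    case True
    have "integral {0..t} (\<lambda>s. matrix_inv (M s) *v (c *\<^sub>R d1 s + d2 s))
      = c *\<^sub>R integral {0..t} (\<lambda>s. matrix_inv (M s) *v d1 s) + integral {0..t} (\<lambda>s. matrix_inv (M s) *v d2 s)"
      using int[OF d(1) True] int[OF d(2) True]
      by (simp add: mn.add_right mn.scaleR_right Henstock_Kurzweil_Integration.integral_add integrable_cmul)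
    then show ?thesis using True by (simp add: W0_def on_unit_def mn.add_right mn.scaleR_right)
  qed (auto simp: W0_def on_unit_def)
qed

lemma chi_eq: "chi S \<phi> M f = W (\<lambda>s. S (\<phi> s)) f"
  by (simp add: chi_def W_def)

lemma V1_eq: "V1 S \<phi> M f k = (\<lambda>t. W (\<lambda>s. grad S (\<phi> s) (chi S \<phi> M f s)) k t + W (\<lambda>s. grad S (\<phi> s) (chi S \<phi> M k s)) f t)"
  by (auto simp: V1_def W_def on_unit_def fun_eq_iff matrix_vector_right_distrib)

lemma V2_eq: "V2 S b0 z \<phi> M f k = (\<lambda>t. W (\<lambda>s. grad2 S (\<phi> s) (chi S \<phi> M f s) (chi S \<phi> M k s)) z t
    + W0 (\<lambda>s. grad2 b0 (\<phi> s) (chi S \<phi> M f s) (chi S \<phi> M k s)) t)"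
  by (auto simp: V2_def W_def W0_def on_unit_def fun_eq_iff matrix_vector_right_distrib)

lemma S_path: "\<exists>c. var_bounded (3/2) (\<lambda>s. S (\<phi> s)) c"
  using \<phi> var_bounded_C2_lipschitz(1)[OF S, of "3/2" \<phi>] by auto

lemma chi_bounded:
  obtains C where "0 \<le> C" "\<And>f b. var_bounded (3/2) f b \<Longrightarrow> var_bounded (3/2) (chi S \<phi> M f) (C * b)"
proof -
  obtain c where c: "var_bounded (3/2) (\<lambda>s. S (\<phi> s)) c" using S_path by blast
  obtain C where C: "0 \<le> C" "\<And>G f a b. var_bounded (3/2) G a \<Longrightarrow> var_bounded (3/2) f b \<Longrightarrow> var_bounded (3/2) (W G f) (C * a * b)"
    by (rule W_bounded) blast
  show ?thesis
    by (rule that[of "C * c"]) (use C C(2)[OF c] var_boundedD(2)[OF c] in \<open>auto simp: chi_eq\<close>)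
qed

lemma chi_linear:
  assumes "var_bounded (3/2) f a" "var_bounded (3/2) g b"
  shows "chi S \<phi> M (\<lambda>t. c *\<^sub>R f t + g t) = (\<lambda>t. c *\<^sub>R chi S \<phi> M f t + chi S \<phi> M g t)"
  using S_path W_linear_right[OF _ assms] unfolding chi_eq by blast

lemma gradS_bounded:
  obtains C where "0 \<le> C" "\<And>x b. var_bounded (3/2) x b \<Longrightarrow> var_bounded (3/2) (\<lambda>s. grad S (\<phi> s) (x s)) (C * b)"
proof -
  obtain c where c: "var_bounded (3/2) \<phi> c" using \<phi> by blast
  show ?thesis
    by (rule linear_field_bounded[of "3/2" "\<lambda>s. grad S (\<phi> s)"])
      (auto intro: C2_lipschitzD(3)[OF S] var_bounded_C2_lipschitz(2)[OF S c] that)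
qed

lemma grad2_bounded:
  assumes g: "C2_lipschitz g"
  obtains C where "0 \<le> C" "\<And>x y a b. var_bounded (3/2) x a \<Longrightarrow> var_bounded (3/2) y b \<Longrightarrow>
    var_bounded (3/2) (\<lambda>s. grad2 g (\<phi> s) (x s) (y s)) (C * a * b)"
proof -
  obtain c where c: "var_bounded (3/2) \<phi> c" using \<phi> by blast
  show ?thesis
    by (rule bilinear_field_bounded[of "3/2" "\<lambda>s. grad2 g (\<phi> s)"])
      (auto intro: C2_lipschitzD(4,5)[OF g] var_bounded_C2_lipschitz(3)[OF g c] that)
qed

text \<open>Every term of \<open>V1\<close> and \<open>V2\<close> contains one factor linear in
  \<open>f\<close> and one linear in \<open>k\<close>, so the composed bounds are multiples of
  \<open>a * b\<close>; flow, coefficients and driver enter the constant.\<close>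

lemma second_derivative_bounded:
  obtains C where "0 \<le> C" "\<And>f k a b. var_bounded (3/2) f a \<Longrightarrow> var_bounded (3/2) k b \<Longrightarrow>
    var_bounded (3/2) (\<lambda>t. V1 S \<phi> M f k t + V2 S b0 z \<phi> M f k t) (C * a * b)"
proof -
  obtain CW where W: "0 \<le> CW" "\<And>G f a b. var_bounded (3/2) G a \<Longrightarrow> var_bounded (3/2) f b \<Longrightarrow> var_bounded (3/2) (W G f) (CW * a * b)"
    by (rule W_bounded) blast
  obtain CW0 where W0: "0 \<le> CW0" "\<And>c b. var_bounded (3/2) c b \<Longrightarrow> var_bounded (3/2) (W0 c) (CW0 * b)"
    by (rule W0_bounded) blast
  obtain X where X: "0 \<le> X" "\<And>f b. var_bounded (3/2) f b \<Longrightarrow> var_bounded (3/2) (chi S \<phi> M f) (X * b)"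
    by (rule chi_bounded) blast
  obtain G where G: "0 \<le> G" "\<And>x b. var_bounded (3/2) x b \<Longrightarrow> var_bounded (3/2) (\<lambda>s. grad S (\<phi> s) (x s)) (G * b)"
    by (rule gradS_bounded) blast
  obtain G2 where G2: "0 \<le> G2" "\<And>x y a b. var_bounded (3/2) x a \<Longrightarrow> var_bounded (3/2) y b \<Longrightarrow>
    var_bounded (3/2) (\<lambda>s. grad2 S (\<phi> s) (x s) (y s)) (G2 * a * b)" by (rule grad2_bounded[OF S]) blast
  obtain B2 where B2: "0 \<le> B2" "\<And>x y a b. var_bounded (3/2) x a \<Longrightarrow> var_bounded (3/2) y b \<Longrightarrow>
    var_bounded (3/2) (\<lambda>s. grad2 b0 (\<phi> s) (x s) (y s)) (B2 * a * b)" by (rule grad2_bounded[OF b0]) blast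
  obtain zc where zc: "var_bounded (3/2) z zc" using z by blast
  have zc0: "0 \<le> zc" using var_boundedD(2)[OF zc] .
  define C where "C = 4 * (4 * (CW * (G * X) + CW * (G * X)) + 4 * (CW * (G2 * X * X) * zc + CW0 * (B2 * X * X)))"
  show ?thesis
  proof (rule that[of C])
    show "0 \<le> C" using W W0 X G G2 B2 zc0 by (simp add: C_def)
    fix f k :: "real \<Rightarrow> real^'m" and a b assume f: "var_bounded (3/2) f a" and k: "var_bounded (3/2) k b"
    have "var_bounded (3/2) (\<lambda>t. V1 S \<phi> M f k t + V2 S b0 z \<phi> M f k t)
      (4 * (4 * (CW * (G * (X * a)) * b + CW * (G * (X * b)) * a)
        + 4 * (CW * (G2 * (X * a) * (X * b)) * zc + CW0 * (B2 * (X * a) * (X * b)))))"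
      unfolding V1_eq V2_eq by (intro var_bounded_add W W0 G G2 B2 X f k zc) auto
    then show "var_bounded (3/2) (\<lambda>t. V1 S \<phi> M f k t + V2 S b0 z \<phi> M f k t) (C * a * b)"
      by (simp add: C_def algebra_simps)
  qed
qed

text \<open>In \<open>V1\<close> the two summands trade places; in \<open>V2\<close> it is the
  symmetry of the second derivatives of the coefficients.\<close>

lemma second_derivative_symmetric:
  "V1 S \<phi> M f k = V1 S \<phi> M k f" "V2 S b0 z \<phi> M f k = V2 S b0 z \<phi> M k f"
proof -
  show "V1 S \<phi> M f k = V1 S \<phi> M k f" by (simp add: V1_eq fun_eq_iff add.commute)
  have "(\<lambda>s. grad2 g (\<phi> s) (chi S \<phi> M f s) (chi S \<phi> M k s)) = (\<lambda>s. grad2 g (\<phi> s) (chi S \<phi> M k s) (chi S \<phi> M f s))"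
    if "C2_lipschitz g" for g :: "real^'n \<Rightarrow> 'b::euclidean_space"
    by (intro ext grad2_symmetric[OF that])
  from this[OF S] this[OF b0] show "V2 S b0 z \<phi> M f k = V2 S b0 z \<phi> M k f" by (simp only: V2_eq)
qed

lemma V1_linear:
  assumes f: "var_bounded (3/2) f a" and g: "var_bounded (3/2) g b" and k: "var_bounded (3/2) k e"
  shows "V1 S \<phi> M (\<lambda>t. c *\<^sub>R f t + g t) k = (\<lambda>t. c *\<^sub>R V1 S \<phi> M f k t + V1 S \<phi> M g k t)"
proof -
  note lin = C2_lipschitzD(3)[OF S]
  have ex: "\<exists>c. var_bounded (3/2) (\<lambda>s. grad S (\<phi> s) (chi S \<phi> M h s)) c" if "var_bounded (3/2) h d" for h d
  proof -
    obtain X where "\<And>f b. var_bounded (3/2) f b \<Longrightarrow> var_bounded (3/2) (chi S \<phi> M f) (X * b)"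
      by (rule chi_bounded) blast
    note X = this[OF that]
    show ?thesis by (rule gradS_bounded) (use X in blast)
  qed
  obtain cf cg ck where c: "var_bounded (3/2) (\<lambda>s. grad S (\<phi> s) (chi S \<phi> M f s)) cf"
    "var_bounded (3/2) (\<lambda>s. grad S (\<phi> s) (chi S \<phi> M g s)) cg" "var_bounded (3/2) (\<lambda>s. grad S (\<phi> s) (chi S \<phi> M k s)) ck"
    using ex[OF f] ex[OF g] ex[OF k] by blast
  show ?thesis
    unfolding V1_eq chi_linear[OF f g] linear_add[OF lin] linear_scale[OF lin] W_linear_left[OF c(1,2) k]
      W_linear_right[OF c(3) f g]
    by (simp add: fun_eq_iff algebra_simps)
qed

lemma V2_linear:
  assumes f: "var_bounded (3/2) f a" and g: "var_bounded (3/2) g b" and k: "var_bounded (3/2) k e"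
  shows "V2 S b0 z \<phi> M (\<lambda>t. c *\<^sub>R f t + g t) k = (\<lambda>t. c *\<^sub>R V2 S b0 z \<phi> M f k t + V2 S b0 z \<phi> M g k t)"
proof -
  note lin = C2_lipschitzD(4)[OF S] C2_lipschitzD(4)[OF b0]
  obtain zc where zc: "var_bounded (3/2) z zc" using z by blast
  have exS: "\<exists>c. var_bounded (3/2) (\<lambda>s. grad2 S (\<phi> s) (chi S \<phi> M h s) (chi S \<phi> M k s)) c" if "var_bounded (3/2) h d" for h d
  proof -
    obtain X where "\<And>f b. var_bounded (3/2) f b \<Longrightarrow> var_bounded (3/2) (chi S \<phi> M f) (X * b)"
      by (rule chi_bounded) blast
    note X = this[OF that] this[OF k]
    show ?thesis by (rule grad2_bounded[OF S]) (use X in blast)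
  qed
  have exb: "\<exists>c. var_bounded (3/2) (\<lambda>s. grad2 b0 (\<phi> s) (chi S \<phi> M h s) (chi S \<phi> M k s)) c" if "var_bounded (3/2) h d" for h d
  proof -
    obtain X where "\<And>f b. var_bounded (3/2) f b \<Longrightarrow> var_bounded (3/2) (chi S \<phi> M f) (X * b)"
      by (rule chi_bounded) blast
    note X = this[OF that] this[OF k]
    show ?thesis by (rule grad2_bounded[OF b0]) (use X in blast)
  qed
  obtain cf cg bf bg where c: "var_bounded (3/2) (\<lambda>s. grad2 S (\<phi> s) (chi S \<phi> M f s) (chi S \<phi> M k s)) cf"
    "var_bounded (3/2) (\<lambda>s. grad2 S (\<phi> s) (chi S \<phi> M g s) (chi S \<phi> M k s)) cg"
    "var_bounded (3/2) (\<lambda>s. grad2 b0 (\<phi> s) (chi S \<phi> M f s) (chi S \<phi> M k s)) bf"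
    "var_bounded (3/2) (\<lambda>s. grad2 b0 (\<phi> s) (chi S \<phi> M g s) (chi S \<phi> M k s)) bg"
    using exS[OF f] exS[OF g] exb[OF f] exb[OF g] by blast
  show ?thesis
    unfolding V2_eq chi_linear[OF f g] linear_add[OF lin(1)] linear_scale[OF lin(1)] linear_add[OF lin(2)] linear_scale[OF lin(2)]
      W_linear_left[OF c(1,2) zc] W0_linear[OF c(3,4)]
    by (simp add: fun_eq_iff algebra_simps)
qed

lemma derivative_paths_support:
  "chi S \<phi> M f 0 = 0" "t \<notin> {0..1} \<Longrightarrow> chi S \<phi> M f t = 0"
  "V1 S \<phi> M f k 0 + V2 S b0 z \<phi> M f k 0 = 0" "t \<notin> {0..1} \<Longrightarrow> V1 S \<phi> M f k t + V2 S b0 z \<phi> M f k t = 0"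
  using W_support W0_support by (simp_all add: chi_eq V1_eq V2_eq)

end

section \<open>From the form on paths to the Hessian\<close>

lemma C0_var_linear_combination:
  assumes x: "x \<in> C0_var r" and y: "y \<in> C0_var r" and r: "1 \<le> r"
  shows "a *\<^sub>R x + b *\<^sub>R y \<in> C0_var r" "var_norm r (a *\<^sub>R x + b *\<^sub>R y) \<le> 4 * (\<bar>a\<bar> * var_norm r x + \<bar>b\<bar> * var_norm r y)"
proof -
  have s: "var_bounded r (\<lambda>t. c *\<^sub>R w t) (\<bar>c\<bar> * var_norm r w)" if "w \<in> C0_var r" for c and w :: "real \<Rightarrow> 'a"
    by (rule var_bounded_linear[OF C0_var_var_bounded[OF that r] r]) (auto simp: linear_scaleR)
  have eq: "a *\<^sub>R x + b *\<^sub>R y = (\<lambda>t. a *\<^sub>R x t + b *\<^sub>R y t)" by (simp add: fun_eq_iff scaleR_fun_def)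
  have z: "x 0 = 0" "y 0 = 0" "t \<notin> {0..1} \<Longrightarrow> x t = 0" "t \<notin> {0..1} \<Longrightarrow> y t = 0" for t
    using x y unfolding C0_var_def by blast+
  show "a *\<^sub>R x + b *\<^sub>R y \<in> C0_var r" "var_norm r (a *\<^sub>R x + b *\<^sub>R y) \<le> 4 * (\<bar>a\<bar> * var_norm r x + \<bar>b\<bar> * var_norm r y)"
    unfolding eq using var_bounded_C0_var[OF var_bounded_add[OF s[OF x] s[OF y] r] r order_refl] z by auto
qed

lemma subspace_C0_var:
  assumes "1 \<le> r"
  shows "subspace (C0_var r)"
proof (rule subspaceI)
  have "(\<lambda>_. 0) \<in> C0_var r"
    by (rule var_bounded_C0_var(1)[OF var_bounded_const[OF assms, of 0] assms order_refl]) auto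
  then show "0 \<in> C0_var r" by (simp add: zero_fun_def)
  show "x + y \<in> C0_var r" if "x \<in> C0_var r" "y \<in> C0_var r" for x y
    using C0_var_linear_combination(1)[OF that assms, of 1 1] by simp
  show "c *\<^sub>R x \<in> C0_var r" if "x \<in> C0_var r" for c x
    using C0_var_linear_combination(1)[OF that that assms, of c 0] by simp
qed

lemma norm_stack_diff:
  "(norm (stack_path f g t - stack_path f g s))\<^sup>2 = (norm (f t - f s))\<^sup>2 + (norm (g t - g s))\<^sup>2"
  unfolding power2_norm_eq_inner inner_vec_def stack_path_def
  by (subst UNIV_Plus_UNIV[symmetric], subst sum.Plus) auto

lemma stack_path_linear: "stack_path (a *\<^sub>R f + f') (a *\<^sub>R g + g') t = a *\<^sub>R stack_path f g t + stack_path f' g' t"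
  by (auto simp: stack_path_def vec_eq_iff scaleR_fun_def split: sum.split)

lemma block_matrix_C2_lipschitz:
  assumes "C2_lipschitz \<sigma>" "C2_lipschitz \<sigma>h"
  shows "C2_lipschitz (\<lambda>y. block_matrix (\<sigma> y) (\<sigma>h y))"
proof -
  have "linear (\<lambda>A. block_matrix A 0)" "linear (\<lambda>B. block_matrix 0 B)"
    by (auto intro!: linearI simp: block_matrix_def vec_eq_iff split: sum.split)
  from C2_lipschitz_linear_combination[OF assms this]
  have "C2_lipschitz (\<lambda>y. block_matrix (\<sigma> y) 0 + block_matrix 0 (\<sigma>h y))" .
  moreover have "block_matrix (\<sigma> y) 0 + block_matrix 0 (\<sigma>h y) = block_matrix (\<sigma> y) (\<sigma>h y)" for y
    by (auto simp: block_matrix_def vec_eq_iff split: sum.split)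
  ultimately show ?thesis by simp
qed

text \<open>Squared increments of the stacked path are sums of those of its two parts, so the
  energies add. The Brownian energy is weighted by the length of a cell; as lengths are at most 1
  and \<open>2 * H < 1\<close>, it dominates the one weighted by the power
  \<open>2 * H\<close>.\<close>

lemma cameron_martin_energy_space:
  fixes HH :: "(real \<Rightarrow> real^'d1) set"
  assumes H: "1/3 < H" "H < 1/2" and cm: "fbm_cameron_martin H HH ipH"
  shows "energy_space (HH \<times> (bm_cameron_martin :: (real \<Rightarrow> real^'d2) set)) (direct_sum_ip ipH bm_ip)
    (\<lambda>x. stack_path (fst x) (snd x)) H"
proof
  have hs: "hilbert_space_on HH ipH" using cm by (simp add: fbm_cameron_martin_def is_rkhs_def)
  note h = hilbert_space_onD[OF hs]
  have bs: "subspace (bm_cameron_martin :: (real \<Rightarrow> real^'d2) set)"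
  proof (rule subspaceI)
    show "0 \<in> bm_cameron_martin" by (rule bm_cameron_martin_zero)
    show "x + y \<in> bm_cameron_martin" if "x \<in> bm_cameron_martin" "y \<in> bm_cameron_martin" for x y :: "real \<Rightarrow> real^'d2"
      using bm_cameron_martin_linear[OF that, of 1] by simp
    show "c *\<^sub>R x \<in> bm_cameron_martin" if "x \<in> bm_cameron_martin" for c and x :: "real \<Rightarrow> real^'d2"
      using bm_cameron_martin_linear[OF that bm_cameron_martin_zero, of c] by simp
  qed
  show "subspace (HH \<times> (bm_cameron_martin :: (real \<Rightarrow> real^'d2) set))" by (rule subspace_Times[OF h(1) bs])
  show "direct_sum_ip ipH bm_ip x y = direct_sum_ip ipH bm_ip y x"
    if "x \<in> HH \<times> bm_cameron_martin" "y \<in> HH \<times> bm_cameron_martin" for x y :: "(real \<Rightarrow> real^'d1) \<times> (real \<Rightarrow> real^'d2)"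
    using that h(2)[of "fst x" "fst y"] by (auto simp: direct_sum_ip_def bm_ip_sym[of "snd x"])
  show "direct_sum_ip ipH bm_ip (a *\<^sub>R x + y) w = a * direct_sum_ip ipH bm_ip x w + direct_sum_ip ipH bm_ip y w"
    if "x \<in> HH \<times> bm_cameron_martin" "y \<in> HH \<times> bm_cameron_martin" "w \<in> HH \<times> bm_cameron_martin"
    for a and x y w :: "(real \<Rightarrow> real^'d1) \<times> (real \<Rightarrow> real^'d2)"
    using that h(3)[of "fst x" "fst y" "fst w" a] bm_ip_linear[of "snd x" "snd y" "snd w" a]
    by (auto simp: direct_sum_ip_def algebra_simps)
  show "0 \<le> direct_sum_ip ipH bm_ip x x" if "x \<in> HH \<times> bm_cameron_martin" for x :: "(real \<Rightarrow> real^'d1) \<times> (real \<Rightarrow> real^'d2)"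
    using that h(4)[of "fst x"] bm_ip_nonneg[of "snd x"] by (auto simp: direct_sum_ip_def)
  show "stack_path (fst (a *\<^sub>R x + y)) (snd (a *\<^sub>R x + y)) t
    = a *\<^sub>R stack_path (fst x) (snd x) t + stack_path (fst y) (snd y) t"
    for a and x y :: "(real \<Rightarrow> real^'d1) \<times> (real \<Rightarrow> real^'d2)" and t
    by (simp add: stack_path_linear)
  show "stack_path (fst x) (snd x) 0 = 0" if "x \<in> HH \<times> bm_cameron_martin" for x :: "(real \<Rightarrow> real^'d1) \<times> (real \<Rightarrow> real^'d2)"
  proof -
    have "fst x 0 = 0" "snd x 0 = 0" using that fbm_vanishes_at_0[OF cm] bm_cameron_martinD(2)[of "snd x"] by auto
    then show ?thesis by (auto simp: stack_path_def vec_eq_iff split: sum.split)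
  qed
  show "(\<Sum>K\<in>d. (norm (stack_path (fst x) (snd x) (Sup K) - stack_path (fst x) (snd x) (Inf K)))\<^sup>2
      / (Sup K - Inf K) powr (2 * H)) \<le> 2 * direct_sum_ip ipH bm_ip x x"
    if x: "x \<in> HH \<times> bm_cameron_martin" and d: "d division_of {0..1}" for x :: "(real \<Rightarrow> real^'d1) \<times> (real \<Rightarrow> real^'d2)" and d
  proof -
    have x': "fst x \<in> HH" "snd x \<in> bm_cameron_martin" using x by auto
    have "(\<Sum>K\<in>d. (norm (snd x (Sup K) - snd x (Inf K)))\<^sup>2 / (Sup K - Inf K) powr (2 * H))
      \<le> (\<Sum>K\<in>d. (norm (snd x (Sup K) - snd x (Inf K)))\<^sup>2 / (Sup K - Inf K))"
    proof (rule sum_mono)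
      fix K assume K: "K \<in> d"
      note e = division_of_interval_elem[OF d K]
      show "(norm (snd x (Sup K) - snd x (Inf K)))\<^sup>2 / (Sup K - Inf K) powr (2 * H)
        \<le> (norm (snd x (Sup K) - snd x (Inf K)))\<^sup>2 / (Sup K - Inf K)"
      proof (cases "Sup K = Inf K")
        case False
        then have pos: "0 < Sup K - Inf K" "Sup K - Inf K \<le> 1" using e by auto
        have "(Sup K - Inf K) powr 1 \<le> (Sup K - Inf K) powr (2 * H)" using pos H by (intro powr_mono') auto
        then show ?thesis using pos by (intro divide_left_mono) auto
      qed simp
    qed
    also have "\<dots> \<le> bm_ip (snd x) (snd x)" by (rule bm_energy[OF x'(2) d])
    also have "\<dots> \<le> 2 * bm_ip (snd x) (snd x)" using bm_ip_nonneg[of "snd x"] by simp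
    finally have 1: "(\<Sum>K\<in>d. (norm (snd x (Sup K) - snd x (Inf K)))\<^sup>2 / (Sup K - Inf K) powr (2 * H)) \<le> 2 * bm_ip (snd x) (snd x)" .
    have 2: "(\<Sum>K\<in>d. (norm (fst x (Sup K) - fst x (Inf K)))\<^sup>2 / (Sup K - Inf K) powr (2 * H)) \<le> 2 * ipH (fst x) (fst x)"
      by (rule fbm_energy[OF _ H(2) cm x'(1) d]) (use H in simp)
    show ?thesis
      using 1 2 by (simp add: norm_stack_diff add_divide_distrib sum.distrib direct_sum_ip_def)
  qed
qed (rule H)+

text \<open>As \<open>3/2 \<le> p\<close>, the derivative paths lie in the domain of
  \<open>D 1 \<phi>\<close> and \<open>D 2 \<phi>\<close>, with norms bounded by their
  \<open>3/2\<close>-variation bounds; multilinearity and boundedness of these two forms then carry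
  over to \<open>B\<close>.\<close>

lemma (in young_flow) hessian_form:
  fixes D :: "nat \<Rightarrow> (real \<Rightarrow> real^'n) \<Rightarrow> (real \<Rightarrow> real^'n) list \<Rightarrow> real"
  assumes p: "3/2 \<le> p"
    and D1: "bounded_multilinear_on (C0_var p) (var_norm p) 1 (D 1 \<phi>)"
    and D2: "bounded_multilinear_on (C0_var p) (var_norm p) 2 (D 2 \<phi>)"
    and D2_sym: "\<And>x y. x \<in> C0_var p \<Longrightarrow> y \<in> C0_var p \<Longrightarrow> D 2 \<phi> [x, y] = D 2 \<phi> [y, x]"
    and B_def: "\<And>f k. B f k = D 1 \<phi> [V1 S \<phi> M f k + V2 S b0 z \<phi> M f k] + D 2 \<phi> [chi S \<phi> M f, chi S \<phi> M k]"
  obtains C where "0 \<le> C"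
    "\<And>a x y w b c d. var_bounded (3/2) x b \<Longrightarrow> var_bounded (3/2) y c \<Longrightarrow> var_bounded (3/2) w d \<Longrightarrow>
      B (\<lambda>t. a *\<^sub>R x t + y t) w = a * B x w + B y w"
    "\<And>x y b c. var_bounded (3/2) x b \<Longrightarrow> var_bounded (3/2) y c \<Longrightarrow> B x y = B y x"
    "\<And>x y b c. var_bounded (3/2) x b \<Longrightarrow> var_bounded (3/2) y c \<Longrightarrow> \<bar>B x y\<bar> \<le> C * b * c"
proof -
  let ?chi = "chi S \<phi> M" and ?V = "\<lambda>f k. V1 S \<phi> M f k + V2 S b0 z \<phi> M f k"
  let ?P = "C0_var p :: (real \<Rightarrow> real^'n) set"
  have Veq: "?V f k = (\<lambda>t. V1 S \<phi> M f k t + V2 S b0 z \<phi> M f k t)" for f k by (simp add: fun_eq_iff)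
  obtain X where X: "0 \<le> X" "\<And>f b. var_bounded (3/2) f b \<Longrightarrow> var_bounded (3/2) (?chi f) (X * b)"
    by (rule chi_bounded) blast
  obtain Y where Y: "0 \<le> Y" "\<And>f k a b. var_bounded (3/2) f a \<Longrightarrow> var_bounded (3/2) k b \<Longrightarrow> var_bounded (3/2) (?V f k) (Y * a * b)"
    unfolding Veq by (rule second_derivative_bounded) blast
  have chi_in: "?chi f \<in> ?P" "var_norm p (?chi f) \<le> X * b" if "var_bounded (3/2) f b" for f b
    using var_bounded_C0_var[OF X(2)[OF that] _ p] derivative_paths_support(1,2) by auto
  have V_in: "?V f k \<in> ?P" "var_norm p (?V f k) \<le> Y * a * b"
    if "var_bounded (3/2) f a" "var_bounded (3/2) k b" for f k a b
    using var_bounded_C0_var[OF Y(2)[OF that] _ p] derivative_paths_support(3,4) unfolding Veq by auto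
  obtain C1 where C1: "\<And>xs. set xs \<subseteq> ?P \<and> length xs = 1 \<Longrightarrow> \<bar>D 1 \<phi> xs\<bar> \<le> C1 * prod_list (map (var_norm p) xs)"
    using D1 unfolding bounded_multilinear_on_def by blast
  obtain C2 where C2: "\<And>xs. set xs \<subseteq> ?P \<and> length xs = 2 \<Longrightarrow> \<bar>D 2 \<phi> xs\<bar> \<le> C2 * prod_list (map (var_norm p) xs)"
    using D2 unfolding bounded_multilinear_on_def by blast
  have n: "0 \<le> var_norm p x" for x :: "real \<Rightarrow> real^'n" by (simp add: var_norm_def)
  have lin1: "D 1 \<phi> [a *\<^sub>R u + v] = a * D 1 \<phi> [u] + D 1 \<phi> [v]" if "u \<in> ?P" "v \<in> ?P" for a u v
  proof -
    have "\<forall>xs ys. \<forall>x\<in>?P. \<forall>y\<in>?P. \<forall>a. set xs \<subseteq> ?P \<and> set ys \<subseteq> ?P \<and> length xs + length ys + 1 = 1 \<longrightarrow>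
        D 1 \<phi> (xs @ (a *\<^sub>R x + y) # ys) = a * D 1 \<phi> (xs @ x # ys) + D 1 \<phi> (xs @ y # ys)"
      using D1 unfolding bounded_multilinear_on_def by (elim conjE)
    from this[rule_format, of u v "[]" "[]" a] show ?thesis using that by simp
  qed
  have lin2: "D 2 \<phi> [a *\<^sub>R u + v, w] = a * D 2 \<phi> [u, w] + D 2 \<phi> [v, w]" if "u \<in> ?P" "v \<in> ?P" "w \<in> ?P" for a u v w
  proof -
    have "\<forall>xs ys. \<forall>x\<in>?P. \<forall>y\<in>?P. \<forall>a. set xs \<subseteq> ?P \<and> set ys \<subseteq> ?P \<and> length xs + length ys + 1 = 2 \<longrightarrow>
        D 2 \<phi> (xs @ (a *\<^sub>R x + y) # ys) = a * D 2 \<phi> (xs @ x # ys) + D 2 \<phi> (xs @ y # ys)"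
      using D2 unfolding bounded_multilinear_on_def by (elim conjE)
    from this[rule_format, of u v "[]" "[w]" a] show ?thesis using that by simp
  qed
  show ?thesis
  proof (rule that[of "\<bar>C1\<bar> * Y + \<bar>C2\<bar> * (X * X)"])
    show "0 \<le> \<bar>C1\<bar> * Y + \<bar>C2\<bar> * (X * X)" using X Y by simp
  next
    fix a and x y w :: "real \<Rightarrow> real^'m" and b c d
    assume x: "var_bounded (3/2) x b" and y: "var_bounded (3/2) y c" and w: "var_bounded (3/2) w d"
    have "?V (\<lambda>t. a *\<^sub>R x t + y t) w = a *\<^sub>R ?V x w + ?V y w"
      unfolding V1_linear[OF x y w] V2_linear[OF x y w] by (simp add: fun_eq_iff scaleR_fun_def algebra_simps)
    moreover have "?chi (\<lambda>t. a *\<^sub>R x t + y t) = a *\<^sub>R ?chi x + ?chi y"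
      unfolding chi_linear[OF x y] by (simp add: fun_eq_iff scaleR_fun_def)
    ultimately show "B (\<lambda>t. a *\<^sub>R x t + y t) w = a * B x w + B y w"
      unfolding B_def
      using lin1[OF V_in(1)[OF x w] V_in(1)[OF y w], of a] lin2[OF chi_in(1)[OF x] chi_in(1)[OF y] chi_in(1)[OF w], of a]
      by (simp only: distrib_left add_ac)
  next
    fix x y :: "real \<Rightarrow> real^'m" and b c assume x: "var_bounded (3/2) x b" and y: "var_bounded (3/2) y c"
    show "B x y = B y x"
      unfolding B_def second_derivative_symmetric[of x y] D2_sym[OF chi_in(1)[OF x] chi_in(1)[OF y]] ..
    have bc: "0 \<le> b" "0 \<le> c" using var_boundedD(2)[OF x] var_boundedD(2)[OF y] by auto
    have "\<bar>D 1 \<phi> [?V x y]\<bar> \<le> C1 * var_norm p (?V x y)" using C1[of "[?V x y]"] V_in(1)[OF x y] by simp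
    also have "\<dots> \<le> \<bar>C1\<bar> * (Y * b * c)"
      using V_in(2)[OF x y] n by (intro mult_mono) auto
    finally have 1: "\<bar>D 1 \<phi> [?V x y]\<bar> \<le> \<bar>C1\<bar> * (Y * b * c)" .
    have "\<bar>D 2 \<phi> [?chi x, ?chi y]\<bar> \<le> C2 * (var_norm p (?chi x) * var_norm p (?chi y))"
      using C2[of "[?chi x, ?chi y]"] chi_in(1)[OF x] chi_in(1)[OF y] by simp
    also have "\<dots> \<le> \<bar>C2\<bar> * ((X * b) * (X * c))"
      using chi_in(2)[OF x] chi_in(2)[OF y] n X bc by (intro mult_mono) auto
    finally have "\<bar>D 2 \<phi> [?chi x, ?chi y]\<bar> \<le> \<bar>C2\<bar> * ((X * b) * (X * c))" .
    then have "\<bar>B x y\<bar> \<le> \<bar>C1\<bar> * (Y * b * c) + \<bar>C2\<bar> * ((X * b) * (X * c))"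
      unfolding B_def using 1 abs_triangle_ineq[of "D 1 \<phi> [?V x y]" "D 2 \<phi> [?chi x, ?chi y]"] by linarith
    then show "\<bar>B x y\<bar> \<le> (\<bar>C1\<bar> * Y + \<bar>C2\<bar> * (X * X)) * b * c" by (simp add: algebra_simps)
  qed
qed

text \<open>The bound for finite orthonormal families is uniform, and a nonnegative family with
  bounded finite sums is summable.\<close>

lemma (in young_form) hilbert_schmidt:
  shows "symmetric_form_on V (\<lambda>x y. B (path x) (path y))"
    "hilbert_schmidt_form_on V ip (\<lambda>x y. B (path x) (path y))"
proof -
  have r: "rough (path x)" if "x \<in> V" for x using path_rough[OF that] path_0[OF that] by (auto simp: rough_def)
  have sym: "B (path x) (path y) = B (path y) (path x)" if "x \<in> V" "y \<in> V" for x y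
    using B_sym'[OF r r] that by blast
  then show "symmetric_form_on V (\<lambda>x y. B (path x) (path y))" by (simp add: symmetric_form_on_def)
  have lin: "B (path (a *\<^sub>R x + y)) (path z) = a * B (path x) (path z) + B (path y) (path z)"
    if "x \<in> V" "y \<in> V" "z \<in> V" for a x y z
  proof -
    have "path (a *\<^sub>R x + y) = (\<lambda>t. a *\<^sub>R path x t + path y t)" using path_lin[OF that(1,2)] by (simp add: fun_eq_iff)
    then show ?thesis using B_lin'[OF r r r] that by simp
  qed
  have bil: "bounded_bilinear_form_on V ip (\<lambda>x y. B (path x) (path y))"
    unfolding bounded_bilinear_form_on_def norm_of_def
  proof (intro conjI ballI allI exI)
    fix x y z a assume xyz: "x \<in> V" "y \<in> V" "z \<in> V"
    show "B (path (a *\<^sub>R x + y)) (path z) = a * B (path x) (path z) + B (path y) (path z)" by (rule lin[OF xyz])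
    have "a *\<^sub>R x + y \<in> V" using V xyz by (intro subspace_add subspace_scale)
    then show "B (path z) (path (a *\<^sub>R x + y)) = a * B (path z) (path x) + B (path z) (path y)"
      using sym[OF xyz(3)] lin[OF xyz, of a] xyz by simp
  next
    fix x y assume "x \<in> V" "y \<in> V"
    then show "\<bar>B (path x) (path y)\<bar> \<le> 9 * C * sqrt (ip x x) * sqrt (ip y y)" by (rule form_bounded)
  qed
  moreover have "(\<lambda>(e, e'). (B (path e) (path e'))\<^sup>2) summable_on E \<times> E" if E: "orthonormal_basis_on V ip E" for E
  proof (rule nonneg_bdd_above_summable_on)
    have E': "E \<subseteq> V" "\<forall>e\<in>E. \<forall>e'\<in>E. ip e e' = (if e = e' then 1 else 0)"
      using E by (auto simp: orthonormal_basis_on_def)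
    let ?K = "(2 * sqrt (real CARD('d)) * (288 * C) * (1 / (1 - 2 powr (1/3 - H)))\<^sup>2)\<^sup>2"
    show "bdd_above (sum (\<lambda>(e, e'). (B (path e) (path e'))\<^sup>2) ` {F. F \<subseteq> E \<times> E \<and> finite F})"
    proof (rule bdd_aboveI2)
      fix F assume F: "F \<in> {F. F \<subseteq> E \<times> E \<and> finite F}"
      \<comment> \<open>A finite set of pairs is enlarged to a square \<open>A \<times> A\<close>,
        to which the estimate for finite orthonormal families applies.\<close>
      define A where "A = fst ` F \<union> snd ` F"
      have A: "finite A" "A \<subseteq> E" "F \<subseteq> A \<times> A" using F by (auto simp: A_def rev_image_eqI)
      have "orthonormal A" using A(2) E' unfolding orthonormal_def by blast
      have "sum (\<lambda>(e, e'). (B (path e) (path e'))\<^sup>2) F \<le> sum (\<lambda>(e, e'). (B (path e) (path e'))\<^sup>2) (A \<times> A)"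
        using A by (intro sum_mono2) auto
      also have "\<dots> = (\<Sum>e\<in>A. \<Sum>e'\<in>A. (B (path e) (path e'))\<^sup>2)" by (simp add: sum.cartesian_product)
      also have "\<dots> \<le> ?K" by (rule form_hilbert_schmidt[OF A(1) \<open>orthonormal A\<close>])
      finally show "sum (\<lambda>(e, e'). (B (path e) (path e'))\<^sup>2) F \<le> ?K" .
    qed
  qed auto
  ultimately show "hilbert_schmidt_form_on V ip (\<lambda>x y. B (path x) (path y))"
    by (simp add: hilbert_schmidt_form_on_def)
qed

theorem theorem4p1:
  fixes H p q p' :: real
    and \<sigma> :: "real^'n \<Rightarrow> real^'d1^'n"
    and \<sigma>h :: "real^'n \<Rightarrow> real^'d2^'n"
    and \<beta> :: "real \<times> (real^'n) \<Rightarrow> real^'n"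
    and S :: "real^'n \<Rightarrow> real^('d1 + 'd2)^'n"
    and \<beta>0 :: "real^'n \<Rightarrow> real^'n"
    and HH :: "(real \<Rightarrow> real^'d1) set"
    and ipH :: "(real \<Rightarrow> real^'d1) \<Rightarrow> (real \<Rightarrow> real^'d1) \<Rightarrow> real"
    and \<gamma> :: "real \<Rightarrow> real^'d1"
    and \<eta> :: "real \<Rightarrow> real^'d2"
    and \<phi> :: "real \<Rightarrow> real^'n"
    and M :: "real \<Rightarrow> real^'n^'n"
    and F :: "(real \<Rightarrow> real^'n) \<Rightarrow> real"
    and U :: "(real \<Rightarrow> real^'n) set"
    and D :: "nat \<Rightarrow> (real \<Rightarrow> real^'n) \<Rightarrow> (real \<Rightarrow> real^'n) list \<Rightarrow> real"
    and Mc :: "nat \<Rightarrow> real"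
  assumes H: "1/3 < H" "H < 1/2"
    and exponents: "p' > 0" "max (1/p') (1/3) < 1/p" "1/p < H" "1/2 < 1/q" "1/q < H + 1/2"
      "1/p + 1/q > 1" "1/q - 1/p > 1/2"
    and coefficients: "Cb_infinity_on UNIV \<sigma>" "Cb_infinity_on UNIV \<sigma>h"
      "Cb_infinity_on ({0..1} \<times> UNIV) \<beta>"
    and S: "S = (\<lambda>y. block_matrix (\<sigma> y) (\<sigma>h y))"
    and \<beta>0: "\<beta>0 = (\<lambda>y. \<beta> (0, y))"
    and cameron_martin: "fbm_cameron_martin H HH ipH"
    and \<gamma>\<eta>: "(\<gamma>, \<eta>) \<in> HH \<times> bm_cameron_martin"
    and \<phi>: "young_ode_solution q S \<beta>0 (stack_path \<gamma> \<eta>) \<phi>"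
    and M: "jacobian_flow q S \<beta>0 (stack_path \<gamma> \<eta>) \<phi> M"
    and F_bounded: "\<exists>C. \<forall>y \<in> C0_var p'. \<bar>F y\<bar> \<le> C"
    and F_continuous: "continuous_on_normed (C0_var p') (var_norm p') F"
    and U: "open_in_normed (C0_var p') (var_norm p') U" "\<phi> \<in> U"
    and F_diff: "frechet_derivatives_on (C0_var p') (var_norm p') 3 U F D"
    and F_deriv_bound: "\<forall>j\<in>{1,2,3}. \<forall>y\<in>U. \<forall>z\<in>C0_var p'.
      \<bar>D j y (replicate j z)\<bar> \<le> Mc j * var_norm p' z ^ j"
  shows "symmetric_form_on (HH \<times> bm_cameron_martin)
           (hessian S \<beta>0 (stack_path \<gamma> \<eta>) \<phi> M D)
       \<and> hilbert_schmidt_form_on (HH \<times> bm_cameron_martin) (direct_sum_ip ipH bm_ip)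
           (hessian S \<beta>0 (stack_path \<gamma> \<eta>) \<phi> M D)"
proof -
  have p: "1/3 < 1/p" "1/p' < 1/p" using exponents(2) by auto
  \<comment> \<open>From \<open>1/q > 1/2 + 1/p > 5/6\<close> and
    \<open>1/q < H + 1/2 < 1\<close>.\<close>
  have q: "5/6 < 1/q" "1/q < 1" using exponents(5,7) p H by linarith+
  have q0: "0 < q" using q(1) zero_less_divide_1_iff[of q] by linarith
  then have q': "1 < q" "q < 6/5" using q by (simp_all add: field_simps)
  have "1/p' < 1/2" using p(2) exponents(3) H by linarith
  then have p': "3/2 \<le> p'" using exponents(1) by (simp add: field_simps)
  let ?HS = "HH \<times> (bm_cameron_martin :: (real \<Rightarrow> real^'d2) set)"
  let ?path = "\<lambda>x :: (real \<Rightarrow> real^'d1) \<times> (real \<Rightarrow> real^'d2). stack_path (fst x) (snd x)"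
  let ?z = "stack_path \<gamma> \<eta>"
  interpret es: energy_space ?HS "direct_sum_ip ipH bm_ip" ?path H
    by (rule cameron_martin_energy_space[OF H cameron_martin])
  have S_smooth: "C2_lipschitz S"
    unfolding S using coefficients(1,2)
    by (intro block_matrix_C2_lipschitz Cb_infinity_C2_lipschitz[where j = "\<lambda>y. y" and j' = "\<lambda>v. v" and X = UNIV]) auto
  have b_smooth: "C2_lipschitz \<beta>0"
    unfolding \<beta>0
  proof (rule Cb_infinity_C2_lipschitz[OF coefficients(3)])
    show "((\<lambda>y. (0, y)) has_derivative (\<lambda>v. (0, v))) (at y)" for y :: "real^'n"
      by (intro has_derivative_Pair has_derivative_const has_derivative_ident)
    show "norm ((0 :: real, x) - (0, y)) \<le> norm (x - y)" for x y :: "real^'n" by (simp add: norm_Pair)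
  qed (auto intro: convex_Times)
  obtain zc where zc: "var_bounded q ?z zc"
  proof -
    \<comment> \<open>The hypothesis \<open>1/q < H + 1/2\<close>, rewritten as the condition under
      which finite energy gives finite \<open>q\<close>-variation.\<close>
    have "2 / q - 1 \<le> 2 * H" using exponents(5) by simp
    from es.path_var_bounded[OF \<gamma>\<eta> _ _ this] q' show ?thesis by (intro that) auto
  qed
  have "\<phi> \<in> C0_var q" using \<phi> unfolding young_ode_solution_def by (rule conjunct1)
  then have \<phi>c: "var_bounded q \<phi> (var_norm q \<phi>)" using q' by (intro C0_var_var_bounded) auto
  have M': "continuous_on {0..1} M" "finite_var q M"
    "\<And>t. t \<in> {0..1} \<Longrightarrow> M t = mat 1 + young_integral (\<lambda>s A. A ** M s) (Omega S \<beta>0 ?z \<phi>) 0 t"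
    using M unfolding jacobian_flow_def by blast+
  \<comment> \<open>From here on \<open>Mc\<close> is a variation bound of the flow and no longer
    the family of derivative constants.\<close>
  obtain Mc where Mc: "var_bounded q M Mc"
    by (rule finite_var_var_bounded[OF M'(1,2)]) (use q' in auto)
  obtain \<Omega>c where \<Omega>c: "var_bounded q (Omega S \<beta>0 ?z \<phi>) \<Omega>c"
    using Omega_var_bounded[OF _ _ S_smooth b_smooth zc \<phi>c] q' by auto
  have up: "var_bounded (3/2) x c" if "var_bounded q x c" for x :: "real \<Rightarrow> 'x::real_normed_vector" and c
    using that q' by (intro var_bounded_exponent[OF that]) auto
  \<comment> \<open>The gap between \<open>q\<close> for the driver of the linear equation and
    \<open>3/2\<close> for the flow is spent here.\<close>
  have inv: "invertible (M t)" if "t \<in> {0..1}" for t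
    by (rule linear_flow_invertible[OF _ _ _ \<Omega>c up[OF Mc] M'(3) that]) (use q' in auto)
  obtain Mi where Mi: "var_bounded (3/2) (\<lambda>t. matrix_inv (M t)) Mi"
    by (rule var_bounded_matrix_inv[OF up[OF Mc] _ inv]) auto
  interpret yf: young_flow \<phi> M S \<beta>0 ?z
    by unfold_locales (use up[OF \<phi>c] up[OF Mc] Mi up[OF zc] S_smooth b_smooth in blast)+
  have D: "bounded_multilinear_on (C0_var p') (var_norm p') 1 (D 1 \<phi>)"
    "bounded_multilinear_on (C0_var p') (var_norm p') 2 (D 2 \<phi>)"
    using F_diff U(2) unfolding frechet_derivatives_on_def has_frechet_derivative_form_def numeral_2_eq_2 by auto
  have D2_sym: "D 2 \<phi> [x, y] = D 2 \<phi> [y, x]" if xy: "x \<in> C0_var p'" "y \<in> C0_var p'" for x y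
  proof (rule second_frechet_derivative_symmetric[OF _ U F_diff])
    have p1: "1 \<le> p'" using p' by simp
    show "subspace (C0_var p' :: (real \<Rightarrow> real^'n) set)" by (rule subspace_C0_var[OF p1])
    show n: "0 \<le> var_norm p' w" for w :: "real \<Rightarrow> real^'n" by (simp add: var_norm_def)
    fix a b
    have "var_norm p' (a *\<^sub>R x + b *\<^sub>R y) \<le> 4 * (\<bar>a\<bar> * var_norm p' x + \<bar>b\<bar> * var_norm p' y)"
      by (rule C0_var_linear_combination(2)[OF xy p1])
    also have "\<dots> \<le> 4 * (\<bar>a\<bar> * (var_norm p' x + var_norm p' y) + \<bar>b\<bar> * (var_norm p' x + var_norm p' y))"
      using n by (intro mult_left_mono add_mono) auto
    finally show "var_norm p' (a *\<^sub>R x + b *\<^sub>R y) \<le> 4 * (var_norm p' x + var_norm p' y) * (\<bar>a\<bar> + \<bar>b\<bar>)"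
      by (simp add: algebra_simps)
  qed (use xy in auto)
  define B where "B f k = D 1 \<phi> [V1 S \<phi> M f k + V2 S \<beta>0 ?z \<phi> M f k] + D 2 \<phi> [chi S \<phi> M f, chi S \<phi> M k]" for f k
  obtain C where C: "0 \<le> C"
    "\<And>a x y w b c d. var_bounded (3/2) x b \<Longrightarrow> var_bounded (3/2) y c \<Longrightarrow> var_bounded (3/2) w d \<Longrightarrow>
      B (\<lambda>t. a *\<^sub>R x t + y t) w = a * B x w + B y w"
    "\<And>x y b c. var_bounded (3/2) x b \<Longrightarrow> var_bounded (3/2) y c \<Longrightarrow> B x y = B y x"
    "\<And>x y b c. var_bounded (3/2) x b \<Longrightarrow> var_bounded (3/2) y c \<Longrightarrow> \<bar>B x y\<bar> \<le> C * b * c"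
    by (rule yf.hessian_form[where D = D and B = B, OF p' D D2_sym B_def]) blast+
  interpret form: young_form ?HS "direct_sum_ip ipH bm_ip" ?path H B C
    by unfold_locales (use C in blast)+
  have "hessian S \<beta>0 ?z \<phi> M D = (\<lambda>x y. B (?path x) (?path y))"
    by (simp add: hessian_def B_def Let_def fun_eq_iff)
  then show ?thesis using form.hilbert_schmidt by simp
qed

end
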